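(* Let $Q$ be the Bondal quiver, $P^\perp\subset D^b(Q)$ the right orthogonal of the exceptional object $P$, and $E\in P^\perp$ the $3$-spherical object defined by the triangle $S(P)[-1]\to E\to P$. Assume that $F\in P^\perp$ is an $n$-spherical object. Then either there exists an isomorphism $F\simeq E[m]$ for some integer $m$, or $n=1$.
   Context: Let $k$ be an algebraically closed field of characteristic $0$. The Bondal quiver $Q$ has vertices $1,2,3$, arrows $\alpha_1,\beta_1\colon 1\to 2$ and $\alpha_2,\beta_2\colon 2\to 3$, and relations $\beta_2\alpha_1=0$, $\alpha_2\beta_1=0$. Let $I$ be the ideal of $kQ$ generated by $\beta_2\alpha_1,\alpha_2\beta_1$, and let $D^b(Q)$ be the bounded derived category of finite-dimensional right $kQ/I$-modules, identified with finite-dimensional representations $V_1\rightrightarrows V_2\rightrightarrows V_3$ of $Q$ satisfying the relations. $D^b(Q)$ has a Serre functor $S$. The representation $P$ is $V_1=V_2=V_3=k$ with $\alpha_1=\alpha_2=1$, $\beta_1=\beta_2=0$; it is an exceptional object. $P^\perp=\{T\in D^b(Q) : \mathrm{Hom}(P,T[i])=0\ \forall i\in\mathbb{Z}\}$; it is an admissible subcategory, hence has a Serre functor $S_{P^\perp}$. The object $E\in P^\perp$ is defined by the distinguished triangle $S(P)[-1]\to E\to P\to S(P)$ whose last map is the (unique up to scalar) nonzero morphism $P\to S(P)$. An object $F\in P^\perp$ is $n$-spherical ($n\in\mathbb{Z}$) if $S_{P^\perp}(F)\simeq F[n]$ and $\mathrm{Hom}^\bullet(F,F)\simeq k\oplus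 k[-n]$ as graded vector spaces. *)

theory Defs
  imports
    "HOL-Computational_Algebra.Polynomial"
    "HOL-Library.FuncSet"
    "Jordan_Normal_Form.Matrix_Kernel"
begin

section \<open>Linear categories and Serre functors\<close>

record ('k, 'o, 'm) lincat =
  Ob :: "'o set"
  Hom :: "'o \<Rightarrow> 'o \<Rightarrow> 'm set"
  Idm :: "'o \<Rightarrow> 'm"
  Cmp :: "'m \<Rightarrow> 'm \<Rightarrow> 'm"  \<comment> \<open>\<open>Cmp C g f\<close> is \<open>g\<close> after \<open>f\<close>\<close>
  Zer :: "'o \<Rightarrow> 'o \<Rightarrow> 'm"
  Add :: "'m \<Rightarrow> 'm \<Rightarrow> 'm"
  Scl :: "'k \<Rightarrow> 'm \<Rightarrow> 'm"

definition full_subcat :: "('k, 'o, 'm) lincat \<Rightarrow> 'o set \<Rightarrow> ('k, 'o, 'm) lincat" where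
  "full_subcat C A = C\<lparr>Ob := Ob C \<inter> A\<rparr>"

definition iso_in :: "('k, 'o, 'm) lincat \<Rightarrow> 'o \<Rightarrow> 'o \<Rightarrow> 'm \<Rightarrow> bool" where
  "iso_in C X Y f \<longleftrightarrow> X \<in> Ob C \<and> Y \<in> Ob C \<and> f \<in> Hom C X Y \<and>
     (\<exists>g\<in>Hom C Y X. Cmp C g f = Idm C X \<and> Cmp C f g = Idm C Y)"

definition isomorphic :: "('k, 'o, 'm) lincat \<Rightarrow> 'o \<Rightarrow> 'o \<Rightarrow> bool" where
  "isomorphic C X Y \<longleftrightarrow> (\<exists>f. iso_in C X Y f)"

record ('o, 'm) func =
  fob :: "'o \<Rightarrow> 'o"
  fmap :: "'o \<Rightarrow> 'o \<Rightarrow> 'm \<Rightarrow> 'm"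

definition linear_endofunctor :: "('k, 'o, 'm) lincat \<Rightarrow> ('o, 'm) func \<Rightarrow> bool" where
  "linear_endofunctor C F \<longleftrightarrow>
     (\<forall>X\<in>Ob C. fob F X \<in> Ob C \<and> fmap F X X (Idm C X) = Idm C (fob F X)) \<and>
     (\<forall>X\<in>Ob C. \<forall>Y\<in>Ob C. \<forall>f\<in>Hom C X Y.
        fmap F X Y f \<in> Hom C (fob F X) (fob F Y) \<and>
        (\<forall>c. fmap F X Y (Scl C c f) = Scl C c (fmap F X Y f)) \<and>
        (\<forall>g\<in>Hom C X Y. fmap F X Y (Add C f g) = Add C (fmap F X Y f) (fmap F X Y g)) \<and>
        (\<forall>Z\<in>Ob C. \<forall>g\<in>Hom C Y Z.
           fmap F X Z (Cmp C g f) = Cmp C (fmap F Y Z g) (fmap F X Y f)))"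

definition linear_autoequivalence :: "('k, 'o, 'm) lincat \<Rightarrow> ('o, 'm) func \<Rightarrow> bool" where
  "linear_autoequivalence C F \<longleftrightarrow> linear_endofunctor C F \<and>
     (\<forall>X\<in>Ob C. \<forall>Y\<in>Ob C. bij_betw (fmap F X Y) (Hom C X Y) (Hom C (fob F X) (fob F Y))) \<and>
     (\<forall>Y\<in>Ob C. \<exists>X\<in>Ob C. isomorphic C (fob F X) Y)"

definition dual_hom :: "('k::field, 'o, 'm) lincat \<Rightarrow> 'o \<Rightarrow> 'o \<Rightarrow> ('m \<Rightarrow> 'k) set" where
  "dual_hom C X Y = {l \<in> extensional (Hom C X Y).
     (\<forall>f\<in>Hom C X Y. \<forall>g\<in>Hom C X Y. l (Add C f g) = l f + l g) \<and>
     (\<forall>c. \<forall>f\<in>Hom C X Y. l (Scl C c f) = c * l f)}"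

text \<open>The Bondal-Kapranov definition: an autoequivalence \<open>S\<close> together with linear
  isomorphisms \<open>\<phi> X Y\<close> from \<open>Hom(X,Y)\<close> to the dual of \<open>Hom(Y,SX)\<close>, natural in both arguments.\<close>

definition serre_functor :: "('k::field, 'o, 'm) lincat \<Rightarrow> ('o, 'm) func \<Rightarrow> bool" where
  "serre_functor C S \<longleftrightarrow> linear_autoequivalence C S \<and>
     (\<exists>\<phi> :: 'o \<Rightarrow> 'o \<Rightarrow> 'm \<Rightarrow> 'm \<Rightarrow> 'k.
        (\<forall>X\<in>Ob C. \<forall>Y\<in>Ob C.
           bij_betw (\<phi> X Y) (Hom C X Y) (dual_hom C Y (fob S X)) \<and>
           (\<forall>f\<in>Hom C X Y. \<forall>h\<in>Hom C Y (fob S X).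
              (\<forall>g\<in>Hom C X Y. \<phi> X Y (Add C f g) h = \<phi> X Y f h + \<phi> X Y g h) \<and>
              (\<forall>c. \<phi> X Y (Scl C c f) h = c * \<phi> X Y f h))) \<and>
        (\<forall>X\<in>Ob C. \<forall>Y\<in>Ob C. \<forall>X'\<in>Ob C. \<forall>Y'\<in>Ob C.
           \<forall>f\<in>Hom C X Y. \<forall>u\<in>Hom C X' X. \<forall>v\<in>Hom C Y Y'. \<forall>h\<in>Hom C Y' (fob S X').
             \<phi> X' Y' (Cmp C v (Cmp C f u)) h = \<phi> X Y f (Cmp C (fmap S X' X u) (Cmp C h v))))"


section \<open>Representations of the Bondal quiver\<close>

datatype vtx = V1 | V2 | V3
datatype arr = Alpha1 | Beta1 | Alpha2 | Beta2

fun src :: "arr \<Rightarrow> vtx" where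
  "src Alpha1 = V1" | "src Beta1 = V1" | "src Alpha2 = V2" | "src Beta2 = V2"

fun tgt :: "arr \<Rightarrow> vtx" where
  "tgt Alpha1 = V2" | "tgt Beta1 = V2" | "tgt Alpha2 = V3" | "tgt Beta2 = V3"

text \<open>Finite-dimensional vector spaces are taken to be the coordinate spaces \<open>k\<^sup>d\<close>; linear maps
  \<open>k\<^sup>d \<rightarrow> k\<^sup>e\<close> are \<open>e \<times> d\<close> matrices.\<close>

record 'k rep =
  rdim :: "vtx \<Rightarrow> nat"
  ract :: "arr \<Rightarrow> 'k mat"

definition is_rep :: "'k::field rep \<Rightarrow> bool" where
  "is_rep V \<longleftrightarrow>
     (\<forall>a. ract V a \<in> carrier_mat (rdim V (tgt a)) (rdim V (src a))) \<and>
     ract V Beta2 * ract V Alpha1 = 0\<^sub>m (rdim V V3) (rdim V V1) \<and>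
     ract V Alpha2 * ract V Beta1 = 0\<^sub>m (rdim V V3) (rdim V V1)"

type_synonym 'k rmap = "vtx \<Rightarrow> 'k mat"

definition rep_map :: "'k::field rep \<Rightarrow> 'k rep \<Rightarrow> 'k rmap \<Rightarrow> bool" where
  "rep_map V W f \<longleftrightarrow>
     (\<forall>v. f v \<in> carrier_mat (rdim W v) (rdim V v)) \<and>
     (\<forall>a. f (tgt a) * ract V a = ract W a * f (src a))"

definition zero_rep :: "'k::field rep" where
  "zero_rep = \<lparr>rdim = (\<lambda>_. 0), ract = (\<lambda>_. 0\<^sub>m 0 0)\<rparr>"

definition dsum_rep :: "'k::field rep \<Rightarrow> 'k rep \<Rightarrow> 'k rep" where
  "dsum_rep V W = \<lparr>rdim = (\<lambda>v. rdim V v + rdim W v),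
     ract = (\<lambda>a. four_block_mat
       (ract V a) (0\<^sub>m (rdim V (tgt a)) (rdim W (src a)))
       (0\<^sub>m (rdim W (tgt a)) (rdim V (src a))) (ract W a))\<rparr>"

definition P_rep :: "'k::field rep" where
  "P_rep = \<lparr>rdim = (\<lambda>_. 1),
     ract = (\<lambda>a. if a = Alpha1 \<or> a = Alpha2 then 1\<^sub>m 1 else 0\<^sub>m 1 1)\<rparr>"


section \<open>Bounded complexes\<close>

record 'k cplx =
  cobj :: "int \<Rightarrow> 'k rep"
  cdif :: "int \<Rightarrow> 'k rmap"  \<comment> \<open>\<open>cdif X i\<close> goes from degree \<open>i\<close> to degree \<open>i + 1\<close>\<close>

abbreviation cdim :: "'k cplx \<Rightarrow> int \<Rightarrow> vtx \<Rightarrow> nat" where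
  "cdim X i v \<equiv> rdim (cobj X i) v"

definition is_cplx :: "'k::field cplx \<Rightarrow> bool" where
  "is_cplx X \<longleftrightarrow>
     (\<forall>i. is_rep (cobj X i)) \<and>
     (\<forall>i. rep_map (cobj X i) (cobj X (i + 1)) (cdif X i)) \<and>
     (\<forall>i v. cdif X (i + 1) v * cdif X i v = 0\<^sub>m (cdim X (i + 2) v) (cdim X i v)) \<and>
     (\<exists>N. \<forall>i v. \<bar>i\<bar> > N \<longrightarrow> cdim X i v = 0)"

type_synonym 'k cmap = "int \<Rightarrow> 'k rmap"

definition chain_map :: "'k::field cplx \<Rightarrow> 'k cplx \<Rightarrow> 'k cmap \<Rightarrow> bool" where
  "chain_map X Y f \<longleftrightarrow>
     (\<forall>i. rep_map (cobj X i) (cobj Y i) (f i)) \<and>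
     (\<forall>i v. f (i + 1) v * cdif X i v = cdif Y i v * f i v)"

definition cid :: "'k::field cplx \<Rightarrow> 'k cmap" where
  "cid X = (\<lambda>i v. 1\<^sub>m (cdim X i v))"

definition czero :: "'k::field cplx \<Rightarrow> 'k cplx \<Rightarrow> 'k cmap" where
  "czero X Y = (\<lambda>i v. 0\<^sub>m (cdim Y i v) (cdim X i v))"

definition ccomp :: "'k::field cmap \<Rightarrow> 'k cmap \<Rightarrow> 'k cmap" where
  "ccomp g f = (\<lambda>i v. g i v * f i v)"

definition cadd :: "'k::field cmap \<Rightarrow> 'k cmap \<Rightarrow> 'k cmap" where
  "cadd f g = (\<lambda>i v. f i v + g i v)"

definition cscale :: "'k::field \<Rightarrow> 'k cmap \<Rightarrow> 'k cmap" where
  "cscale c f = (\<lambda>i v. c \<cdot>\<^sub>m f i v)"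

definition homotopic :: "'k::field cplx \<Rightarrow> 'k cplx \<Rightarrow> 'k cmap \<Rightarrow> 'k cmap \<Rightarrow> bool" where
  "homotopic X Y f g \<longleftrightarrow> (\<exists>h :: 'k cmap.
     (\<forall>i. rep_map (cobj X i) (cobj Y (i - 1)) (h i)) \<and>
     (\<forall>i v. f i v = g i v + (cdif Y (i - 1) v * h i v + h (i + 1) v * cdif X i v)))"

text \<open>Cohomology is computed vertexwise, as the set of cosets of the image in the kernel.\<close>

definition boundaries :: "'k::field cplx \<Rightarrow> int \<Rightarrow> vtx \<Rightarrow> 'k vec set" where
  "boundaries X i v = (\<lambda>x. cdif X (i - 1) v *\<^sub>v x) ` carrier_vec (cdim X (i - 1) v)"

definition coh_class :: "'k::field cplx \<Rightarrow> int \<Rightarrow> vtx \<Rightarrow> 'k vec \<Rightarrow> 'k vec set" where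
  "coh_class X i v z = (\<lambda>b. z + b) ` boundaries X i v"

definition cohomology :: "'k::field cplx \<Rightarrow> int \<Rightarrow> vtx \<Rightarrow> 'k vec set set" where
  "cohomology X i v = coh_class X i v ` mat_kernel (cdif X i v)"

definition coh_map :: "'k::field cplx \<Rightarrow> 'k cmap \<Rightarrow> int \<Rightarrow> vtx \<Rightarrow> 'k vec set \<Rightarrow> 'k vec set" where
  "coh_map Y f i v c = (\<Union>z\<in>c. coh_class Y i v (f i v *\<^sub>v z))"

definition quasi_iso :: "'k::field cplx \<Rightarrow> 'k cplx \<Rightarrow> 'k cmap \<Rightarrow> bool" where
  "quasi_iso X Y f \<longleftrightarrow> chain_map X Y f \<and>
     (\<forall>i v. bij_betw (coh_map Y f i v) (cohomology X i v) (cohomology Y i v))"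

definition shift :: "int \<Rightarrow> 'k::field cplx \<Rightarrow> 'k cplx" where
  "shift n X = \<lparr>cobj = (\<lambda>i. cobj X (i + n)),
     cdif = (\<lambda>i v. (if even n then 1 else - 1) \<cdot>\<^sub>m cdif X (i + n) v)\<rparr>"

definition cshift :: "int \<Rightarrow> 'k cmap \<Rightarrow> 'k cmap" where
  "cshift n f = (\<lambda>i. f (i + n))"

definition stalk :: "'k::field rep \<Rightarrow> 'k cplx" where
  "stalk V = \<lparr>cobj = (\<lambda>i. if i = 0 then V else zero_rep),
     cdif = (\<lambda>i v. 0\<^sub>m (if i = - 1 then rdim V v else 0) (if i = 0 then rdim V v else 0))\<rparr>"

text \<open>The mapping cone of \<open>f : X \<rightarrow> Y\<close> is \<open>X[1] \<oplus> Y\<close> with differential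
  \<open>(x, y) \<mapsto> (- d x, f x + d y)\<close>.\<close>

definition cone :: "'k::field cplx \<Rightarrow> 'k cplx \<Rightarrow> 'k cmap \<Rightarrow> 'k cplx" where
  "cone X Y f = \<lparr>cobj = (\<lambda>i. dsum_rep (cobj X (i + 1)) (cobj Y i)),
     cdif = (\<lambda>i v. four_block_mat
       ((- 1) \<cdot>\<^sub>m cdif X (i + 1) v) (0\<^sub>m (cdim X (i + 2) v) (cdim Y i v))
       (f (i + 1) v) (cdif Y i v))\<rparr>"

definition cone_in :: "'k::field cplx \<Rightarrow> 'k cplx \<Rightarrow> 'k cmap" where
  "cone_in X Y = (\<lambda>i v. four_block_mat
     (0\<^sub>m (cdim X (i + 1) v) (cdim Y i v)) (0\<^sub>m (cdim X (i + 1) v) 0)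
     (1\<^sub>m (cdim Y i v)) (0\<^sub>m (cdim Y i v) 0))"

definition cone_out :: "'k::field cplx \<Rightarrow> 'k cplx \<Rightarrow> 'k cmap" where
  "cone_out X Y = (\<lambda>i v. four_block_mat
     (1\<^sub>m (cdim X (i + 1) v)) (0\<^sub>m (cdim X (i + 1) v) (cdim Y i v))
     (0\<^sub>m 0 (cdim X (i + 1) v)) (0\<^sub>m 0 (cdim Y i v)))"


section \<open>The bounded derived category\<close>

text \<open>Morphisms are equivalence classes of roofs \<open>src \<leftarrow> mid \<rightarrow> tgt\<close> whose denominator \<open>rden\<close> is a
  quasi-isomorphism.\<close>

record 'k roof =
  rsrc :: "'k cplx"
  rmid :: "'k cplx"
  rtgt :: "'k cplx"
  rden :: "'k cmap"
  rnum :: "'k cmap"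

definition is_roof :: "'k::field roof \<Rightarrow> bool" where
  "is_roof A \<longleftrightarrow> is_cplx (rsrc A) \<and> is_cplx (rmid A) \<and> is_cplx (rtgt A) \<and>
     quasi_iso (rmid A) (rsrc A) (rden A) \<and> chain_map (rmid A) (rtgt A) (rnum A)"

definition roof_eq :: "'k::field roof \<Rightarrow> 'k roof \<Rightarrow> bool" where
  "roof_eq A B \<longleftrightarrow> is_roof A \<and> is_roof B \<and> rsrc A = rsrc B \<and> rtgt A = rtgt B \<and>
     (\<exists>W p q. is_cplx W \<and> chain_map W (rmid A) p \<and> chain_map W (rmid B) q \<and>
        quasi_iso W (rsrc A) (ccomp (rden A) p) \<and>
        homotopic W (rsrc A) (ccomp (rden A) p) (ccomp (rden B) q) \<and>
        homotopic W (rtgt A) (ccomp (rnum A) p) (ccomp (rnum B) q))"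

definition roof_class :: "'k::field roof \<Rightarrow> 'k roof set" where
  "roof_class A = {R. roof_eq A R}"

definition Db_hom :: "'k::field cplx \<Rightarrow> 'k cplx \<Rightarrow> 'k roof set set" where
  "Db_hom X Y = roof_class ` {A. is_roof A \<and> rsrc A = X \<and> rtgt A = Y}"

definition chain_roof :: "'k::field cplx \<Rightarrow> 'k cplx \<Rightarrow> 'k cmap \<Rightarrow> 'k roof set" where
  "chain_roof X Y f = roof_class \<lparr>rsrc = X, rmid = X, rtgt = Y, rden = cid X, rnum = f\<rparr>"

text \<open>The operations on classes below collect the results over all representatives that can be
  composed (via an Ore square commuting up to homotopy), respectively added (because they have the
  same denominator); all these results are equivalent, so that the union is a single class.\<close>

definition Db_comp :: "'k::field roof set \<Rightarrow> 'k roof set \<Rightarrow> 'k roof set" where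
  "Db_comp b a = {R. \<exists>A\<in>a. \<exists>B\<in>b. \<exists>V p q.
     rtgt A = rsrc B \<and> is_cplx V \<and> quasi_iso V (rmid A) p \<and> chain_map V (rmid B) q \<and>
     homotopic V (rtgt A) (ccomp (rnum A) p) (ccomp (rden B) q) \<and>
     roof_eq \<lparr>rsrc = rsrc A, rmid = V, rtgt = rtgt B,
       rden = ccomp (rden A) p, rnum = ccomp (rnum B) q\<rparr> R}"

definition Db_add :: "'k::field roof set \<Rightarrow> 'k roof set \<Rightarrow> 'k roof set" where
  "Db_add a b = {R. \<exists>A\<in>a. \<exists>B\<in>b.
     rsrc A = rsrc B \<and> rtgt A = rtgt B \<and> rmid A = rmid B \<and> rden A = rden B \<and>
     roof_eq (A\<lparr>rnum := cadd (rnum A) (rnum B)\<rparr>) R}"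

definition Db_scale :: "'k::field \<Rightarrow> 'k roof set \<Rightarrow> 'k roof set" where
  "Db_scale c a = {R. \<exists>A\<in>a. roof_eq (A\<lparr>rnum := cscale c (rnum A)\<rparr>) R}"

definition roof_shift :: "int \<Rightarrow> 'k::field roof \<Rightarrow> 'k roof" where
  "roof_shift n A = \<lparr>rsrc = shift n (rsrc A), rmid = shift n (rmid A), rtgt = shift n (rtgt A),
     rden = cshift n (rden A), rnum = cshift n (rnum A)\<rparr>"

definition Db_shift :: "int \<Rightarrow> 'k::field roof set \<Rightarrow> 'k roof set" where
  "Db_shift n a = {R. \<exists>A\<in>a. roof_eq (roof_shift n A) R}"

definition Db :: "('k::field, 'k cplx, 'k roof set) lincat" where
  "Db = \<lparr>Ob = {X. is_cplx X}, Hom = Db_hom, Idm = (\<lambda>X. chain_roof X X (cid X)),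
     Cmp = Db_comp, Zer = (\<lambda>X Y. chain_roof X Y (czero X Y)), Add = Db_add, Scl = Db_scale\<rparr>"

text \<open>The triangle \<open>X \<rightarrow> Y \<rightarrow> Z \<rightarrow> X[1]\<close> is distinguished if it is isomorphic in the derived category
  to the standard triangle of the mapping cone of a chain map.\<close>

definition distinguished :: "'k::field cplx \<Rightarrow> 'k cplx \<Rightarrow> 'k cplx \<Rightarrow>
    'k roof set \<Rightarrow> 'k roof set \<Rightarrow> 'k roof set \<Rightarrow> bool" where
  "distinguished X Y Z u v w \<longleftrightarrow>
     u \<in> Hom Db X Y \<and> v \<in> Hom Db Y Z \<and> w \<in> Hom Db Z (shift 1 X) \<and>
     (\<exists>X' Y' f a b c. is_cplx X' \<and> is_cplx Y' \<and> chain_map X' Y' f \<and>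
        iso_in Db X X' a \<and> iso_in Db Y Y' b \<and> iso_in Db Z (cone X' Y' f) c \<and>
        Cmp Db b u = Cmp Db (chain_roof X' Y' f) a \<and>
        Cmp Db c v = Cmp Db (chain_roof Y' (cone X' Y' f) (cone_in X' Y')) b \<and>
        Cmp Db (Db_shift 1 a) w = Cmp Db (chain_roof (cone X' Y' f) (shift 1 X') (cone_out X' Y')) c)"


section \<open>The subcategory orthogonal to \<open>P\<close> and spherical objects\<close>

definition P_obj :: "'k::field cplx" where
  "P_obj = stalk P_rep"

definition right_orth :: "'k::field cplx \<Rightarrow> ('k, 'k cplx, 'k roof set) lincat" where
  "right_orth X = full_subcat Db {T. \<forall>i. Hom Db X (shift i T) = {Zer Db X (shift i T)}}"

text \<open>The degree \<open>i\<close> part of the graded vector space \<open>k \<oplus> k[-n]\<close>, inside \<open>k \<oplus> k\<close>.\<close>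

definition sphere_part :: "int \<Rightarrow> int \<Rightarrow> ('k::field \<times> 'k) set" where
  "sphere_part n i = {(x, y). (i \<noteq> 0 \<longrightarrow> x = 0) \<and> (i \<noteq> n \<longrightarrow> y = 0)}"

definition spherical :: "('k::field, 'k cplx, 'k roof set) lincat \<Rightarrow>
    ('k cplx, 'k roof set) func \<Rightarrow> int \<Rightarrow> 'k cplx \<Rightarrow> bool" where
  "spherical C S n F \<longleftrightarrow> F \<in> Ob C \<and> isomorphic C (fob S F) (shift n F) \<and>
     (\<forall>i. \<exists>\<psi> :: 'k roof set \<Rightarrow> 'k \<times> 'k.
        bij_betw \<psi> (Hom C F (shift i F)) (sphere_part n i) \<and>
        (\<forall>f\<in>Hom C F (shift i F). \<forall>g\<in>Hom C F (shift i F). \<forall>c.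
           \<psi> (Add C f g) = (fst (\<psi> f) + fst (\<psi> g), snd (\<psi> f) + snd (\<psi> g)) \<and>
           \<psi> (Scl C c f) = (c * fst (\<psi> f), c * snd (\<psi> f))))"

end

theory Submission
 imports Defs "HOL-Library.Function_Algebras" "HOL-Library.Product_Plus"
begin

text \<open>A complex of representations is encoded by strict matrix data: the differential \<open>d\<close> and two
 signed arrow operators \<open>A\<close> (for \<open>\<alpha>\<^sub>1, \<beta>\<^sub>2\<close>) and \<open>B\<close> (for \<open>\<beta>\<^sub>1, \<alpha>\<^sub>2\<close>), which square to zero and
 anticommute with \<open>d\<close>. A weak morphism is a pair of vertex-triangular matrices with the same
 diagonal part, the first commuting with \<open>d + B\<close> and the second with \<open>d + A\<close>; modulo homotopy these pairs
 are the morphisms of the derived category, because every complex has a bar resolution through which weak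
 morphisms factor strictly.

 In this model \<open>F\<close> lies in \<open>P\<^sup>\<bottom>\<close> iff \<open>d + B\<close> is acyclic on \<open>F\<close>, and \<open>S(P)\<close> is the second string module \<open>Q\<close>
 up to shift. If \<open>Hom(F, F[1 - n]) = 0\<close>, which holds for an \<open>n\<close>-spherical \<open>F\<close> with \<open>n \<noteq> 1\<close>, a trace argument shows that a
 nonzero \<open>g : F \<rightarrow> F[n]\<close> is detected by a morphism \<open>Q[m] \<rightarrow> F\<close>. That morphism extends to \<open>E\<close>, and Serre
 duality on \<open>P\<^sup>\<bottom>\<close> gives \<open>x : E[m] \<rightarrow> F\<close> and \<open>y : F \<rightarrow> E[m]\<close> with \<open>g x y \<noteq> 0\<close>. As \<open>End(E) = k\<close>, this is an
 isomorphism up to a scalar when \<open>n \<noteq> 0\<close>; when \<open>n = 0\<close>, \<open>Hom(E, E[3]) \<noteq> 0\<close> forces all these composites \<open>x y\<close> to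
 square to zero, which is impossible in the two-dimensional algebra \<open>End(F)\<close>.\<close>

section \<open>One ring of matrices over a field: products, traces, generalised inverses, separating
  functionals\<close>

section \<open>Finitely supported matrices\<close>

text \<open>The shape of weak morphisms comes from Koszul duality. The relations
  \<open>Beta2\<close> after \<open>Alpha1\<close> and \<open>Alpha2\<close> after
  \<open>Beta1\<close> never mix the classes {\<open>Alpha1\<close>, \<open>Beta2\<close>} and
  {\<open>Beta1\<close>, \<open>Alpha2\<close>}, so the minimal bimodule resolution has one
  generator for each of the three vertices, four arrows and two relations, and every chain stays in
  one class. A cochain has three diagonal blocks and three strictly triangular blocks per class: two
  triangular matrices with a common diagonal. Composition is then matrix multiplication, and the
  relations say that \<open>A\<close> and \<open>B\<close> square to zero. The obstacle is that
  morphisms are classes of roofs between complexes of sized matrices, on which direct computation is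
  unwieldy; hence the dimension-free matrices and the dictionary from roof classes to weak
  morphisms. The case n = 1 escapes because the obstruction to gluing two homotopies is dual to
  Hom(F, F[1 - n]). The degree 1 - n is one of the two degrees 0 and n of a sphere only for n = 1,
  as 1 - n = n has no integer solution.\<close>

typedef (overloaded) ('i, 'k::zero) fm = "{f :: 'i \<Rightarrow> 'i \<Rightarrow> 'k. finite {p. f (fst p) (snd p) \<noteq> 0}}"
 morphisms ent Abs_fm
 by (rule exI[of _ "\<lambda>_ _. 0"]) simp

setup_lifting type_definition_fm

lemma finite_ent: "finite {p. ent x (fst p) (snd p) \<noteq> 0}"
 using ent[of x] by simp

lemma fm_eqI: "(!!i j. ent x i j = ent y i j) ==> x = y"
 by (metis ent_inject ext)

definition fsupp :: "('i, 'k::zero) fm \<Rightarrow> 'i set" where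
 "fsupp x = {i. \<exists>j. ent x i j \<noteq> 0 \<or> ent x j i \<noteq> 0}"

lemma finite_fsupp [simp]: "finite (fsupp x)"
proof -
 have "fsupp x \<subseteq> fst ` {p. ent x (fst p) (snd p) \<noteq> 0} \<union> snd ` {p. ent x (fst p) (snd p) \<noteq> 0}"
  by (auto simp: fsupp_def image_iff)
 then show ?thesis
  by (rule finite_subset) (intro finite_UnI finite_imageI finite_ent)
qed

lemma ent_fsupp: "i \<notin> fsupp x \<or> j \<notin> fsupp x ==> ent x i j = 0"
 by (auto simp: fsupp_def)

lemma ent_Abs_fm:
 assumes "finite S" "!!i j. f i j \<noteq> 0 ==> i \<in> S \<and> j \<in> S"
 shows "ent (Abs_fm f) = f"
proof -
 have "{p. f (fst p) (snd p) \<noteq> 0} \<subseteq> S \<times> S" using assms(2) by auto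
 then have "finite {p. f (fst p) (snd p) \<noteq> 0}"
  by (rule finite_subset) (use assms(1) in simp)
 then show ?thesis by (simp add: Abs_fm_inverse)
qed

text \<open>All Hom spaces sit inside one associative ring, so no sizes have to match. For an
  infinite index type the ring has no unit; identities of objects are idempotents such as
  \<open>pr S\<close>.\<close>

instantiation fm :: (type, field) ring
begin

definition zero_fm :: "('a, 'b) fm" where "zero_fm = Abs_fm (\<lambda>_ _. 0)"
definition plus_fm :: "('a, 'b) fm \<Rightarrow> ('a, 'b) fm \<Rightarrow> ('a, 'b) fm" where
 "plus_fm x y = Abs_fm (\<lambda>i j. ent x i j + ent y i j)"
definition minus_fm :: "('a, 'b) fm \<Rightarrow> ('a, 'b) fm \<Rightarrow> ('a, 'b) fm" where
 "minus_fm x y = Abs_fm (\<lambda>i j. ent x i j - ent y i j)"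
definition uminus_fm :: "('a, 'b) fm \<Rightarrow> ('a, 'b) fm" where
 "uminus_fm x = Abs_fm (\<lambda>i j. - ent x i j)"
definition times_fm :: "('a, 'b) fm \<Rightarrow> ('a, 'b) fm \<Rightarrow> ('a, 'b) fm" where
 "times_fm x y = Abs_fm (\<lambda>i j. \<Sum>l\<in>fsupp x \<union> fsupp y. ent x i l * ent y l j)"

lemma ent_zero [simp]: "ent (0 :: ('a, 'b) fm) i j = 0"
 unfolding zero_fm_def by (subst ent_Abs_fm[of "{}"]) auto

lemma ent_plus [simp]: "ent (x + y :: ('a, 'b) fm) i j = ent x i j + ent y i j"
 unfolding plus_fm_def
 by (subst ent_Abs_fm[of "fsupp x \<union> fsupp y"]) (simp, rule ccontr, auto simp: ent_fsupp)

lemma ent_minus [simp]: "ent (x - y :: ('a, 'b) fm) i j = ent x i j - ent y i j"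
 unfolding minus_fm_def
 by (subst ent_Abs_fm[of "fsupp x \<union> fsupp y"]) (simp, rule ccontr, auto simp: ent_fsupp)

lemma ent_uminus [simp]: "ent (- x :: ('a, 'b) fm) i j = - ent x i j"
 unfolding uminus_fm_def
 by (subst ent_Abs_fm[of "fsupp x"]) (simp, rule ccontr, auto simp: ent_fsupp)

lemma ent_times: "ent (x * y :: ('a, 'b) fm) i j = (\<Sum>l\<in>fsupp x \<union> fsupp y. ent x i l * ent y l j)"
 unfolding times_fm_def
proof (subst ent_Abs_fm[of "fsupp x \<union> fsupp y"], goal_cases)
 case (2 i j)
 then have "\<exists>l. ent x i l * ent y l j \<noteq> 0" by (metis (no_types, lifting) sum.neutral)
 then show ?case by (metis UnI1 UnI2 ent_fsupp mult_zero_left mult_zero_right)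
qed auto

lemma ent_times_sup:
 assumes "finite S" "!!l. l \<notin> S ==> ent x i l * ent y l j = 0"
 shows "ent (x * y :: ('a, 'b) fm) i j = (\<Sum>l\<in>S. ent x i l * ent y l j)"
proof -
 let ?T = "fsupp x \<union> fsupp y"
 have "(\<Sum>l\<in>?T. ent x i l * ent y l j) = (\<Sum>l\<in>S \<union> ?T. ent x i l * ent y l j)"
  by (rule sum.mono_neutral_left) (use assms in \<open>auto simp: ent_fsupp\<close>)
 also have "\<dots> = (\<Sum>l\<in>S. ent x i l * ent y l j)"
  by (rule sum.mono_neutral_right) (use assms in auto)
 finally show ?thesis by (simp add: ent_times)
qed

instance
proof
 fix a b c :: "('a, 'b) fm"
 show "a * b * c = a * (b * c)"
 proof (rule fm_eqI)
  fix i j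
  define S where "S = fsupp a \<union> fsupp b \<union> fsupp c"
  have f: "finite S" by (simp add: S_def)
  have ab: "ent (a * b) i l = (\<Sum>m\<in>S. ent a i m * ent b m l)" for i l
   by (rule ent_times_sup[OF f]) (auto simp: S_def ent_fsupp)
  have bc: "ent (b * c) i l = (\<Sum>m\<in>S. ent b i m * ent c m l)" for i l
   by (rule ent_times_sup[OF f]) (auto simp: S_def ent_fsupp)
  have "ent (a * b * c) i j = (\<Sum>l\<in>S. ent (a * b) i l * ent c l j)"
   by (rule ent_times_sup[OF f]) (auto simp: S_def ent_fsupp)
  also have "\<dots> = (\<Sum>l\<in>S. \<Sum>m\<in>S. ent a i m * ent b m l * ent c l j)"
   by (simp add: ab sum_distrib_right)
  also have "\<dots> = (\<Sum>m\<in>S. \<Sum>l\<in>S. ent a i m * ent b m l * ent c l j)"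
   by (rule sum.swap)
  also have "\<dots> = (\<Sum>m\<in>S. ent a i m * ent (b * c) m j)"
   by (simp add: bc sum_distrib_left mult.assoc)
  also have "\<dots> = ent (a * (b * c)) i j"
   by (rule ent_times_sup[OF f, symmetric]) (auto simp: S_def ent_fsupp)
  finally show "ent (a * b * c) i j = ent (a * (b * c)) i j" .
 qed
 show "(a + b) * c = a * c + b * c"
 proof (rule fm_eqI)
  fix i j
  define S where "S = fsupp a \<union> fsupp b \<union> fsupp c"
  have f: "finite S" by (simp add: S_def)
  have "ent (x * c) i j = (\<Sum>l\<in>S. ent x i l * ent c l j)" for x
   by (rule ent_times_sup[OF f]) (auto simp: S_def ent_fsupp)
  then show "ent ((a + b) * c) i j = ent (a * c + b * c) i j"
   by (simp add: sum.distrib ring_distribs)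
 qed
 show "a * (b + c) = a * b + a * c"
 proof (rule fm_eqI)
  fix i j
  define S where "S = fsupp a \<union> fsupp b \<union> fsupp c"
  have f: "finite S" by (simp add: S_def)
  have "ent (a * x) i j = (\<Sum>l\<in>S. ent a i l * ent x l j)" for x
   by (rule ent_times_sup[OF f]) (auto simp: S_def ent_fsupp)
  then show "ent (a * (b + c)) i j = ent (a * b + a * c) i j"
   by (simp add: sum.distrib ring_distribs)
 qed
qed (auto intro!: fm_eqI)

end

definition sc :: "'k::field \<Rightarrow> ('i, 'k) fm \<Rightarrow> ('i, 'k) fm" where
 "sc c x = Abs_fm (\<lambda>i j. c * ent x i j)"

lemma ent_sc [simp]: "ent (sc c x) i j = c * ent x i j"
 unfolding sc_def by (subst ent_Abs_fm[of "fsupp x"]) (simp, rule ccontr, auto simp: ent_fsupp)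

lemma ent_sum: "ent (sum f A) i j = (\<Sum>a\<in>A. ent (f a :: ('i, 'k::field) fm) i j)"
 by (induction A rule: infinite_finite_induct) auto

lemma ent_times_fsupp:
 assumes "x' = x \<or> x' = sc c x" "y' = y \<or> y' = sc d y"
 shows "ent (x' * y') i j = (\<Sum>l\<in>fsupp x \<union> fsupp y. ent x' i l * ent y' l j)"
 by (rule ent_times_sup) (use assms in \<open>auto simp: ent_fsupp\<close>)

lemma sc_mult_left: "sc c x * y = sc c (x * y)"
proof (rule fm_eqI)
 fix i j
 have "ent (sc c x * y) i j = (\<Sum>l\<in>fsupp x \<union> fsupp y. c * (ent x i l * ent y l j))"
  by (subst ent_times_fsupp[of "sc c x" x c y y 1]) (auto simp: mult.assoc)
 then show "ent (sc c x * y) i j = ent (sc c (x * y)) i j"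
  by (simp add: ent_times sum_distrib_left)
qed

lemma sc_mult_right: "x * sc c y = sc c (x * y)"
proof (rule fm_eqI)
 fix i j
 have "ent (x * sc c y) i j = (\<Sum>l\<in>fsupp x \<union> fsupp y. c * (ent x i l * ent y l j))"
  by (subst ent_times_fsupp[of x x 1 "sc c y" y c]) (auto simp: mult_ac)
 then show "ent (x * sc c y) i j = ent (sc c (x * y)) i j"
  by (simp add: ent_times sum_distrib_left)
qed

lemma sc_simps:
 "sc c (x + y) = sc c x + sc c y" "sc c (x - y) = sc c x - sc c y" "sc c (- x) = - sc c x"
 "sc (a + c) x = sc a x + sc c x" "sc a (sc c x) = sc (a * c) x" "sc 1 x = x" "sc 0 x = 0" "sc c 0 = 0"
 by (auto intro!: fm_eqI simp: algebra_simps)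

definition Em :: "'i \<Rightarrow> 'i \<Rightarrow> ('i, 'k::field) fm" where
 "Em i j = Abs_fm (\<lambda>a b. if a = i \<and> b = j then 1 else 0)"

lemma ent_Em [simp]: "ent (Em i j) a b = (if a = i \<and> b = j then 1 else 0)"
 unfolding Em_def by (subst ent_Abs_fm[of "{i, j}"]) (auto split: if_splits)

lemma ent_Em_times: "ent (Em i j * x) a b = (if a = i then ent x j b else 0)"
 by (subst ent_times_sup[of "{j}"]) auto

lemma ent_times_Em: "ent (x * Em i j) a b = (if b = j then ent x a i else 0)"
 by (subst ent_times_sup[of "{i}"]) auto

lemma Em_times_Em: "Em i j * Em k l = (if j = k then Em i l else 0)"
 by (rule fm_eqI) (auto simp: ent_Em_times)

definition pr :: "'i set \<Rightarrow> ('i, 'k::field) fm" where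
 "pr S = Abs_fm (\<lambda>i j. if i = j \<and> i \<in> S then 1 else 0)"

lemma ent_pr [simp]: "finite S ==> ent (pr S) i j = (if i = j \<and> i \<in> S then 1 else 0)"
 unfolding pr_def by (subst ent_Abs_fm[of S]) (auto split: if_splits)

lemma ent_pr_times: "finite S ==> ent (pr S * x) i j = (if i \<in> S then ent x i j else 0)"
 by (subst ent_times_sup[of "{i}"]) auto

lemma ent_times_pr: "finite S ==> ent (x * pr S) i j = (if j \<in> S then ent x i j else 0)"
 by (subst ent_times_sup[of "{j}"]) auto

definition pick :: "('i \<Rightarrow> 'i \<Rightarrow> bool) \<Rightarrow> ('i, 'k::field) fm \<Rightarrow> ('i, 'k) fm" where
 "pick Q x = Abs_fm (\<lambda>i j. if Q i j then ent x i j else 0)"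

lemma ent_pick [simp]: "ent (pick Q x) i j = (if Q i j then ent x i j else 0)"
 unfolding pick_def by (subst ent_Abs_fm[of "fsupp x"]) (simp, rule ccontr, auto simp: ent_fsupp split: if_splits)

lemma pick_simps:
 "pick Q (x + y) = pick Q x + pick Q y" "pick Q (x - y) = pick Q x - pick Q y"
 "pick Q (- x) = - pick Q x" "pick Q 0 = 0" "pick Q (sc c x) = sc c (pick Q x)"
 by (auto intro!: fm_eqI)

definition tr :: "('i, 'k::field) fm \<Rightarrow> 'k" where
 "tr x = (\<Sum>i\<in>fsupp x. ent x i i)"

lemma tr_sup: "finite S ==> (!!i. i \<notin> S ==> ent x i i = 0) ==> tr x = (\<Sum>i\<in>S. ent x i i)"
proof -
 assume a: "finite S" "!!i. i \<notin> S ==> ent x i i = 0"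
 have "(\<Sum>i\<in>fsupp x. ent x i i) = (\<Sum>i\<in>S \<union> fsupp x. ent x i i)"
  by (rule sum.mono_neutral_left) (use a in \<open>auto simp: ent_fsupp\<close>)
 also have "\<dots> = (\<Sum>i\<in>S. ent x i i)"
  by (rule sum.mono_neutral_right) (use a in auto)
 finally show ?thesis by (simp add: tr_def)
qed

lemma tr_add: "tr (x + y) = tr x + tr y"
proof -
 let ?S = "fsupp x \<union> fsupp y"
 have "tr x = (\<Sum>i\<in>?S. ent x i i)" "tr y = (\<Sum>i\<in>?S. ent y i i)"
  "tr (x + y) = (\<Sum>i\<in>?S. ent (x + y) i i)"
  by (rule tr_sup; auto simp: ent_fsupp)+
 then show ?thesis by (simp add: sum.distrib)
qed

lemma tr_sc: "tr (sc c x) = c * tr x"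
proof -
 have "tr (sc c x) = (\<Sum>i\<in>fsupp x. ent (sc c x) i i)"
  by (rule tr_sup) (auto simp: ent_fsupp)
 then show ?thesis by (simp add: tr_def sum_distrib_left)
qed

lemma tr_uminus: "tr (- x) = - tr x"
 by (metis add.commute add.right_inverse add_eq_0_iff tr_add tr_sc sc_simps(8) mult_zero_left sc_simps(7))

lemma tr_mult_commute: "tr (x * y) = tr (y * x)"
proof -
 define S where "S = fsupp x \<union> fsupp y"
 have f: "finite S" by (simp add: S_def)
 have e: "ent (a * b) i j = (\<Sum>l\<in>S. ent a i l * ent b l j)" if "(a = x \<and> b = y) \<or> (a = y \<and> b = x)" for a b i j
  by (rule ent_times_sup[OF f]) (use that in \<open>auto simp: S_def ent_fsupp\<close>)
 have z: "ent (a * b) i i = 0" if "(a = x \<and> b = y) \<or> (a = y \<and> b = x)" "i \<notin> S" for a b i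
  by (subst e[OF that(1)], rule sum.neutral) (use that in \<open>auto simp: S_def ent_fsupp\<close>)
 have "tr (x * y) = (\<Sum>i\<in>S. \<Sum>l\<in>S. ent x i l * ent y l i)"
  by (subst tr_sup[OF f z]) (auto simp: e)
 also have "\<dots> = (\<Sum>l\<in>S. \<Sum>i\<in>S. ent x i l * ent y l i)" by (rule sum.swap)
 also have "\<dots> = tr (y * x)"
  by (subst tr_sup[OF f z]) (auto simp: e mult.commute)
 finally show ?thesis .
qed

lemma tr_Em_times: "tr (Em i j * x) = ent x j i"
 by (subst tr_sup[of "{i}"]) (auto simp: ent_Em_times)

lemma fm_decomp:
 fixes x :: "('i, 'k::field) fm"
 assumes "finite S" "!!i j. ent x i j \<noteq> 0 ==> i \<in> S \<and> j \<in> S"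
 shows "x = (\<Sum>p\<in>S \<times> S. sc (ent x (fst p) (snd p)) (Em (fst p) (snd p)))"
proof (rule fm_eqI)
 fix i j
 have "(\<Sum>p\<in>S \<times> S. ent x (fst p) (snd p) * (if i = fst p \<and> j = snd p then 1 else 0))
   = (\<Sum>p\<in>S \<times> S. if (i, j) = p then ent x i j else 0)"
  by (rule sum.cong) auto
 also have "\<dots> = (if (i, j) \<in> S \<times> S then ent x i j else 0)"
  using assms(1) by (subst sum.delta') auto
 also have "\<dots> = ent x i j" using assms(2) by auto
 finally show "ent x i j = ent (\<Sum>p\<in>S \<times> S. sc (ent x (fst p) (snd p)) (Em (fst p) (snd p))) i j"
  by (simp add: ent_sum)
qed

lemma fun_sum_apply: "sum f A i = (\<Sum>a\<in>A. (f a i :: 'k::comm_monoid_add))"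
 by (induction A rule: infinite_finite_induct) auto

text \<open>Von Neumann regularity: a linear map \<open>f\<close> has a linear \<open>g\<close> with
  f g f = f, and \<open>q\<close> is the matrix of \<open>g\<close> cut down to the support of
  \<open>c\<close>, outside of which \<open>c\<close> sees nothing. Exactness statements are turned
  into explicit homotopies by such generalised inverses.\<close>

lemma quasi_inverse:
 fixes c :: "('i, 'k::field) fm"
 shows "\<exists>q. c * q * c = c"
proof -
 define S where "S = fsupp c"
 have fS: "finite S" by (simp add: S_def)
 interpret V: vector_space "\<lambda>(a::'k) (f::'i \<Rightarrow> 'k) i. a * f i"
  by unfold_locales (auto simp: algebra_simps fun_eq_iff)
 interpret VV: vector_space_pair "\<lambda>(a::'k) (f::'i \<Rightarrow> 'k) i. a * f i" "\<lambda>(a::'k) (f::'i \<Rightarrow> 'k) i. a * f i"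
  by unfold_locales
 define f where "f x = (\<lambda>i. \<Sum>j\<in>S. ent c i j * x j)" for x :: "'i \<Rightarrow> 'k"
 have "Vector_Spaces.linear (\<lambda>(a::'k) (f::'i \<Rightarrow> 'k) i. a * f i) (\<lambda>(a::'k) (f::'i \<Rightarrow> 'k) i. a * f i) f"
  by unfold_locales
   (auto simp: f_def fun_eq_iff sum.distrib algebra_simps sum_distrib_left)
 from VV.linear_exists_right_inverse_on[OF this V.subspace_UNIV]
 obtain g where g: "Vector_Spaces.linear (\<lambda>(a::'k) (f::'i \<Rightarrow> 'k) i. a * f i) (\<lambda>(a::'k) (f::'i \<Rightarrow> 'k) i. a * f i) g" and fg: "!!x. f (g (f x)) = f x"
  by auto
 define \<delta> :: "'i \<Rightarrow> 'i \<Rightarrow> 'k" where "\<delta> j = (\<lambda>i. if i = j then 1 else 0)" for j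
 define q where "q = Abs_fm (\<lambda>i j. if i \<in> S \<and> j \<in> S then g (\<delta> j) i else 0)"
 have q: "ent q i j = (if i \<in> S \<and> j \<in> S then g (\<delta> j) i else 0)" for i j
  unfolding q_def by (subst ent_Abs_fm[OF fS]) (auto split: if_splits)
 have fd: "f (\<delta> b) = (\<lambda>i. ent c i b)" for b
 proof
  fix i
  show "f (\<delta> b) i = ent c i b"
  proof (cases "b \<in> S")
   case True
   then show ?thesis
    using fS by (simp add: f_def \<delta>_def if_distrib cong: if_cong)
  next
   case False
   then have "ent c i b = 0" by (simp add: S_def ent_fsupp)
   moreover have "f (\<delta> b) i = 0" unfolding f_def
    by (rule sum.neutral) (use False in \<open>auto simp: \<delta>_def\<close>)
   ultimately show ?thesis by simp
  qed
 qed
 have fd2: "f (\<delta> b) = (\<Sum>j\<in>S. (\<lambda>i. ent c j b * \<delta> j i))" for b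
 proof
  fix i
  have "(\<Sum>j\<in>S. ent c j b * \<delta> j i) = (\<Sum>j\<in>S. if i = j then ent c i b else 0)"
   by (rule sum.cong) (auto simp: \<delta>_def)
  also have "\<dots> = ent c i b"
   using fS by (simp add: S_def ent_fsupp)
  finally show "f (\<delta> b) i = (\<Sum>j\<in>S. (\<lambda>i. ent c j b * \<delta> j i)) i"
   by (simp add: fd fun_sum_apply)
 qed
 have gf: "g (f (\<delta> b)) i = (\<Sum>j\<in>S. ent c j b * g (\<delta> j) i)" for b i
  unfolding fd2 by (simp add: VV.linear_sum[OF g] VV.linear_scale[OF g] fun_sum_apply)
 have qc: "ent (q * c) i b = (if i \<in> S then g (f (\<delta> b)) i else 0)" for i b
  by (subst ent_times_sup[OF fS]) (auto simp: q gf mult.commute)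
 have "c * (q * c) = c"
 proof (rule fm_eqI)
  fix a b
  have "ent (c * (q * c)) a b = (\<Sum>l\<in>S. ent c a l * ent (q * c) l b)"
   by (rule ent_times_sup[OF fS]) (auto simp: S_def ent_fsupp)
  also have "\<dots> = f (g (f (\<delta> b))) a"
   unfolding f_def[of "g _"] by (rule sum.cong) (auto simp: qc)
  also have "\<dots> = ent c a b" using fg[of "\<delta> b"] by (simp only: fd)
  finally show "ent (c * (q * c)) a b = ent c a b" .
 qed
 then show ?thesis by (metis mult.assoc)
qed

text \<open>A basis of \<open>A\<close> stays independent when \<open>a\<close> is added, and a
  functional may be prescribed on it. Both duality arguments separate a vector from a subspace in
  this way.\<close>

lemma (in vector_space) separating_functional:
 assumes A: "subspace A" and a: "a \<notin> A"
 shows "\<exists>l :: 'b \<Rightarrow> 'a. (\<forall>x y. l (x + y) = l x + l y) \<and> (\<forall>c x. l (scale c x) = c * l x)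
  \<and> (\<forall>x\<in>A. l x = 0) \<and> l a = 1"
proof -
 interpret K: vector_space "(*) :: 'a \<Rightarrow> 'a \<Rightarrow> 'a"
  by unfold_locales (auto simp: algebra_simps)
 interpret VV: vector_space_pair scale "(*) :: 'a \<Rightarrow> 'a \<Rightarrow> 'a"
  by unfold_locales
 obtain B where B: "B \<subseteq> A" "independent B" "A \<subseteq> span B"
  using basis_exists[of A] by metis
 have sB: "span B = A"
  using B A by (metis span_subspace)
 have ind: "independent (insert a B)"
  by (rule independent_insertI) (use a sB B in auto)
 obtain l where l: "Vector_Spaces.linear scale (*) l" "\<forall>x\<in>insert a B. l x = (if x = a then 1 else 0)"
  using VV.linear_independent_extend[OF ind, of "\<lambda>x. if x = a then 1 else 0"] by auto
 have z: "l x = 0" if "x \<in> A" for x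
 proof -
  have "x \<in> span B" using that sB by simp
  moreover have "!!b. b \<in> B ==> l b = 0" using l(2) a B(1) by auto
  ultimately show ?thesis using VV.linear_eq_0_on_span[OF l(1), of B x] by simp
 qed
 have "\<forall>x y. l (x + y) = l x + l y" using VV.linear_add[OF l(1)] by auto
 moreover have "\<forall>c x. l (scale c x) = c * l x" using VV.linear_scale[OF l(1)] by auto
 moreover have "l a = 1" using l(2) by simp
 ultimately show ?thesis using z by blast
qed

section \<open>Total degree, vertex-triangular matrices and pairs of them with a common
  diagonal\<close>

section \<open>Weak morphisms\<close>

declare split_paired_All [simp del] split_paired_Ex [simp del]

type_synonym blk = "int \<times> vtx"
type_synonym idx = "blk \<times> nat"
type_synonym 'k bm = "(idx, 'k) fm"

fun vn :: "vtx \<Rightarrow> int" where "vn V1 = 1" | "vn V2 = 2" | "vn V3 = 3"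

lemma vn_inject [simp]: "vn v = vn w \<longleftrightarrow> v = w"
 by (cases v; cases w) auto

definition vt :: "idx \<Rightarrow> vtx" where "vt a = snd (fst a)"
text \<open>An arrow keeps the complex degree and raises the vertex by one. Adding the vertex number
  therefore gives arrows degree one, like the differential, and makes \<open>d + A\<close> and
  \<open>d + B\<close> homogeneous.\<close>

definition td :: "idx \<Rightarrow> int" where "td a = fst (fst a) + vn (vt a)"

lemma vt_simps [simp]: "vt ((i, v), a) = v" by (simp add: vt_def)
lemma td_simps [simp]: "td ((i, v), a) = i + vn v" by (simp add: td_def)

definition dgr :: "int \<Rightarrow> 'k::field bm \<Rightarrow> bool" where
 "dgr p x \<longleftrightarrow> (\<forall>i j. ent x i j \<noteq> 0 --> td i = td j + p)"

definition upr :: "'k::field bm \<Rightarrow> bool" where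
 "upr x \<longleftrightarrow> (\<forall>i j. ent x i j \<noteq> 0 --> vn (vt j) \<le> vn (vt i))"

definition dia :: "'k::field bm \<Rightarrow> 'k bm" where
 "dia = pick (\<lambda>i j. vt i = vt j)"

lemma ent_dia [simp]: "ent (dia x) i j = (if vt i = vt j then ent x i j else 0)"
 by (simp add: dia_def)

lemma ent_times_nonzero:
 "ent (x * y :: ('i, 'k::field) fm) i j \<noteq> 0 ==> \<exists>l. ent x i l \<noteq> 0 \<and> ent y l j \<noteq> 0"
 by (metis (no_types, lifting) ent_times mult_eq_0_iff sum.neutral)

lemma dgr_mult: "dgr p x ==> dgr q y ==> dgr (p + q) (x * y)"
 unfolding dgr_def
proof (intro allI impI)
 fix i j
 assume a: "\<forall>i j. ent x i j \<noteq> 0 --> td i = td j + p" "\<forall>i j. ent y i j \<noteq> 0 --> td i = td j + q"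
  "ent (x * y) i j \<noteq> 0"
 obtain l where "ent x i l \<noteq> 0" "ent y l j \<noteq> 0" using ent_times_nonzero[OF a(3)] by blast
 then have "td i = td l + p" "td l = td j + q" using a by blast+
 then show "td i = td j + (p + q)" by simp
qed

lemma dgr_mult': "dgr p x ==> dgr q y ==> r = p + q ==> dgr r (x * y)"
 using dgr_mult by blast

lemma dgr_add: "dgr p x ==> dgr p y ==> dgr p (x + y)"
 unfolding dgr_def by (metis add.left_neutral ent_plus)

lemma dgr_uminus [simp]: "dgr p (- x) \<longleftrightarrow> dgr p x"
 unfolding dgr_def by simp

lemma dgr_diff: "dgr p x ==> dgr p y ==> dgr p (x - y)"
 by (metis add_uminus_conv_diff dgr_add dgr_uminus)

lemma dgr_0 [simp]: "dgr p 0" by (simp add: dgr_def)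

lemma dgr_sc: "dgr p x ==> dgr p (sc c x)" by (simp add: dgr_def)

lemma upr_mult: "upr x ==> upr y ==> upr (x * y)"
 unfolding upr_def
proof (intro allI impI)
 fix i j
 assume a: "\<forall>i j. ent x i j \<noteq> 0 --> vn (vt j) \<le> vn (vt i)" "\<forall>i j. ent y i j \<noteq> 0 --> vn (vt j) \<le> vn (vt i)"
  "ent (x * y) i j \<noteq> 0"
 obtain l where "ent x i l \<noteq> 0" "ent y l j \<noteq> 0" using ent_times_nonzero[OF a(3)] by blast
 then have "vn (vt l) \<le> vn (vt i)" "vn (vt j) \<le> vn (vt l)" using a by blast+
 then show "vn (vt j) \<le> vn (vt i)" by simp
qed

lemma upr_add: "upr x ==> upr y ==> upr (x + y)"
 unfolding upr_def by (metis add.left_neutral ent_plus)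

lemma upr_uminus [simp]: "upr (- x) \<longleftrightarrow> upr x" by (simp add: upr_def)

lemma upr_diff: "upr x ==> upr y ==> upr (x - y)"
 by (metis add_uminus_conv_diff upr_add upr_uminus)

lemma upr_0 [simp]: "upr 0" by (simp add: upr_def)
lemma upr_sc: "upr x ==> upr (sc c x)" by (simp add: upr_def)
lemma upr_dia [simp]: "upr (dia x)" by (simp add: upr_def)

lemma dia_simps [simp]:
 "dia (x + y) = dia x + dia y" "dia (x - y) = dia x - dia y" "dia (- x) = - dia x"
 "dia 0 = 0" "dia (sc c x) = sc c (dia x)" "dia (dia x) = dia x"
 by (auto simp: dia_def pick_simps intro: fm_eqI)

text \<open>A product of two triangular entries that starts and ends at the same vertex cannot leave
  that vertex in between.\<close>

lemma dia_mult:
 assumes "upr x" "upr y"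
 shows "dia (x * y) = dia x * dia y"
proof (rule fm_eqI)
 fix i j
 let ?S = "fsupp x \<union> fsupp y"
 have e: "ent (dia x * dia y) i j = (\<Sum>l\<in>?S. ent (dia x) i l * ent (dia y) l j)"
  by (rule ent_times_sup) (auto simp: ent_fsupp)
 show "ent (dia (x * y)) i j = ent (dia x * dia y) i j"
 proof (cases "vt i = vt j")
  case True
  have "ent x i l * ent y l j = ent (dia x) i l * ent (dia y) l j" for l
  proof (cases "ent x i l * ent y l j = 0")
   case False
   then have "vn (vt l) \<le> vn (vt i)" "vn (vt j) \<le> vn (vt l)"
    using assms by (auto simp: upr_def)
   then have "vt l = vt i" using True by (metis order_antisym vn_inject)
   then show ?thesis using True by simp
  qed auto
  then have "ent (x * y) i j = (\<Sum>l\<in>?S. ent (dia x) i l * ent (dia y) l j)"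
   by (simp only: ent_times)
  then show ?thesis using True by (simp only: e[symmetric] ent_dia[of "x * y"] if_True refl)
 next
  case False
  have "(\<Sum>l\<in>?S. ent (dia x) i l * ent (dia y) l j) = 0"
   by (rule sum.neutral) (use False in auto)
  then show ?thesis unfolding e using False by simp
 qed
qed

lemma dgr_dia: "dgr p x ==> dgr p (dia x)"
 by (auto simp: dgr_def)

lemma dgr_pick: "dgr p x ==> dgr p (pick Q x)"
 by (auto simp: dgr_def)

text \<open>The component of total degree \<open>p\<close>. Linear equations between homogeneous
  matrices are solved without regard to degree first, and the solution is then projected to the
  right degree.\<close>

definition gc :: "int \<Rightarrow> 'k::field bm \<Rightarrow> 'k bm" where
 "gc p = pick (\<lambda>i j. td i = td j + p)"

lemma ent_gc [simp]: "ent (gc p x) i j = (if td i = td j + p then ent x i j else 0)"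
 by (simp add: gc_def)

lemma dgr_gc [simp]: "dgr p (gc p x)"
 by (auto simp: dgr_def)

lemma gc_simps: "gc p (x + y) = gc p x + gc p y" "gc p (x - y) = gc p x - gc p y" "gc p (- x) = - gc p x" "gc p 0 = 0"
 by (auto simp: gc_def pick_simps)

lemma gc_id: "dgr p x ==> gc p x = x"
 by (rule fm_eqI) (auto simp: dgr_def)

lemma gc_mult_left:
 assumes "dgr q y" shows "gc (p + q) (x * y) = gc p x * y"
proof (rule fm_eqI)
 fix i j
 let ?S = "fsupp x \<union> fsupp y"
 have e: "ent (gc p x * y) i j = (\<Sum>l\<in>?S. ent (gc p x) i l * ent y l j)"
  by (rule ent_times_sup) (auto simp: ent_fsupp)
 have *: "(if td i = td j + (p + q) then ent x i l * ent y l j else 0) = ent (gc p x) i l * ent y l j" for l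
  using assms[unfolded dgr_def, rule_format, of l j] by (cases "ent y l j = 0") auto
 show "ent (gc (p + q) (x * y)) i j = ent (gc p x * y) i j"
  unfolding e *[symmetric] by (cases "td i = td j + (p + q)") (simp_all add: ent_times)
qed

lemma gc_mult_right:
 assumes "dgr p x" shows "gc (p + q) (x * y) = x * gc q y"
proof (rule fm_eqI)
 fix i j
 let ?S = "fsupp x \<union> fsupp y"
 have e: "ent (x * gc q y) i j = (\<Sum>l\<in>?S. ent x i l * ent (gc q y) l j)"
  by (rule ent_times_sup) (auto simp: ent_fsupp)
 have *: "(if td i = td j + (p + q) then ent x i l * ent y l j else 0) = ent x i l * ent (gc q y) l j" for l
  using assms[unfolded dgr_def, rule_format, of i l] by (cases "ent x i l = 0") auto
 show "ent (gc (p + q) (x * y)) i j = ent (x * gc q y) i j"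
  unfolding e *[symmetric] by (cases "td i = td j + (p + q)") (simp_all add: ent_times)
qed

text \<open>The common diagonal is the family of vertexwise maps. The strictly triangular entries of
  the first component are homotopies attached to \<open>Beta1\<close>, \<open>Alpha2\<close> and
  their relation, those of the second component to \<open>Alpha1\<close>, \<open>Beta2\<close> and
  theirs.\<close>

typedef (overloaded) 'k wk = "{g :: 'k::field bm \<times> 'k bm. upr (fst g) \<and> upr (snd g) \<and> dia (fst g) = dia (snd g)}"
 morphisms rwk Abs_wk
 by (rule exI[of _ "(0, 0)"]) simp

definition w1 :: "'k::field wk \<Rightarrow> 'k bm" where "w1 x = fst (rwk x)"
definition w2 :: "'k::field wk \<Rightarrow> 'k bm" where "w2 x = snd (rwk x)"
definition wk :: "'k::field bm \<Rightarrow> 'k bm \<Rightarrow> 'k wk" where "wk g h = Abs_wk (g, h)"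

lemma wk_eqI: "w1 x = w1 y ==> w2 x = w2 y ==> x = y"
 by (metis prod.expand rwk_inject w1_def w2_def)

lemma upr_w [simp]: "upr (w1 x)" "upr (w2 x)"
 using rwk[of x] by (auto simp: w1_def w2_def)

lemma dia_w: "dia (w2 x) = dia (w1 x)"
 using rwk[of x] by (auto simp: w1_def w2_def)

lemma w_wk: "upr g ==> upr h ==> dia g = dia h ==> w1 (wk g h) = g \<and> w2 (wk g h) = h"
 by (simp add: wk_def w1_def w2_def Abs_wk_inverse)

instantiation wk :: (field) ring
begin
definition zero_wk :: "'a wk" where "0 = wk 0 0"
definition plus_wk :: "'a wk \<Rightarrow> 'a wk \<Rightarrow> 'a wk" where "x + y = wk (w1 x + w1 y) (w2 x + w2 y)"
definition minus_wk :: "'a wk \<Rightarrow> 'a wk \<Rightarrow> 'a wk" where "x - y = wk (w1 x - w1 y) (w2 x - w2 y)"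
definition uminus_wk :: "'a wk \<Rightarrow> 'a wk" where "- x = wk (- w1 x) (- w2 x)"
definition times_wk :: "'a wk \<Rightarrow> 'a wk \<Rightarrow> 'a wk" where "x * y = wk (w1 x * w1 y) (w2 x * w2 y)"

lemma w_zero [simp]: "w1 (0 :: 'a wk) = 0" "w2 (0 :: 'a wk) = 0"
 using w_wk[of 0 0] by (auto simp: zero_wk_def)
lemma w_plus [simp]: "w1 (x + y :: 'a wk) = w1 x + w1 y" "w2 (x + y :: 'a wk) = w2 x + w2 y"
 using w_wk[of "w1 x + w1 y" "w2 x + w2 y"] by (auto simp: plus_wk_def upr_add dia_w)
lemma w_minus [simp]: "w1 (x - y :: 'a wk) = w1 x - w1 y" "w2 (x - y :: 'a wk) = w2 x - w2 y"
 using w_wk[of "w1 x - w1 y" "w2 x - w2 y"] by (auto simp: minus_wk_def upr_diff dia_w)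
lemma w_uminus [simp]: "w1 (- x :: 'a wk) = - w1 x" "w2 (- x :: 'a wk) = - w2 x"
 using w_wk[of "- w1 x" "- w2 x"] by (auto simp: uminus_wk_def dia_w)
lemma w_times [simp]: "w1 (x * y :: 'a wk) = w1 x * w1 y" "w2 (x * y :: 'a wk) = w2 x * w2 y"
 using w_wk[of "w1 x * w1 y" "w2 x * w2 y"] by (auto simp: times_wk_def upr_mult dia_w dia_mult)

instance
 by standard (auto intro!: wk_eqI simp: algebra_simps)
end

definition scw :: "'k::field \<Rightarrow> 'k wk \<Rightarrow> 'k wk" where "scw c x = wk (sc c (w1 x)) (sc c (w2 x))"

lemma w_scw [simp]: "w1 (scw c x) = sc c (w1 x)" "w2 (scw c x) = sc c (w2 x)"
 using w_wk[of "sc c (w1 x)" "sc c (w2 x)"] by (auto simp: scw_def upr_sc dia_w)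

lemma scw_mult_left: "scw c x * y = scw c (x * y)"
 and scw_mult_right: "x * scw c y = scw c (x * y)"
 by (auto intro!: wk_eqI simp: sc_mult_left sc_mult_right)

lemma scw_simps:
 "scw c (x + y) = scw c x + scw c y" "scw c (x - y) = scw c x - scw c y" "scw c (- x) = - scw c x"
 "scw (a + c) x = scw a x + scw c x" "scw a (scw c x) = scw (a * c) x" "scw 1 x = x" "scw 0 x = 0" "scw c 0 = 0"
 by (auto intro!: wk_eqI simp: sc_simps)

lemma scw_minus_one: "scw (- 1) x = - x"
 by (rule wk_eqI; rule fm_eqI) simp_all

text \<open>A strict morphism carries no homotopies, so both components are the diagonal.\<close>

definition st :: "'k::field bm \<Rightarrow> 'k wk" where "st x = wk (dia x) (dia x)"

lemma w_st [simp]: "w1 (st x) = dia x" "w2 (st x) = dia x"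
 using w_wk[of "dia x" "dia x"] by (auto simp: st_def)

lemma st_mult: "upr x ==> upr y ==> st (x * y) = st x * st y"
 by (rule wk_eqI) (auto simp: dia_mult)

lemma st_simps: "st (x + y) = st x + st y" "st (x - y) = st x - st y" "st (- x) = - st x" "st 0 = 0"
 "st (sc c x) = scw c (st x)"
 by (rule wk_eqI; simp)+

definition dg :: "int \<Rightarrow> 'k::field wk \<Rightarrow> bool" where
 "dg p x \<longleftrightarrow> dgr p (w1 x) \<and> dgr p (w2 x)"

lemma dg_mult: "dg p x ==> dg q y ==> dg (p + q) (x * y)"
 by (simp add: dg_def dgr_mult)
lemma dg_mult': "dg p x ==> dg q y ==> r = p + q ==> dg r (x * y)"
 using dg_mult by blast
lemma dg_add: "dg p x ==> dg p y ==> dg p (x + y)"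
 by (simp add: dg_def dgr_add)
lemma dg_diff: "dg p x ==> dg p y ==> dg p (x - y)"
 by (simp add: dg_def dgr_diff)
lemma dg_uminus [simp]: "dg p (- x) \<longleftrightarrow> dg p x"
 by (simp add: dg_def)
lemma dg_0 [simp]: "dg p 0"
 by (simp add: dg_def)
lemma dg_scw: "dg p x ==> dg p (scw c x)"
 by (simp add: dg_def dgr_sc)
lemma dg_st: "dgr p x ==> dg p (st x)"
 by (simp add: dg_def dgr_dia)

definition sg :: "int \<Rightarrow> 'a::group_add \<Rightarrow> 'a" where
 "sg p x = (if even p then x else - x)"

lemma sg_0 [simp]: "sg p 0 = 0" by (simp add: sg_def)
lemma sg_zero [simp]: "sg 0 x = x" by (simp add: sg_def)
lemma sg_one [simp]: "sg 1 x = - x" by (simp add: sg_def)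
lemma sg_add: "sg p (x + y :: 'a::ab_group_add) = sg p x + sg p y" by (simp add: sg_def)
lemma sg_diff: "sg p (x - y :: 'a::ab_group_add) = sg p x - sg p y" by (simp add: sg_def)
lemma sg_uminus: "sg p (- x) = - sg p x" by (simp add: sg_def)
lemma sg_sg: "sg p (sg q x) = sg (p + q) x" by (simp add: sg_def)
lemma sg_same [simp]: "sg p (sg p x) = x" by (simp add: sg_def)
lemma sg_mult_left: "sg p x * (y::'a::ring) = sg p (x * y)" by (simp add: sg_def)
lemma sg_mult_right: "(x::'a::ring) * sg p y = sg p (x * y)" by (simp add: sg_def)
lemma sg_eq_0 [simp]: "sg p x = 0 \<longleftrightarrow> x = 0" by (simp add: sg_def)
lemma sg_inject [simp]: "sg p x = sg p y \<longleftrightarrow> x = y" by (simp add: sg_def)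
lemma dg_sg [simp]: "dg p (sg q x) \<longleftrightarrow> dg p x" by (simp add: sg_def)
lemma dgr_sg [simp]: "dgr p (sg q x) \<longleftrightarrow> dgr p x" by (simp add: sg_def)
lemma w_sg [simp]: "w1 (sg p x) = sg p (w1 x)" "w2 (sg p x) = sg p (w2 x)" by (auto simp: sg_def)
lemma sg_scw: "sg p (scw c x) = scw c (sg p x)" by (simp add: sg_def scw_simps)
lemma ent_sg: "ent (sg p x) i j = sg p (ent (x :: ('i, 'k::field) fm) i j)" by (simp add: sg_def)

lemmas sgs = sg_add sg_diff sg_uminus sg_sg sg_mult_left sg_mult_right

section \<open>Hom complexes of weak morphisms, their cocycles and coboundaries\<close>

subsection \<open>The differential graded category\<close>

type_synonym 'k ob = "'k wk \<times> 'k wk"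

text \<open>The first entry is the identity of the object, as an idempotent, and the second its
  differential. With these, \<open>Cm\<close>, \<open>Zc\<close> and \<open>Nl\<close> are the
  cochains, cocycles and coboundaries of the Hom complex.\<close>

definition ob :: "'k::field ob \<Rightarrow> bool" where
 "ob X \<longleftrightarrow> fst X * fst X = fst X \<and> fst X * snd X = snd X \<and> snd X * fst X = snd X \<and>
  snd X * snd X = 0 \<and> dg 0 (fst X) \<and> dg 1 (snd X)"

definition Cm :: "int \<Rightarrow> 'k::field ob \<Rightarrow> 'k ob \<Rightarrow> 'k wk \<Rightarrow> bool" where
 "Cm p X Y g \<longleftrightarrow> dg p g \<and> fst Y * g = g \<and> g * fst X = g"

definition Zc :: "int \<Rightarrow> 'k::field ob \<Rightarrow> 'k ob \<Rightarrow> 'k wk \<Rightarrow> bool" where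
 "Zc p X Y g \<longleftrightarrow> Cm p X Y g \<and> snd Y * g = sg p (g * snd X)"

text \<open>The differential of a cochain \<open>h\<close> of degree p - 1: its Koszul sign -(-1)^(p
  - 1) is \<open>sg p\<close>.\<close>

definition Nl :: "int \<Rightarrow> 'k::field ob \<Rightarrow> 'k ob \<Rightarrow> 'k wk \<Rightarrow> bool" where
 "Nl p X Y g \<longleftrightarrow> (\<exists>h. Cm (p - 1) X Y h \<and> g = snd Y * h + sg p (h * snd X))"

definition hq :: "int \<Rightarrow> 'k::field ob \<Rightarrow> 'k ob \<Rightarrow> 'k wk \<Rightarrow> 'k wk \<Rightarrow> bool" where
 "hq p X Y f g \<longleftrightarrow> Nl p X Y (f - g)"

lemma Cm_comp: "Cm p X Y f ==> Cm q Y Z g ==> r = q + p ==> Cm r X Z (g * f)"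
 by (auto simp: Cm_def dg_mult mult.assoc) (simp flip: mult.assoc)

lemma Cm_add: "Cm p X Y f ==> Cm p X Y g ==> Cm p X Y (f + g)"
 by (auto simp: Cm_def dg_add algebra_simps)
lemma Cm_diff: "Cm p X Y f ==> Cm p X Y g ==> Cm p X Y (f - g)"
 by (auto simp: Cm_def dg_diff algebra_simps)
lemma Cm_uminus: "Cm p X Y f ==> Cm p X Y (- f)"
 by (auto simp: Cm_def)
lemma Cm_sg: "Cm p X Y f ==> Cm p X Y (sg q f)"
 by (auto simp: sg_def Cm_uminus)
lemma Cm_0: "Cm p X Y 0"
 by (auto simp: Cm_def)
lemma Cm_scw: "Cm p X Y f ==> Cm p X Y (scw c f)"
 by (auto simp: Cm_def dg_scw scw_mult_left scw_mult_right)

lemma Zc_comp: "Zc p X Y f ==> Zc q Y Z g ==> r = q + p ==> Zc r X Z (g * f)"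
proof -
 assume a: "Zc p X Y f" "Zc q Y Z g" "r = q + p"
 have y: "snd Y * f = sg p (f * snd X)" and z: "snd Z * g = sg q (g * snd Y)"
  and c: "Cm p X Y f" "Cm q Y Z g"
  using a by (auto simp: Zc_def)
 have "snd Z * (g * f) = (snd Z * g) * f" by (simp only: mult.assoc)
 also have "\<dots> = sg q (g * (snd Y * f))" by (simp only: z sg_mult_left mult.assoc)
 also have "\<dots> = sg r (g * f * snd X)" by (simp only: y a(3) sgs mult.assoc)
 finally show ?thesis using Cm_comp[OF c a(3)] by (auto simp: Zc_def)
qed

lemma Zc_add: "Zc p X Y f ==> Zc p X Y g ==> Zc p X Y (f + g)"
 by (auto simp: Zc_def Cm_add algebra_simps sgs)
lemma Zc_diff: "Zc p X Y f ==> Zc p X Y g ==> Zc p X Y (f - g)"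
 by (auto simp: Zc_def Cm_diff algebra_simps sgs)
lemma Zc_uminus: "Zc p X Y f ==> Zc p X Y (- f)"
 by (auto simp: Zc_def Cm_uminus sgs)
lemma Zc_0: "Zc p X Y 0"
 by (auto simp: Zc_def Cm_0)
lemma Zc_scw: "Zc p X Y f ==> Zc p X Y (scw c f)"
 by (auto simp: Zc_def Cm_scw scw_mult_left scw_mult_right sg_scw)
lemma Zc_sg: "Zc p X Y f ==> Zc p X Y (sg q f)"
 by (auto simp: sg_def Zc_uminus)
lemma Zc_id: "ob X ==> Zc 0 X X (fst X)"
 by (auto simp: Zc_def Cm_def ob_def)

lemma Nl_0: "Nl p X Y 0"
 unfolding Nl_def by (rule exI[of _ 0]) (simp add: Cm_0)
lemma Nl_add: "Nl p X Y f ==> Nl p X Y g ==> Nl p X Y (f + g)"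
proof -
 assume "Nl p X Y f" "Nl p X Y g"
 then obtain h k where "Cm (p - 1) X Y h" "f = snd Y * h + sg p (h * snd X)"
  "Cm (p - 1) X Y k" "g = snd Y * k + sg p (k * snd X)" by (auto simp: Nl_def)
 then show ?thesis unfolding Nl_def
  by (intro exI[of _ "h + k"]) (auto simp: Cm_add algebra_simps sgs)
qed
lemma Nl_scw: "Nl p X Y f ==> Nl p X Y (scw c f)"
proof -
 assume "Nl p X Y f"
 then obtain h where "Cm (p - 1) X Y h" "f = snd Y * h + sg p (h * snd X)" by (auto simp: Nl_def)
 then show ?thesis unfolding Nl_def
  by (intro exI[of _ "scw c h"]) (auto simp: Cm_scw scw_mult_left scw_mult_right scw_simps sg_scw)
qed
lemma Nl_uminus: "Nl p X Y f ==> Nl p X Y (- f)"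
 using Nl_scw[of p X Y f "- 1"] by (simp only: scw_minus_one)
lemma Nl_comp_left: "Nl p X Y f ==> Zc q Y Z g ==> r = q + p ==> Nl r X Z (g * f)"
proof -
 assume a: "Nl p X Y f" "Zc q Y Z g" "r = q + p"
 then obtain h where h: "Cm (p - 1) X Y h" "f = snd Y * h + sg p (h * snd X)" by (auto simp: Nl_def)
 have g: "g * snd Y = sg q (snd Z * g)" using a(2) by (simp add: Zc_def)
 have "Cm (r - 1) X Z (sg q (g * h))"
  using a h by (intro Cm_sg Cm_comp[of "p - 1" X Y h q]) (auto simp: Zc_def)
 moreover have "g * f = snd Z * sg q (g * h) + sg r (sg q (g * h) * snd X)"
 proof -
  have "g * f = (g * snd Y) * h + sg p (g * h * snd X)"
   by (simp add: h(2) distrib_left mult.assoc sgs)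
  also have "\<dots> = sg q (snd Z * g * h) + sg p (g * h * snd X)" by (simp add: g sgs)
  also have "\<dots> = snd Z * sg q (g * h) + sg r (sg q (g * h) * snd X)"
   by (simp add: a(3) sgs mult.assoc sg_def)
  finally show ?thesis .
 qed
 ultimately show ?thesis unfolding Nl_def by blast
qed

lemma Nl_comp_right: "Nl p Y Z f ==> Zc q X Y g ==> r = p + q ==> Nl r X Z (f * g)"
proof -
 assume a: "Nl p Y Z f" "Zc q X Y g" "r = p + q"
 then obtain h where h: "Cm (p - 1) Y Z h" "f = snd Z * h + sg p (h * snd Y)" by (auto simp: Nl_def)
 have "Cm (r - 1) X Z (h * g)"
  using a h by (intro Cm_comp[of q X Y g "p - 1"]) (auto simp: Zc_def)
 moreover have "f * g = snd Z * (h * g) + sg r (h * g * snd X)"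
  using a(2) by (simp add: h(2) distrib_right sgs mult.assoc Zc_def a(3))
 ultimately show ?thesis unfolding Nl_def by blast
qed

lemma Nl_Zc: "Nl p X Y g ==> ob X ==> ob Y ==> Zc p X Y g"
proof -
 assume a: "Nl p X Y g" "ob X" "ob Y"
 then obtain h where h: "Cm (p - 1) X Y h" "g = snd Y * h + sg p (h * snd X)" by (auto simp: Nl_def)
 have "Cm 1 X X (snd X)" "Cm 1 Y Y (snd Y)" using a by (auto simp: ob_def Cm_def)
 then have "Cm p X Y g" using h(1) unfolding h(2)
  by (intro Cm_add Cm_sg) (auto intro: Cm_comp)
 moreover have "snd Y * g = sg p (g * snd X)"
 proof -
  have "snd Y * snd Y = 0" "snd X * snd X = 0" using a by (auto simp: ob_def)
  then show ?thesis
   by (simp add: h(2) distrib_left distrib_right sgs mult.assoc)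
    (simp flip: mult.assoc)
 qed
 ultimately show ?thesis by (simp add: Zc_def)
qed

lemma hq_refl: "hq p X Y f f"
 by (simp add: hq_def Nl_0)
lemma hq_sym: "hq p X Y f g ==> hq p X Y g f"
 unfolding hq_def using Nl_uminus by fastforce
lemma hq_trans: "hq p X Y f g ==> hq p X Y g h ==> hq p X Y f h"
 unfolding hq_def using Nl_add by fastforce
lemma hq_left: "hq p X Y f f' ==> Zc q Y Z g ==> r = q + p ==> hq r X Z (g * f) (g * f')"
 unfolding hq_def right_diff_distrib[symmetric] by (rule Nl_comp_left)
lemma hq_right: "hq p Y Z f f' ==> Zc q X Y g ==> r = p + q ==> hq r X Z (f * g) (f' * g)"
 unfolding hq_def left_diff_distrib[symmetric] by (rule Nl_comp_right)
lemma hq_add: "hq p X Y f f' ==> hq p X Y g g' ==> hq p X Y (f + g) (f' + g')"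
 unfolding hq_def by (metis Nl_add add_diff_add)
lemma hq_scw: "hq p X Y f f' ==> hq p X Y (scw c f) (scw c f')"
 unfolding hq_def scw_simps(2)[symmetric] by (rule Nl_scw)
lemma hq_Nl: "hq p X Y f g ==> Nl p X Y g ==> Nl p X Y f"
 unfolding hq_def using Nl_add by fastforce

section \<open>Complexes as one differential together with two arrow operators of square
  zero\<close>

section \<open>Strict objects\<close>

record (overloaded) 'k so =
 se :: "'k bm"
 sd :: "'k bm"
 sA :: "'k bm"
 sB :: "'k bm"

definition vst :: "'k::field bm \<Rightarrow> bool" where
 "vst x \<longleftrightarrow> (\<forall>i j. ent x i j \<noteq> 0 --> vn (vt i) = vn (vt j) + 1)"

lemma vst_upr: "vst x ==> upr x"
 unfolding vst_def upr_def by (metis zle_add1_eq_le zless_add1_eq order_less_imp_le)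

lemma vst_dia: "vst x ==> dia x = 0"
proof (rule fm_eqI)
 fix i j assume "vst x"
 then have "ent x i j \<noteq> 0 --> vn (vt i) = vn (vt j) + 1" by (simp add: vst_def)
 then show "ent (dia x) i j = ent 0 i j" by auto
qed

lemma sg_comm:
 fixes x y :: "'a::ring"
 assumes "b * x = sg p (x * a)" "c * y = sg q (y * b)" "r = q + p"
 shows "c * (y * x) = sg r (y * x * a)"
proof -
 have "c * (y * x) = (c * y) * x" by (simp only: mult.assoc)
 also have "\<dots> = sg q (y * (b * x))" by (simp only: assms(2) sg_mult_left mult.assoc)
 also have "\<dots> = sg r (y * x * a)" by (simp only: assms(1,3) sgs mult.assoc)
 finally show ?thesis .
qed

lemma dia_upr: "dia x = x ==> upr x"
 by (metis upr_dia)

text \<open>The mixed products of \<open>sA\<close> and \<open>sB\<close> are left free, because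
  \<open>Alpha2\<close> after \<open>Alpha1\<close> and \<open>Beta2\<close> after
  \<open>Beta1\<close> are not relations of the quiver.\<close>

definition sob :: "'k::field so \<Rightarrow> bool" where
 "sob S \<longleftrightarrow> dgr 0 (se S) \<and> dgr 1 (sd S) \<and> dgr 1 (sA S) \<and> dgr 1 (sB S) \<and>
  dia (se S) = se S \<and> dia (sd S) = sd S \<and> vst (sA S) \<and> vst (sB S) \<and>
  se S * se S = se S \<and> se S * sd S = sd S \<and> sd S * se S = sd S \<and>
  se S * sA S = sA S \<and> sA S * se S = sA S \<and> se S * sB S = sB S \<and> sB S * se S = sB S \<and>
  sd S * sd S = 0 \<and> sA S * sA S = 0 \<and> sB S * sB S = 0 \<and>
  sd S * sA S = - (sA S * sd S) \<and> sd S * sB S = - (sB S * sd S)"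

definition oo :: "'k::field so \<Rightarrow> 'k ob" where
 "oo S = (st (se S), wk (sd S + sB S) (sd S + sA S))"

lemma w_oo:
 assumes "sob S"
 shows "w1 (fst (oo S)) = se S" "w2 (fst (oo S)) = se S"
  "w1 (snd (oo S)) = sd S + sB S" "w2 (snd (oo S)) = sd S + sA S"
proof -
 have "upr (sd S + sB S)" "upr (sd S + sA S)" "dia (sd S + sB S) = dia (sd S + sA S)"
  using assms by (auto simp: sob_def vst_dia intro!: upr_add intro: dia_upr vst_upr)
 then show "w1 (snd (oo S)) = sd S + sB S" "w2 (snd (oo S)) = sd S + sA S"
  using w_wk[of "sd S + sB S" "sd S + sA S"] by (simp_all add: oo_def)
qed (use assms in \<open>auto simp: oo_def sob_def\<close>)

lemma ob_oo: "sob S ==> ob (oo S)"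
 unfolding ob_def
 by (intro conjI; (rule wk_eqI)?)
  (auto simp: w_oo dg_def, auto simp: sob_def distrib_left distrib_right intro!: dgr_add)

text \<open>Families of morphisms of representations of degree \<open>p\<close>. Arrows count as
  operators of degree one, whence the sign in the commutation.\<close>

definition Sm :: "int \<Rightarrow> 'k::field so \<Rightarrow> 'k so \<Rightarrow> 'k bm \<Rightarrow> bool" where
 "Sm p S T x \<longleftrightarrow> dgr p x \<and> dia x = x \<and> se T * x = x \<and> x * se S = x \<and>
  sA T * x = sg p (x * sA S) \<and> sB T * x = sg p (x * sB S)"

definition Sc :: "int \<Rightarrow> 'k::field so \<Rightarrow> 'k so \<Rightarrow> 'k bm \<Rightarrow> bool" where
 "Sc p S T x \<longleftrightarrow> Sm p S T x \<and> sd T * x = sg p (x * sd S)"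

lemma Sm_Cm: "sob S ==> sob T ==> Sm p S T x ==> Cm p (oo S) (oo T) (st x)"
 unfolding Cm_def by (auto intro!: wk_eqI simp: w_oo Sm_def dg_def)

lemma Sc_Zc: "sob S ==> sob T ==> Sc p S T x ==> Zc p (oo S) (oo T) (st x)"
 unfolding Zc_def Sc_def using Sm_Cm
 by (auto intro!: wk_eqI simp: w_oo Sm_def distrib_left distrib_right sgs)

lemma Sm_comp: "Sm p S T x ==> Sm q T U y ==> r = q + p ==> Sm r S U (y * x)"
proof -
 assume a: "Sm p S T x" "Sm q T U y" "r = q + p"
 then have 1: "sA U * (y * x) = sg r (y * x * sA S)" "sB U * (y * x) = sg r (y * x * sB S)"
  unfolding Sm_def using sg_comm by blast+
 have 2: "dia (y * x) = y * x"
  using a by (subst dia_mult) (auto simp: Sm_def intro!: dia_upr)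
 have 3: "se U * (y * x) = y * x" using a by (simp add: Sm_def flip: mult.assoc)
 show ?thesis using 1 2 3 a by (auto simp: Sm_def mult.assoc intro: dgr_mult')
qed

lemma Sc_comp: "Sc p S T x ==> Sc q T U y ==> r = q + p ==> Sc r S U (y * x)"
proof -
 assume a: "Sc p S T x" "Sc q T U y" "r = q + p"
 then have 1: "sd U * (y * x) = sg r (y * x * sd S)"
  unfolding Sc_def using sg_comm by blast
 then show ?thesis using a Sm_comp unfolding Sc_def by blast
qed

lemma Sm_diff: "Sm p S T x ==> Sm p S T y ==> Sm p S T (x - y)"
 by (auto simp: Sm_def dgr_diff algebra_simps sgs)
lemma Sm_add: "Sm p S T x ==> Sm p S T y ==> Sm p S T (x + y)"
 by (auto simp: Sm_def dgr_add algebra_simps sgs)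
lemma Sc_id: "sob S ==> Sc 0 S S (se S)"
 by (auto simp: Sc_def Sm_def sob_def)

section \<open>Translation between families of sized matrices and single matrices over all
  blocks\<close>

section \<open>Matrix encoding of complexes\<close>

text \<open>\<open>T\<close> gives the target block of each source block. It is partial because no
  arrow leaves \<open>V3\<close>; the same encoding then serves differentials, morphisms and
  arrows.\<close>

definition en :: "(blk \<Rightarrow> blk option) \<Rightarrow> (blk \<Rightarrow> nat) \<Rightarrow> (blk \<Rightarrow> nat) \<Rightarrow> (blk \<Rightarrow> 'k::field mat) \<Rightarrow> 'k bm" where
 "en T m n f = Abs_fm (\<lambda>a b. if T (fst b) = Some (fst a) \<and> snd a < m (fst a) \<and> snd b < n (fst b)
   then f (fst b) $$ (snd a, snd b) else 0)"

definition bd :: "(blk \<Rightarrow> nat) \<Rightarrow> bool" where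
 "bd n \<longleftrightarrow> finite {s. n s \<noteq> 0}"

lemma ent_en:
 assumes "bd n"
 shows "ent (en T m n f) a b = (if T (fst b) = Some (fst a) \<and> snd a < m (fst a) \<and> snd b < n (fst b)
   then f (fst b) $$ (snd a, snd b) else 0)"
proof -
 define S where "S = (\<Union>s\<in>{s. n s \<noteq> 0}. ({s} \<times> {..<n s}) \<union> ({the (T s)} \<times> {..<m (the (T s))}))"
 have "finite S" unfolding S_def using assms by (auto simp: bd_def)
 then show ?thesis unfolding en_def
 proof (subst ent_Abs_fm[of S], goal_cases)
  case (2 i j)
  then have h: "T (fst j) = Some (fst i)" "snd i < m (fst i)" "snd j < n (fst j)"
   by (auto split: if_splits)
  then have "fst j \<in> {s. n s \<noteq> 0}" by auto
  moreover have "j \<in> {fst j} \<times> {..<n (fst j)}" "i \<in> {the (T (fst j))} \<times> {..<m (the (T (fst j)))}"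
   using h by (auto simp: mem_Times_iff)
  ultimately show ?case unfolding S_def by (auto intro: UN_I[of "fst j"])
 qed auto
qed

definition ok :: "(blk \<Rightarrow> blk option) \<Rightarrow> (blk \<Rightarrow> nat) \<Rightarrow> (blk \<Rightarrow> nat) \<Rightarrow> (blk \<Rightarrow> 'k::field mat) \<Rightarrow> bool" where
 "ok T m n f \<longleftrightarrow> (\<forall>s s'. T s = Some s' --> f s \<in> carrier_mat (m s') (n s))"

lemma en_mult:
 assumes n: "bd n" and m: "bd m" and f: "ok T1 m n f" and g: "ok T2 l m g"
 shows "en T2 l m g * en T1 m n f = en (\<lambda>s. Option.bind (T1 s) T2) l n (\<lambda>s. g (the (T1 s)) * f s)"
proof (rule fm_eqI)
 fix a b
 let ?x = "en T2 l m g" and ?y = "en T1 m n f"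
 show "ent (?x * ?y) a b = ent (en (\<lambda>s. Option.bind (T1 s) T2) l n (\<lambda>s. g (the (T1 s)) * f s)) a b"
 proof (cases "T1 (fst b)")
  case None
  then show ?thesis by (subst ent_times_sup[of "{}"]) (auto simp: ent_en n m)
 next
  case (Some s)
  have "ent (?x * ?y) a b = (\<Sum>c\<in>Pair s ` {..<m s}. ent ?x a c * ent ?y c b)"
   by (rule ent_times_sup) (auto simp: ent_en n m Some)
  also have "\<dots> = (\<Sum>c<m s. ent ?x a (s, c) * ent ?y (s, c) b)"
   by (subst sum.reindex) (auto simp: inj_on_def)
  also have "\<dots> = ent (en (\<lambda>s. Option.bind (T1 s) T2) l n (\<lambda>s. g (the (T1 s)) * f s)) a b"
  proof (cases "T2 s = Some (fst a) \<and> snd a < l (fst a) \<and> snd b < n (fst b)")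
   case True
   have "g s \<in> carrier_mat (l (fst a)) (m s)" "f (fst b) \<in> carrier_mat (m s) (n (fst b))"
    using f g True Some by (auto simp: ok_def)
   then show ?thesis using True
    by (auto simp: ent_en n m Some scalar_prod_def lessThan_atLeast0 intro!: sum.cong)
  next
   case False
   then show ?thesis by (auto simp: ent_en n m Some intro!: sum.neutral)
  qed
  finally show ?thesis .
 qed
qed

lemma en_cong: "(!!s s'. T s = Some s' ==> f s = g s) ==> bd n ==> en T m n f = en T m n g"
 by (rule fm_eqI) (auto simp: ent_en)

lemma en_eq_iff:
 assumes "bd n" "ok T m n f" "ok T m n g"
 shows "en T m n f = en T m n g \<longleftrightarrow> (\<forall>s s'. T s = Some s' --> f s = g s)"
proof (intro iffI allI impI)
 fix s s' assume h: "en T m n f = en T m n g" "T s = Some s'"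
 then have "f s \<in> carrier_mat (m s') (n s)" "g s \<in> carrier_mat (m s') (n s)"
  using assms by (auto simp: ok_def)
 moreover have "f s $$ (a, b) = g s $$ (a, b)" if "a < m s'" "b < n s" for a b
  using arg_cong[OF h(1), of "\<lambda>x. ent x (s', a) (s, b)"] that h(2) assms(1) by (simp add: ent_en)
 ultimately show "f s = g s" by (auto intro!: eq_matI)
qed (use assms(1) in \<open>auto intro: en_cong\<close>)

lemma en_add:
 assumes "bd n" "ok T m n f" "ok T m n g"
 shows "en T m n f + en T m n g = en T m n (\<lambda>s. f s + g s)"
proof (rule fm_eqI)
 fix a b show "ent (en T m n f + en T m n g) a b = ent (en T m n (\<lambda>s. f s + g s)) a b"
  using assms(2,3)[unfolded ok_def, rule_format, of "fst b" "fst a"]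
  by (auto simp: ent_en assms(1))
qed

lemma en_sc:
 assumes "bd n" "ok T m n f"
 shows "sc c (en T m n f) = en T m n (\<lambda>s. c \<cdot>\<^sub>m f s)"
proof (rule fm_eqI)
 fix a b show "ent (sc c (en T m n f)) a b = ent (en T m n (\<lambda>s. c \<cdot>\<^sub>m f s)) a b"
  using assms(2)[unfolded ok_def, rule_format, of "fst b" "fst a"]
  by (auto simp: ent_en assms(1))
qed

definition sgn1 :: "int \<Rightarrow> 'k::field" where "sgn1 p = (if even p then 1 else - 1)"

lemma sc_minus_one: "sc (- 1) x = - x"
 by (rule fm_eqI) simp

lemma sg_sc: "sg p x = sc (sgn1 p) x"
 by (simp add: sg_def sgn1_def sc_simps sc_minus_one)

lemma sgn1_add: "sgn1 (p + q) = sgn1 p * sgn1 q"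
 by (simp add: sgn1_def)

lemma en_zero: "bd n ==> (!!s s'. T s = Some s' ==> f s = 0\<^sub>m (m s') (n s)) ==> en T m n f = 0"
 by (rule fm_eqI) (auto simp: ent_en)

lemma en_eq_0_iff:
 assumes "bd n" "ok T m n f"
 shows "en T m n f = 0 \<longleftrightarrow> (\<forall>s s'. T s = Some s' --> f s = 0\<^sub>m (m s') (n s))"
proof (intro iffI allI impI)
 fix s s' assume h: "en T m n f = 0" "T s = Some s'"
 then have "f s \<in> carrier_mat (m s') (n s)"
  using assms by (auto simp: ok_def)
 moreover have "f s $$ (a, b) = 0" if "a < m s'" "b < n s" for a b
  using arg_cong[OF h(1), of "\<lambda>x. ent x (s', a) (s, b)"] that h(2) assms(1) by (simp add: ent_en)
 ultimately show "f s = 0\<^sub>m (m s') (n s)" by (auto intro!: eq_matI)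
qed (use assms(1) in \<open>auto intro: en_zero\<close>)

definition de :: "(blk \<Rightarrow> blk option) \<Rightarrow> (blk \<Rightarrow> nat) \<Rightarrow> (blk \<Rightarrow> nat) \<Rightarrow> 'k::field bm \<Rightarrow> blk \<Rightarrow> 'k mat" where
 "de T m n x s = mat (m (the (T s))) (n s) (\<lambda>(a, b). ent x (the (T s), a) (s, b))"

lemma ok_de: "ok T m n (de T m n x)"
 by (simp add: ok_def de_def)

lemma en_de:
 assumes "bd n" "!!a b. ent x a b \<noteq> 0 ==> T (fst b) = Some (fst a) \<and> snd a < m (fst a) \<and> snd b < n (fst b)"
 shows "en T m n (de T m n x) = x"
proof (rule fm_eqI)
 fix a b show "ent (en T m n (de T m n x)) a b = ent x a b"
  using assms(2)[of a b] by (auto simp: ent_en assms(1) de_def)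
qed

lemma smult_mat_cancel:
 fixes M N :: "'k::field mat"
 assumes "c \<noteq> 0" shows "c \<cdot>\<^sub>m M = c \<cdot>\<^sub>m N \<longleftrightarrow> M = N"
proof
 assume e: "c \<cdot>\<^sub>m M = c \<cdot>\<^sub>m N"
 have d: "dim_row M = dim_row N" "dim_col M = dim_col N"
  using arg_cong[OF e, of dim_row] arg_cong[OF e, of dim_col] by auto
 show "M = N"
 proof (rule eq_matI)
  fix i j assume "i < dim_row N" "j < dim_col N"
  then show "M $$ (i, j) = N $$ (i, j)"
   using arg_cong[OF e, of "\<lambda>A. A $$ (i, j)"] d assms by simp
 qed (use d in auto)
qed simp

definition Tp :: "int \<Rightarrow> blk \<Rightarrow> blk option" where
 "Tp p s = Some (fst s + p, snd s)"

fun arw :: "bool \<Rightarrow> vtx \<Rightarrow> arr option" where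
 "arw True V1 = Some Alpha1" | "arw True V2 = Some Beta2" | "arw True V3 = None"
| "arw False V1 = Some Beta1" | "arw False V2 = Some Alpha2" | "arw False V3 = None"

definition Ta :: "bool \<Rightarrow> blk \<Rightarrow> blk option" where
 "Ta c s = map_option (\<lambda>a. (fst s, tgt a)) (arw c (snd s))"

lemma src_arw: "arw c v = Some a ==> src a = v"
 by (cases c; cases v) auto

lemma arw_arr: "\<exists>c. arw c (src a) = Some a"
 by (cases a) (auto intro: exI[of _ True] exI[of _ False])

definition dm :: "'k cplx \<Rightarrow> blk \<Rightarrow> nat" where "dm X s = cdim X (fst s) (snd s)"

definition cme :: "int \<Rightarrow> 'k::field cplx \<Rightarrow> 'k cplx \<Rightarrow> 'k cmap \<Rightarrow> 'k bm" where
 "cme p X Y f = en (Tp p) (dm Y) (dm X) (\<lambda>s. f (fst s) (snd s))"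

text \<open>In a complex of representations arrows commute with the differential. The sign of the
  complex degree makes them anticommute, so that \<open>d + A\<close> squares to zero.\<close>

definition arm :: "'k::field cplx \<Rightarrow> bool \<Rightarrow> blk \<Rightarrow> 'k mat" where
 "arm X c s = sgn1 (fst s) \<cdot>\<^sub>m ract (cobj X (fst s)) (the (arw c (snd s)))"

definition are :: "bool \<Rightarrow> 'k::field cplx \<Rightarrow> 'k bm" where
 "are c X = en (Ta c) (dm X) (dm X) (arm X c)"

definition so :: "'k::field cplx \<Rightarrow> 'k so" where
 "so X = \<lparr>se = cme 0 X X (cid X), sd = cme 1 X X (cdif X), sA = are True X, sB = are False X\<rparr>"

lemma so_sel [simp]: "se (so X) = cme 0 X X (cid X)" "sd (so X) = cme 1 X X (cdif X)"
 "sA (so X) = are True X" "sB (so X) = are False X"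
 by (simp_all add: so_def)

definition cmc :: "int \<Rightarrow> 'k::field cplx \<Rightarrow> 'k cplx \<Rightarrow> 'k cmap \<Rightarrow> bool" where
 "cmc p X Y f \<longleftrightarrow> (\<forall>i v. f i v \<in> carrier_mat (cdim Y (i + p) v) (cdim X i v))"

definition rpm :: "int \<Rightarrow> 'k::field cplx \<Rightarrow> 'k cplx \<Rightarrow> 'k cmap \<Rightarrow> bool" where
 "rpm p X Y f \<longleftrightarrow> (\<forall>i. rep_map (cobj X i) (cobj Y (i + p)) (f i))"

lemma rpm_cmc: "rpm p X Y f ==> cmc p X Y f"
 by (simp add: rpm_def cmc_def rep_map_def)

lemma cmc_ok: "cmc p X Y f \<longleftrightarrow> ok (Tp p) (dm Y) (dm X) (\<lambda>s. f (fst s) (snd s))"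
 by (simp add: cmc_def ok_def Tp_def dm_def split_paired_All)

lemma finite_vtx: "finite (UNIV :: vtx set)"
proof -
 have "(UNIV :: vtx set) = {V1, V2, V3}" using vtx.exhaust by auto
 then show ?thesis by (metis finite.emptyI finite.insertI)
qed

lemma cplx_bd: "is_cplx X ==> bd (dm X)"
proof -
 assume "is_cplx X"
 then obtain N where "\<forall>i v. \<bar>i\<bar> > N --> cdim X i v = 0" by (auto simp: is_cplx_def)
 then have "{s. dm X s \<noteq> 0} \<subseteq> {-N..N} \<times> UNIV"
  by (force simp: dm_def not_less[symmetric])
 then show ?thesis unfolding bd_def
  by (rule finite_subset) (simp add: finite_vtx)
qed

text \<open>Weaker than \<open>is_cplx\<close>, so that the encoding can be applied to a complex
  under construction whose relations and differential are still to be verified.\<close>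

definition pcx :: "'k::field cplx \<Rightarrow> bool" where
 "pcx X \<longleftrightarrow> bd (dm X) \<and> (\<forall>i a. ract (cobj X i) a \<in> carrier_mat (cdim X i (tgt a)) (cdim X i (src a)))"

lemma cplx_pcx: "is_cplx X ==> pcx X"
 by (simp add: pcx_def cplx_bd) (simp add: is_cplx_def is_rep_def)

lemma arm_ok: "pcx X ==> ok (Ta c) (dm X) (dm X) (arm X c)"
 unfolding ok_def
proof safe
 fix i v i' v' assume X: "pcx X" and "Ta c (i, v) = Some (i', v')"
 then obtain a where a: "arw c v = Some a" "i' = i" "v' = tgt a" by (auto simp: Ta_def)
 have "ract (cobj X i) a \<in> carrier_mat (cdim X i (tgt a)) (cdim X i (src a))"
  using X by (auto simp: pcx_def)
 then show "arm X c (i, v) \<in> carrier_mat (dm X (i', v')) (dm X (i, v))"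
  using src_arw[OF a(1)] by (simp add: arm_def dm_def a)
qed

lemma cme_mult:
 assumes "bd (dm X)" "bd (dm Y)" "cmc p X Y f" "cmc q Y Z g"
 shows "cme q Y Z g * cme p X Y f = cme (p + q) X Z (\<lambda>i v. g (i + p) v * f i v)"
proof -
 have *: "(\<lambda>s. Option.bind (Tp p s) (Tp q)) = Tp (p + q)"
  by (auto simp: Tp_def add.assoc)
 show ?thesis
  unfolding cme_def en_mult[OF assms(1,2) assms(3,4)[unfolded cmc_ok]] * by (simp add: Tp_def)
qed

lemma cmc_mult: "cmc p X Y f ==> cmc q Y Z g ==> cmc (p + q) X Z (\<lambda>i v. g (i + p) v * f i v)"
 unfolding cmc_def
proof (intro allI)
 fix i v
 assume a: "\<forall>i v. f i v \<in> carrier_mat (cdim Y (i + p) v) (cdim X i v)"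
  "\<forall>i v. g i v \<in> carrier_mat (cdim Z (i + q) v) (cdim Y i v)"
 have "g (i + p) v \<in> carrier_mat (cdim Z (i + (p + q)) v) (cdim Y (i + p) v)"
  using a(2)[rule_format, of "i + p" v] by (simp add: add.assoc)
 then show "g (i + p) v * f i v \<in> carrier_mat (cdim Z (i + (p + q)) v) (cdim X i v)"
  using a(1) mult_carrier_mat by blast
qed

lemma cme_eq_iff:
 assumes "bd (dm X)" "cmc p X Y f" "cmc p X Y g"
 shows "cme p X Y f = cme p X Y g \<longleftrightarrow> f = g"
 using assms unfolding cme_def cmc_ok by (subst en_eq_iff) (auto simp: Tp_def fun_eq_iff split_paired_All)

text \<open>A morphism that raises the degree by \<open>p\<close> changes the sign built into
  \<open>arm\<close> by (-1)^p, so ordinary commutation with arrows turns into graded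
  commutation.\<close>

lemma cme_are_mult:
 assumes "pcx X" "pcx Y" "cmc p X Y f"
 shows "are c Y * cme p X Y f = sg p (cme p X Y f * are c X) \<longleftrightarrow>
  (\<forall>i v a. arw c v = Some a --> ract (cobj Y (i + p)) a * f i v = f i (tgt a) * ract (cobj X i) a)"
proof -
 note b = assms(1)[unfolded pcx_def, THEN conjunct1] assms(2)[unfolded pcx_def, THEN conjunct1] arm_ok[OF assms(1)] arm_ok[OF assms(2)]
  assms(3)[unfolded cmc_ok]
 let ?T = "\<lambda>s. map_option (\<lambda>a. (fst s + p, tgt a)) (arw c (snd s))"
 have T: "(\<lambda>s. Option.bind (Tp p s) (Ta c)) = ?T" "(\<lambda>s. Option.bind (Ta c s) (Tp p)) = ?T"
  by (auto simp: Tp_def Ta_def fun_eq_iff map_option_case split: option.splits)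
 let ?F = "\<lambda>s. arm Y c (fst s + p, snd s) * f (fst s) (snd s)"
 let ?G = "\<lambda>s. f (fst s) (tgt (the (arw c (snd s)))) * arm X c s"
 have l: "are c Y * cme p X Y f = en ?T (dm Y) (dm X) ?F"
  unfolding are_def cme_def by (subst en_mult[OF b(1,2,5,4)]) (simp only: T, simp add: Tp_def)
 have r: "cme p X Y f * are c X = en ?T (dm Y) (dm X) ?G"
  unfolding are_def cme_def
  by (subst en_mult[OF b(1,1,3,5)], simp only: T, rule en_cong[OF _ b(1)], auto simp: Ta_def)
 have rep: "ract (cobj X i) a \<in> carrier_mat (cdim X i (tgt a)) (cdim X i (src a))"
  "ract (cobj Y i) a \<in> carrier_mat (cdim Y i (tgt a)) (cdim Y i (src a))" for i a
  using assms(1,2) by (auto simp: pcx_def)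
 have fc: "f i v \<in> carrier_mat (cdim Y (i + p) v) (cdim X i v)" for i v
  using assms(3) by (simp add: cmc_def)
 have okF: "ok ?T (dm Y) (dm X) ?F" "ok ?T (dm Y) (dm X) ?G"
 proof -
  have "?F s \<in> carrier_mat (dm Y s') (dm X s) \<and> ?G s \<in> carrier_mat (dm Y s') (dm X s)"
   if "?T s = Some s'" for s s'
  proof -
   obtain i v where s: "s = (i, v)" by (cases s)
   obtain a where a: "arw c v = Some a" "s' = (i + p, tgt a)" using \<open>?T s = Some s'\<close> by (auto simp: s)
   note c1 = rep(2)[of "i + p" a, unfolded src_arw[OF a(1)]] and c2 = rep(1)[of i a, unfolded src_arw[OF a(1)]]
   show ?thesis
    using mult_carrier_mat[OF smult_carrier_mat[OF c1] fc[of i v]] mult_carrier_mat[OF fc smult_carrier_mat[OF c2]]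
    by (simp add: arm_def dm_def a s)
  qed
  then show "ok ?T (dm Y) (dm X) ?F" "ok ?T (dm Y) (dm X) ?G" by (auto simp: ok_def)
 qed
 have okG: "ok ?T (dm Y) (dm X) (\<lambda>s. sgn1 p \<cdot>\<^sub>m ?G s)"
  using okF(2) by (auto simp: ok_def)
 have eq: "?F (i, v) = sgn1 p \<cdot>\<^sub>m ?G (i, v) \<longleftrightarrow> ract (cobj Y (i + p)) a * f i v = f i (tgt a) * ract (cobj X i) a"
  if h: "arw c v = Some a" for i v a
 proof -
  have s: "src a = v" using src_arw[OF h] .
  note c1 = rep(2)[of "i + p" a, unfolded s] and c2 = rep(1)[of i a, unfolded s] and c3 = fc[of i v] fc[of i "tgt a"]
  have "?F (i, v) = (sgn1 i * sgn1 p) \<cdot>\<^sub>m (ract (cobj Y (i + p)) a * f i v)"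
   using c1 c3 by (simp add: arm_def h sgn1_add mult_smult_assoc_mat[OF c1 c3(1)])
  moreover have "sgn1 p \<cdot>\<^sub>m ?G (i, v) = (sgn1 i * sgn1 p) \<cdot>\<^sub>m (f i (tgt a) * ract (cobj X i) a)"
   using c2 c3 by (auto simp: arm_def h mult_smult_distrib[OF c3(2) c2] mult.commute intro!: eq_matI)
  moreover have "(sgn1 i * sgn1 p) \<cdot>\<^sub>m (ract (cobj Y (i + p)) a * f i v) = (sgn1 i * sgn1 p) \<cdot>\<^sub>m (f i (tgt a) * ract (cobj X i) a)
   \<longleftrightarrow> ract (cobj Y (i + p)) a * f i v = f i (tgt a) * ract (cobj X i) a"
   by (rule smult_mat_cancel) (simp add: sgn1_def)
  ultimately show ?thesis
   by (simp only:)
 qed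
 have "are c Y * cme p X Y f = sg p (cme p X Y f * are c X) \<longleftrightarrow>
   (\<forall>s s'. ?T s = Some s' --> ?F s = sgn1 p \<cdot>\<^sub>m ?G s)"
  unfolding l r sg_sc by (subst en_sc[OF b(1) okF(2)], subst en_eq_iff[OF b(1) okF(1) okG]) simp
 also have "\<dots> \<longleftrightarrow> (\<forall>i v a. arw c v = Some a --> ?F (i, v) = sgn1 p \<cdot>\<^sub>m ?G (i, v))"
  by (auto simp: split_paired_All)
 also have "\<dots> \<longleftrightarrow> (\<forall>i v a. arw c v = Some a --> ract (cobj Y (i + p)) a * f i v = f i (tgt a) * ract (cobj X i) a)"
  by (simp only: eq cong: imp_cong)
 finally show ?thesis .
qed

lemma rpm_iff:
 assumes "is_cplx X" "is_cplx Y"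
 shows "rpm p X Y f \<longleftrightarrow> cmc p X Y f \<and> (\<forall>c. are c Y * cme p X Y f = sg p (cme p X Y f * are c X))"
proof -
 have "(\<forall>i a. f i (tgt a) * ract (cobj X i) a = ract (cobj Y (i + p)) a * f i (src a)) \<longleftrightarrow>
  (\<forall>c i v a. arw c v = Some a --> ract (cobj Y (i + p)) a * f i v = f i (tgt a) * ract (cobj X i) a)"
  (is "?L \<longleftrightarrow> ?R")
 proof
  assume l: ?L
  show ?R
  proof (intro allI impI)
   fix c i v a assume "arw c v = Some a"
   then have "src a = v" by (rule src_arw)
   then show "ract (cobj Y (i + p)) a * f i v = f i (tgt a) * ract (cobj X i) a" using l by auto
  qed
 next
  assume r: ?R
  show ?L
  proof (intro allI)
   fix i a
   obtain c where "arw c (src a) = Some a" using arw_arr by blast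
   then show "f i (tgt a) * ract (cobj X i) a = ract (cobj Y (i + p)) a * f i (src a)" using r by auto
  qed
 qed
 moreover have "rpm p X Y f \<longleftrightarrow> cmc p X Y f \<and> (\<forall>i a. f i (tgt a) * ract (cobj X i) a = ract (cobj Y (i + p)) a * f i (src a))"
  by (auto simp: rpm_def rep_map_def cmc_def)
 ultimately show ?thesis using cme_are_mult[OF cplx_pcx[OF assms(1)] cplx_pcx[OF assms(2)], of p f] by auto
qed

lemma dgr_cme: "bd (dm X) ==> dgr p (cme p X Y f)"
 unfolding dgr_def
proof (intro allI impI)
 fix i j :: idx assume "bd (dm X)" "ent (cme p X Y f) i j \<noteq> 0"
 then show "td i = td j + p"
  by (cases i; cases j) (auto simp: cme_def ent_en Tp_def td_def vt_def split: if_splits)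
qed

lemma dia_cme: "bd (dm X) ==> dia (cme p X Y f) = cme p X Y f"
proof (rule fm_eqI)
 fix i j :: idx assume "bd (dm X)"
 then show "ent (dia (cme p X Y f)) i j = ent (cme p X Y f) i j"
  by (cases i; cases j) (auto simp: cme_def ent_en Tp_def td_def vt_def split: if_splits)
qed

lemma are_ent:
 assumes "bd (dm X)" "ent (are c X) i j \<noteq> 0"
 shows "td i = td j + 1 \<and> vn (vt i) = vn (vt j) + 1"
proof -
 obtain a where a: "arw c (vt j) = Some a" "fst i = (fst (fst j), tgt a)"
  using assms by (auto simp: are_def ent_en Ta_def vt_def split: if_splits)
 have "vn (tgt a) = vn (vt j) + 1" using a(1) by (cases c; cases "vt j") auto
 moreover have "vt i = tgt a" using a(2) by (simp add: vt_def)
 ultimately show ?thesis using a(2) by (simp add: td_def)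
qed

lemma cmc_cid: "cmc 0 X X (cid X)"
 by (simp add: cmc_def cid_def)

lemma cplx_rpm_cdif: "is_cplx X ==> rpm 1 X X (cdif X)"
 by (simp add: rpm_def is_cplx_def)

lemma cplx_cmc: "is_cplx X ==> cmc 1 X X (cdif X)"
 by (simp add: cplx_rpm_cdif rpm_cmc)

lemma cme_id_left:
 assumes "bd (dm X)" "bd (dm Y)" "cmc p X Y f"
 shows "cme 0 Y Y (cid Y) * cme p X Y f = cme p X Y f"
proof -
 have "cme 0 Y Y (cid Y) * cme p X Y f = cme (p + 0) X Y (\<lambda>i v. cid Y (i + p) v * f i v)"
  by (rule cme_mult) (use assms cmc_cid in auto)
 also have "(\<lambda>i v. cid Y (i + p) v * f i v) = f"
  by (intro ext) (simp add: cid_def left_mult_one_mat[OF assms(3)[unfolded cmc_def, rule_format]])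
 finally show ?thesis by simp
qed

lemma cme_id_right:
 assumes "bd (dm X)" "cmc p X Y f"
 shows "cme p X Y f * cme 0 X X (cid X) = cme p X Y f"
proof -
 have "cme p X Y f * cme 0 X X (cid X) = cme (0 + p) X Y (\<lambda>i v. f (i + 0) v * cid X i v)"
  by (rule cme_mult) (use assms cmc_cid in auto)
 also have "(\<lambda>i v. f (i + 0) v * cid X i v) = f"
  by (intro ext) (simp add: cid_def right_mult_one_mat[OF assms(2)[unfolded cmc_def, rule_format]])
 finally show ?thesis by simp
qed

lemma ent_se:
 assumes "bd (dm X)"
 shows "ent (se (so X)) i j = (if i = j \<and> snd i < dm X (fst i) then 1 else 0)"
 by (cases i; cases j) (auto simp: cme_def ent_en assms Tp_def cid_def dm_def)

lemma se_pr:
 assumes "bd (dm X)"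
 shows "se (so X) = pr {i. snd i < dm X (fst i)}" and "finite {i. snd i < dm X (fst i)}"
proof -
 have "{i. snd i < dm X (fst i)} = (SIGMA s:{s. dm X s \<noteq> 0}. {..<dm X s})"
  by (auto simp: split_paired_all)
 then show f: "finite {i. snd i < dm X (fst i)}"
  using assms by (simp add: bd_def)
 show "se (so X) = pr {i. snd i < dm X (fst i)}"
  by (rule fm_eqI) (auto simp: ent_se[OF assms] ent_pr[OF f] simp del: so_sel)
qed

lemma se_left: "bd (dm X) ==> ent (se (so X) * x) i j = (if snd i < dm X (fst i) then ent x i j else 0)"
 by (simp add: se_pr ent_pr_times del: so_sel)

lemma se_right: "bd (dm X) ==> ent (x * se (so X)) i j = (if snd j < dm X (fst j) then ent x i j else 0)"
 by (simp add: se_pr ent_times_pr del: so_sel)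

text \<open>Two consecutive arrows of the same class form one of the two relations of the
  quiver.\<close>

lemma are_square:
 fixes X :: "'k::field cplx"
 assumes "is_cplx X" shows "are c X * are c X = 0"
proof -
 note b = cplx_bd[OF assms] arm_ok[OF cplx_pcx[OF assms], of c]
 have r: "is_rep (cobj X i)" for i using assms by (auto simp: is_cplx_def)
 show ?thesis
  unfolding are_def en_mult[OF b(1,1,2,2)]
 proof (rule en_zero[OF b(1)])
  fix s s' assume h: "Option.bind (Ta c s) (Ta c) = Some s'"
  obtain i v where s: "s = (i, v)" by (cases s)
  have v: "v = V1" "s' = (i, V3)" using h by (cases c; cases v; auto simp: Ta_def s)+
  have car: "ract (cobj X i) a \<in> carrier_mat (cdim X i (tgt a)) (cdim X i (src a))" for a
   using r[of i] by (auto simp: is_rep_def)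
  have z: "ract (cobj X i) Beta2 * ract (cobj X i) Alpha1 = 0\<^sub>m (cdim X i V3) (cdim X i V1)"
   "ract (cobj X i) Alpha2 * ract (cobj X i) Beta1 = 0\<^sub>m (cdim X i V3) (cdim X i V1)"
   using r[of i] by (auto simp: is_rep_def)
  have m: "(k \<cdot>\<^sub>m M) * (k \<cdot>\<^sub>m N) = k \<cdot>\<^sub>m (k \<cdot>\<^sub>m (M * N))"
   if "M \<in> carrier_mat (cdim X i V3) (cdim X i V2)" "N \<in> carrier_mat (cdim X i V2) (cdim X i V1)" for k :: 'k and M N :: "'k mat"
   by (simp add: mult_smult_assoc_mat[OF that(1) smult_carrier_mat[OF that(2)]] mult_smult_distrib[OF that])
  show "arm X c (the (Ta c s)) * arm X c s = 0\<^sub>m (dm X s') (dm X s)"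
   using m[OF car[of Beta2, simplified] car[of Alpha1, simplified]] m[OF car[of Alpha2, simplified] car[of Beta1, simplified]] z
   by (cases c) (auto simp: s v arm_def Ta_def dm_def)
 qed
qed

lemma cme_are_left: "is_cplx X ==> se (so X) * are c X = are c X"
 by (rule fm_eqI, subst se_left) (auto simp: cplx_bd are_def ent_en)

lemma cme_are_right: "is_cplx X ==> are c X * se (so X) = are c X"
 by (rule fm_eqI, subst se_right) (auto simp: cplx_bd are_def ent_en)

lemma cme_zero: "bd (dm X) ==> (!!i v. f i v = 0\<^sub>m (cdim Y (i + p) v) (cdim X i v)) ==> cme p X Y f = 0"
 unfolding cme_def by (rule en_zero) (auto simp: Tp_def dm_def)

lemma sob_so:
 assumes "is_cplx X" shows "sob (so X)"
proof -
 note b = cplx_bd[OF assms] and d = cplx_cmc[OF assms]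
 have "cme 1 X X (cdif X) * cme 1 X X (cdif X) = 0"
  unfolding cme_mult[OF b b d d]
  by (rule cme_zero[OF b]) (use assms in \<open>auto simp: is_cplx_def\<close>)
 moreover have "cme 1 X X (cdif X) * are c X = - (are c X * cme 1 X X (cdif X))" for c
  using cplx_rpm_cdif[OF assms] by (auto simp: rpm_iff[OF assms assms])
 ultimately show ?thesis
  using cme_are_left[OF assms] cme_are_right[OF assms] are_square[OF assms] are_ent[OF b] cme_id_left[OF b b d]
   cme_id_right[OF b d] cme_id_left[OF b b cmc_cid] dgr_cme[OF b] dia_cme[OF b]
  by (auto simp: sob_def vst_def dgr_def[of 1 "are _ _"])
qed

lemma Sm_cme:
 assumes "is_cplx X" "is_cplx Y" "rpm p X Y f"
 shows "Sm p (so X) (so Y) (cme p X Y f)"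
proof -
 note b = cplx_bd[OF assms(1)] cplx_bd[OF assms(2)] and c = rpm_cmc[OF assms(3)]
 show ?thesis
  using assms(3) dgr_cme[OF b(1)] dia_cme[OF b(1)] cme_id_left[OF b c] cme_id_right[OF b(1) c]
  unfolding Sm_def rpm_iff[OF assms(1,2)] so_sel by simp
qed

text \<open>Vertex and total degree determine the target block of each entry, and the idempotents
  bound its position there, so \<open>x\<close> can be read off block by block.\<close>

lemma Sm_ex:
 assumes "is_cplx X" "is_cplx Y" "Sm p (so X) (so Y) x"
 shows "\<exists>f. rpm p X Y f \<and> x = cme p X Y f"
proof -
 define f where "f = (\<lambda>i v. de (Tp p) (dm Y) (dm X) x (i, v))"
 have x: "x = cme p X Y f"
  unfolding cme_def f_def prod.collapse
 proof (rule en_de[symmetric])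
  show "bd (dm X)" by (rule cplx_bd) fact
  fix a b assume h: "ent x a b \<noteq> 0"
  have "vt a = vt b" "td a = td b + p"
   using h assms(3) unfolding Sm_def dgr_def by (metis ent_dia, blast)
  moreover have "snd a < dm Y (fst a)" "snd b < dm X (fst b)"
   using h assms(3) se_left[OF cplx_bd[OF assms(2)], of x a b] se_right[OF cplx_bd[OF assms(1)], of x a b]
   by (auto simp: Sm_def split: if_splits simp del: so_sel)
  ultimately show "Tp p (fst b) = Some (fst a) \<and> snd a < dm Y (fst a) \<and> snd b < dm X (fst b)"
   by (simp add: Tp_def td_def vt_def prod_eq_iff)
 qed
 have c: "cmc p X Y f"
  unfolding cmc_ok f_def prod.collapse by (rule ok_de)
 have "are c Y * x = sg p (x * are c X)" for c
  using assms(3) by (cases c) (auto simp: Sm_def)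
 then have "rpm p X Y f" using c unfolding rpm_iff[OF assms(1,2)] by (simp add: x)
 then show ?thesis using x by blast
qed

lemma cme_d_left:
 assumes "is_cplx X" "is_cplx Y" "cmc p X Y f"
 shows "sd (so Y) * cme p X Y f = cme (p + 1) X Y (\<lambda>i v. cdif Y (i + p) v * f i v)"
  and "cmc (p + 1) X Y (\<lambda>i v. cdif Y (i + p) v * f i v)"
 using assms by (auto simp: cme_mult cplx_bd cplx_cmc intro!: cmc_mult)

lemma cme_d_right:
 assumes "is_cplx X" "is_cplx Y" "cmc p X Y f"
 shows "cme p X Y f * sd (so X) = cme (p + 1) X Y (\<lambda>i v. f (i + 1) v * cdif X i v)"
  and "cmc (p + 1) X Y (\<lambda>i v. f (i + 1) v * cdif X i v)"
 using cmc_mult[OF cplx_cmc[OF assms(1)] assms(3)] assms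
 by (auto simp: cme_mult cplx_bd cplx_cmc add.commute)

lemma chain_map_iff:
 assumes "is_cplx X" "is_cplx Y"
 shows "chain_map X Y f \<longleftrightarrow> cmc 0 X Y f \<and> Sc 0 (so X) (so Y) (cme 0 X Y f)"
proof -
 have 1: "rpm 0 X Y f \<longleftrightarrow> cmc 0 X Y f \<and> Sm 0 (so X) (so Y) (cme 0 X Y f)"
  using Sm_cme[OF assms, of 0 f] unfolding rpm_iff[OF assms]
  by (auto simp: Sm_def all_bool_eq)
 have 2: "sd (so Y) * cme 0 X Y f = cme 0 X Y f * sd (so X) \<longleftrightarrow> (\<forall>i v. f (i + 1) v * cdif X i v = cdif Y i v * f i v)"
  if "cmc 0 X Y f"
  using cme_d_left(2)[OF assms that] cme_d_right(2)[OF assms that]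
  unfolding cme_d_left(1)[OF assms that] cme_d_right(1)[OF assms that]
  by (subst cme_eq_iff) (auto simp: cplx_bd assms fun_eq_iff)
 have "chain_map X Y f \<longleftrightarrow> rpm 0 X Y f \<and> (\<forall>i v. f (i + 1) v * cdif X i v = cdif Y i v * f i v)"
  by (simp add: chain_map_def rpm_def)
 then show ?thesis using 1 2 by (auto simp: Sc_def simp del: so_sel)
qed

lemma Sc_ex:
 assumes "is_cplx X" "is_cplx Y" "Sc 0 (so X) (so Y) x"
 shows "\<exists>f. chain_map X Y f \<and> x = cme 0 X Y f"
proof -
 obtain f where f: "rpm 0 X Y f" "x = cme 0 X Y f"
  using Sm_ex[OF assms(1,2), of 0 x] assms(3) by (auto simp: Sc_def)
 then have "chain_map X Y f"
  using assms(3) rpm_cmc[OF f(1)] by (simp add: chain_map_iff[OF assms(1,2)] del: so_sel)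
 then show ?thesis using f(2) by blast
qed

lemma cme_add:
 assumes "bd (dm X)" "cmc p X Y f" "cmc p X Y g"
 shows "cme p X Y f + cme p X Y g = cme p X Y (\<lambda>i v. f i v + g i v)"
 using assms unfolding cme_def cmc_ok by (subst en_add) auto

lemma cme_sc:
 assumes "bd (dm X)" "cmc p X Y f"
 shows "sc c (cme p X Y f) = cme p X Y (\<lambda>i v. c \<cdot>\<^sub>m f i v)"
 using assms unfolding cme_def cmc_ok by (subst en_sc) auto

lemma homotopic_iff:
 assumes "is_cplx X" "is_cplx Y" "cmc 0 X Y f" "cmc 0 X Y g"
 shows "homotopic X Y f g \<longleftrightarrow> (\<exists>h. Sm (- 1) (so X) (so Y) h \<and>
  cme 0 X Y f - cme 0 X Y g = sd (so Y) * h + h * sd (so X))"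
proof -
 have *: "cme 0 X Y f - cme 0 X Y g = sd (so Y) * cme (- 1) X Y h + cme (- 1) X Y h * sd (so X)
  \<longleftrightarrow> (\<forall>i v. f i v = g i v + (cdif Y (i - 1) v * h i v + h (i + 1) v * cdif X i v))"
  if h: "rpm (- 1) X Y h" for h
 proof -
  note c = rpm_cmc[OF h] and b = cplx_bd[OF assms(1)]
  note l = cme_d_left[OF assms(1,2) c, simplified] and r = cme_d_right[OF assms(1,2) c, simplified]
  have s: "cmc 0 X Y (\<lambda>i v. cdif Y (i - 1) v * h i v + h (i + 1) v * cdif X i v)"
   using l(2) r(2) by (auto simp: cmc_def)
  have s2: "cmc 0 X Y (\<lambda>i v. g i v + (cdif Y (i - 1) v * h i v + h (i + 1) v * cdif X i v))"
   using s assms(4) by (auto simp: cmc_def)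
  have "cme 0 X Y f - cme 0 X Y g = sd (so Y) * cme (- 1) X Y h + cme (- 1) X Y h * sd (so X) \<longleftrightarrow>
   cme 0 X Y f = cme 0 X Y g + cme 0 X Y (\<lambda>i v. cdif Y (i - 1) v * h i v + h (i + 1) v * cdif X i v)"
   unfolding cme_add[OF b l(2) r(2), symmetric] using l(1) r(1) by (auto simp: algebra_simps)
  also have "\<dots> \<longleftrightarrow> (\<forall>i v. f i v = g i v + (cdif Y (i - 1) v * h i v + h (i + 1) v * cdif X i v))"
   unfolding cme_add[OF b assms(4) s] cme_eq_iff[OF b assms(3) s2] by (simp add: fun_eq_iff)
  finally show ?thesis .
 qed
 show ?thesis
 proof
  assume "homotopic X Y f g"
  then obtain h where h: "rpm (- 1) X Y h" "\<forall>i v. f i v = g i v + (cdif Y (i - 1) v * h i v + h (i + 1) v * cdif X i v)"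
   by (auto simp: homotopic_def rpm_def)
  then show "\<exists>h. Sm (- 1) (so X) (so Y) h \<and> cme 0 X Y f - cme 0 X Y g = sd (so Y) * h + h * sd (so X)"
   using *[OF h(1)] Sm_cme[OF assms(1,2) h(1)] by blast
 next
  assume "\<exists>h. Sm (- 1) (so X) (so Y) h \<and> cme 0 X Y f - cme 0 X Y g = sd (so Y) * h + h * sd (so X)"
  then obtain h where "Sm (- 1) (so X) (so Y) h" "cme 0 X Y f - cme 0 X Y g = sd (so Y) * h + h * sd (so X)" by blast
  then obtain k where "rpm (- 1) X Y k" "h = cme (- 1) X Y k" using Sm_ex[OF assms(1,2)] by blast
  then have "rpm (- 1) X Y k \<and> (\<forall>i v. f i v = g i v + (cdif Y (i - 1) v * k i v + k (i + 1) v * cdif X i v))"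
   using * \<open>cme 0 X Y f - cme 0 X Y g = sd (so Y) * h + h * sd (so X)\<close> by blast
  then show "homotopic X Y f g"
   by (auto simp: homotopic_def rpm_def)
 qed
qed

lemma cme_ccomp:
 assumes "bd (dm X)" "bd (dm Y)" "cmc 0 X Y f" "cmc 0 Y Z g"
 shows "cme 0 X Z (ccomp g f) = cme 0 Y Z g * cme 0 X Y f" "cmc 0 X Z (ccomp g f)"
 using cme_mult[OF assms] cmc_mult[OF assms(3,4)] by (auto simp: ccomp_def)

lemma cme_cadd:
 assumes "bd (dm X)" "cmc p X Y f" "cmc p X Y g"
 shows "cme p X Y (cadd f g) = cme p X Y f + cme p X Y g" "cmc p X Y (cadd f g)"
 using cme_add[OF assms] assms by (auto simp: cadd_def cmc_def)

lemma cme_cscale: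
 assumes "bd (dm X)" "cmc p X Y f"
 shows "cme p X Y (cscale c f) = sc c (cme p X Y f)" "cmc p X Y (cscale c f)"
 using cme_sc[OF assms] assms by (auto simp: cscale_def cmc_def)

section \<open>Isomorphism on vertexwise cohomology, rewritten for matrices whose columns are
  vectors\<close>

section \<open>Quasi-isomorphisms\<close>

text \<open>A matrix is a finite family of vectors, one for each column and block. This view
  translates quantifiers over vectors into quantifiers over matrices; \<open>mkx\<close> goes
  back.\<close>

definition colv :: "'k::field cplx \<Rightarrow> 'k bm \<Rightarrow> int \<Rightarrow> vtx \<Rightarrow> idx \<Rightarrow> 'k vec" where
 "colv X x i v b = vec (cdim X i v) (\<lambda>c. ent x ((i, v), c) b)"

lemma colv_carrier [simp]: "colv X x i v b \<in> carrier_vec (cdim X i v)"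
 by (simp add: colv_def)

lemma colv_cme_times:
 assumes "bd (dm X)" "cmc p X Y f"
 shows "colv Y (cme p X Y f * x) (i + p) v b = f i v *\<^sub>v colv X x i v b"
proof (rule eq_vecI)
 have c: "f i v \<in> carrier_mat (cdim Y (i + p) v) (cdim X i v)" using assms(2) by (simp add: cmc_def)
 show "dim_vec (colv Y (cme p X Y f * x) (i + p) v b) = dim_vec (f i v *\<^sub>v colv X x i v b)"
  using c by (simp add: colv_def)
 fix a assume "a < dim_vec (f i v *\<^sub>v colv X x i v b)"
 then have a: "a < cdim Y (i + p) v" using c by simp
 have "ent (cme p X Y f * x) ((i + p, v), a) b = (\<Sum>l\<in>Pair (i, v) ` {..<cdim X i v}. ent (cme p X Y f) ((i + p, v), a) l * ent x l b)"
  by (rule ent_times_sup)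
   (auto simp: cme_def ent_en assms(1) Tp_def dm_def image_iff split_paired_all)
 also have "\<dots> = (\<Sum>l<cdim X i v. ent (cme p X Y f) ((i + p, v), a) ((i, v), l) * ent x ((i, v), l) b)"
  by (subst sum.reindex) (auto simp: inj_on_def)
 also have "\<dots> = (\<Sum>l<cdim X i v. f i v $$ (a, l) * ent x ((i, v), l) b)"
  by (rule sum.cong) (auto simp: cme_def ent_en assms(1) Tp_def dm_def a)
 also have "\<dots> = (f i v *\<^sub>v colv X x i v b) $ a"
  using c a by (auto simp: scalar_prod_def colv_def lessThan_atLeast0 intro!: sum.cong)
 finally show "colv Y (cme p X Y f * x) (i + p) v b $ a = (f i v *\<^sub>v colv X x i v b) $ a"
  using a by (simp add: colv_def)
qed

lemma colv_eqI:
 assumes "bd (dm X)" "se (so X) * x = x" "se (so X) * y = y" "!!i v b. colv X x i v b = colv X y i v b"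
 shows "x = y"
proof (rule fm_eqI)
 fix a b :: idx
 obtain i v c where a: "a = ((i, v), c)" by (metis prod.collapse)
 show "ent x a b = ent y a b"
 proof (cases "c < cdim X i v")
  case True
  then show ?thesis using arg_cong[OF assms(4)[of i v b], of "\<lambda>u. u $ c"] by (simp add: colv_def a)
 next
  case False
  then show ?thesis using se_left[OF assms(1), of x a b] se_left[OF assms(1), of y a b] assms(2,3)
   by (simp add: a dm_def del: so_sel)
 qed
qed

definition mkx :: "'k::field cplx \<Rightarrow> (int \<Rightarrow> vtx \<Rightarrow> idx \<Rightarrow> 'k vec) \<Rightarrow> idx set \<Rightarrow> 'k bm" where
 "mkx X z S = Abs_fm (\<lambda>a b. if b \<in> S \<and> snd a < dm X (fst a) then z (fst (fst a)) (snd (fst a)) b $ snd a else 0)"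

lemma ent_mkx:
 assumes "bd (dm X)" "finite S"
 shows "ent (mkx X z S) a b = (if b \<in> S \<and> snd a < dm X (fst a) then z (fst (fst a)) (snd (fst a)) b $ snd a else 0)"
 unfolding mkx_def by (subst ent_Abs_fm[of "S \<union> {i. snd i < dm X (fst i)}"])
  (use assms se_pr(2)[OF assms(1)] in \<open>auto split: if_splits\<close>)

lemma colv_mkx:
 assumes "bd (dm X)" "finite S" "b \<in> S" "z i v b \<in> carrier_vec (cdim X i v)"
 shows "colv X (mkx X z S) i v b = z i v b"
 using assms by (auto simp: colv_def ent_mkx dm_def intro!: eq_vecI)

lemma mkx_left: "bd (dm X) ==> finite S ==> se (so X) * mkx X z S = mkx X z S"
 by (rule fm_eqI, subst se_left) (auto simp: ent_mkx)

lemma colv_out: "b \<notin> fsupp x ==> colv X x i v b = 0\<^sub>v (cdim X i v)"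
 by (auto simp: colv_def ent_fsupp)

lemma colv_mkx_out:
 assumes "bd (dm X)" "finite S" "b \<notin> S"
 shows "colv X (mkx X z S) i v b = 0\<^sub>v (cdim X i v)"
 using assms by (auto simp: colv_def ent_mkx)

lemma colv_add: "colv X (x + y) i v b = colv X x i v b + colv X y i v b"
 by (auto simp: colv_def)

lemma mult_mat_zero_vec: "A \<in> carrier_mat n m ==> A *\<^sub>v 0\<^sub>v m = (0\<^sub>v n :: 'k::field vec)"
 by (rule eq_vecI) auto

lemma vec_add_diff: "a \<in> carrier_vec n ==> b \<in> carrier_vec n ==> a + b - a = (b :: 'k::field vec)"
 by (rule eq_vecI) auto

lemma boundaries_carrier:
 assumes "is_cplx X" "b \<in> boundaries X i v" shows "b \<in> carrier_vec (cdim X i v)"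
proof -
 have "cdif X (i - 1) v \<in> carrier_mat (cdim X i v) (cdim X (i - 1) v)"
  using cplx_cmc[OF assms(1)] unfolding cmc_def by (metis diff_add_cancel)
 then show ?thesis using assms(2) by (auto simp: boundaries_def)
qed

lemma cdif_carrier:
 assumes "is_cplx X" shows "cdif X i v \<in> carrier_mat (cdim X (i + 1) v) (cdim X i v)"
  "cdif X (i - 1) v \<in> carrier_mat (cdim X i v) (cdim X (i - 1) v)"
 using cplx_cmc[OF assms] unfolding cmc_def by (auto, metis diff_add_cancel)

lemma boundaries_zero: "is_cplx X ==> 0\<^sub>v (cdim X i v) \<in> boundaries X i v"
 unfolding boundaries_def
 by (rule image_eqI[of _ _ "0\<^sub>v (cdim X (i - 1) v)"]) (simp_all add: mult_mat_zero_vec[OF cdif_carrier(2)])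

lemma boundaries_add:
 assumes "is_cplx X" "b \<in> boundaries X i v" "c \<in> boundaries X i v" shows "b + c \<in> boundaries X i v"
proof -
 obtain x y where "b = cdif X (i - 1) v *\<^sub>v x" "c = cdif X (i - 1) v *\<^sub>v y"
  "x \<in> carrier_vec (cdim X (i - 1) v)" "y \<in> carrier_vec (cdim X (i - 1) v)"
  using assms by (auto simp: boundaries_def)
 then show ?thesis unfolding boundaries_def
  by (intro image_eqI[of _ _ "x + y"]) (auto simp: mult_add_distrib_mat_vec[OF cdif_carrier(2)[OF assms(1)]])
qed

lemma boundaries_minus:
 assumes "is_cplx X" "b \<in> boundaries X i v" shows "- b \<in> boundaries X i v"
proof -
 obtain x where "b = cdif X (i - 1) v *\<^sub>v x" "x \<in> carrier_vec (cdim X (i - 1) v)"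
  using assms by (auto simp: boundaries_def)
 then show ?thesis unfolding boundaries_def using cdif_carrier(2)[OF assms(1), of i v]
  by (intro image_eqI[of _ _ "- x"]) auto
qed

lemma coh_class_eq_iff:
 assumes "is_cplx X" "z \<in> carrier_vec (cdim X i v)" "z' \<in> carrier_vec (cdim X i v)"
 shows "coh_class X i v z = coh_class X i v z' \<longleftrightarrow> (\<exists>b\<in>boundaries X i v. z = z' + b)"
proof
 assume "coh_class X i v z = coh_class X i v z'"
 moreover have "z = z + 0\<^sub>v (cdim X i v)" using assms(2) by simp
 then have "z \<in> coh_class X i v z"
  unfolding coh_class_def using boundaries_zero[OF assms(1), of i v] by blast
 ultimately show "\<exists>b\<in>boundaries X i v. z = z' + b" by (auto simp: coh_class_def)
next
 assume "\<exists>b\<in>boundaries X i v. z = z' + b"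
 then obtain b where b: "b \<in> boundaries X i v" "z = z' + b" by blast
 note bc = boundaries_carrier[OF assms(1)]
 have 1: "z + c = z' + (b + c)" "z' + c = z + (- b + c)" if "c \<in> boundaries X i v" for c
  using bc[OF b(1)] bc[OF that] assms(3) by (auto simp: b(2) intro!: eq_vecI)
 show "coh_class X i v z = coh_class X i v z'"
  unfolding coh_class_def
 proof (intro equalityI subsetI)
  fix y assume "y \<in> (+) z ` boundaries X i v"
  then obtain c where "c \<in> boundaries X i v" "y = z + c" by auto
  then show "y \<in> (+) z' ` boundaries X i v"
   using 1 boundaries_add[OF assms(1) b(1)] by auto
 next
  fix y assume "y \<in> (+) z' ` boundaries X i v"
  then obtain c where "c \<in> boundaries X i v" "y = z' + c" by auto
  then show "y \<in> (+) z ` boundaries X i v"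
   using 1 boundaries_add[OF assms(1) boundaries_minus[OF assms(1) b(1)]] by auto
 qed
qed

lemma chain_map_boundaries:
 assumes "is_cplx X" "is_cplx Y" "chain_map X Y f" "b \<in> boundaries X i v"
 shows "f i v *\<^sub>v b \<in> boundaries Y i v"
proof -
 have fc: "f i v \<in> carrier_mat (cdim Y i v) (cdim X i v)" for i v
  using assms(3) by (auto simp: chain_map_def rep_map_def)
 obtain x where x: "b = cdif X (i - 1) v *\<^sub>v x" "x \<in> carrier_vec (cdim X (i - 1) v)"
  using assms(4) by (auto simp: boundaries_def)
 have "f i v * cdif X (i - 1) v = cdif Y (i - 1) v * f (i - 1) v"
  using assms(3) unfolding chain_map_def by (metis diff_add_cancel)
 then have "f i v *\<^sub>v b = cdif Y (i - 1) v *\<^sub>v (f (i - 1) v *\<^sub>v x)"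
  using x fc cdif_carrier(2)[OF assms(1)] cdif_carrier(2)[OF assms(2)]
  by (metis assoc_mult_mat_vec)
 then show ?thesis using x fc[of "i - 1" v] by (auto simp: boundaries_def)
qed

lemma coh_map_class:
 assumes "is_cplx X" "is_cplx Y" "chain_map X Y f" "z \<in> carrier_vec (cdim X i v)"
 shows "coh_map Y f i v (coh_class X i v z) = coh_class Y i v (f i v *\<^sub>v z)"
proof -
 have fc: "f i v \<in> carrier_mat (cdim Y i v) (cdim X i v)"
  using assms(3) by (auto simp: chain_map_def rep_map_def)
 have "coh_class Y i v (f i v *\<^sub>v (z + b)) = coh_class Y i v (f i v *\<^sub>v z)" if "b \<in> boundaries X i v" for b
  by (subst coh_class_eq_iff[OF assms(2)])
   (use fc assms(4) boundaries_carrier[OF assms(1) that] chain_map_boundaries[OF assms(1-3) that] in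
    \<open>auto simp: mult_add_distrib_mat_vec[OF fc]\<close>)
 moreover have "boundaries X i v \<noteq> {}" using boundaries_zero[OF assms(1)] by blast
 ultimately show ?thesis by (auto simp: coh_map_def coh_class_def[of X])
qed

lemma ker_carrier: "is_cplx X ==> z \<in> mat_kernel (cdif X i v) \<longleftrightarrow> z \<in> carrier_vec (cdim X i v) \<and> cdif X i v *\<^sub>v z = 0\<^sub>v (cdim X (i + 1) v)"
 using mat_kernel[OF cdif_carrier(1)] by blast

lemma chain_map_kernel:
 assumes "is_cplx X" "is_cplx Y" "chain_map X Y f" "z \<in> mat_kernel (cdif X i v)"
 shows "f i v *\<^sub>v z \<in> mat_kernel (cdif Y i v)"
proof -
 have fc: "f i v \<in> carrier_mat (cdim Y i v) (cdim X i v)" for i v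
  using assms(3) by (auto simp: chain_map_def rep_map_def)
 have z: "z \<in> carrier_vec (cdim X i v)" "cdif X i v *\<^sub>v z = 0\<^sub>v (cdim X (i + 1) v)"
  using assms(4) by (auto simp: ker_carrier[OF assms(1)])
 have "f (i + 1) v * cdif X i v = cdif Y i v * f i v"
  using assms(3) unfolding chain_map_def by auto
 then have "cdif Y i v *\<^sub>v (f i v *\<^sub>v z) = f (i + 1) v *\<^sub>v (cdif X i v *\<^sub>v z)"
  using z(1) fc cdif_carrier(1)[OF assms(1)] cdif_carrier(1)[OF assms(2)]
  by (metis assoc_mult_mat_vec)
 then show ?thesis using z fc[of i v] mult_mat_zero_vec[OF fc[of "i + 1" v]] mult_mat_vec_carrier[OF fc z(1)]
  by (auto simp: ker_carrier[OF assms(2)])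
qed

lemma quasi_iso_iff:
 assumes "is_cplx X" "is_cplx Y"
 shows "quasi_iso X Y f \<longleftrightarrow> chain_map X Y f \<and> (\<forall>i v.
  (\<forall>z\<in>mat_kernel (cdif X i v). f i v *\<^sub>v z \<in> boundaries Y i v --> z \<in> boundaries X i v) \<and>
  (\<forall>y\<in>mat_kernel (cdif Y i v). \<exists>z\<in>mat_kernel (cdif X i v). \<exists>b\<in>boundaries Y i v. y = f i v *\<^sub>v z + b))"
proof -
 have *: "bij_betw (coh_map Y f i v) (cohomology X i v) (cohomology Y i v) \<longleftrightarrow>
  (\<forall>z\<in>mat_kernel (cdif X i v). f i v *\<^sub>v z \<in> boundaries Y i v --> z \<in> boundaries X i v) \<and>
  (\<forall>y\<in>mat_kernel (cdif Y i v). \<exists>z\<in>mat_kernel (cdif X i v). \<exists>b\<in>boundaries Y i v. y = f i v *\<^sub>v z + b)"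
  (is "_ \<longleftrightarrow> ?I \<and> ?S") if f: "chain_map X Y f" for i v
 proof -
  let ?K = "mat_kernel (cdif X i v)" and ?L = "mat_kernel (cdif Y i v)"
  have fc: "f i v \<in> carrier_mat (cdim Y i v) (cdim X i v)"
   using f by (auto simp: chain_map_def rep_map_def)
  have kc: "z \<in> ?K ==> z \<in> carrier_vec (cdim X i v)" for z by (simp add: ker_carrier[OF assms(1)])
  have lc: "z \<in> ?L ==> z \<in> carrier_vec (cdim Y i v)" for z by (simp add: ker_carrier[OF assms(2)])
  have kd: "z - z' \<in> ?K" if "z \<in> ?K" "z' \<in> ?K" for z z'
   using that mult_minus_distrib_mat_vec[OF cdif_carrier(1)[OF assms(1)], of z i v z']
   by (auto simp: ker_carrier[OF assms(1)])
  have im: "coh_map Y f i v (coh_class X i v z) = coh_class Y i v (f i v *\<^sub>v z)" if "z \<in> ?K" for z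
   by (rule coh_map_class[OF assms f kc[OF that]])
  have fk: "f i v *\<^sub>v z \<in> ?L" if "z \<in> ?K" for z by (rule chain_map_kernel[OF assms f that])
  note eqX = coh_class_eq_iff[OF assms(1)] and eqY = coh_class_eq_iff[OF assms(2)]
  have inj: "inj_on (coh_map Y f i v) (cohomology X i v) \<longleftrightarrow> ?I"
  proof
   assume inj: "inj_on (coh_map Y f i v) (cohomology X i v)"
   show ?I
   proof (intro ballI impI)
    fix z assume z: "z \<in> ?K" "f i v *\<^sub>v z \<in> boundaries Y i v"
    have 0: "0\<^sub>v (cdim X i v) \<in> ?K" using mult_mat_zero_vec[OF cdif_carrier(1)[OF assms(1)]] by (auto simp: ker_carrier[OF assms(1)])
    have "f i v *\<^sub>v 0\<^sub>v (cdim X i v) = 0\<^sub>v (cdim Y i v)" using fc by auto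
    moreover have "coh_class Y i v (f i v *\<^sub>v z) = coh_class Y i v (0\<^sub>v (cdim Y i v))"
     using z lc[OF fk[OF z(1)]] by (subst eqY) (auto intro!: bexI[of _ "f i v *\<^sub>v z"])
    ultimately have "coh_map Y f i v (coh_class X i v z) = coh_map Y f i v (coh_class X i v (0\<^sub>v (cdim X i v)))"
     using im z 0 by simp
    then have "coh_class X i v z = coh_class X i v (0\<^sub>v (cdim X i v))"
     using inj z(1) 0 unfolding inj_on_def cohomology_def by blast
    then obtain b where "b \<in> boundaries X i v" "z = 0\<^sub>v (cdim X i v) + b"
     using eqX[OF kc[OF z(1)]] by auto
    then show "z \<in> boundaries X i v" using boundaries_carrier[OF assms(1)] by auto
   qed
  next
   assume I: ?I
   show "inj_on (coh_map Y f i v) (cohomology X i v)"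
   proof (rule inj_onI)
    fix c c' assume "c \<in> cohomology X i v" "c' \<in> cohomology X i v" and e: "coh_map Y f i v c = coh_map Y f i v c'"
    then obtain z z' where z: "z \<in> ?K" "z' \<in> ?K" "c = coh_class X i v z" "c' = coh_class X i v z'"
     by (auto simp: cohomology_def)
    have "coh_class Y i v (f i v *\<^sub>v z) = coh_class Y i v (f i v *\<^sub>v z')"
     using e im z by simp
    then obtain b where b: "b \<in> boundaries Y i v" "f i v *\<^sub>v z = f i v *\<^sub>v z' + b"
     using eqY[OF lc[OF fk[OF z(1)]] lc[OF fk[OF z(2)]]] by blast
    have "f i v *\<^sub>v (z - z') = f i v *\<^sub>v z - f i v *\<^sub>v z'"
     by (rule mult_minus_distrib_mat_vec[OF fc kc[OF z(1)] kc[OF z(2)]])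
    also have "\<dots> = b" unfolding b(2)
     by (rule vec_add_diff[OF lc[OF fk[OF z(2)]] boundaries_carrier[OF assms(2) b(1)]])
    finally have "z - z' \<in> boundaries X i v" using I b(1) kd[OF z(1,2)] by auto
    moreover have "z = z' + (z - z')" using kc[OF z(1)] kc[OF z(2)] by (auto intro!: eq_vecI)
    ultimately show "c = c'" unfolding z(3,4) using eqX[OF kc[OF z(1)] kc[OF z(2)]] by blast
   qed
  qed
  have "coh_map Y f i v ` cohomology X i v = cohomology Y i v \<longleftrightarrow> ?S"
  proof
   assume s: "coh_map Y f i v ` cohomology X i v = cohomology Y i v"
   show ?S
   proof
    fix y assume y: "y \<in> ?L"
    then have "coh_class Y i v y \<in> coh_map Y f i v ` cohomology X i v" unfolding s by (simp add: cohomology_def)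
    then obtain z where "z \<in> ?K" "coh_class Y i v y = coh_class Y i v (f i v *\<^sub>v z)"
     using im by (auto simp: cohomology_def)
    then show "\<exists>z\<in>?K. \<exists>b\<in>boundaries Y i v. y = f i v *\<^sub>v z + b"
     using eqY[OF lc[OF y] lc[OF fk]] by blast
   qed
  next
   assume S: ?S
   show "coh_map Y f i v ` cohomology X i v = cohomology Y i v"
   proof (intro equalityI subsetI)
    fix c assume "c \<in> coh_map Y f i v ` cohomology X i v"
    then obtain z where z: "z \<in> ?K" "c = coh_map Y f i v (coh_class X i v z)" by (auto simp: cohomology_def)
    then show "c \<in> cohomology Y i v" using im[OF z(1)] fk[OF z(1)] by (auto simp: cohomology_def)
   next
    fix c assume "c \<in> cohomology Y i v"
    then obtain y where y: "y \<in> ?L" "c = coh_class Y i v y" by (auto simp: cohomology_def)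
    then obtain z b where z: "z \<in> ?K" "b \<in> boundaries Y i v" "y = f i v *\<^sub>v z + b" using S by blast
    then have "c = coh_map Y f i v (coh_class X i v z)"
     unfolding y(2) im[OF z(1)] using eqY[OF lc[OF y(1)] lc[OF fk[OF z(1)]]] by blast
    then show "c \<in> coh_map Y f i v ` cohomology X i v" using z(1) by (auto simp: cohomology_def)
   qed
  qed
  then show ?thesis using inj by (auto simp: bij_betw_def)
 qed
 show ?thesis unfolding quasi_iso_def using * by (auto simp only: simp_thms)
qed

text \<open>Injectivity and surjectivity on cohomology for many vectors of all degrees at once:
  \<open>u\<close> and \<open>w\<close> range over matrices, whose columns are unrelated
  vectors.\<close>

definition qir :: "'k::field so \<Rightarrow> 'k so \<Rightarrow> 'k bm \<Rightarrow> bool" where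
 "qir S T x \<longleftrightarrow>
  (\<forall>u w. se S * u = u --> sd S * u = 0 --> se T * w = w --> x * u = sd T * w --> (\<exists>u'. se S * u' = u' \<and> u = sd S * u')) \<and>
  (\<forall>w. se T * w = w --> sd T * w = 0 --> (\<exists>u w'. se S * u = u \<and> sd S * u = 0 \<and> se T * w' = w' \<and> w = x * u + sd T * w'))"

lemma sd_left_se: "is_cplx X ==> se (so X) * (sd (so X) * x) = sd (so X) * x"
 using sob_so[of X] by (simp add: sob_def del: so_sel flip: mult.assoc)

lemma colv_zero: "colv X 0 i v b = 0\<^sub>v (cdim X i v)"
 by (auto simp: colv_def)

lemma colv_sd: "is_cplx X ==> colv X (sd (so X) * x) i v b = cdif X (i - 1) v *\<^sub>v colv X x (i - 1) v b"
 using colv_cme_times[where X=X and Y=X and p=1 and f="cdif X" and x=x and i="i - 1" and v=v and b=b]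
 by (simp add: cplx_bd cplx_cmc)

lemma quasi_iso_qir:
 assumes "is_cplx X" "is_cplx Y" "quasi_iso X Y f"
 shows "qir (so X) (so Y) (cme 0 X Y f)"
proof -
 note bX = cplx_bd[OF assms(1)] and bY = cplx_bd[OF assms(2)]
 have f: "chain_map X Y f"
  and I: "!!i v z. z \<in> mat_kernel (cdif X i v) ==> f i v *\<^sub>v z \<in> boundaries Y i v ==> z \<in> boundaries X i v"
  and S: "!!i v y. y \<in> mat_kernel (cdif Y i v) ==> \<exists>z\<in>mat_kernel (cdif X i v). \<exists>b\<in>boundaries Y i v. y = f i v *\<^sub>v z + b"
  using assms(3) quasi_iso_iff[OF assms(1,2)] by blast+
 have fm: "cmc 0 X Y f" using f chain_map_iff[OF assms(1,2)] by blast
 have fc: "f i v \<in> carrier_mat (cdim Y i v) (cdim X i v)" for i v using fm by (auto simp: cmc_def)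
 have col: "colv Y (cme 0 X Y f * x) i v b = f i v *\<^sub>v colv X x i v b" for x i v b
  using colv_cme_times[OF bX fm, of x i v b] by simp
 have ker: "colv Z x i v b \<in> mat_kernel (cdif Z i v)" if "is_cplx Z" "sd (so Z) * x = 0" for Z :: "'a cplx" and x i v b
  using colv_sd[OF that(1), of x "i + 1" v b] that(2)
  by (auto simp: ker_carrier[OF that(1)] colv_zero)
 have bnd: "colv Z (sd (so Z) * x) i v b \<in> boundaries Z i v" if "is_cplx Z" for Z :: "'a cplx" and x i v b
  unfolding colv_sd[OF that] boundaries_def by auto
 show ?thesis unfolding qir_def
 proof (intro conjI allI impI)
  fix u w assume u: "se (so X) * u = u" "sd (so X) * u = 0" "se (so Y) * w = w" "cme 0 X Y f * u = sd (so Y) * w"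
  have Hb: "colv X u i v b \<in> boundaries X i v" for i v b
   by (rule I[OF ker[OF assms(1) u(2)]]) (use bnd[OF assms(2)] in \<open>simp add: u(4) del: so_sel flip: col\<close>)
  have "\<exists>t. t \<in> carrier_vec (cdim X (i - 1) v) \<and> colv X u i v b = cdif X (i - 1) v *\<^sub>v t" for i v b
   using Hb[of i v b] by (auto simp: boundaries_def)
  then obtain t where t: "!!i v b. t i v b \<in> carrier_vec (cdim X (i - 1) v)"
   "!!i v b. colv X u i v b = cdif X (i - 1) v *\<^sub>v t i v b" by metis
  \<comment> \<open>Only columns in the support of \<open>u\<close> are filled, which keeps the
    support finite. The index is raised by one because a preimage of a vector of degree i lives in
    degree i - 1.\<close>
  define u' where "u' = mkx X (\<lambda>i v b. t (i + 1) v b) (fsupp u)"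
  have "u = sd (so X) * u'"
  proof (rule colv_eqI[OF bX u(1) sd_left_se[OF assms(1)]])
   fix i v b
   show "colv X u i v b = colv X (sd (so X) * u') i v b"
   proof (cases "b \<in> fsupp u")
    case True
    then show ?thesis unfolding colv_sd[OF assms(1)] u'_def
     by (subst colv_mkx) (use t[of i v b] bX t(1)[of "i - 1 + 1" v b] in auto)
   next
    case False
    then show ?thesis unfolding colv_sd[OF assms(1)] u'_def
     by (subst colv_mkx_out) (use bX in \<open>auto simp: colv_out mult_mat_zero_vec[OF cdif_carrier(2)[OF assms(1)]]\<close>)
   qed
  qed
  then show "\<exists>u'. se (so X) * u' = u' \<and> u = sd (so X) * u'"
   using mkx_left[OF bX] unfolding u'_def by (metis finite_fsupp)
 next
  fix w assume w: "se (so Y) * w = w" "sd (so Y) * w = 0"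
  have kk: "colv Y w i v b \<in> mat_kernel (cdif Y i v)" for i v b by (rule ker[OF assms(2) w(2)])
  have "\<exists>z t. z \<in> mat_kernel (cdif X i v) \<and> t \<in> carrier_vec (cdim Y (i - 1) v) \<and> colv Y w i v b = f i v *\<^sub>v z + cdif Y (i - 1) v *\<^sub>v t" for i v b
   using S[OF kk[of i v b]] by (auto simp: boundaries_def)
  then obtain z t where z: "!!i v b. z i v b \<in> mat_kernel (cdif X i v)" and t: "!!i v b. t i v b \<in> carrier_vec (cdim Y (i - 1) v)"
   and e: "!!i v b. colv Y w i v b = f i v *\<^sub>v z i v b + cdif Y (i - 1) v *\<^sub>v t i v b" by metis
  have zc: "z i v b \<in> carrier_vec (cdim X i v)" "cdif X i v *\<^sub>v z i v b = 0\<^sub>v (cdim X (i + 1) v)" for i v b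
   using z by (auto simp: ker_carrier[OF assms(1)])
  define u where "u = mkx X z (fsupp w)"
  define w' where "w' = mkx Y (\<lambda>i v b. t (i + 1) v b) (fsupp w)"
  have ue: "se (so X) * u = u" unfolding u_def by (rule mkx_left[OF bX finite_fsupp])
  have we: "se (so Y) * w' = w'" unfolding w'_def by (rule mkx_left[OF bY finite_fsupp])
  have "sd (so X) * u = 0"
  proof (rule colv_eqI[OF bX sd_left_se[OF assms(1)]])
   fix i v b
   have "cdif X (i - 1) v *\<^sub>v colv X u (i - 1) v b = 0\<^sub>v (cdim X i v)"
    using zc[of "i - 1" v b] colv_mkx[OF bX finite_fsupp, of b w z "i - 1" v] colv_mkx_out[OF bX finite_fsupp, of b w z "i - 1" v]
     mult_mat_zero_vec[OF cdif_carrier(2)[OF assms(1), of i v]]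
    by (cases "b \<in> fsupp w") (auto simp: u_def)
   then show "colv X (sd (so X) * u) i v b = colv X 0 i v b"
    unfolding colv_sd[OF assms(1)] by (auto simp: colv_def)
  qed simp
  moreover have "w = cme 0 X Y f * u + sd (so Y) * w'"
  proof (rule colv_eqI[OF bY w(1)])
   have "se (so Y) * cme 0 X Y f = cme 0 X Y f"
    using f chain_map_iff[OF assms(1,2)] by (auto simp: Sc_def Sm_def)
   then show "se (so Y) * (cme 0 X Y f * u + sd (so Y) * w') = cme 0 X Y f * u + sd (so Y) * w'"
    using sd_left_se[OF assms(2)] by (simp add: distrib_left del: so_sel flip: mult.assoc)
   fix i v b
   show "colv Y w i v b = colv Y (cme 0 X Y f * u + sd (so Y) * w') i v b"
   proof (cases "b \<in> fsupp w")
    case True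
    then show ?thesis unfolding colv_add col colv_sd[OF assms(2)] u_def w'_def
     by (subst (1 2) colv_mkx) (use e[of i v b] bX bY zc t[of "i" v b] t[of "i - 1 + 1" v b] in auto)
   next
    case False
    then show ?thesis unfolding colv_add col colv_sd[OF assms(2)] u_def w'_def
     using mult_mat_zero_vec[OF fc[of i v]] mult_mat_zero_vec[OF cdif_carrier(2)[OF assms(2), of i v]]
     by (auto simp: colv_out colv_mkx_out bX bY)
   qed
  qed
  ultimately show "\<exists>u w'. se (so X) * u = u \<and> sd (so X) * u = 0 \<and> se (so Y) * w' = w' \<and> w = cme 0 X Y f * u + sd (so Y) * w'"
   using ue we by blast
 qed
qed

lemma qir_quasi_iso:
 assumes "is_cplx X" "is_cplx Y" "chain_map X Y f" "qir (so X) (so Y) (cme 0 X Y f)"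
 shows "quasi_iso X Y f"
proof -
 note bX = cplx_bd[OF assms(1)] and bY = cplx_bd[OF assms(2)]
 have fm: "cmc 0 X Y f" using assms(3) chain_map_iff[OF assms(1,2)] by blast
 have fc: "f i v \<in> carrier_mat (cdim Y i v) (cdim X i v)" for i v using fm by (auto simp: cmc_def)
 have ef: "se (so Y) * cme 0 X Y f = cme 0 X Y f"
  using assms(3) chain_map_iff[OF assms(1,2)] by (auto simp: Sc_def Sm_def)
 have col: "colv Y (cme 0 X Y f * x) i v b = f i v *\<^sub>v colv X x i v b" for x i v b
  using colv_cme_times[OF bX fm, of x i v b] by simp
 \<comment> \<open>An arbitrary column label: a single vector is viewed as a matrix with this one
   column.\<close>
 define o1 :: idx where "o1 = ((0, V1), 0)"
 define em where "em Z z i v = mkx Z (\<lambda>j w b. if j = i \<and> w = v then z else 0\<^sub>v (cdim Z j w)) {o1}" for Z :: "'a cplx" and z i v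
 have ce: "colv Z (em Z z i v) j w b = (if j = i \<and> w = v \<and> b = o1 then z else 0\<^sub>v (cdim Z j w))"
  if "is_cplx Z" "z \<in> carrier_vec (cdim Z i v)" for Z :: "'a cplx" and z i v j w b
  unfolding em_def using that cplx_bd[OF that(1)] by (cases "b = o1") (auto simp: colv_mkx colv_mkx_out)
 have ee: "se (so Z) * em Z z i v = em Z z i v" if "is_cplx Z" for Z :: "'a cplx" and z i v
  unfolding em_def by (rule mkx_left[OF cplx_bd[OF that]]) simp
 have de: "sd (so Z) * em Z z i v = em Z (cdif Z i v *\<^sub>v z) (i + 1) v"
  if "is_cplx Z" "z \<in> carrier_vec (cdim Z i v)" for Z :: "'a cplx" and z i v
 proof (rule colv_eqI[OF cplx_bd[OF that(1)] sd_left_se[OF that(1)] ee[OF that(1)]])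
  fix j w b
  show "colv Z (sd (so Z) * em Z z i v) j w b = colv Z (em Z (cdif Z i v *\<^sub>v z) (i + 1) v) j w b"
   unfolding colv_sd[OF that(1)] using cdif_carrier[OF that(1), of i v] cdif_carrier(2)[OF that(1), of j w] that(2)
   by (auto simp: ce[OF that] ce[OF that(1)])
 qed
 have ez: "em Z (0\<^sub>v (cdim Z i v)) i v = 0" if "is_cplx Z" for Z :: "'a cplx" and i v
  by (rule colv_eqI[OF cplx_bd[OF that] ee[OF that]]) (auto simp: ce[OF that], auto simp: colv_def)
 show ?thesis unfolding quasi_iso_iff[OF assms(1,2)]
 proof (intro conjI allI ballI impI)
  fix i v z assume z: "z \<in> mat_kernel (cdif X i v)" "f i v *\<^sub>v z \<in> boundaries Y i v"
  have zc: "z \<in> carrier_vec (cdim X i v)" "cdif X i v *\<^sub>v z = 0\<^sub>v (cdim X (i + 1) v)"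
   using z(1) by (auto simp: ker_carrier[OF assms(1)])
  obtain y where y: "y \<in> carrier_vec (cdim Y (i - 1) v)" "f i v *\<^sub>v z = cdif Y (i - 1) v *\<^sub>v y"
   using z(2) by (auto simp: boundaries_def)
  have "cme 0 X Y f * em X z i v = sd (so Y) * em Y y (i - 1) v"
  proof (rule colv_eqI[OF bY _ sd_left_se[OF assms(2)]])
   show "se (so Y) * (cme 0 X Y f * em X z i v) = cme 0 X Y f * em X z i v"
    using ef by (simp flip: mult.assoc del: so_sel)
   fix j w b
   show "colv Y (cme 0 X Y f * em X z i v) j w b = colv Y (sd (so Y) * em Y y (i - 1) v) j w b"
    unfolding col de[OF assms(2) y(1)]
    using ce[OF assms(1) zc(1), of j w b] ce[OF assms(2), of "cdif Y (i - 1) v *\<^sub>v y" i v j w b]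
     mult_mat_zero_vec[OF fc[of j w]] y(2) mult_mat_vec_carrier[OF cdif_carrier(2)[OF assms(2)] y(1)]
    by auto
  qed
  moreover have "sd (so X) * em X z i v = 0"
   unfolding de[OF assms(1) zc(1)] zc(2) by (rule ez[OF assms(1)])
  ultimately obtain u' where u': "em X z i v = sd (so X) * u'"
   using assms(4) ee[OF assms(1)] ee[OF assms(2)] unfolding qir_def by metis
  have "z = cdif X (i - 1) v *\<^sub>v colv X u' (i - 1) v o1"
   using arg_cong[OF u', of "\<lambda>x. colv X x i v o1"] unfolding colv_sd[OF assms(1)] ce[OF assms(1) zc(1)] by simp
  then show "z \<in> boundaries X i v" by (auto simp: boundaries_def)
 next
  fix i v y assume y: "y \<in> mat_kernel (cdif Y i v)"
  have yc: "y \<in> carrier_vec (cdim Y i v)" "cdif Y i v *\<^sub>v y = 0\<^sub>v (cdim Y (i + 1) v)"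
   using y(1) by (auto simp: ker_carrier[OF assms(2)])
  have "sd (so Y) * em Y y i v = 0"
   unfolding de[OF assms(2) yc(1)] yc(2) by (rule ez[OF assms(2)])
  then obtain u w' where u: "se (so X) * u = u" "sd (so X) * u = 0" "em Y y i v = cme 0 X Y f * u + sd (so Y) * w'"
   using assms(4) ee[OF assms(2)] unfolding qir_def by metis
  have "y = f i v *\<^sub>v colv X u i v o1 + cdif Y (i - 1) v *\<^sub>v colv Y w' (i - 1) v o1"
   using arg_cong[OF u(3), of "\<lambda>x. colv Y x i v o1"] unfolding colv_add col colv_sd[OF assms(2)] ce[OF assms(2) yc(1)] by simp
  moreover have "colv X u i v o1 \<in> mat_kernel (cdif X i v)"
   using colv_sd[OF assms(1), of u "i + 1" v o1] u(2) by (auto simp: ker_carrier[OF assms(1)] colv_zero)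
  ultimately show "\<exists>z\<in>mat_kernel (cdif X i v). \<exists>b\<in>boundaries Y i v. y = f i v *\<^sub>v z + b"
   by (intro bexI[of _ "colv X u i v o1"] bexI[of _ "cdif Y (i - 1) v *\<^sub>v colv Y w' (i - 1) v o1"])
    (auto simp: boundaries_def)
 qed (use assms in auto)
qed

section \<open>Insertion and projection matrices for direct sums of relabelled copies\<close>

section \<open>Slots\<close>

definition slI :: "('i \<Rightarrow> 'i) \<Rightarrow> 'i set \<Rightarrow> ('i, 'k::field) fm" where
 "slI f S = Abs_fm (\<lambda>a b. if b \<in> S \<and> a = f b then 1 else 0)"

definition slP :: "('i \<Rightarrow> 'i) \<Rightarrow> 'i set \<Rightarrow> ('i, 'k::field) fm" where
 "slP f S = Abs_fm (\<lambda>a b. if a \<in> S \<and> b = f a then 1 else 0)"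

lemma ent_slI: "finite S ==> ent (slI f S) a b = (if b \<in> S \<and> a = f b then 1 else 0)"
 unfolding slI_def by (subst ent_Abs_fm[of "S \<union> f ` S"]) (auto split: if_splits)

lemma ent_slP: "finite S ==> ent (slP f S) a b = (if a \<in> S \<and> b = f a then 1 else 0)"
 unfolding slP_def by (subst ent_Abs_fm[of "S \<union> f ` S"]) (auto split: if_splits)

lemma slP_slI:
 assumes "finite S" "inj_on f S"
 shows "slP f S * slI f S = (pr S :: ('i, 'k::field) fm)"
proof (rule fm_eqI)
 fix a b
 show "ent (slP f S * slI f S) a b = ent (pr S :: ('i, 'k) fm) a b"
  using assms by (subst ent_times_sup[of "{f a}"]) (auto simp: ent_slI ent_slP dest: inj_onD)
qed

lemma slP_slI_disjoint:
 assumes "finite S" "finite T" "f ` S \<inter> g ` T = {}"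
 shows "slP f S * slI g T = (0 :: ('i, 'k::field) fm)"
proof (rule fm_eqI)
 fix a b
 show "ent (slP f S * slI g T) a b = ent (0 :: ('i, 'k) fm) a b"
  using assms by (subst ent_times_sup[of "{f a}"]) (auto simp: ent_slI ent_slP)
qed

lemma slI_pr: "finite S ==> slI f S * pr S = slI f S"
 by (rule fm_eqI) (auto simp: ent_times_pr ent_slI)

lemma pr_slP: "finite S ==> pr S * slP f S = slP f S"
 by (rule fm_eqI) (auto simp: ent_pr_times ent_slP)

lemma dgr_slI: "finite S ==> (!!b. b \<in> S ==> td (f b) = td b + p) ==> dgr p (slI f S)"
 by (auto simp: dgr_def ent_slI)

lemma dgr_slP: "finite S ==> (!!b. b \<in> S ==> td (f b) = td b - p) ==> dgr p (slP f S)"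
 by (auto simp: dgr_def ent_slP)

lemma dia_slI: "finite S ==> (!!b. b \<in> S ==> vt (f b) = vt b) ==> dia (slI f S) = slI f S"
proof (rule fm_eqI)
 fix i j assume a: "finite S" "!!b. b \<in> S ==> vt (f b) = vt b"
 show "ent (dia (slI f S)) i j = ent (slI f S) i j"
  using a(2)[of j] by (auto simp: ent_slI[OF a(1)])
qed

lemma dia_slP: "finite S ==> (!!b. b \<in> S ==> vt (f b) = vt b) ==> dia (slP f S) = slP f S"
proof (rule fm_eqI)
 fix i j assume a: "finite S" "!!b. b \<in> S ==> vt (f b) = vt b"
 show "ent (dia (slP f S)) i j = ent (slP f S) i j"
  using a(2)[of i] by (auto simp: ent_slP[OF a(1)])
qed

lemma dia_mult_left:
 assumes "dia x = x" shows "dia (x * y) = x * dia y"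
proof (rule fm_eqI)
 fix i j
 let ?S = "fsupp x \<union> fsupp y"
 have e: "ent (x * dia y) i j = (\<Sum>l\<in>?S. ent x i l * ent (dia y) l j)"
  by (rule ent_times_sup) (auto simp: ent_fsupp)
 have x: "ent x i l = (if vt i = vt l then ent x i l else 0)" for l
  using arg_cong[OF assms, of "\<lambda>x. ent x i l"] by simp
 have *: "(if vt i = vt j then ent x i l * ent y l j else 0) = ent x i l * ent (dia y) l j" for l
  using x[of l] by (auto split: if_splits)
 show "ent (dia (x * y)) i j = ent (x * dia y) i j"
  unfolding e *[symmetric] by (cases "vt i = vt j") (simp_all add: ent_times)
qed

lemma dia_mult_right:
 assumes "dia y = y" shows "dia (x * y) = dia x * y"
proof (rule fm_eqI)
 fix i j
 let ?S = "fsupp x \<union> fsupp y"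
 have e: "ent (dia x * y) i j = (\<Sum>l\<in>?S. ent (dia x) i l * ent y l j)"
  by (rule ent_times_sup) (auto simp: ent_fsupp)
 have y: "ent y l j = (if vt l = vt j then ent y l j else 0)" for l
  using arg_cong[OF assms, of "\<lambda>x. ent x l j"] by simp
 have *: "(if vt i = vt j then ent x i l * ent y l j else 0) = ent (dia x) i l * ent y l j" for l
  using y[of l] by (auto split: if_splits)
 show "ent (dia (x * y)) i j = ent (dia x * y) i j"
  unfolding e *[symmetric] by (cases "vt i = vt j") (simp_all add: ent_times)
qed

section \<open>From exactness over a field to contracting homotopies and weak inverses\<close>

section \<open>Contractions\<close>

text \<open>For a generalised inverse \<open>q\<close> of \<open>c\<close> the matrix
  \<open>e - q * c\<close> has its image in the kernel of \<open>c\<close>, hence equals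
  \<open>c * z\<close> by exactness. Then \<open>k = q * c * z * e\<close> gives c k + k c = c z + q
  c = e.\<close>

lemma exact_contraction:
 fixes c e :: "('i, 'k::field) fm"
 assumes "c * c = 0" "e * e = e" "e * c = c" "c * e = c"
  and ex: "!!z. e * z = z ==> c * z = 0 ==> \<exists>w. z = c * w"
 shows "\<exists>k. e * k = k \<and> k * e = k \<and> c * k + k * c = e"
proof -
 obtain q0 where q0: "c * q0 * c = c" using quasi_inverse by blast
 define q where "q = e * q0 * e"
 have q: "c * q * c = c"
 proof -
  have "c * q * c = (c * e) * q0 * (e * c)" by (simp add: q_def mult.assoc)
  then show ?thesis using q0 assms by simp
 qed
 have eq: "e * q = q" "q * e = q" using assms(2) by (simp_all add: q_def flip: mult.assoc) (simp add: mult.assoc assms(2))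
 have "e * (e - q * c) = e - q * c" using eq assms by (simp add: right_diff_distrib flip: mult.assoc)
 moreover have "c * (e - q * c) = 0" using q assms by (simp add: right_diff_distrib flip: mult.assoc)
 ultimately obtain z where z: "e - q * c = c * z" using ex by blast
 define k where "k = q * c * z * e"
 have qc: "q * c + c * z = e" using z by (simp add: algebra_simps)
 have cze: "c * z * e = c * z"
 proof -
  have "(e - q * c) * e = e - q * c" using assms by (simp add: left_diff_distrib mult.assoc)
  then show ?thesis using z by simp
 qed
 have czc: "c * z * c = c"
 proof -
  have "(q * c + c * z) * c = c" using qc assms by simp
  then show ?thesis using assms(1) by (simp add: distrib_right mult.assoc)
 qed
 have "c * k + k * c = c * q * c * z * e + q * (c * z * (e * c))" by (simp add: k_def mult.assoc)
 also have "\<dots> = c * z + q * c" using q cze czc assms by simp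
 finally have "c * k + k * c = e" using qc by (simp add: add.commute)
 moreover have "e * k = k" using eq by (simp add: k_def flip: mult.assoc)
 moreover have "k * e = k" using assms(2) by (simp add: k_def mult.assoc)
 ultimately show ?thesis by blast
qed

lemma graded_contraction:
 fixes c e :: "'k::field bm"
 assumes "dgr 1 c" "dgr 0 e" and k: "e * k = k" "k * e = k" "c * k + k * c = e"
 shows "\<exists>k. dgr (- 1) k \<and> e * k = k \<and> k * e = k \<and> c * k + k * c = e"
proof (intro exI conjI)
 let ?k = "gc (- 1) k"
 show "dgr (- 1) ?k" by simp
 show "e * ?k = ?k" using gc_mult_right[OF assms(2), of "- 1" k] k by simp
 show "?k * e = ?k" using gc_mult_left[OF assms(2), of "- 1" k] k by simp
 have "gc 0 (c * k + k * c) = c * ?k + ?k * c"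
  using gc_mult_right[OF assms(1), of "- 1" k] gc_mult_left[OF assms(1), of "- 1" k] by (simp add: gc_simps)
 then show "c * ?k + ?k * c = e" using k gc_id[OF assms(2)] by simp
qed

lemma diagonal_contraction:
 fixes c e :: "'k::field bm"
 assumes "dgr 1 c" "dgr 0 e" "dia c = c" "dia e = e" and k: "e * k = k" "k * e = k" "c * k + k * c = e"
 shows "\<exists>k. dgr (- 1) k \<and> dia k = k \<and> e * k = k \<and> k * e = k \<and> c * k + k * c = e"
proof -
 obtain k where k: "dgr (- 1) k" "e * k = k" "k * e = k" "c * k + k * c = e"
  using graded_contraction[OF assms(1,2) k] by blast
 have "c * dia k + dia k * c = e"
  using arg_cong[OF k(4), of dia] dia_mult_left[OF assms(3)] dia_mult_right[OF assms(3)] assms(4) by simp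
 moreover have "e * dia k = dia k" "dia k * e = dia k"
  using dia_mult_left[OF assms(4), of k] dia_mult_right[OF assms(4), of k] k by simp_all
 ultimately show ?thesis using k dgr_dia by (intro exI[of _ "dia k"]) simp
qed

text \<open>A nonzero entry of the cube would raise the vertex number by at least three, but there
  are only three vertices.\<close>

lemma strictly_upper_nilpotent:
 fixes n :: "'k::field wk"
 assumes "dia (w1 n) = 0"
 shows "n * n * n = 0"
proof -
 have *: "x * x * x = 0" if "upr x" "dia x = 0" for x :: "'k bm"
 proof (rule fm_eqI, rule ccontr)
  fix i j assume "ent (x * x * x) i j \<noteq> ent 0 i j"
  then obtain l m where h: "ent x i l \<noteq> 0" "ent x l m \<noteq> 0" "ent x m j \<noteq> 0"
   using ent_times_nonzero by (metis ent_zero)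
  have s: "vn (vt b) < vn (vt a)" if "ent x a b \<noteq> 0" for a b
  proof -
   have "vt a \<noteq> vt b"
    using arg_cong[OF \<open>dia x = 0\<close>, of "\<lambda>x. ent x a b"] that by (auto split: if_splits)
   moreover have "vn (vt b) \<le> vn (vt a)" using \<open>upr x\<close> that by (auto simp: upr_def)
   ultimately show ?thesis by (metis order_le_neq_trans vn_inject)
  qed
  have "vn (vt j) + 3 \<le> vn (vt i)" using s[OF h(1)] s[OF h(2)] s[OF h(3)] by simp
  then show False by (cases "vt i"; cases "vt j") auto
 qed
 show ?thesis
  by (rule wk_eqI) (use *[of "w1 n"] *[of "w2 n"] assms dia_w[of n] in auto)
qed

text \<open>The error term of the given contraction is strictly triangular, hence nilpotent.\<close>

lemma perturb:
 fixes D e k :: "'k::field wk"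
 assumes "D * D = 0" "e * e = e" "e * D = D" "D * e = D" "e * k = k" "k * e = k"
  "dg 1 D" "dg 0 e" "dg (- 1) k" "dia (w1 (D * k + k * D - e)) = 0"
 shows "\<exists>K. dg (- 1) K \<and> e * K = K \<and> K * e = K \<and> D * K + K * D = e"
proof -
 define n where "n = D * k + k * D - e"
 \<comment> \<open>The inverse of \<open>e + n\<close> as a geometric series, which stops because
   the cube of \<open>n\<close> is zero.\<close>
 define r where "r = e - n + n * n"
 have n3: "n * n * n = 0" using strictly_upper_nilpotent[of n] assms(10) by (simp only: n_def)
 have en: "e * n = n" "n * e = n"
  using assms by (simp_all add: n_def algebra_simps flip: mult.assoc) (simp_all add: mult.assoc assms)
 have Dn: "D * n = n * D"
 proof -
  have "D * n = D * k * D - D" using assms by (simp add: n_def algebra_simps flip: mult.assoc)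
  moreover have "n * D = D * k * D - D" using assms by (simp add: n_def algebra_simps)
  ultimately show ?thesis by simp
 qed
 have Dr: "D * r = r * D"
 proof -
  have "D * (n * n) = n * n * D" by (simp only: mult.assoc[symmetric] Dn) (simp only: mult.assoc Dn)
  then show ?thesis using Dn assms by (simp add: r_def distrib_left distrib_right left_diff_distrib right_diff_distrib)
 qed
 have er: "(e + n) * r = e"
 proof -
  have "(e + n) * r = e - n + n * n + (n - n * n + n * n * n)"
   using en assms by (simp add: r_def algebra_simps flip: mult.assoc)
  then show ?thesis using n3 by simp
 qed
 have dn: "dg 0 n" using assms dg_mult'[of 1 D "- 1" k 0] dg_mult'[of "- 1" k 1 D 0] by (auto simp: n_def intro!: dg_diff dg_add)
 have dr: "dg 0 r" using dn assms dg_mult'[of 0 n 0 n 0] by (auto simp: r_def intro!: dg_diff dg_add)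
 have re: "r * e = r" using en assms by (simp add: r_def algebra_simps)
 have u: "D * k + k * D = e + n" by (simp add: n_def)
 have "D * (k * r) + k * r * D = (D * k + k * D) * r"
  by (simp add: distrib_right mult.assoc) (simp only: Dr[symmetric])
 then have "D * (k * r) + k * r * D = e" using u er by simp
 moreover have "e * (k * r) = k * r" using assms by (simp flip: mult.assoc)
 moreover have "k * r * e = k * r" using re by (simp add: mult.assoc)
 moreover have "dg (- 1) (k * r)" using dg_mult'[OF assms(9) dr] by simp
 ultimately show ?thesis by blast
qed

lemma mult_assoc_eq: "a * b = c ==> a * (b * z) = c * (z :: 'a::semigroup_mult)"
 by (simp flip: mult.assoc)

lemmas ring_dist = distrib_left distrib_right left_diff_distrib right_diff_distrib

lemma dia_oo: "sob S ==> dia (w1 (snd (oo S))) = sd S"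
 by (simp add: w_oo) (simp add: sob_def vst_dia)

text \<open>The cone of a quasi-isomorphism is acyclic. A contraction of its vertexwise part is
  corrected by \<open>perturb\<close> to one of the weak cone, and the blocks of that contraction
  are the inverse and the two homotopies.\<close>

lemma qir_inverse:
 fixes S T :: "'k::field so"
 assumes S: "sob S" "se S = pr U" "finite U" and T: "sob T" "se T = pr V" "finite V"
  and x: "Sc 0 S T x" and q: "qir S T x"
 shows "\<exists>t. Zc 0 (oo T) (oo S) t \<and> hq 0 (oo S) (oo S) (t * st x) (fst (oo S)) \<and>
  hq 0 (oo T) (oo T) (st x * t) (fst (oo T))"
proof -
 \<comment> \<open>Coordinates of the cone: even positions, one degree lower, hold
   \<open>S[1]\<close>, and odd positions hold \<open>T\<close>.\<close>
 define f0 f1 :: "idx \<Rightarrow> idx" where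
  "f0 b = ((fst (fst b) - 1, snd (fst b)), 2 * snd b)" and "f1 b = (fst b, 2 * snd b + 1)" for b
 have inj: "inj_on f0 A" "inj_on f1 A" for A
  by (auto simp: inj_on_def f0_def f1_def prod_eq_iff)
 have dj: "f0 ` A \<inter> f1 ` B = {}" "f1 ` B \<inter> f0 ` A = {}" for A B
  by (auto simp: f0_def f1_def, presburger+)
 define I0 P0 I1 P1 :: "'k bm" where I: "I0 = slI f0 U" "P0 = slP f0 U" "I1 = slI f1 V" "P1 = slP f1 V"
 define d d' e e' where d: "d = sd S" "d' = sd T" "e = se S" "e' = se T"
 have R: "P0 * I0 = e" "P1 * I1 = e'" "P0 * I1 = 0" "P1 * I0 = 0" "I0 * e = I0" "I1 * e' = I1" "e * P0 = P0" "e' * P1 = P1"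
  using S T inj dj by (auto simp: I d slP_slI slP_slI_disjoint slI_pr pr_slP)
 have X: "x * e = x" "e' * x = x" "e * d = d" "d * e = d" "e' * d' = d'" "d' * e' = d'" "d * d = 0" "d' * d' = 0" "d' * x = x * d"
  "e * e = e" "e' * e' = e'"
  using x S T by (auto simp: Sc_def Sm_def sob_def d)
 note RX = R X and RX' = R[THEN mult_assoc_eq] X[THEN mult_assoc_eq]
 have gr: "dgr (- 1) I0" "dgr 1 P0" "dgr 0 I1" "dgr 0 P1"
  using S T by (auto simp: I f0_def f1_def td_def vt_def intro!: dgr_slI dgr_slP)
 have di: "dia I0 = I0" "dia P0 = P0" "dia I1 = I1" "dia P1 = P1"
  using S T by (auto simp: I f0_def f1_def vt_def intro!: dia_slI dia_slP)
 have xd: "dgr 0 x" "dia x = x" "dgr 1 d" "dgr 1 d'" "dia d = d" "dia d' = d'"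
  using x S T by (auto simp: Sc_def Sm_def sob_def d)
 define c where "c = I1 * (x * P0) + I1 * (d' * P1) - I0 * (d * P0)"
 define E where "E = I0 * P0 + I1 * P1"
 have c0: "c * c = 0" "E * E = E" "E * c = c" "c * E = c"
  by (simp_all add: c_def E_def ring_dist mult.assoc RX RX')
 have cd: "dgr 1 c" "dgr 0 E"
  using dgr_mult[OF gr(3) dgr_mult[OF xd(1) gr(2)]] dgr_mult[OF gr(3) dgr_mult[OF xd(4) gr(4)]]
   dgr_mult[OF gr(1) dgr_mult[OF xd(3) gr(2)]] dgr_mult[OF gr(1,2)] dgr_mult[OF gr(3,4)]
  by (auto simp: c_def E_def intro!: dgr_add dgr_diff)
 have cdia: "dia c = c" "dia E = E"
  by (simp_all add: c_def E_def dia_mult_left di xd)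
 \<comment> \<open>Acyclicity of the cone. Injectivity on cohomology makes the \<open>S\<close> part
   of a cycle a boundary; surjectivity then takes care of the corrected \<open>T\<close>
   part.\<close>
 have ex: "\<exists>w. z = c * w" if z: "E * z = z" "c * z = 0" for z
 proof -
  have "P0 * (c * z) = - (d * (P0 * z))" "P1 * (c * z) = x * (P0 * z) + d' * (P1 * z)"
   by (simp_all add: c_def ring_dist mult.assoc RX RX')
  then have h: "d * (P0 * z) = 0" "x * (P0 * z) = d' * (- (P1 * z))"
   using z(2) by (auto simp: add_eq_0_iff)
  have "e * (P0 * z) = P0 * z" "e' * (- (P1 * z)) = - (P1 * z)" by (simp_all add: RX')
  then obtain u' where u': "e * u' = u'" "P0 * z = d * u'"
   using q h unfolding qir_def d by metis
  have "e' * (P1 * z + x * u') = P1 * z + x * u'" by (simp add: ring_dist RX')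
  moreover have "d' * (P1 * z + x * u') = 0"
   using h(2) u'(2) by (simp add: ring_dist RX' mult.assoc)
  ultimately obtain u w' where u: "d * u = 0" "P1 * z + x * u' = x * u + d' * w'" "e * u = u" "e' * w' = w'"
   using q unfolding qir_def d by metis
  have "z = I0 * (P0 * z) + I1 * (P1 * z)" using z(1) by (simp add: E_def ring_dist mult.assoc)
  also have "P1 * z = x * u + d' * w' - x * u'" using u(2) by (simp add: algebra_simps)
  also have "I0 * (P0 * z) + I1 * (x * u + d' * w' - x * u') = c * (I0 * (u - u') + I1 * w')"
   using u u' by (simp add: c_def ring_dist mult.assoc RX RX')
  finally show ?thesis by blast
 qed
 obtain k0 where "E * k0 = k0" "k0 * E = k0" "c * k0 + k0 * c = E"
  using exact_contraction[OF c0 ex] by blast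
 then obtain k where k: "dgr (- 1) k" "dia k = k" "E * k = k" "k * E = k" "c * k + k * c = E"
  using diagonal_contraction[OF cd cdia] by blast
 define J0 Q0 J1 Q1 where J: "J0 = st I0" "Q0 = st P0" "J1 = st I1" "Q1 = st P1"
 define X where "X = st x"
 define a a' where a: "a = fst (oo S)" "a' = fst (oo T)"
 define D D' where D: "D = snd (oo S)" "D' = snd (oo T)"
 have R2: "Q0 * J0 = a" "Q1 * J1 = a'" "Q0 * J1 = 0" "Q1 * J0 = 0" "J0 * a = J0" "J1 * a' = J1" "a * Q0 = Q0" "a' * Q1 = Q1"
  by (rule wk_eqI; simp add: J a w_oo[OF S(1)] w_oo[OF T(1)] di R d(3,4)[symmetric])+
 have X2: "X * a = X" "a' * X = X" "a * D = D" "D * a = D" "a' * D' = D'" "D' * a' = D'" "D * D = 0" "D' * D' = 0" "D' * X = X * D"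
  "a * a = a" "a' * a' = a'"
  using Sc_Zc[OF S(1) T(1) x] ob_oo[OF S(1)] ob_oo[OF T(1)] by (auto simp: Zc_def Cm_def ob_def X_def a D)
 note RX2 = R2 X2 and RX2' = R2[THEN mult_assoc_eq] X2[THEN mult_assoc_eq]
 \<comment> \<open>The cone differential with arrows included. Its diagonal part is
   \<open>c\<close>, so \<open>k\<close> contracts it up to a strictly triangular error.\<close>
 define DZ where "DZ = J1 * (X * Q0) + J1 * (D' * Q1) - J0 * (D * Q0)"
 define EZ where "EZ = J0 * Q0 + J1 * Q1"
 define kz where "kz = st k"
 have wDZ: "dia (w1 DZ) = c"
  by (simp add: DZ_def J X_def D di xd c_def dia_mult_left dia_mult_right dia_oo S T d)
 have wEZ: "w1 EZ = E" "w2 EZ = E" by (simp_all add: EZ_def J di E_def)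
 have wk: "w1 kz = k" "w2 kz = k" by (simp_all add: kz_def k)
 have gJ: "dg (- 1) J0" "dg 1 Q0" "dg 0 J1" "dg 0 Q1" "dg 0 X" "dg 1 D" "dg 1 D'" "dg (- 1) kz"
  using gr xd k ob_oo[OF S(1)] ob_oo[OF T(1)] by (auto simp: J X_def D kz_def ob_def intro: dg_st)
 have "\<exists>K. dg (- 1) K \<and> EZ * K = K \<and> K * EZ = K \<and> DZ * K + K * DZ = EZ"
 proof (rule perturb[of DZ EZ kz])
  show "DZ * DZ = 0" "EZ * EZ = EZ" "EZ * DZ = DZ" "DZ * EZ = DZ"
   by (simp_all add: DZ_def EZ_def ring_dist mult.assoc RX2 RX2')
  show "EZ * kz = kz" "kz * EZ = kz" by (rule wk_eqI; simp add: wEZ wk k)+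
  show "dg 1 DZ"
   using dg_mult[OF gJ(3) dg_mult[OF gJ(5) gJ(2)]] dg_mult[OF gJ(3) dg_mult[OF gJ(7) gJ(4)]]
    dg_mult[OF gJ(1) dg_mult[OF gJ(6) gJ(2)]]
   by (auto simp: DZ_def intro!: dg_add dg_diff)
  show "dg 0 EZ" using cd by (simp add: dg_def wEZ)
  show "dg (- 1) kz" by (rule gJ)
  have "dia (w1 (DZ * kz + kz * DZ - EZ)) = c * k + k * c - E"
   by (simp add: wk wEZ dia_mult_left[OF k(2)] dia_mult_right[OF k(2)] wDZ cdia)
  then show "dia (w1 (DZ * kz + kz * DZ - EZ)) = 0" using k by simp
 qed
 then obtain K where K: "dg (- 1) K" "EZ * K = K" "K * EZ = K" "DZ * K + K * DZ = EZ" by blast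
 have b: "Q0 * DZ = - (D * Q0)" "Q1 * DZ = X * Q0 + D' * Q1" "DZ * J1 = J1 * D'" "DZ * J0 = J1 * X - J0 * D"
  by (simp_all add: DZ_def ring_dist mult.assoc RX2 RX2')
 \<comment> \<open>The block of \<open>K\<close> from \<open>T\<close> to \<open>S\<close> is the
   inverse, and its two diagonal blocks are the homotopies; the equations follow by sandwiching the
   contraction identity.\<close>
 define t h h' where t: "t = Q0 * K * J1" and h: "h = Q0 * K * J0" and h': "h' = Q1 * K * J1"
 have Ke: "Q * (DZ * K + K * DZ) * J' = Q * EZ * J'" for Q J' using K(4) by simp
 have e1: "- (D * t) + t * D' = 0"
 proof -
  have "Q0 * (DZ * K + K * DZ) * J1 = (Q0 * DZ) * K * J1 + Q0 * K * (DZ * J1)" by (simp add: ring_dist mult.assoc)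
  also have "\<dots> = - (D * t) + t * D'" by (simp add: b t mult.assoc)
  also have "Q0 * (DZ * K + K * DZ) * J1 = 0" unfolding Ke by (simp add: EZ_def ring_dist mult.assoc RX2 RX2')
  finally show ?thesis by simp
 qed
 have e2: "t * X - a = D * h + h * D"
 proof -
  have "Q0 * (DZ * K + K * DZ) * J0 = (Q0 * DZ) * K * J0 + Q0 * K * (DZ * J0)" by (simp add: ring_dist mult.assoc)
  also have "\<dots> = - (D * h) + (t * X - h * D)" by (simp add: b t h ring_dist mult.assoc)
  also have "Q0 * (DZ * K + K * DZ) * J0 = a" unfolding Ke by (simp add: EZ_def ring_dist mult.assoc RX2 RX2')
  finally show ?thesis by (simp add: algebra_simps)
 qed
 have e3: "X * t - a' = - (D' * h' + h' * D')"
 proof -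
  have "Q1 * (DZ * K + K * DZ) * J1 = (Q1 * DZ) * K * J1 + Q1 * K * (DZ * J1)" by (simp add: ring_dist mult.assoc)
  also have "\<dots> = X * t + D' * h' + h' * D'" by (simp add: b t h' ring_dist mult.assoc)
  also have "Q1 * (DZ * K + K * DZ) * J1 = a'" unfolding Ke by (simp add: EZ_def ring_dist mult.assoc RX2 RX2')
  finally show ?thesis by (simp add: algebra_simps)
 qed
 have ct: "Cm 0 (oo T) (oo S) t" "Cm (- 1) (oo S) (oo S) h" "Cm (- 1) (oo T) (oo T) h'"
  using dg_mult[OF dg_mult[OF gJ(2) K(1)] gJ(3)] dg_mult[OF dg_mult[OF gJ(2) K(1)] gJ(1)] dg_mult[OF dg_mult[OF gJ(4) K(1)] gJ(3)]
  unfolding Cm_def t h h' a[symmetric] by (simp_all add: mult.assoc RX2 RX2')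
 have "Zc 0 (oo T) (oo S) t" using ct(1) e1 by (simp add: Zc_def D[symmetric])
 moreover have "hq 0 (oo S) (oo S) (t * X) a"
  unfolding hq_def Nl_def using ct(2) e2 by (intro exI[of _ h]) (simp add: D[symmetric])
 moreover have "hq 0 (oo T) (oo T) (X * t) a'"
  unfolding hq_def Nl_def using Cm_uminus[OF ct(3)] e3 by (intro exI[of _ "- h'"]) (simp add: D[symmetric])
 ultimately show ?thesis by (auto simp: X_def a)
qed

text \<open>A weakly invertible strict morphism is a quasi-isomorphism, as its diagonal part is a homotopy
 equivalence of complexes of vector spaces.\<close>

lemma weak_inverse_qir:
 assumes S: "sob S" and T: "sob T" and x: "Sc 0 S T x"
  and j: "sd S * j = j * sd T" "dia j = j" "se S * j = j"
  and k: "x * j - se T = sd T * k + k * sd T" "se T * k = k"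
  and l: "j * x - se S = sd S * l + l * sd S" "se S * l = l"
 shows "qir S T x"
 unfolding qir_def
proof (intro conjI allI impI)
 have X: "sd T * x = x * sd S" using x by (simp add: Sc_def)
 fix u w assume u: "se S * u = u" "sd S * u = 0" "se T * w = w" "x * u = sd T * w"
 have "j * (x * u) - u = sd S * (l * u)"
  using arg_cong[OF l(1), of "\<lambda>y. y * u"] u(1,2) by (simp add: ring_dist mult.assoc)
 then have "u = sd S * (j * w - l * u)"
  using mult_assoc_eq[OF j(1), of w] by (simp add: u(4) ring_dist mult.assoc algebra_simps)
 moreover have "se S * (j * w - l * u) = j * w - l * u"
  using mult_assoc_eq[OF j(3), of w] mult_assoc_eq[OF l(2), of u] by (simp add: ring_dist)
 ultimately show "\<exists>u'. se S * u' = u' \<and> u = sd S * u'" by blast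
next
 fix w assume w: "se T * w = w" "sd T * w = 0"
 have "x * (j * w) - w = sd T * (k * w)"
  using arg_cong[OF k(1), of "\<lambda>y. y * w"] w by (simp add: ring_dist mult.assoc)
 then have "w = x * (j * w) + sd T * (- (k * w))" by (simp add: algebra_simps)
 moreover have "sd S * (j * w) = 0" "se S * (j * w) = j * w" "se T * (- (k * w)) = - (k * w)"
  using mult_assoc_eq[OF j(1), of w] mult_assoc_eq[OF j(3), of w] mult_assoc_eq[OF k(2), of w] w by (simp_all add: mult.assoc)
 ultimately show "\<exists>u w'. se S * u = u \<and> sd S * u = 0 \<and> se T * w' = w' \<and> w = x * u + sd T * w'" by blast
qed

lemma weak_inverse_qir':
 assumes S: "sob S" and T: "sob T" and x: "Sc 0 S T x" and t: "Zc 0 (oo T) (oo S) t"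
  and 1: "hq 0 (oo S) (oo S) (t * st x) (fst (oo S))" and 2: "hq 0 (oo T) (oo T) (st x * t) (fst (oo T))"
 shows "qir S T x"
proof -
 have dx: "dia x = x" using x by (simp add: Sc_def Sm_def)
 have dd: "dia (sd S) = sd S" "dia (sd T) = sd T" "dia (se S) = se S" "dia (se T) = se T"
  using S T by (auto simp: sob_def)
 obtain l where l: "Cm (- 1) (oo S) (oo S) l" "t * st x - fst (oo S) = snd (oo S) * l + l * snd (oo S)"
  using 1 by (auto simp: hq_def Nl_def)
 obtain k where k: "Cm (- 1) (oo T) (oo T) k" "st x * t - fst (oo T) = snd (oo T) * k + k * snd (oo T)"
  using 2 by (auto simp: hq_def Nl_def)
 have u1: "dia (w1 (snd (oo S)) * w1 y) = sd S * dia (w1 y)" "dia (w1 y * w1 (snd (oo S))) = dia (w1 y) * sd S" for y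
  using dia_oo[OF S] by (simp_all add: dia_mult)
 have u2: "dia (w1 (snd (oo T)) * w1 y) = sd T * dia (w1 y)" "dia (w1 y * w1 (snd (oo T))) = dia (w1 y) * sd T" for y
  using dia_oo[OF T] by (simp_all add: dia_mult)
 show ?thesis
 proof (rule weak_inverse_qir[OF S T x, of "dia (w1 t)" "dia (w1 k)" "dia (w1 l)"])
  have "snd (oo S) * t = t * snd (oo T)" using t by (simp add: Zc_def)
  from arg_cong[OF this, of "\<lambda>y. dia (w1 y)"] show "sd S * dia (w1 t) = dia (w1 t) * sd T"
   by (simp add: u1 u2)
  show "x * dia (w1 t) - se T = sd T * dia (w1 k) + dia (w1 k) * sd T"
   using arg_cong[OF k(2), of "\<lambda>y. dia (w1 y)"] dia_mult_left[OF dx] by (simp add: u2 w_oo(1)[OF T] dd dx)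
  show "dia (w1 t) * x - se S = sd S * dia (w1 l) + dia (w1 l) * sd S"
   using arg_cong[OF l(2), of "\<lambda>y. dia (w1 y)"] dia_mult_right[OF dx] by (simp add: u1 w_oo(1)[OF S] dd dx)
  have "fst (oo S) * t = t" using t by (simp add: Zc_def Cm_def)
  from arg_cong[OF this, of "\<lambda>y. dia (w1 y)"] show "se S * dia (w1 t) = dia (w1 t)"
   using dia_mult_left[OF dd(3)] by (simp add: w_oo(1)[OF S])
  have "fst (oo S) * l = l" using l by (simp add: Cm_def)
  from arg_cong[OF this, of "\<lambda>y. dia (w1 y)"] show "se S * dia (w1 l) = dia (w1 l)"
   using dia_mult_left[OF dd(3)] by (simp add: w_oo(1)[OF S])
  have "fst (oo T) * k = k" using k by (simp add: Cm_def)
  from arg_cong[OF this, of "\<lambda>y. dia (w1 y)"] show "se T * dia (w1 k) = dia (w1 k)"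
   using dia_mult_left[OF dd(4)] by (simp add: w_oo(1)[OF T])
 qed simp
qed

section \<open>A resolution through which weak morphisms factor uniquely as strict ones\<close>

section \<open>The bar resolution\<close>

declare One_nat_def [simp del]

definition rw :: "vtx \<Rightarrow> 'k::field bm \<Rightarrow> 'k bm" where
 "rw k = pick (\<lambda>i j. vt i = k)"

lemma ent_rw [simp]: "ent (rw k x) i j = (if vt i = k then ent x i j else 0)"
 by (simp add: rw_def)

lemma rw_simps:
 "rw k (x + y) = rw k x + rw k y" "rw k (x - y) = rw k x - rw k y" "rw k (- x) = - rw k x" "rw k 0 = 0"
 "rw k (sg p x) = sg p (rw k x)"
 by (auto simp: rw_def pick_simps sg_def)

lemma rw_rw: "rw k (rw l x) = (if k = l then rw k x else 0)"
 by (rule fm_eqI) auto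

lemma rw_mult: "rw k (x * y) = rw k x * y"
proof (rule fm_eqI)
 fix i j
 have "ent (rw k x * y) i j = (\<Sum>l\<in>fsupp x \<union> fsupp y. ent (rw k x) i l * ent y l j)"
  by (rule ent_times_sup) (auto simp: ent_fsupp)
 then show "ent (rw k (x * y)) i j = ent (rw k x * y) i j"
  by (auto simp: ent_times)
qed

lemma rw_shift:
 assumes "!!i l. ent x i l \<noteq> 0 ==> vt i = k \<longleftrightarrow> vt l = m"
 shows "rw k (x * y) = x * rw m y"
proof (rule fm_eqI)
 fix i j
 have e: "ent (x * rw m y) i j = (\<Sum>l\<in>fsupp x \<union> fsupp y. ent x i l * ent (rw m y) l j)"
  by (rule ent_times_sup) (auto simp: ent_fsupp)
 have "(if vt i = k then ent x i l * ent y l j else 0) = ent x i l * ent (rw m y) l j" for l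
  using assms[of i l] by (cases "ent x i l = 0") auto
 then have "(\<Sum>l\<in>fsupp x \<union> fsupp y. if vt i = k then ent x i l * ent y l j else 0) = ent (x * rw m y) i j"
  unfolding e by (intro sum.cong) auto
 then show "ent (rw k (x * y)) i j = ent (x * rw m y) i j"
  by (cases "vt i = k") (auto simp: ent_times)
qed

lemma rw_dia: "dia x = x ==> rw k (x * y) = x * rw k y"
 by (rule rw_shift) (metis ent_dia)

lemma vst_step: "vst x ==> ent x i l \<noteq> 0 ==> (vt i = V2 \<and> vt l = V1) \<or> (vt i = V3 \<and> vt l = V2)"
proof -
 assume "vst x" "ent x i l \<noteq> 0"
 then have "vn (vt i) = vn (vt l) + 1" by (simp add: vst_def)
 then show ?thesis by (cases "vt i"; cases "vt l") auto
qed

lemma rw_vst: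
 assumes "vst x"
 shows "rw V1 (x * y) = 0" "rw V2 (x * y) = x * rw V1 y" "rw V3 (x * y) = x * rw V2 y" "x * rw V3 y = 0"
proof -
 have "rw V1 x = 0"
  by (rule fm_eqI) (use vst_step[OF assms] in fastforce)
 then show "rw V1 (x * y) = 0" by (simp add: rw_mult)
 show "rw V2 (x * y) = x * rw V1 y" "rw V3 (x * y) = x * rw V2 y"
  by (rule rw_shift, use vst_step[OF assms] in fastforce)+
 show "x * rw V3 y = 0"
 proof (rule fm_eqI, rule ccontr)
  fix i j assume "ent (x * rw V3 y) i j \<noteq> ent 0 i j"
  then obtain l where "ent x i l \<noteq> 0" "ent (rw V3 y) l j \<noteq> 0"
   using ent_times_nonzero by (metis ent_zero)
  then show False using vst_step[OF assms, of i l] by (auto split: if_splits)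
 qed
qed

lemma rw_sum: "rw V1 x + rw V2 x + rw V3 x = x"
proof (rule fm_eqI)
 fix i j show "ent (rw V1 x + rw V2 x + rw V3 x) i j = ent x i j" by (cases "vt i") auto
qed

lemma slI_slP:
 assumes "finite S" "inj_on f S"
 shows "slI f S * slP f S = (pr (f ` S) :: ('i, 'k::field) fm)"
proof (rule fm_eqI)
 fix a b
 show "ent (slI f S * slP f S) a b = ent (pr (f ` S) :: ('i, 'k) fm) a b"
 proof (cases "a \<in> f ` S")
  case True
  then obtain s where s: "s \<in> S" "a = f s" by blast
  then show ?thesis using assms
   by (subst ent_times_sup[of "{s}"]) (auto simp: ent_slI ent_slP dest: inj_onD)
 next
  case False
  then show ?thesis using assms(1)
   by (subst ent_times_sup[of "{}"]) (auto simp: ent_slI)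
 qed
qed

lemma all19: "Q 0 ==> Q 1 ==> Q 2 ==> Q 3 ==> Q 4 ==> Q 5 ==> Q 6 ==> Q 7 ==> Q 8 ==> Q 9 ==> Q 10 ==> Q 11 ==> Q 12 ==> Q 13 ==> Q 14 ==> Q 15 ==> Q 16 ==> Q 17 ==> Q 18 ==> c < (19::nat) ==> Q c"
proof -
 assume q: "Q 0" "Q 1" "Q 2" "Q 3" "Q 4" "Q 5" "Q 6" "Q 7" "Q 8" "Q 9" "Q 10" "Q 11" "Q 12" "Q 13" "Q 14" "Q 15" "Q 16" "Q 17" "Q 18"
 assume "c < (19::nat)"
 then have "c = 0 \<or> c = 1 \<or> c = 2 \<or> c = 3 \<or> c = 4 \<or> c = 5 \<or> c = 6 \<or> c = 7 \<or> c = 8 \<or> c = 9 \<or> c = 10 \<or> c = 11 \<or> c = 12 \<or> c = 13 \<or> c = 14 \<or> c = 15 \<or> c = 16 \<or> c = 17 \<or> c = 18" by presburger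
 then show "Q c" using q by (elim disjE) simp_all
qed

text \<open>Slot \<open>c\<close> of the bar resolution is a copy of the vector space at vertex \<open>sv c\<close>, placed at
 vertex \<open>tv c\<close>, with total degree raised by \<open>sh c\<close>. Slots 0, 1, 6 are the generators, slots
 4, 5, 15, 16 and 17, 18 the generators attached to arrows and to relations; the remaining slots
 are the images of these under the arrows.\<close>

definition sv :: "nat \<Rightarrow> vtx" where
 "sv c = (if c = 1 \<or> c = 7 \<or> c = 8 \<or> c = 15 \<or> c = 16 then V2 else if c = 6 then V3 else V1)"
definition tv :: "nat \<Rightarrow> vtx" where
 "tv c = (if c = 0 then V1 else if c < 6 then V2 else V3)"
definition sh :: "nat \<Rightarrow> int" where
 "sh c = (if c = 9 \<or> c = 10 then 2 else if c = 2 \<or> c = 3 \<or> c = 7 \<or> c = 8 \<or> c = 11 \<or> c = 12 \<or> c = 13 \<or> c = 14 then 1 else 0)"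
text \<open>Positions are congruent to the slot number modulo 19, which keeps the slots disjoint.
  The complex degree is chosen so that the total degree becomes \<open>td b + sh c\<close>.\<close>

definition kap :: "nat \<Rightarrow> idx \<Rightarrow> idx" where
 "kap c b = ((td b + sh c - vn (tv c), tv c), 19 * snd b + c)"

locale bar =
 fixes S :: "'k::field so" and U :: "idx set"
 assumes S: "sob S" and U: "se S = pr U" "finite U"
begin

definition ev :: "vtx \<Rightarrow> 'k bm" where "ev k = rw k (se S)"
definition d :: "vtx \<Rightarrow> 'k bm" where "d k = sd S * ev k"
definition ar :: "bool \<Rightarrow> 'k bm" where "ar c = (if c then sA S else sB S)"
definition X :: "bool \<Rightarrow> 'k bm" where "X c = ar c * ev V1"
definition Y :: "bool \<Rightarrow> 'k bm" where "Y c = ar c * ev V2"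
definition Uv :: "vtx \<Rightarrow> idx set" where "Uv k = {i \<in> U. vt i = k}"
definition I :: "nat \<Rightarrow> 'k bm" where "I c = slI (kap c) (Uv (sv c))"
definition P :: "nat \<Rightarrow> 'k bm" where "P c = slP (kap c) (Uv (sv c))"

lemma Sx: "sd S * se S = sd S" "se S * sd S = sd S" "sd S * sd S = 0" "dia (sd S) = sd S" "dia (se S) = se S" "se S * se S = se S"
 "dgr 0 (se S)" "dgr 1 (sd S)"
 using S by (auto simp: sob_def)

lemma arx: "ar c * se S = ar c" "se S * ar c = ar c" "vst (ar c)" "ar c * ar c = 0" "sd S * ar c = - (ar c * sd S)" "dgr 1 (ar c)"
 using S by (auto simp: sob_def ar_def)

lemma finite_Uv: "finite (Uv k)"
 using U by (simp add: Uv_def)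

lemma ev_pr: "ev k = pr (Uv k)"
 by (rule fm_eqI) (auto simp: ev_def U ent_pr finite_Uv, auto simp: Uv_def)

lemma ev_left: "ev k * x = rw k (se S * x)"
 by (simp add: ev_def rw_mult)

lemma rw_ev: "rw k (ev l) = (if k = l then ev k else 0)"
 by (simp add: ev_def rw_rw)

lemma ev_se: "se S * ev k = ev k" "ev k * se S = ev k"
proof -
 show "se S * ev k = ev k" unfolding ev_def rw_dia[OF Sx(5), symmetric] Sx ..
 show "ev k * se S = ev k" unfolding ev_left Sx by (simp add: ev_def)
qed

lemma ev_ev: "ev k * ev l = (if k = l then ev k else 0)"
 unfolding ev_left ev_se rw_ev ..

lemma ev_sum: "ev V1 + ev V2 + ev V3 = se S"
 by (simp add: ev_def rw_sum)

lemma ev_d: "ev k * d l = (if k = l then d k else 0)" "d k * ev l = (if k = l then d k else 0)" "d k * d l = 0"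
proof -
 show 1: "ev k * d l = (if k = l then d k else 0)" for k l
 proof -
  have "ev k * d l = rw k (sd S * ev l)" by (simp add: ev_left d_def Sx(2)[THEN mult_assoc_eq])
  then show ?thesis by (simp add: rw_dia[OF Sx(4)] rw_ev d_def)
 qed
 show "d k * ev l = (if k = l then d k else 0)" by (simp add: d_def mult.assoc ev_ev)
 have "d k * d l = sd S * (ev k * d l)" by (simp add: d_def mult.assoc)
 then show "d k * d l = 0" unfolding 1 by (simp add: d_def Sx flip: mult.assoc)
qed

lemma ev_X: "ev k * X c = (if k = V2 then X c else 0)" "X c * ev k = (if k = V1 then X c else 0)"
proof -
 have "ev k * X c = rw k (ar c * ev V1)" by (simp add: ev_left X_def arx(2)[THEN mult_assoc_eq])
 then show "ev k * X c = (if k = V2 then X c else 0)"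
  by (cases k) (simp_all add: rw_vst[OF arx(3)] rw_ev X_def)
 show "X c * ev k = (if k = V1 then X c else 0)" by (simp add: X_def mult.assoc ev_ev)
qed

lemma ev_Y: "ev k * Y c = (if k = V3 then Y c else 0)" "Y c * ev k = (if k = V2 then Y c else 0)"
proof -
 have "ev k * Y c = rw k (ar c * ev V2)" by (simp add: ev_left Y_def arx(2)[THEN mult_assoc_eq])
 then show "ev k * Y c = (if k = V3 then Y c else 0)"
  by (cases k) (simp_all add: rw_vst[OF arx(3)] rw_ev Y_def)
 show "Y c * ev k = (if k = V2 then Y c else 0)" by (simp add: Y_def mult.assoc ev_ev)
qed

lemma XX: "Y c * X c = 0" "d V2 * X c = - (X c * d V1)" "d V3 * Y c = - (Y c * d V2)"
proof -
 have "Y c * X c = ar c * (ev V2 * X c)" by (simp add: Y_def mult.assoc)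
 then show "Y c * X c = 0" unfolding ev_X by (simp add: X_def arx flip: mult.assoc)
 have "d V2 * X c = sd S * (ev V2 * X c)" by (simp add: d_def mult.assoc)
 also have "\<dots> = sd S * ar c * ev V1" unfolding ev_X by (simp add: X_def mult.assoc)
 also have "\<dots> = - (ar c * d V1)" by (simp add: arx d_def mult.assoc)
 also have "ar c * d V1 = X c * d V1" using ev_d(1)[of V1 V1] by (simp add: X_def mult.assoc)
 finally show "d V2 * X c = - (X c * d V1)" .
 have "d V3 * Y c = sd S * (ev V3 * Y c)" by (simp add: d_def mult.assoc)
 also have "\<dots> = sd S * ar c * ev V2" unfolding ev_Y by (simp add: Y_def mult.assoc)
 also have "\<dots> = - (ar c * d V2)" by (simp add: arx d_def mult.assoc)
 also have "ar c * d V2 = Y c * d V2" using ev_d(1)[of V2 V2] by (simp add: Y_def mult.assoc)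
 finally show "d V3 * Y c = - (Y c * d V2)" .
qed

lemma kap_inj: "inj_on (kap c) (Uv k)"
proof (rule inj_onI)
 fix x y assume "x \<in> Uv k" "y \<in> Uv k" "kap c x = kap c y"
 then show "x = y" by (auto simp: Uv_def kap_def td_def vt_def prod_eq_iff)
qed

lemma kap_disjoint: "b < 19 ==> c < 19 ==> b \<noteq> c ==> kap b ` A \<inter> kap c ` B = {}"
 by (auto simp: kap_def, presburger+)

lemma PI: "b < 19 ==> c < 19 ==> P b * I c = (if b = c then ev (sv b) else 0)"
 by (simp add: P_def I_def slP_slI finite_Uv kap_inj slP_slI_disjoint kap_disjoint ev_pr)

lemma I_ev: "I c * ev k = (if sv c = k then I c else 0)"
proof -
 have "I c * ev k = I c * (ev (sv c) * ev k)"
  by (simp add: I_def ev_pr slI_pr finite_Uv flip: mult.assoc)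
 then show ?thesis unfolding ev_ev by (auto simp: I_def ev_pr slI_pr finite_Uv)
qed

lemma ev_P: "ev k * P c = (if sv c = k then P c else 0)"
proof -
 have "ev k * P c = (ev k * ev (sv c)) * P c"
  by (simp add: P_def ev_pr pr_slP finite_Uv mult.assoc)
 then show ?thesis unfolding ev_ev by (auto simp: P_def ev_pr pr_slP finite_Uv)
qed

lemma dgr_I: "dgr (sh c) (I c)" and dgr_P: "dgr (- sh c) (P c)"
 by (auto simp: I_def P_def kap_def finite_Uv intro!: dgr_slI dgr_slP)

lemma rw_I: "rw k (I c) = (if tv c = k then I c else 0)"
 by (rule fm_eqI) (auto simp: I_def ent_slI finite_Uv kap_def)

lemma P_col: "ent (P c) l j \<noteq> 0 ==> vt j = tv c"
 by (simp add: P_def ent_slP finite_Uv kap_def split: if_splits)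

lemma dia_P: "dia (y * P c) = rw (tv c) y * P c"
proof -
 have "vt j = tv c" if "ent (y * P c) i j \<noteq> 0" for i j
  using ent_times_nonzero[OF that] P_col by blast
 then have "ent (dia (y * P c)) i j = ent (rw (tv c) (y * P c)) i j" for i j
  by (cases "ent (y * P c) i j = 0") auto
 then have "dia (y * P c) = rw (tv c) (y * P c)" by (rule fm_eqI)
 then show ?thesis by (simp add: rw_mult)
qed

lemma vst_P: "(!!i j. ent y i j \<noteq> 0 ==> vn (vt i) = vn (tv c) + 1) ==> vst (y * P c)"
 unfolding vst_def
proof (intro allI impI)
 fix i j assume a: "!!i j. ent y i j \<noteq> 0 ==> vn (vt i) = vn (tv c) + 1" "ent (y * P c) i j \<noteq> 0"
 obtain l where l: "ent y i l \<noteq> 0" "ent (P c) l j \<noteq> 0" using ent_times_nonzero[OF a(2)] by blast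
 show "vn (vt i) = vn (vt j) + 1"
  using a(1)[OF l(1)] P_col[OF l(2)] by simp
qed

definition eB :: "'k bm" where "eB = (\<Sum>c<19. I c * P c)"
text \<open>Each slot carries the internal differential with the sign of its shift. A generator
  attached to an arrow also maps to the difference of acting on the vector and acting on the
  generator, as in \<open>I 1 * X True\<close> against \<open>I 2\<close> for slot 4; slots 17 and
  18 repeat this one step further. The remaining terms are forced by anticommutation with
  \<open>AB\<close>.\<close>

definition dB :: "'k bm" where "dB = (I 0 * (d V1 * P 0))
  + (I 1 * (d V2 * P 1))
  + (- (I 2 * (d V1 * P 2)))
  + (- (I 3 * (d V1 * P 3)))
  + (I 4 * (d V1 * P 4) + I 1 * (X True * P 4) - I 2 * P 4)
  + (I 5 * (d V1 * P 5) + I 1 * (X False * P 5) - I 3 * P 5)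
  + (I 6 * (d V3 * P 6))
  + (- (I 7 * (d V2 * P 7)))
  + (- (I 8 * (d V2 * P 8)))
  + (I 9 * (d V1 * P 9))
  + (I 10 * (d V1 * P 10))
  + (- (I 11 * (d V1 * P 11)) - I 7 * (X True * P 11))
  + (- (I 12 * (d V1 * P 12)) - I 8 * (X True * P 12) + I 9 * P 12)
  + (- (I 13 * (d V1 * P 13)) - I 7 * (X False * P 13) + I 10 * P 13)
  + (- (I 14 * (d V1 * P 14)) - I 8 * (X False * P 14))
  + (I 15 * (d V2 * P 15) + I 6 * (Y True * P 15) - I 7 * P 15)
  + (I 16 * (d V2 * P 16) + I 6 * (Y False * P 16) - I 8 * P 16)
  + (I 17 * (d V1 * P 17) + I 15 * (X True * P 17) - I 11 * P 17)
  + (I 18 * (d V1 * P 18) + I 16 * (X False * P 18) - I 14 * P 18)"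
text \<open>Slots 9 and 10 are the images of slot 0 under the two nonzero paths of length two. The
  arrow images of slots 4 and 5, already at \<open>V3\<close>, are slots 11 to 14.\<close>

definition AB :: "bool \<Rightarrow> 'k bm" where
 "AB t = (if t then I 2 * P 0 + I 7 * P 1 + I 10 * P 3 + I 11 * P 4 + I 13 * P 5 else I 3 * P 0 + I 8 * P 1 + I 9 * P 2 + I 12 * P 4 + I 14 * P 5)"
text \<open>A homotopy that retracts the resolution onto the generator slots 0, 1 and 6: up to sign,
  an arrow image goes back to the generator of that arrow or relation. On slots 9 and 10 the second
  terms cancel the parts in slots 8 and 7 of the boundary of the first.\<close>

definition kB :: "'k bm" where "kB = (- I 5 * P 3)
  + (- I 4 * P 2)
  + (- I 15 * P 7)
  + (- I 16 * P 8)
  + (- I 18 * P 14)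
  + (- I 17 * P 11)
  + (I 12 * P 9 - I 16 * (X True * P 9))
  + (I 13 * P 10 - I 15 * (X False * P 10))"

lemmas rules = ev_ev ev_d ev_X ev_Y XX PI I_ev ev_P
lemmas rules' = rules[THEN mult_assoc_eq]

lemma dI: "dB * I 0 = I 0 * d V1"
  "dB * I 1 = I 1 * d V2" "dB * I 2 = - (I 2 * d V1)" "dB * I 3 = - (I 3 * d V1)"
  "dB * I 4 = I 4 * d V1 + I 1 * X True - I 2" "dB * I 5 = I 5 * d V1 + I 1 * X False - I 3" "dB * I 6 = I 6 * d V3"
  "dB * I 7 = - (I 7 * d V2)" "dB * I 8 = - (I 8 * d V2)" "dB * I 9 = I 9 * d V1" "dB * I 10 = I 10 * d V1"
  "dB * I 11 = - (I 11 * d V1) - I 7 * X True" "dB * I 12 = - (I 12 * d V1) - I 8 * X True + I 9"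
  "dB * I 13 = - (I 13 * d V1) - I 7 * X False + I 10" "dB * I 14 = - (I 14 * d V1) - I 8 * X False"
  "dB * I 15 = I 15 * d V2 + I 6 * Y True - I 7" "dB * I 16 = I 16 * d V2 + I 6 * Y False - I 8"
  "dB * I 17 = I 17 * d V1 + I 15 * X True - I 11" "dB * I 18 = I 18 * d V1 + I 16 * X False - I 14"
 by (simp_all add: dB_def ring_dist mult.assoc rules sv_def)

lemma aI: "AB True * I 0 = I 2"
  "AB True * I 1 = I 7" "AB True * I 2 = 0" "AB True * I 3 = I 10" "AB True * I 4 = I 11" "AB True * I 5 = I 13"
  "AB True * I 6 = 0" "AB True * I 7 = 0" "AB True * I 8 = 0" "AB True * I 9 = 0" "AB True * I 10 = 0" "AB True * I 11 = 0"
  "AB True * I 12 = 0" "AB True * I 13 = 0" "AB True * I 14 = 0" "AB True * I 15 = 0" "AB True * I 16 = 0"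
  "AB True * I 17 = 0" "AB True * I 18 = 0"
 by (simp_all add: AB_def ring_dist mult.assoc rules sv_def)

lemma bI: "AB False * I 0 = I 3"
  "AB False * I 1 = I 8" "AB False * I 2 = I 9" "AB False * I 3 = 0" "AB False * I 4 = I 12" "AB False * I 5 = I 14"
  "AB False * I 6 = 0" "AB False * I 7 = 0" "AB False * I 8 = 0" "AB False * I 9 = 0" "AB False * I 10 = 0"
  "AB False * I 11 = 0" "AB False * I 12 = 0" "AB False * I 13 = 0" "AB False * I 14 = 0" "AB False * I 15 = 0"
  "AB False * I 16 = 0" "AB False * I 17 = 0" "AB False * I 18 = 0"
 by (simp_all add: AB_def ring_dist mult.assoc rules sv_def)

lemma kI: "kB * I 0 = 0"
  "kB * I 1 = 0" "kB * I 2 = - I 4" "kB * I 3 = - I 5" "kB * I 4 = 0" "kB * I 5 = 0" "kB * I 6 = 0" "kB * I 7 = - I 15"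
  "kB * I 8 = - I 16" "kB * I 9 = I 12 - I 16 * X True" "kB * I 10 = I 13 - I 15 * X False" "kB * I 11 = - I 17"
  "kB * I 12 = 0" "kB * I 13 = 0" "kB * I 14 = - I 18" "kB * I 15 = 0" "kB * I 16 = 0" "kB * I 17 = 0" "kB * I 18 = 0"
 by (simp_all add: kB_def ring_dist mult.assoc rules sv_def)

lemmas cI = dI aI bI kI
lemmas cI' = cI[THEN mult_assoc_eq]

lemma eB_I: "c < 19 ==> eB * I c = I c"
proof -
 assume c: "c < 19"
 have "eB * I c = (\<Sum>b<19. I b * (P b * I c))" by (simp add: eB_def sum_distrib_right mult.assoc)
 also have "\<dots> = (\<Sum>b<19. if b = c then I c else 0)"
  by (rule sum.cong) (use c in \<open>auto simp: PI I_ev\<close>)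
 also have "\<dots> = I c" using c by simp
 finally show ?thesis .
qed

lemma P_eB: "c < 19 ==> P c * eB = P c"
proof -
 assume c: "c < 19"
 have "P c * eB = (\<Sum>b<19. (P c * I b) * P b)" by (simp add: eB_def sum_distrib_left mult.assoc)
 also have "\<dots> = (\<Sum>b<19. if b = c then P c else 0)"
  by (rule sum.cong) (use c in \<open>auto simp: PI ev_P\<close>)
 also have "\<dots> = P c" using c by simp
 finally show ?thesis .
qed

lemma cols:
 assumes "x * eB = x" "y * eB = y" "!!c. c < 19 ==> x * I c = y * I c"
 shows "x = y"
proof -
 have "x = (\<Sum>c<19. x * I c * P c)" using assms(1) by (simp add: eB_def sum_distrib_left mult.assoc)
 also have "\<dots> = (\<Sum>c<19. y * I c * P c)" using assms(3) by simp
 also have "\<dots> = y" using assms(2) by (simp add: eB_def sum_distrib_left mult.assoc)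
 finally show ?thesis .
qed

lemma eB_right: "dB * eB = dB" "AB t * eB = AB t" "kB * eB = kB" "eB * eB = eB"
proof -
 show "dB * eB = dB" by (simp add: dB_def ring_dist mult.assoc P_eB)
 show "AB t * eB = AB t" by (simp add: AB_def ring_dist mult.assoc P_eB)
 show "kB * eB = kB" by (simp add: kB_def ring_dist mult.assoc P_eB)
 show "eB * eB = eB" by (subst (2 3) eB_def) (simp add: sum_distrib_left eB_I flip: mult.assoc)
qed

lemma eB_left: "eB * dB = dB" "eB * AB t = AB t" "eB * kB = kB"
proof -
 show "eB * dB = dB" by (simp add: dB_def ring_dist eB_I eB_I[THEN mult_assoc_eq])
 show "eB * AB t = AB t" by (simp add: AB_def ring_dist eB_I eB_I[THEN mult_assoc_eq])
 show "eB * kB = kB" by (simp add: kB_def ring_dist eB_I eB_I[THEN mult_assoc_eq])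
qed

lemma dgr_d: "dgr 1 (d k)" "dgr 1 (X c)" "dgr 1 (Y c)" "dgr 0 (ev k)"
proof -
 show e: "dgr 0 (ev k)" for k using Sx dgr_pick by (simp add: ev_def rw_def)
 show "dgr 1 (d k)" "dgr 1 (X c)" "dgr 1 (Y c)"
  using dgr_mult[OF Sx(8) e] dgr_mult[OF arx(6) e] by (simp_all add: d_def X_def Y_def)
qed

lemma dgr_IyP: "dgr q y ==> r = sh b + q - sh c ==> dgr r (I b * (y * P c))"
 by (rule dgr_mult'[OF dgr_I dgr_mult[OF _ dgr_P]]) simp_all

lemma dgr_IP: "r = sh b - sh c ==> dgr r (I b * P c)"
 using dgr_mult[OF dgr_I dgr_P, of b c] by simp

lemma dgr_B: "dgr 1 dB" "dgr 1 (AB t)" "dgr (- 1) kB" "dgr 0 eB"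
proof -
 show "dgr 1 dB" unfolding dB_def
  by (intro dgr_add dgr_diff dgr_uminus[THEN iffD2] dgr_IyP[OF dgr_d(1)] dgr_IyP[OF dgr_d(2)] dgr_IyP[OF dgr_d(3)] dgr_IP)
   (simp_all add: sh_def)
 show "dgr 1 (AB t)" unfolding AB_def
  by (cases t; simp; intro dgr_add dgr_IP) (simp_all add: sh_def)
 show "dgr (- 1) kB" unfolding kB_def minus_mult_left[symmetric]
  by (intro dgr_add dgr_diff dgr_uminus[THEN iffD2] dgr_IyP[OF dgr_d(2)] dgr_IP)
   (simp_all add: sh_def)
 have "dgr 0 (\<Sum>c\<in>A. I c * P c)" for A
  by (induction A rule: infinite_finite_induct) (auto intro!: dgr_add dgr_IP)
 then show "dgr 0 eB" by (simp add: eB_def)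
qed

lemma dia_B: "dia dB = dB" "dia eB = eB"
proof -
 have i: "dia (I b * (y * P c)) = (if tv b = tv c then I b * (y * P c) else 0)" for b y c
  using dia_P[of "I b * y" c] by (simp add: rw_mult rw_I mult.assoc)
 have j: "dia (I b * P c) = (if tv b = tv c then I b * P c else 0)" for b c
  using dia_P[of "I b" c] by (simp add: rw_I)
 show "dia dB = dB" unfolding dB_def by (simp add: i j tv_def)
 have "dia (\<Sum>c\<in>A. I c * P c) = (\<Sum>c\<in>A. I c * P c)" for A
  by (induction A rule: infinite_finite_induct) (auto simp: j)
 then show "dia eB = eB" by (simp add: eB_def)
qed

lemma vst_add: "vst x ==> vst y ==> vst (x + y)"
 unfolding vst_def by (metis add.right_neutral ent_plus)

lemma vst_AB: "vst (AB t)"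
proof -
 have "vst (I b * P c)" if "vn (tv b) = vn (tv c) + 1" for b c
 proof (rule vst_P)
  fix i j assume "ent (I b) i j \<noteq> 0"
  then have "vt i = tv b" by (auto simp: I_def ent_slI[OF finite_Uv] kap_def simp del: split_paired_Ex split: if_splits)
  then show "vn (vt i) = vn (tv c) + 1" using that by simp
 qed
 then show ?thesis unfolding AB_def
  by (cases t; simp; intro vst_add) (simp_all add: tv_def)
qed

definition UB :: "idx set" where "UB = (\<Union>c<19. kap c ` Uv (sv c))"

lemma eB_pr: "eB = pr UB" and finite_UB: "finite UB"
proof -
 show f: "finite UB" by (simp add: UB_def finite_Uv)
 show "eB = pr UB"
 proof (rule fm_eqI)
  fix i j
  have "ent eB i j = (\<Sum>c<19. if i = j \<and> i \<in> kap c ` Uv (sv c) then 1 else 0)"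
   by (simp add: eB_def ent_sum I_def P_def slI_slP finite_Uv kap_inj)
  also have "\<dots> = (\<Sum>c<19. if c = snd i mod 19 then (if i = j \<and> i \<in> kap (snd i mod 19) ` Uv (sv (snd i mod 19)) then 1 else 0) else 0)"
   by (rule sum.cong) (auto simp: kap_def)
  also have "\<dots> = (if i = j \<and> i \<in> kap (snd i mod 19) ` Uv (sv (snd i mod 19)) then 1 else 0)"
   by simp
  also have "i \<in> kap (snd i mod 19) ` Uv (sv (snd i mod 19)) \<longleftrightarrow> i \<in> UB"
  proof
   assume "i \<in> kap (snd i mod 19) ` Uv (sv (snd i mod 19))"
   moreover have "snd i mod 19 \<in> {..<19}" by simp
   ultimately show "i \<in> UB" unfolding UB_def by (rule UN_I[rotated])
  next
   assume "i \<in> UB"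
   then obtain c where c: "c < 19" "i \<in> kap c ` Uv (sv c)" by (auto simp: UB_def)
   then have "snd i mod 19 = c" by (auto simp: kap_def)
   then show "i \<in> kap (snd i mod 19) ` Uv (sv (snd i mod 19))" using c by simp
  qed
  finally show "ent eB i j = ent (pr UB) i j" by (simp add: f)
 qed
qed

definition BS :: "'k so" where "BS = \<lparr>se = eB, sd = dB, sA = AB True, sB = AB False\<rparr>"

lemma BS_sel [simp]: "se BS = eB" "sd BS = dB" "sA BS = AB True" "sB BS = AB False"
 by (simp_all add: BS_def)

lemma dB_sq: "dB * dB = 0"
proof (rule cols)
 show "dB * dB * I c = 0 * I c" if "c < 19" for c
  by (rule all19[OF _ _ _ _ _ _ _ _ _ _ _ _ _ _ _ _ _ _ _ that]; simp add: mult.assoc ring_dist cI cI' rules rules' sv_def)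
qed (simp_all add: mult.assoc eB_right)

lemma AB_sq: "AB t * AB t = 0"
proof (rule cols)
 show "AB t * AB t * I c = 0 * I c" if "c < 19" for c
  by (rule all19[OF _ _ _ _ _ _ _ _ _ _ _ _ _ _ _ _ _ _ _ that]; cases t; simp add: mult.assoc ring_dist cI cI' rules rules' sv_def)
qed (simp_all add: mult.assoc eB_right)

lemma dB_AB: "dB * AB t = - (AB t * dB)"
proof (rule cols)
 show "dB * AB t * I c = - (AB t * dB) * I c" if "c < 19" for c
  by (rule all19[OF _ _ _ _ _ _ _ _ _ _ _ _ _ _ _ _ _ _ _ that]; cases t; simp add: mult.assoc ring_dist cI cI' rules rules' sv_def)
qed (simp_all add: mult.assoc eB_right)

lemma sob_BS: "sob BS"
 using dgr_B dia_B vst_AB eB_right eB_left dB_sq AB_sq dB_AB by (auto simp: sob_def)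

text \<open>The universal weak morphism into the resolution. Besides the vertex generators, the
  first component collects the generators of the class {\<open>Beta1\<close>, \<open>Alpha2\<close>}
  and of its relation, and \<open>eta2\<close> those of the other class.\<close>

definition eta1 :: "'k bm" where "eta1 = I 0 + I 1 + I 6 + I 5 + I 16 + I 18"
definition eta2 :: "'k bm" where "eta2 = I 0 + I 1 + I 6 + I 4 + I 15 + I 17"
definition eta :: "'k wk" where "eta = wk eta1 eta2"

lemma ent_I: "ent (I c) i j = (if j \<in> Uv (sv c) \<and> i = kap c j then 1 else 0)"
 by (simp add: I_def ent_slI[OF finite_Uv])

lemma vt_kap [simp]: "vt (kap c j) = tv c"
 by (simp add: kap_def)

lemma vt_Uv: "j \<in> Uv k ==> vt j = k"
 by (simp add: Uv_def)

lemma dia_I: "dia (I c) = (if tv c = sv c then I c else 0)"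
proof (rule fm_eqI)
 fix i j show "ent (dia (I c)) i j = ent (if tv c = sv c then I c else 0) i j"
  using vt_Uv[of j "sv c"] by (auto simp: ent_I)
qed

lemma upr_I: "vn (sv c) \<le> vn (tv c) ==> upr (I c)"
 unfolding upr_def ent_I using vt_Uv by (metis vt_kap)

lemma w_eta: "w1 eta = eta1" "w2 eta = eta2"
proof -
 have "upr eta1" "upr eta2" unfolding eta1_def eta2_def
  by (intro upr_add upr_I; simp add: sv_def tv_def)+
 moreover have "dia eta1 = dia eta2" by (simp add: eta1_def eta2_def dia_I sv_def tv_def)
 ultimately show "w1 eta = eta1" "w2 eta = eta2" using w_wk by (auto simp: eta_def)
qed

lemma se_split: "x * se S = x * ev V1 + x * ev V2 + x * ev V3"
 by (simp add: ev_sum flip: distrib_left)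

lemma sd_split: "sd S = d V1 + d V2 + d V3"
 using se_split[of "sd S"] by (simp add: Sx d_def)

lemma ar_split: "ar c = X c + Y c"
proof -
 have "ar c * ev V3 = 0"
  using rw_vst(4)[OF arx(3), of c "se S"] by (simp add: ev_def)
 then show ?thesis using se_split[of "ar c"] by (simp add: arx X_def Y_def)
qed

lemma I_mult_0:
 assumes "ev k * y = y" "sv c \<noteq> k" shows "I c * y = 0"
proof -
 have "I c * y = (I c * ev k) * y" by (simp only: mult.assoc assms(1))
 also have "\<dots> = 0" using assms(2) by (simp only: I_ev if_False mult_zero_left)
 finally show ?thesis .
qed

lemma I_d:
 "sv c \<noteq> k ==> I c * d k = 0" "sv c \<noteq> V2 ==> I c * X t = 0" "sv c \<noteq> V3 ==> I c * Y t = 0"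
 by (rule I_mult_0[of k], simp_all add: ev_d, rule I_mult_0[of V2], simp_all add: ev_X, rule I_mult_0[of V3], simp_all add: ev_Y)

lemma Zc_eta: "Zc 0 (oo S) (oo BS) eta"
proof -
 have i0: "I c * d k = 0" if "sv c \<noteq> k" for c k using I_d(1) that by blast
 have i1: "I c * X t = 0" if "sv c \<noteq> V2" for c t using I_d(2) that by blast
 have i2: "I c * Y t = 0" if "sv c \<noteq> V3" for c t using I_d(3) that by blast
 have ie: "I c * se S = I c" for c
  using se_split[of "I c"] by (cases "sv c") (simp_all add: I_ev)
 have 1: "eB * eta1 = eta1" "eB * eta2 = eta2" "eta1 * se S = eta1" "eta2 * se S = eta2"
  by (simp_all add: eta1_def eta2_def ring_dist eB_I ie)
 have 2: "dgr 0 eta1" "dgr 0 eta2"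
  unfolding eta1_def eta2_def using dgr_I[of 0] dgr_I[of 1] dgr_I[of 6] dgr_I[of 5] dgr_I[of 16] dgr_I[of 18] dgr_I[of 4] dgr_I[of 15] dgr_I[of 17]
  by (auto simp: sh_def intro!: dgr_add)
 have s: "sB S = X False + Y False" "sA S = X True + Y True" using ar_split[of False] ar_split[of True] by (auto simp: ar_def)
 have 3: "(dB + AB False) * eta1 = eta1 * (sd S + sB S)"
  unfolding sd_split s eta1_def by (simp add: ring_dist cI i0 i1 i2 sv_def)
 have 4: "(dB + AB True) * eta2 = eta2 * (sd S + sA S)"
  unfolding sd_split s eta2_def by (simp add: ring_dist cI i0 i1 i2 sv_def)
 show ?thesis
  unfolding Zc_def Cm_def using 1 2 3 4 S sob_BS
  by (auto simp: dg_def w_eta w_oo intro!: wk_eqI)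
qed

lemma ar_ev: "sA S * ev V1 = X True" "sB S * ev V1 = X False" "sA S * ev V2 = Y True" "sB S * ev V2 = Y False"
 "sB S * X True = Y False * X True" "sA S * X False = Y True * X False"
proof -
 have "ar c * X t = Y c * X t" for c t
  unfolding Y_def mult.assoc ev_X by simp
 from this[of False True] this[of True False] show "sB S * X True = Y False * X True" "sA S * X False = Y True * X False"
  by (simp_all add: ar_def)
qed (simp_all add: X_def Y_def ar_def)

text \<open>The lift of \<open>g\<close> on slot \<open>c\<close>. On the nine generator slots it is
  a block of \<open>g\<close>; elsewhere compatibility with arrows forces it, with a sign for one
  arrow that cancels for two.\<close>

definition hc :: "int \<Rightarrow> 'k so \<Rightarrow> 'k wk \<Rightarrow> nat \<Rightarrow> 'k bm" where
 "hc p T g c = (let f1 = rw V1 (w1 g) * ev V1; f2 = rw V2 (w1 g) * ev V2; f3 = rw V3 (w1 g) * ev V3;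
   g4 = rw V2 (w2 g) * ev V1; g5 = rw V2 (w1 g) * ev V1; A = sA T; B = sB T in
   if c = 0 then f1 else if c = 1 then f2 else if c = 2 then sg p (A * f1) else if c = 3 then sg p (B * f1)
   else if c = 4 then g4 else if c = 5 then g5 else if c = 6 then f3
   else if c = 7 then sg p (A * f2) else if c = 8 then sg p (B * f2)
   else if c = 9 then B * (A * f1) else if c = 10 then A * (B * f1)
   else if c = 11 then sg p (A * g4) else if c = 12 then sg p (B * g4)
   else if c = 13 then sg p (A * g5) else if c = 14 then sg p (B * g5)
   else if c = 15 then rw V3 (w2 g) * ev V2 else if c = 16 then rw V3 (w1 g) * ev V2
   else if c = 17 then rw V3 (w2 g) * ev V1 else rw V3 (w1 g) * ev V1)"

definition hat :: "int \<Rightarrow> 'k so \<Rightarrow> 'k wk \<Rightarrow> 'k bm" where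
 "hat p T g = (\<Sum>c<19. hc p T g c * P c)"

lemma hc_ev: "c < 19 ==> hc p T g c * ev (sv c) = hc p T g c"
 by (rule all19[of "\<lambda>c. hc p T g c * ev (sv c) = hc p T g c"]; simp add: hc_def Let_def sv_def sg_mult_left mult.assoc ev_ev)

lemma hat_I: "c < 19 ==> hat p T g * I c = hc p T g c"
proof -
 assume c: "c < 19"
 have "hat p T g * I c = (\<Sum>b<19. hc p T g b * (P b * I c))" by (simp add: hat_def sum_distrib_right mult.assoc)
 also have "\<dots> = (\<Sum>b<19. if b = c then hc p T g c else 0)"
  by (rule sum.cong) (use c in \<open>auto simp: PI hc_ev\<close>)
 also have "\<dots> = hc p T g c" using c by simp
 finally show ?thesis .
qed

lemma hat_eB: "hat p T g * eB = hat p T g"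
 by (simp add: hat_def sum_distrib_right mult.assoc P_eB)

lemma rw_hc:
 assumes "sob T" "c < 19"
 shows "rw (tv c) (hc p T g c) = hc p T g c"
proof -
 have v: "vst (sA T)" "vst (sB T)" using assms by (auto simp: sob_def)
 note r = rw_vst[OF v(1)] rw_vst[OF v(2)]
 show ?thesis
  by (rule all19[OF _ _ _ _ _ _ _ _ _ _ _ _ _ _ _ _ _ _ _ assms(2)];
    simp add: hc_def Let_def tv_def rw_simps r rw_rw rw_mult[of _ "rw _ _"])
qed

lemma hc_dgr:
 assumes "sob T" "dg p g" "c < 19"
 shows "dgr (p + sh c) (hc p T g c)"
proof -
 have w: "dgr p (rw k (w1 g) * ev l)" "dgr p (rw k (w2 g) * ev l)" for k l
  using assms(2) dgr_mult[OF dgr_pick dgr_d(4), of p] by (auto simp: dg_def rw_def)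
 have a: "dgr 1 (sA T)" "dgr 1 (sB T)" using assms by (auto simp: sob_def)
 have b: "dgr q y ==> dgr (q + 1) (sA T * y)" "dgr q y ==> dgr (q + 1) (sB T * y)" for q y
  using dgr_mult[OF a(1), of q y] dgr_mult[OF a(2), of q y] by (simp_all add: ac_simps)
 have b2: "dgr q y ==> dgr (q + 2) (sA T * (sB T * y))" "dgr q y ==> dgr (q + 2) (sB T * (sA T * y))" for q y
  using b(1)[OF b(2), of q y] b(2)[OF b(1), of q y] by (simp_all add: ac_simps)
 show ?thesis
  by (rule all19[OF _ _ _ _ _ _ _ _ _ _ _ _ _ _ _ _ _ _ _ assms(3)];
    simp add: hc_def Let_def sh_def w b b2)
qed

lemma se_hc:
 assumes "sob T" "fst (oo T) * g = g" "c < 19"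
 shows "se T * hc p T g c = hc p T g c"
proof -
 have d: "dia (se T) = se T" "se T * sA T = sA T" "se T * sB T = sB T" using assms(1) by (auto simp: sob_def)
 have "se T * w1 g = w1 g" "se T * w2 g = w2 g"
  using arg_cong[OF assms(2), of w1] arg_cong[OF assms(2), of w2] by (auto simp: w_oo[OF assms(1)])
 then have w: "se T * rw k (w1 g) = rw k (w1 g)" "se T * rw k (w2 g) = rw k (w2 g)" for k
  by (simp_all flip: rw_dia[OF d(1)])
 show ?thesis
  by (rule all19[OF _ _ _ _ _ _ _ _ _ _ _ _ _ _ _ _ _ _ _ assms(3)];
    simp add: hc_def Let_def sg_mult_right w w[THEN mult_assoc_eq] d(2,3)[THEN mult_assoc_eq])
qed

lemma AB_V3: "c < 19 ==> tv c = V3 ==> AB t * I c = 0"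
proof -
 assume c: "c < 19" and "tv c = V3"
 have "tv c = V3 --> AB t * I c = 0"
  by (rule all19[OF _ _ _ _ _ _ _ _ _ _ _ _ _ _ _ _ _ _ _ c]; cases t; simp add: tv_def aI bI)
 then show ?thesis using \<open>tv c = V3\<close> by simp
qed

lemma Sm_hat:
 assumes T: "sob T" and g: "Cm p (oo S) (oo T) g"
 shows "Sm p BS T (hat p T g)"
proof -
 have v: "vst (sA T)" "vst (sB T)" "sA T * sA T = 0" "sB T * sB T = 0" using T by (auto simp: sob_def)
 note r = rw_vst(4)[OF v(1)] rw_vst(4)[OF v(2)] v(3,4)[THEN mult_assoc_eq]
 have z3: "sA T * y = 0" "sB T * y = 0" if "rw V3 y = y" for y
  using r(1)[of y] r(2)[of y] that by auto
 have "dgr p (hat p T g)"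
 proof -
  have "dgr p (hc p T g c * P c)" if "c < 19" for c
   using dgr_mult[OF hc_dgr[OF T _ that] dgr_P, of p g c] g by (simp add: Cm_def)
  then have "dgr p (\<Sum>c\<in>A. hc p T g c * P c)" if "A \<subseteq> {..<19}" for A
   using that finite_subset[OF that] by (induction A rule: infinite_finite_induct) (auto intro!: dgr_add)
  then show ?thesis by (auto simp: hat_def)
 qed
 moreover have "dia (hat p T g) = hat p T g"
 proof -
  have "dia (\<Sum>c\<in>A. hc p T g c * P c) = (\<Sum>c\<in>A. hc p T g c * P c)" if "A \<subseteq> {..<19}" for A
   using that by (induction A rule: infinite_finite_induct) (auto simp: dia_P rw_hc[OF T])
  then show ?thesis by (auto simp: hat_def)
 qed
 moreover have "se T * hat p T g = hat p T g"
  using se_hc[OF T] g by (simp add: hat_def sum_distrib_left Cm_def flip: mult.assoc)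
 moreover have "sA T * hat p T g = sg p (hat p T g * AB True)"
 proof (rule cols)
  fix c :: nat assume c: "c < 19"
  have h3: "sA T * hc p T g c = 0" if "tv c = V3" using z3(1) rw_hc[OF T c, of p g] that by simp
  have "sA T * hat p T g * I c = sA T * hc p T g c" using c by (simp add: mult.assoc hat_I)
  also have "\<dots> = sg p (hat p T g * (AB True * I c))"
  proof (cases "tv c = V3")
   case True
   then show ?thesis using h3 AB_V3[OF c] by simp
  next
   case False
   then have "c = 0 \<or> c = 1 \<or> c = 2 \<or> c = 3 \<or> c = 4 \<or> c = 5" by (auto simp: tv_def split: if_splits)
   then show ?thesis by (elim disjE; simp add: aI hat_I hc_def Let_def sg_mult_right r v)
  qed
  finally show "sA T * hat p T g * I c = sg p (hat p T g * AB True) * I c" by (simp add: mult.assoc sg_mult_left)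
 qed (simp_all add: mult.assoc sg_mult_left eB_right hat_eB)
 moreover have "sB T * hat p T g = sg p (hat p T g * AB False)"
 proof (rule cols)
  fix c :: nat assume c: "c < 19"
  have h3: "sB T * hc p T g c = 0" if "tv c = V3" using z3(2) rw_hc[OF T c, of p g] that by simp
  have "sB T * hat p T g * I c = sB T * hc p T g c" using c by (simp add: mult.assoc hat_I)
  also have "\<dots> = sg p (hat p T g * (AB False * I c))"
  proof (cases "tv c = V3")
   case True
   then show ?thesis using h3 AB_V3[OF c] by simp
  next
   case False
   then have "c = 0 \<or> c = 1 \<or> c = 2 \<or> c = 3 \<or> c = 4 \<or> c = 5" by (auto simp: tv_def split: if_splits)
   then show ?thesis by (elim disjE; simp add: bI hat_I hc_def Let_def sg_mult_right r v)
  qed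
  finally show "sB T * hat p T g * I c = sg p (hat p T g * AB False) * I c" by (simp add: mult.assoc sg_mult_left)
 qed (simp_all add: mult.assoc sg_mult_left eB_right hat_eB)
 ultimately show ?thesis by (simp add: Sm_def hat_eB)
qed

text \<open>The nine generator slots met by \<open>eta\<close> match the blocks of a weak morphism
  one by one: three common diagonal blocks and three triangular ones for each component.\<close>

lemma hat_eta:
 assumes T: "sob T" and g: "Cm p (oo S) (oo T) g"
 shows "st (hat p T g) * eta = g"
proof -
 have dh: "dia (hat p T g) = hat p T g" using Sm_hat[OF T g] by (simp add: Sm_def)
 have gs: "w1 g * se S = w1 g" "w2 g * se S = w2 g"
  using g by (auto simp: Cm_def w_oo[OF S] dest!: arg_cong[of _ _ w1] arg_cong[of _ _ w2])
   (metis w_oo(1,2)[OF S] w_times(1,2) g Cm_def)+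
 have split: "x * se S = rw V1 x * ev V1 + rw V2 x * ev V1 + rw V3 x * ev V1 + rw V2 x * ev V2 + rw V3 x * ev V2 + rw V3 x * ev V3" if "upr x" for x
 proof -
  have z: "rw k x * ev l = 0" if "vn k < vn l" for k l
  proof (rule fm_eqI)
   fix i j
   have "ent x i j = 0" if "vt i = k" "vt j = l"
    using \<open>upr x\<close> \<open>vn k < vn l\<close> that by (force simp: upr_def)
   then show "ent (rw k x * ev l) i j = ent 0 i j"
    using vt_Uv[of j l] by (simp add: ev_pr ent_times_pr finite_Uv)
  qed
  have "rw V1 x * ev V2 = 0" "rw V1 x * ev V3 = 0" "rw V2 x * ev V3 = 0"
   by (simp_all add: z)
  moreover have "x * se S = (rw V1 x + rw V2 x + rw V3 x) * (ev V1 + ev V2 + ev V3)"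
   by (simp only: rw_sum ev_sum)
  ultimately show ?thesis by (simp add: ring_dist)
 qed
 have same: "rw k (w2 g) * ev k = rw k (w1 g) * ev k" for k
 proof -
  have "rw k x * ev k = rw k (dia x) * ev k" for x
  proof (rule fm_eqI)
   fix i j show "ent (rw k x * ev k) i j = ent (rw k (dia x) * ev k) i j"
    using vt_Uv[of j k] by (simp add: ev_pr ent_times_pr finite_Uv)
  qed
  from this[of "w2 g"] this[of "w1 g"] show ?thesis by (simp add: dia_w)
 qed
 show ?thesis
 proof (rule wk_eqI)
  show "w1 (st (hat p T g) * eta) = w1 g"
   using split[OF upr_w(1), of g] gs(1) by (simp add: dh w_eta eta1_def ring_dist hat_I hc_def Let_def add_ac)
  show "w2 (st (hat p T g) * eta) = w2 g"
   using split[OF upr_w(2), of g] gs(2) by (simp add: dh w_eta eta2_def ring_dist hat_I hc_def Let_def add_ac same)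
 qed
qed

text \<open>Composition with \<open>eta\<close> recovers a strict map on the generator slots, by
  isolating source and target vertices; all other slots are arrow images of these.\<close>

lemma eta_cancel:
 assumes T: "sob T" and x: "Sm p BS T x" and 0: "st x * eta = 0"
 shows "x = 0"
proof -
 have dx: "dia x = x" "x * eB = x" "sA T * x = sg p (x * AB True)" "sB T * x = sg p (x * AB False)"
  using x by (auto simp: Sm_def)
 have e: "x * eta1 = 0" "x * eta2 = 0"
  using arg_cong[OF 0, of w1] arg_cong[OF 0, of w2] by (auto simp: dx w_eta)
 have re: "rw k (x * eta1 * ev l) = 0" "rw k (x * eta2 * ev l) = 0" for k l using e by (simp_all add: rw_simps)
 have g0: "x * I 0 = 0" using re(1)[of V1 V1]
  by (simp add: mult.assoc rw_dia[OF dx(1)] eta1_def ring_dist I_ev rw_simps rw_I sv_def tv_def)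
 have g1: "x * I 1 = 0" using re(1)[of V2 V2]
  by (simp add: mult.assoc rw_dia[OF dx(1)] eta1_def ring_dist I_ev rw_simps rw_I sv_def tv_def)
 have g6: "x * I 6 = 0" using re(1)[of V3 V3]
  by (simp add: mult.assoc rw_dia[OF dx(1)] eta1_def ring_dist I_ev rw_simps rw_I sv_def tv_def)
 have g5: "x * I 5 = 0" using re(1)[of V2 V1]
  by (simp add: mult.assoc rw_dia[OF dx(1)] eta1_def ring_dist I_ev rw_simps rw_I sv_def tv_def)
 have g16: "x * I 16 = 0" using re(1)[of V3 V2]
  by (simp add: mult.assoc rw_dia[OF dx(1)] eta1_def ring_dist I_ev rw_simps rw_I sv_def tv_def)
 have g18: "x * I 18 = 0" using re(1)[of V3 V1]
  by (simp add: mult.assoc rw_dia[OF dx(1)] eta1_def ring_dist I_ev rw_simps rw_I sv_def tv_def)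
 have g4: "x * I 4 = 0" using re(2)[of V2 V1]
  by (simp add: mult.assoc rw_dia[OF dx(1)] eta2_def ring_dist I_ev rw_simps rw_I sv_def tv_def)
 have g15: "x * I 15 = 0" using re(2)[of V3 V2]
  by (simp add: mult.assoc rw_dia[OF dx(1)] eta2_def ring_dist I_ev rw_simps rw_I sv_def tv_def)
 have g17: "x * I 17 = 0" using re(2)[of V3 V1]
  by (simp add: mult.assoc rw_dia[OF dx(1)] eta2_def ring_dist I_ev rw_simps rw_I sv_def tv_def)
 have xA: "x * (AB True * z) = sg p (sA T * (x * z))" "x * (AB False * z) = sg p (sB T * (x * z))" for z
  using dx(3,4) by (simp_all flip: mult.assoc add: sg_mult_left)
 have g: "x * I 2 = 0" "x * I 3 = 0" "x * I 7 = 0" "x * I 8 = 0" "x * I 11 = 0" "x * I 12 = 0" "x * I 13 = 0" "x * I 14 = 0"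
  using xA(1)[of "I 0"] xA(2)[of "I 0"] xA(1)[of "I 1"] xA(2)[of "I 1"] xA(1)[of "I 4"] xA(2)[of "I 4"] xA(1)[of "I 5"] xA(2)[of "I 5"]
  by (simp_all only: aI bI g0 g1 g4 g5 mult_zero_right sg_0)
 have g': "x * I 9 = 0" "x * I 10 = 0"
  using xA(2)[of "I 2"] xA(1)[of "I 3"] by (simp_all only: aI bI g mult_zero_right sg_0)
 show "x = 0"
 proof (rule cols)
  show "x * I c = 0 * I c" if "c < 19" for c
   by (rule all19[OF _ _ _ _ _ _ _ _ _ _ _ _ _ _ _ _ _ _ _ that]; simp only: g0 g1 g4 g5 g6 g15 g16 g17 g18 g g' mult_zero_left)
 qed (simp_all add: dx)
qed

text \<open>The failure of the lift to commute with the differentials is again a strict map. It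
  vanishes after composition with \<open>eta\<close>, hence is zero by uniqueness.\<close>

lemma Sc_hat:
 assumes T: "sob T" and g: "Zc p (oo S) (oo T) g"
 shows "Sc p BS T (hat p T g)"
proof -
 have c: "Cm p (oo S) (oo T) g" using g by (simp add: Zc_def)
 let ?h = "hat p T g"
 note m = Sm_hat[OF T c] and e = hat_eta[OF T c]
 have a: "sd T * ?h - sg p (?h * dB) = 0"
 proof (rule eta_cancel[OF T])
  have "Sm 1 T T (sd T)" "Sm 1 BS BS dB" using T sob_BS by (auto simp: Sm_def sob_def)
  from Sm_comp[OF m this(1), of "p + 1"] Sm_comp[OF this(2) m, of "p + 1"]
  show "Sm (p + 1) BS T (sd T * ?h - sg p (?h * dB))"
   using Sm_diff Sm_add Sm_diff[of "p+1" BS T 0 "?h * dB"]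
   by (auto simp: sg_def intro!: Sm_diff simp: Sm_def[of _ _ _ 0])
  have dh: "dia ?h = ?h" using m by (simp add: Sm_def)
  have dT: "dia (sd T) = sd T" using T by (simp add: sob_def)
  have z: "snd (oo BS) * eta = eta * snd (oo S)" using Zc_eta by (simp add: Zc_def)
  have "snd (oo T) * st ?h - sg p (st ?h * snd (oo BS)) = st (sd T * ?h - sg p (?h * dB))"
   using m by (auto intro!: wk_eqI simp: w_oo[OF T] w_oo[OF sob_BS] dh dB_sq dia_mult dia_upr dT dia_B Sm_def ring_dist sgs dia_mult_left)
    (simp_all add: sg_def dia_mult_left dh dT dia_B dia_upr)
  then have "st (sd T * ?h - sg p (?h * dB)) * eta = (snd (oo T) * st ?h - sg p (st ?h * snd (oo BS))) * eta" by simp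
  also have "\<dots> = snd (oo T) * (st ?h * eta) - sg p (st ?h * eta * snd (oo S))"
   by (simp add: ring_dist sgs mult.assoc z)
  also have "\<dots> = 0" using g by (simp add: e Zc_def)
  finally show "st (sd T * ?h - sg p (?h * dB)) * eta = 0" .
 qed
 then show ?thesis using m by (simp add: Sc_def)
qed

definition rB :: "'k bm" where "rB = hat 0 S (fst (oo S))"

lemma rB: "Sc 0 BS S rB" "st rB * eta = fst (oo S)"
 using Sc_hat[OF S Zc_id[OF ob_oo[OF S]]] hat_eta[OF S, of 0 "fst (oo S)"] Zc_id[OF ob_oo[OF S]]
 by (auto simp: rB_def Zc_def)

lemma rB_I: "c < 19 ==> rB * I c = hc 0 S (fst (oo S)) c"
 by (simp add: rB_def hat_I)

text \<open>Vectors are placed in the vertex generators by a section of \<open>rB\<close>, and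
  \<open>kB\<close> contracts the rest. The section ignores the arrows, which suffices because
  quasi-isomorphy only concerns vector spaces at each vertex.\<close>

lemma qir_rB: "qir BS S rB"
proof (rule weak_inverse_qir[OF sob_BS S rB(1)])
 let ?j = "I 0 + I 1 + I 6"
 have rI: "rB * I 0 = ev V1" "rB * I 1 = ev V2" "rB * I 6 = ev V3" "rB * I 2 = X True" "rB * I 3 = X False"
  "rB * I 4 = 0" "rB * I 5 = 0" "rB * I 7 = Y True" "rB * I 8 = Y False" "rB * I 9 = Y False * X True" "rB * I 10 = Y True * X False"
  "rB * I 11 = 0" "rB * I 12 = 0" "rB * I 13 = 0" "rB * I 14 = 0" "rB * I 15 = 0" "rB * I 16 = 0" "rB * I 17 = 0" "rB * I 18 = 0"
  using ar_ev by (simp_all add: rB_I hc_def Let_def w_oo[OF S] ev_def[symmetric] ev_ev)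
 have i0: "I c * d k = 0" if "sv c \<noteq> k" for c k using I_d(1) that by blast
 have i1: "I c * X t = 0" if "sv c \<noteq> V2" for c t using I_d(2) that by blast
 have i2: "I c * Y t = 0" if "sv c \<noteq> V3" for c t using I_d(3) that by blast
 have i2': "I c * (Y t * z) = 0" if "sv c \<noteq> V3" for c t z using mult_assoc_eq[OF i2[OF that], of t z] by simp
 show "sd BS * ?j = ?j * sd S" unfolding sd_split by (simp add: ring_dist cI i0 sv_def)
 show "dia ?j = ?j" by (simp add: dia_I sv_def tv_def)
 show "se BS * ?j = ?j" by (simp add: ring_dist eB_I)
 show "rB * ?j - se S = sd S * 0 + 0 * sd S" by (simp add: ring_dist rI ev_sum)
 show "se S * 0 = 0" by simp
 have "eB - ?j * rB = dB * kB + kB * dB"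
 proof (rule cols)
  show "(eB - ?j * rB) * I c = (dB * kB + kB * dB) * I c" if "c < 19" for c
   by (rule all19[OF _ _ _ _ _ _ _ _ _ _ _ _ _ _ _ _ _ _ _ that];
    simp add: mult.assoc ring_dist cI cI' rules rules' sv_def eB_I rI i1 i2 i2')
  have "rB * eB = rB" by (simp add: rB_def hat_eB)
  then show "(eB - ?j * rB) * eB = eB - ?j * rB" by (simp add: left_diff_distrib eB_right mult.assoc)
 qed (simp add: ring_dist mult.assoc eB_right)
 then show "?j * rB - se BS = sd BS * (- kB) + (- kB) * sd BS" by (simp add: algebra_simps)
 show "se BS * (- kB) = - kB" by (simp add: eB_left)
qed

end

section \<open>Realising strict data as complexes of representations, and the universal property of
  resolutions\<close>

definition isA :: "arr \<Rightarrow> bool" where "isA a \<longleftrightarrow> a = Alpha1 \<or> a = Beta2"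

lemma arw_isA: "arw (isA a) (src a) = Some a"
 by (cases a) (auto simp: isA_def)

lemma arw_isA': "arw c v = Some a ==> isA a = c"
 by (cases c; cases v) (auto simp: isA_def)

text \<open>The scattered coordinates of each block are renumbered as an initial segment of the
  naturals. Conjugation by this renumbering turns \<open>sd\<close>, \<open>sA\<close> and
  \<open>sB\<close> into the matrices of a complex. It is needed because the bar resolution occupies
  residue classes of positions.\<close>

lemma strict_object_is_complex:
 fixes S :: "'k::field so"
 assumes S: "sob S" "se S = pr U" "finite U"
 shows "\<exists>X u u'. is_cplx X \<and> Sc 0 S (so X) u \<and> Sc 0 (so X) S u' \<and> u' * u = se S \<and> u * u' = se (so X)"
proof -
 define Us where "Us s = {a. (s, a) \<in> U}" for s
 define n where "n s = card (Us s)" for s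
 have fin: "finite (Us s)" for s
  by (rule finite_subset[of _ "snd ` U"]) (force simp: Us_def S(3))+
 have "\<exists>h. bij_betw h {0..<n s} (Us s)" for s
  unfolding n_def by (rule ex_bij_betw_nat_finite[OF fin])
 then obtain h where h: "!!s. bij_betw (h s) {0..<n s} (Us s)" by metis
 define f :: "idx \<Rightarrow> idx" where "f b = (fst b, h (fst b) (snd b))" for b
 define W where "W = {b. snd b < n (fst b)}"
 have inj: "inj_on f W"
 proof (rule inj_onI)
  fix x y assume "x \<in> W" "y \<in> W" "f x = f y"
  then have e: "fst x = fst y" "h (fst x) (snd x) = h (fst x) (snd y)" by (auto simp: f_def)
  have "inj_on (h (fst x)) {0..<n (fst x)}" using h by (simp add: bij_betw_def)
  then have "snd x = snd y" using e \<open>x \<in> W\<close> \<open>y \<in> W\<close> by (auto simp: W_def dest: inj_onD)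
  then show "x = y" using e(1) by (rule_tac prod_eqI) auto
 qed
 have im: "f ` W = U"
 proof (intro equalityI subsetI)
  fix b assume "b \<in> f ` W"
  then obtain x where x: "x \<in> W" "b = f x" by blast
  then have "h (fst x) (snd x) \<in> Us (fst x)" using h[of "fst x"] by (auto simp: W_def bij_betw_def)
  then show "b \<in> U" using x by (simp add: f_def Us_def)
 next
  fix b assume "b \<in> U"
  then have "snd b \<in> Us (fst b)" by (simp add: Us_def)
  moreover have "h (fst b) ` {0..<n (fst b)} = Us (fst b)" using h[of "fst b"] by (simp add: bij_betw_def)
  ultimately obtain a where a: "a < n (fst b)" "h (fst b) a = snd b" by (metis imageE atLeastLessThan_iff)
  then have "f (fst b, a) = b" "(fst b, a) \<in> W" by (auto simp: f_def W_def)
  then show "b \<in> f ` W" by (metis imageI)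
 qed
 have finW: "finite W" using inj im S(3) finite_imageD by fastforce
 have bdn: "bd n" unfolding bd_def
 proof (rule finite_subset)
  show "{s. n s \<noteq> 0} \<subseteq> fst ` W"
  proof
   fix s assume "s \<in> {s. n s \<noteq> 0}"
   then have "(s, 0) \<in> W" by (simp add: W_def)
   then show "s \<in> fst ` W" by force
  qed
 qed (simp add: finW)
 define v u :: "'k bm" where "v = slI f W" and "u = slP f W"
 have uv: "u * v = pr W" "v * u = se S" "v * pr W = v" "pr W * u = u"
  by (simp_all add: u_def v_def slP_slI finW inj slI_slP im S(2) slI_pr pr_slP)
 have uvS: "se S * v = v" "u * se S = u"
 proof -
  have "(v * u) * v = v * (u * v)" "u * (v * u) = (u * v) * u" by (simp_all only: mult.assoc)
  then show "se S * v = v" "u * se S = u" using uv by simp_all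
 qed
 have uvd: "dgr 0 u" "dgr 0 v" "dia u = u" "dia v = v"
  by (auto simp: u_def v_def f_def td_def vt_def finW intro!: dgr_slI dgr_slP dia_slI dia_slP)
 note sS = S(1)[unfolded sob_def]
 define dd where "dd = u * sd S * v"
 define AA where "AA c = u * (if c then sA S else sB S) * v" for c
 have supp: "snd a < n (fst a) \<and> snd b < n (fst b)" if "ent (u * x * v) a b \<noteq> 0" for x a b
 proof -
  have "u * x * v = pr W * (u * x * v) * pr W"
   by (simp add: mult.assoc uv) (simp add: uv flip: mult.assoc)
  then have "ent (pr W * (u * x * v) * pr W) a b \<noteq> 0" using that by simp
  then have "a \<in> W \<and> b \<in> W"
   by (simp add: ent_pr_times[OF finW] ent_times_pr[OF finW] split: if_splits)
  then show ?thesis by (simp add: W_def)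
 qed
 define X where "X = \<lparr>cobj = (\<lambda>i. \<lparr>rdim = (\<lambda>w. n (i, w)),
   ract = (\<lambda>a. sgn1 i \<cdot>\<^sub>m de (Ta (isA a)) n n (AA (isA a)) (i, src a))\<rparr>),
   cdif = (\<lambda>i w. de (Tp 1) n n dd (i, w))\<rparr>"
 have dmX: "dm X = n" by (auto simp: dm_def X_def)
 have rd: "rdim (cobj X i) w = n (i, w)" for i w by (simp add: X_def)
 have ddg: "dgr 1 dd" "dia dd = dd"
 proof -
  show "dgr 1 dd" using dgr_mult[OF dgr_mult[OF uvd(1), of 1 "sd S"] uvd(2)] sS by (simp add: dd_def)
  show "dia dd = dd" using sS by (simp add: dd_def mult.assoc dia_mult_left uvd)
 qed
 have cX: "cme 1 X X (cdif X) = dd"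
 proof -
  have "cme 1 X X (cdif X) = en (Tp 1) n n (de (Tp 1) n n dd)"
   by (simp add: cme_def dmX) (simp add: X_def)
  also have "\<dots> = dd"
  proof (rule en_de[OF bdn])
   fix a b assume nz: "ent dd a b \<noteq> 0"
   have "vt a = vt b" using nz ddg(2) by (metis ent_dia)
   moreover have "td a = td b + 1" using nz ddg(1) by (simp add: dgr_def)
   ultimately show "Tp 1 (fst b) = Some (fst a) \<and> snd a < n (fst a) \<and> snd b < n (fst b)"
    using supp[of "sd S" a b] nz by (simp add: dd_def[symmetric] Tp_def td_def vt_def prod_eq_iff)
  qed
  finally show ?thesis .
 qed
 have cmd: "cmc 1 X X (cdif X)"
  unfolding cmc_ok dmX by (simp add: X_def ok_de)
 have AAp: "dgr 1 (AA c)" "vst (AA c)" for c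
 proof -
  have x: "dgr 1 (if c then sA S else sB S)" "vst (if c then sA S else sB S)" using sS by auto
  show "dgr 1 (AA c)" using dgr_mult[OF dgr_mult[OF uvd(1) x(1)] uvd(2)] by (simp add: AA_def)
  show "vst (AA c)" unfolding vst_def
  proof (intro allI impI)
   fix i j assume "ent (AA c) i j \<noteq> 0"
   then obtain k where k: "ent (u * (if c then sA S else sB S)) i k \<noteq> 0" "ent v k j \<noteq> 0"
    unfolding AA_def using ent_times_nonzero by metis
   obtain l where l: "ent u i l \<noteq> 0" "ent (if c then sA S else sB S) l k \<noteq> 0"
    using ent_times_nonzero[OF k(1)] by blast
   have "vt k = vt j" using k(2) uvd(4) by (metis ent_dia)
   moreover have "vt i = vt l" using l(1) uvd(3) by (metis ent_dia)
   moreover have "vn (vt l) = vn (vt k) + 1" using l(2) x(2) unfolding vst_def by blast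
   ultimately show "vn (vt i) = vn (vt j) + 1" by simp
  qed
 qed
 have aX: "are c X = AA c" for c
 proof -
  have "are c X = en (Ta c) n n (de (Ta c) n n (AA c))"
   unfolding are_def dmX
  proof (rule en_cong[OF _ bdn])
   fix s s' assume "Ta c s = Some s'"
   then obtain a where a: "arw c (snd s) = Some a" by (auto simp: Ta_def)
   have "sgn1 (fst s) * sgn1 (fst s) = (1 :: 'k)" by (simp add: sgn1_def)
   then show "arm X c s = de (Ta c) n n (AA c) s"
    using arw_isA'[OF a] src_arw[OF a] a
    by (auto simp: arm_def X_def intro!: eq_matI)
  qed
  also have "\<dots> = AA c"
  proof (rule en_de[OF bdn])
   fix a b assume nz: "ent (AA c) a b \<noteq> 0"
   have v1: "vn (vt a) = vn (vt b) + 1" "td a = td b + 1" using nz AAp[of c] by (auto simp: vst_def dgr_def)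
   have "Ta c (fst b) = Some (fst (fst b), vt a)"
    using v1(1) by (cases c; cases "vt b"; cases "vt a") (auto simp: Ta_def vt_def)
   moreover have "fst a = (fst (fst b), vt a)" using v1 by (simp add: td_def vt_def prod_eq_iff)
   ultimately show "Ta c (fst b) = Some (fst a) \<and> snd a < n (fst a) \<and> snd b < n (fst b)"
    using supp[of "if c then sA S else sB S" a b] nz by (simp add: AA_def[symmetric])
  qed
  finally show ?thesis .
 qed
 have car: "ract (cobj X i) a \<in> carrier_mat (n (i, tgt a)) (n (i, src a))" for i a
  using arw_isA[of a] by (simp add: X_def de_def Ta_def)
 have pX: "pcx X" using bdn car by (simp add: pcx_def dmX rd)
 have seX: "se (so X) = pr W"
  using se_pr(1)[of X] bdn by (simp add: dmX W_def del: so_sel)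
 have m0: "u * x * v * (u * y * v) = u * (x * y) * v" if "x * se S = x" for x y
 proof -
  have "u * x * v * (u * y * v) = u * (x * (v * u)) * y * v" by (simp add: mult.assoc)
  then show ?thesis using that by (simp add: uv mult.assoc)
 qed
 have AA0: "AA c * AA c = 0" for c unfolding AA_def by (subst m0) (use sS in auto)
 have dd0: "dd * dd = 0" unfolding dd_def by (subst m0) (use sS in auto)
 have dA: "dd * AA c = - (AA c * dd)" for c
  unfolding AA_def dd_def by (subst (1 2) m0) (use sS in \<open>auto\<close>)
 have rel: "ract (cobj X i) Beta2 * ract (cobj X i) Alpha1 = 0\<^sub>m (n (i, V3)) (n (i, V1))"
  "ract (cobj X i) Alpha2 * ract (cobj X i) Beta1 = 0\<^sub>m (n (i, V3)) (n (i, V1))" for i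
 proof -
  have z: "arm X c (i, V2) * arm X c (i, V1) = 0\<^sub>m (n (i, V3)) (n (i, V1))" for c
  proof -
   note ok = arm_ok[OF pX, of c, unfolded dmX]
   have e: "en (\<lambda>s. Option.bind (Ta c s) (Ta c)) n n (\<lambda>s. arm X c (the (Ta c s)) * arm X c s) = 0"
    using AA0[of c] unfolding aX[symmetric] are_def dmX en_mult[OF bdn bdn ok ok] .
   have okc: "ok (\<lambda>s. Option.bind (Ta c s) (Ta c)) n n (\<lambda>s. arm X c (the (Ta c s)) * arm X c s)"
    unfolding ok_def
   proof (intro allI impI)
    fix s s' assume "Option.bind (Ta c s) (Ta c) = Some s'"
    then obtain t where "Ta c s = Some t" "Ta c t = Some s'" by (cases "Ta c s") auto
    then show "arm X c (the (Ta c s)) * arm X c s \<in> carrier_mat (n s') (n s)"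
     using ok unfolding ok_def by (metis mult_carrier_mat option.sel)
   qed
   have T: "Ta c (i, V1) = Some (i, V2)" "Ta c (i, V2) = Some (i, V3)" by (cases c; simp add: Ta_def)+
   show ?thesis
    using e[unfolded en_eq_0_iff[OF bdn okc], rule_format, of "(i, V1)" "(i, V3)"] by (simp add: T)
  qed
  have m: "(k \<cdot>\<^sub>m M) * (k \<cdot>\<^sub>m N) = (k * k) \<cdot>\<^sub>m (M * N)"
   if "M \<in> carrier_mat (n (i, V3)) (n (i, V2))" "N \<in> carrier_mat (n (i, V2)) (n (i, V1))" for k :: 'k and M N :: "'k mat"
   using mult_smult_assoc_mat[OF that(1) smult_carrier_mat[OF that(2), of k], of k] mult_smult_distrib[OF that, of k]
   by (auto intro!: eq_matI)
  have k: "sgn1 i * sgn1 i = (1::'k)" by (simp add: sgn1_def)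
  have one: "(1::'k) \<cdot>\<^sub>m M = M" for M by (rule eq_matI) auto
  show "ract (cobj X i) Beta2 * ract (cobj X i) Alpha1 = 0\<^sub>m (n (i, V3)) (n (i, V1))"
   using z[of True] m[OF car[of i Beta2, simplified] car[of i Alpha1, simplified], of "sgn1 i"] by (simp add: arm_def k one)
  show "ract (cobj X i) Alpha2 * ract (cobj X i) Beta1 = 0\<^sub>m (n (i, V3)) (n (i, V1))"
   using z[of False] m[OF car[of i Alpha2, simplified] car[of i Beta1, simplified], of "sgn1 i"] by (simp add: arm_def k one)
 qed
 have rep: "f (tgt a) * ract (cobj X i) a = ract (cobj X (i + 1)) a * f (src a)" if "f = cdif X i" for f i a
 proof -
  have "are c X * cme 1 X X (cdif X) = sg 1 (cme 1 X X (cdif X) * are c X)" for c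
   by (simp add: aX cX dA)
  then have "\<forall>i w a. arw c w = Some a --> ract (cobj X (i + 1)) a * cdif X i w = cdif X i (tgt a) * ract (cobj X i) a" for c
   using cme_are_mult[OF pX pX cmd] by blast
  then show ?thesis using arw_isA that by metis
 qed
 have d2: "cdif X (i + 1) w * cdif X i w = 0\<^sub>m (n (i + 2, w)) (n (i, w))" for i w
 proof -
  have "cme (1 + 1) X X (\<lambda>i v. cdif X (i + 1) v * cdif X i v) = 0"
   using cme_mult[OF _ _ cmd cmd] bdn dd0 by (simp add: dmX cX)
  moreover have "cmc (1 + 1) X X (\<lambda>i v. cdif X (i + 1) v * cdif X i v)" by (rule cmc_mult[OF cmd cmd])
  ultimately have "\<forall>s s'. Tp (1 + 1) s = Some s' --> cdif X (fst s + 1) (snd s) * cdif X (fst s) (snd s) = 0\<^sub>m (n s') (n s)"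
   unfolding cme_def cmc_ok dmX by (subst (asm) en_eq_0_iff) (auto simp: bdn)
  from this[rule_format, of "(i, w)" "(i + 2, w)"] show ?thesis by (simp add: Tp_def)
 qed
 have bnd: "\<exists>N. \<forall>i w. \<bar>i\<bar> > N --> n (i, w) = 0"
 proof -
  have "finite (fst ` {s. n s \<noteq> 0})" using bdn by (simp add: bd_def)
  then obtain N where N: "abs ` fst ` {s. n s \<noteq> 0} \<subseteq> {..N}" unfolding finite_int_iff_bounded_le by blast
  have "n (i, w) = 0" if "\<bar>i\<bar> > N" for i w
  proof (rule ccontr)
   assume "n (i, w) \<noteq> 0"
   then have "(i, w) \<in> {s. n s \<noteq> 0}" by simp
   then have "\<bar>i\<bar> \<in> abs ` fst ` {s. n s \<noteq> 0}" by (metis fst_conv imageI)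
   then have "\<bar>i\<bar> \<le> N" using N by (meson atMost_iff subsetD)
   then show False using that by simp
  qed
  then show ?thesis by blast
 qed
 have X: "is_cplx X"
  unfolding is_cplx_def is_rep_def rep_map_def rd
  using car rel rep d2 bnd cmd by (auto simp: cmc_def rd)
 have 1: "AA c * u = u * (if c then sA S else sB S)" "v * AA c = (if c then sA S else sB S) * v" for c
 proof -
  have "AA c * u = u * ((if c then sA S else sB S) * (v * u))" "v * AA c = ((v * u) * (if c then sA S else sB S)) * v"
   by (simp_all add: AA_def mult.assoc)
  then show "AA c * u = u * (if c then sA S else sB S)" "v * AA c = (if c then sA S else sB S) * v"
   using sS uv by auto
 qed
 have 2: "dd * u = u * sd S" "v * dd = sd S * v"
 proof -
  have "dd * u = u * (sd S * (v * u))" "v * dd = ((v * u) * sd S) * v" by (simp_all add: dd_def mult.assoc)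
  then show "dd * u = u * sd S" "v * dd = sd S * v" using sS uv by auto
 qed
 have sX: "se (so X) = pr W" "sd (so X) = dd" "sA (so X) = AA True" "sB (so X) = AA False"
  using seX by (simp_all add: cX aX)
 have "Sc 0 S (so X) u" "Sc 0 (so X) S v"
  using 1 2 uv uvS uvd unfolding Sc_def Sm_def sX by auto
 then show ?thesis using X uv(1,2) seX
  by (intro exI[of _ X] exI[of _ u] exI[of _ v]) (simp del: so_sel)
qed

text \<open>For a strict map the arrow parts of both weak differentials cancel, so its boundary in
  the Hom complex is strict again.\<close>

lemma strict_bd:
 assumes "sob S" "sob T" "Sm p S T x"
 shows "snd (oo T) * st x - sg p (st x * snd (oo S)) = st (sd T * x - sg p (x * sd S))"
  and "Sm (p + 1) S T (sd T * x - sg p (x * sd S))"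
proof -
 have dx: "dia x = x" and dT: "dia (sd T) = sd T" "dia (sd S) = sd S" using assms by (auto simp: Sm_def sob_def)
 have dd: "dia (sd T * x) = sd T * x" "dia (sg p (x * sd S)) = sg p (x * sd S)"
  using dx dT by (simp_all add: dia_mult_left sg_def)
 have "sA T * x = sg p (x * sA S)" "sB T * x = sg p (x * sB S)" using assms by (auto simp: Sm_def)
 then show "snd (oo T) * st x - sg p (st x * snd (oo S)) = st (sd T * x - sg p (x * sd S))"
  by (intro wk_eqI) (simp_all add: w_oo[OF assms(1)] w_oo[OF assms(2)] dx dd ring_dist sgs)
 have "Sm 1 T T (sd T)" "Sm 1 S S (sd S)" using assms by (auto simp: Sm_def sob_def)
 then have "Sm (p + 1) S T (sd T * x)" "Sm (p + 1) S T (x * sd S)"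
  using Sm_comp[OF assms(3), of 1 T "sd T" "p + 1"] Sm_comp[OF _ assms(3), of 1 S "sd S" "p + 1"] by auto
 then show "Sm (p + 1) S T (sd T * x - sg p (x * sd S))"
  using Sm_diff Sm_add by (auto simp: sg_def)
qed

abbreviation Oc :: "'k::field cplx \<Rightarrow> 'k ob" where "Oc X \<equiv> oo (so X)"
abbreviation Z0 :: "'k::field cplx \<Rightarrow> 'k cplx \<Rightarrow> 'k wk \<Rightarrow> bool" where "Z0 X Y \<equiv> Zc 0 (Oc X) (Oc Y)"
abbreviation N0 :: "'k::field cplx \<Rightarrow> 'k cplx \<Rightarrow> 'k wk \<Rightarrow> bool" where "N0 X Y \<equiv> Nl 0 (Oc X) (Oc Y)"
abbreviation H0 :: "'k::field cplx \<Rightarrow> 'k cplx \<Rightarrow> 'k wk \<Rightarrow> 'k wk \<Rightarrow> bool" where "H0 X Y \<equiv> hq 0 (Oc X) (Oc Y)"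
abbreviation ce :: "'k::field cplx \<Rightarrow> 'k cplx \<Rightarrow> 'k cmap \<Rightarrow> 'k bm" where "ce X Y f \<equiv> cme 0 X Y f"

lemma ob_Oc: "is_cplx X ==> ob (Oc X)"
 by (simp add: ob_oo sob_so)

lemma chain_Sc: "is_cplx X ==> is_cplx Y ==> chain_map X Y f ==> Sc 0 (so X) (so Y) (ce X Y f)"
 using chain_map_iff by blast

lemma chain_cmc: "is_cplx X ==> is_cplx Y ==> chain_map X Y f ==> cmc 0 X Y f"
 using chain_map_iff by blast

lemma chain_Zc: "is_cplx X ==> is_cplx Y ==> chain_map X Y f ==> Z0 X Y (st (ce X Y f))"
 by (intro Sc_Zc sob_so chain_Sc)

lemma Sm_upr: "Sm p S T x ==> upr x" by (auto simp: Sm_def intro: dia_upr)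

lemma quasi_iso_inverse:
 assumes "is_cplx X" "is_cplx Y" "quasi_iso X Y f"
 shows "\<exists>t. Z0 Y X t \<and> H0 X X (t * st (ce X Y f)) (fst (Oc X)) \<and>
  H0 Y Y (st (ce X Y f) * t) (fst (Oc Y))"
proof -
 note bX = se_pr[OF cplx_bd[OF assms(1)]] and bY = se_pr[OF cplx_bd[OF assms(2)]]
 have "chain_map X Y f" using assms(3) by (simp add: quasi_iso_def)
 then show ?thesis
  using qir_inverse[OF sob_so[OF assms(1)] bX sob_so[OF assms(2)] bY] chain_Sc[OF assms(1,2)] quasi_iso_qir[OF assms]
  by blast
qed

lemma inverse_quasi_iso:
 assumes "is_cplx X" "is_cplx Y" "chain_map X Y f" "Z0 Y X t"
  "H0 X X (t * st (ce X Y f)) (fst (Oc X))" "H0 Y Y (st (ce X Y f) * t) (fst (Oc Y))"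
 shows "quasi_iso X Y f"
 using qir_quasi_iso[OF assms(1-3)] weak_inverse_qir'[OF sob_so[OF assms(1)] sob_so[OF assms(2)] chain_Sc[OF assms(1-3)] assms(4-6)]
 by blast

text \<open>A quasi-isomorphism \<open>r\<close> split by the weak morphism \<eta>, such that
  composition with \<eta> is a bijection from strict to weak morphisms, for cochains as well as for
  cocycles. It plays the role of a projective resolution.\<close>

definition resolution :: "'k::field cplx \<Rightarrow> 'k cplx \<Rightarrow> 'k cmap \<Rightarrow> 'k wk \<Rightarrow> bool" where
 "resolution X W r \<eta> \<longleftrightarrow> is_cplx W \<and> quasi_iso W X r \<and> Z0 X W \<eta> \<and> st (ce W X r) * \<eta> = fst (Oc X) \<and>
  (\<forall>Y p g. is_cplx Y --> Cm p (Oc X) (Oc Y) g --> (\<exists>x. Sm p (so W) (so Y) x \<and> st x * \<eta> = g)) \<and>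
  (\<forall>Y p g. is_cplx Y --> Zc p (Oc X) (Oc Y) g --> (\<exists>x. Sc p (so W) (so Y) x \<and> st x * \<eta> = g)) \<and>
  (\<forall>Y p x. is_cplx Y --> Sm p (so W) (so Y) x --> st x * \<eta> = 0 --> x = 0)"

text \<open>The bar resolution is carried along the isomorphism of
  \<open>strict_object_is_complex\<close> to an actual complex, together with its augmentation and
  its universal morphism.\<close>

lemma resolution_exists:
 fixes X :: "'k::field cplx"
 assumes X: "is_cplx X"
 shows "\<exists>W r \<eta>. resolution X W r \<eta>"
proof -
 interpret B: bar "so X" "{i. snd i < dm X (fst i)}"
  using sob_so[OF X] se_pr[OF cplx_bd[OF X]] by unfold_locales
 obtain W u v where W: "is_cplx W" "Sc 0 B.BS (so W) u" "Sc 0 (so W) B.BS v" "v * u = B.eB" "u * v = se (so W)"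
  using strict_object_is_complex[OF B.sob_BS _ B.finite_UB] B.eB_pr by auto
 have uu: "upr u" "upr v" using W by (auto simp: Sc_def Sm_upr)
 define \<eta> where "\<eta> = st u * B.eta"
 have vu: "st v * \<eta> = B.eta"
 proof -
  have "st v * \<eta> = st (v * u) * B.eta" by (simp add: \<eta>_def st_mult uu mult.assoc)
  also have "\<dots> = fst (oo B.BS) * B.eta" using W(4) by (simp add: oo_def)
  finally show ?thesis using B.Zc_eta by (simp add: Zc_def Cm_def)
 qed
 have eta: "Z0 X W \<eta>"
  unfolding \<eta>_def by (rule Zc_comp[OF B.Zc_eta Sc_Zc[OF B.sob_BS sob_so[OF W(1)] W(2)]]) simp
 have comp: "st (x * v) * \<eta> = st x * B.eta" if "upr x" for x
  using vu by (simp add: st_mult that uu mult.assoc)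
 have "Sc 0 (so W) (so X) (B.rB * v)"
  by (rule Sc_comp[OF W(3) B.rB(1)]) simp
 then obtain r where r: "chain_map W X r" "B.rB * v = ce W X r" using Sc_ex[OF W(1) X] by blast
 have upB: "upr B.rB" using B.rB(1) by (auto simp: Sc_def Sm_upr)
 have reta: "st (ce W X r) * \<eta> = fst (Oc X)"
  using comp[OF upB] B.rB(2) r(2) by simp
 have sW: "Sm 0 B.BS (so W) u" "Sm 0 (so W) B.BS v" "sd (so W) * u = u * B.dB" "B.dB * v = v * sd (so W)"
  using W(2,3) by (auto simp: Sc_def simp del: so_sel)
 have eW: "B.eB * v = v" "se (so W) * u = u" "u * B.eB = u" using sW by (auto simp: Sm_def)
 have "qir (so W) (so X) (ce W X r)"
  unfolding qir_def r(2)[symmetric]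
 proof (intro conjI allI impI)
  fix a w assume a: "se (so W) * a = a" "sd (so W) * a = 0" "se (so X) * w = w" "B.rB * v * a = sd (so X) * w"
  have "B.eB * (v * a) = v * a" "B.dB * (v * a) = 0"
   using a(2) mult_assoc_eq[OF eW(1), of a] mult_assoc_eq[OF sW(4), of a] by (simp_all add: mult.assoc del: so_sel)
  then obtain b where b: "B.eB * b = b" "v * a = B.dB * b"
   using B.qir_rB a(3,4) unfolding qir_def by (simp add: mult.assoc del: so_sel) blast
  have "a = u * (v * a)" using a(1) W(5) by (simp flip: mult.assoc del: so_sel)
  also have "\<dots> = sd (so W) * (u * b)" unfolding b(2) using mult_assoc_eq[OF sW(3), of b] by (simp only: mult.assoc)
  finally have "a = sd (so W) * (u * b)" .
  moreover have "se (so W) * (u * b) = u * b" using mult_assoc_eq[OF eW(2), of b] by simp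
  ultimately show "\<exists>u'. se (so W) * u' = u' \<and> a = sd (so W) * u'" by blast
 next
  fix w assume w: "se (so X) * w = w" "sd (so X) * w = 0"
  then obtain a w' where a: "B.eB * a = a" "B.dB * a = 0" "se (so X) * w' = w'" "w = B.rB * a + sd (so X) * w'"
   using B.qir_rB unfolding qir_def by (simp del: so_sel) blast
  have "B.rB * v * (u * a) = B.rB * ((v * u) * a)" by (simp only: mult.assoc)
  then have "w = B.rB * v * (u * a) + sd (so X) * w'" using a W(4) by simp
  moreover have "se (so W) * (u * a) = u * a" using mult_assoc_eq[OF eW(2), of a] by simp
  moreover have "sd (so W) * (u * a) = 0" using mult_assoc_eq[OF sW(3), of a] a(2) by (simp add: mult.assoc del: so_sel)
  ultimately show "\<exists>u w'. se (so W) * u = u \<and> sd (so W) * u = 0 \<and> se (so X) * w' = w' \<and> w = B.rB * v * u + sd (so X) * w'"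
   using a(3) by blast
 qed
 then have qi: "quasi_iso W X r" by (rule qir_quasi_iso[OF W(1) X r(1)])
 have h1: "\<exists>x. Sm p (so W) (so Y) x \<and> st x * \<eta> = g" if Y: "is_cplx Y" and g: "Cm p (Oc X) (Oc Y) g" for Y p g
  using Sm_comp[OF sW(2) B.Sm_hat[OF sob_so[OF Y] g], of p] comp[OF Sm_upr[OF B.Sm_hat[OF sob_so[OF Y] g]]] B.hat_eta[OF sob_so[OF Y] g]
  by auto
 have h2: "\<exists>x. Sc p (so W) (so Y) x \<and> st x * \<eta> = g" if Y: "is_cplx Y" and g: "Zc p (Oc X) (Oc Y) g" for Y p g
 proof -
  have c: "Cm p (Oc X) (Oc Y) g" using g by (simp add: Zc_def)
  show ?thesis
   using Sc_comp[OF W(3) B.Sc_hat[OF sob_so[OF Y] g], of p] comp[OF Sm_upr[OF B.Sm_hat[OF sob_so[OF Y] c]]] B.hat_eta[OF sob_so[OF Y] c]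
   by auto
 qed
 have h3: "x = 0" if Y: "is_cplx Y" and x: "Sm p (so W) (so Y) x" "st x * \<eta> = 0" for Y :: "'k cplx" and p x
 proof -
  have "Sm p B.BS (so Y) (x * u)" by (rule Sm_comp[OF sW(1) x(1)]) simp
  moreover have "st (x * u) * B.eta = 0" using x(2) by (simp add: st_mult Sm_upr[OF x(1)] uu \<eta>_def mult.assoc)
  ultimately have "x * u = 0" using B.eta_cancel[OF sob_so[OF Y]] by blast
  then have "x * (u * v) = 0" by (simp flip: mult.assoc)
  then show "x = 0" using x(1) W(5) by (simp add: Sm_def del: so_sel)
 qed
 have "resolution X W r \<eta>" unfolding resolution_def using W(1) qi eta reta h1 h2 h3 by blast
 then show ?thesis by blast
qed

text \<open>A weak homotopy lifts through \<eta> to a strict one, and the remaining discrepancy is a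
  strict map killed by \<eta>. Thus weak homotopy on \<open>X\<close> becomes chain homotopy on
  \<open>W\<close>, which is what roofs ask for.\<close>

lemma resolution_homotopy:
 assumes X: "is_cplx X" and R: "resolution X W r \<eta>" and Y: "is_cplx Y"
  and f: "chain_map W Y f" and g: "chain_map W Y g"
  and h: "H0 X Y (st (ce W Y f) * \<eta>) (st (ce W Y g) * \<eta>)"
 shows "homotopic W Y f g"
proof -
 have W: "is_cplx W" and eta: "Z0 X W \<eta>" using R by (auto simp: resolution_def)
 note sW = sob_so[OF W] and sY = sob_so[OF Y]
 obtain k where k: "Cm (- 1) (Oc X) (Oc Y) k"
  "st (ce W Y f) * \<eta> - st (ce W Y g) * \<eta> = snd (Oc Y) * k + k * snd (Oc X)"
  using h by (auto simp: hq_def Nl_def)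
 obtain x where x: "Sm (- 1) (so W) (so Y) x" "st x * \<eta> = k"
  using R Y k(1) unfolding resolution_def by blast
 let ?z = "sd (so Y) * x + x * sd (so W)"
 have b: "snd (Oc Y) * st x + st x * snd (Oc W) = st ?z" "Sm 0 (so W) (so Y) ?z"
  using strict_bd[OF sW sY x(1)] by (simp_all add: sg_def del: so_sel)
 have fg: "Sm 0 (so W) (so Y) (ce W Y f)" "Sm 0 (so W) (so Y) (ce W Y g)"
  using chain_Sc[OF W Y f] chain_Sc[OF W Y g] by (auto simp: Sc_def)
 have e: "snd (Oc W) * \<eta> = \<eta> * snd (Oc X)" using eta by (simp add: Zc_def)
 have "st (ce W Y f - ce W Y g - ?z) * \<eta> = (snd (Oc Y) * k + k * snd (Oc X)) - (snd (Oc Y) * st x + st x * snd (Oc W)) * \<eta>"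
  by (simp only: st_simps left_diff_distrib k(2) b(1))
 also have "\<dots> = 0" by (simp add: distrib_right mult.assoc x(2) e) (simp add: x(2) flip: mult.assoc)
 finally have "ce W Y f - ce W Y g - ?z = 0"
  using R Y Sm_diff[OF Sm_diff[OF fg] b(2)] unfolding resolution_def by blast
 then show ?thesis
  using x(1) homotopic_iff[OF W Y chain_cmc[OF W Y f] chain_cmc[OF W Y g]] by auto
qed

lemma homotopic_hq:
 assumes X: "is_cplx X" and Y: "is_cplx Y" and f: "chain_map X Y f" and g: "chain_map X Y g" and h: "homotopic X Y f g"
 shows "H0 X Y (st (ce X Y f)) (st (ce X Y g))"
proof -
 obtain x where x: "Sm (- 1) (so X) (so Y) x" "ce X Y f - ce X Y g = sd (so Y) * x + x * sd (so X)"
  using h homotopic_iff[OF X Y chain_cmc[OF X Y f] chain_cmc[OF X Y g]] by blast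
 have "st (ce X Y f) - st (ce X Y g) = snd (Oc Y) * st x + st x * snd (Oc X)"
  using strict_bd(1)[OF sob_so[OF X] sob_so[OF Y] x(1)] x(2) by (simp add: sg_def st_simps(2)[symmetric] del: so_sel)
 then show ?thesis unfolding hq_def Nl_def using Sm_Cm[OF sob_so[OF X] sob_so[OF Y] x(1)] by (intro exI[of _ "st x"]) auto
qed

section \<open>The dictionary between roof classes and weak morphisms up to homotopy\<close>

section \<open>Morphisms of the derived category as classes of weak morphisms\<close>

lemma hq_id_right: "Zc p X Y g ==> hq 0 X X a (fst X) ==> hq p X Y (g * a) g"
 using hq_left[of 0 X X a "fst X" p Y g p] by (simp add: Zc_def Cm_def)

lemma hq_id_left: "Zc p X Y g ==> hq 0 Y Y a (fst Y) ==> hq p X Y (a * g) g"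
 using hq_right[of 0 Y Y a "fst Y" p X g p] by (simp add: Zc_def Cm_def)

lemma cancel_right:
 assumes "Zc p Y Z g" "Zc p Y Z g'" "Zc q Y X t" "hq 0 Y Y (s * t) (fst Y)" "hq r X Z (g * s) (g' * s)" "p = r + q"
 shows "hq p Y Z g g'"
proof -
 have "hq p Y Z (g * s * t) (g' * s * t)" by (rule hq_right[OF assms(5,3,6)])
 moreover have "hq p Y Z (g * s * t) g" "hq p Y Z (g' * s * t) g'"
  using hq_id_right[OF assms(1,4)] hq_id_right[OF assms(2,4)] by (simp_all add: mult.assoc)
 ultimately show ?thesis by (meson hq_sym hq_trans)
qed

lemma cancel_left:
 assumes "Zc p X Y g" "Zc p X Y g'" "Zc q Z Y t" "hq 0 Y Y (t * s) (fst Y)" "hq r X Z (s * g) (s * g')" "p = q + r"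
 shows "hq p X Y g g'"
proof -
 have "hq p X Y (t * (s * g)) (t * (s * g'))" by (rule hq_left[OF assms(5,3,6)])
 moreover have "hq p X Y (t * (s * g)) g" "hq p X Y (t * (s * g')) g'"
  using hq_id_left[OF assms(1,4)] hq_id_left[OF assms(2,4)] by (simp_all add: mult.assoc)
 ultimately show ?thesis by (meson hq_sym hq_trans)
qed

definition dn :: "'k::field roof \<Rightarrow> 'k wk" where "dn R = st (ce (rmid R) (rsrc R) (rden R))"
definition nu :: "'k::field roof \<Rightarrow> 'k wk" where "nu R = st (ce (rmid R) (rtgt R) (rnum R))"

text \<open>The roofs with value \<open>g\<close>. The value is numerator divided by denominator,
  written without an inverse as an equation on the middle object.\<close>

definition Gam :: "'k::field cplx \<Rightarrow> 'k cplx \<Rightarrow> 'k wk \<Rightarrow> 'k roof set" where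
 "Gam X Y g = {R. is_roof R \<and> rsrc R = X \<and> rtgt R = Y \<and> H0 (rmid R) Y (g * dn R) (nu R)}"

lemma quasi_iso_chain: "quasi_iso X Y f ==> chain_map X Y f"
 by (simp add: quasi_iso_def)

lemma roof_facts:
 assumes "is_roof R"
 shows "is_cplx (rsrc R)" "is_cplx (rmid R)" "is_cplx (rtgt R)"
  "Z0 (rmid R) (rsrc R) (dn R)" "Z0 (rmid R) (rtgt R) (nu R)"
  "chain_map (rmid R) (rsrc R) (rden R)" "chain_map (rmid R) (rtgt R) (rnum R)"
 using assms by (auto simp: is_roof_def dn_def nu_def intro: chain_Zc quasi_iso_chain)

lemma roof_inverse:
 assumes "is_roof R"
 obtains t where "Z0 (rsrc R) (rmid R) t" "H0 (rmid R) (rmid R) (t * dn R) (fst (Oc (rmid R)))"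
  "H0 (rsrc R) (rsrc R) (dn R * t) (fst (Oc (rsrc R)))"
 using assms quasi_iso_inverse[of "rmid R" "rsrc R" "rden R"] by (auto simp: is_roof_def dn_def)

lemma roof_in_Gam:
 assumes "is_roof R"
 shows "\<exists>g. Z0 (rsrc R) (rtgt R) g \<and> R \<in> Gam (rsrc R) (rtgt R) g"
proof -
 note f = roof_facts[OF assms]
 obtain t where t: "Z0 (rsrc R) (rmid R) t" "H0 (rmid R) (rmid R) (t * dn R) (fst (Oc (rmid R)))"
  using roof_inverse[OF assms] by blast
 have "Z0 (rsrc R) (rtgt R) (nu R * t)" by (rule Zc_comp[OF t(1) f(5)]) simp
 moreover have "H0 (rmid R) (rtgt R) (nu R * t * dn R) (nu R)"
  using hq_id_right[OF f(5) t(2)] by (simp add: mult.assoc)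
 ultimately show ?thesis using assms by (auto simp: Gam_def)
qed

lemma Gam_unique:
 assumes "Z0 X Y g" "Z0 X Y g'" "R \<in> Gam X Y g" "R \<in> Gam X Y g'"
 shows "H0 X Y g g'"
proof -
 have R: "is_roof R" "rsrc R = X" "rtgt R = Y" "H0 (rmid R) Y (g * dn R) (nu R)" "H0 (rmid R) Y (g' * dn R) (nu R)"
  using assms by (auto simp: Gam_def)
 obtain t where t: "Z0 X (rmid R) t" "H0 X X (dn R * t) (fst (Oc X))"
  using roof_inverse[OF R(1)] R(2) by metis
 show ?thesis
  by (rule cancel_right[OF assms(1,2) t hq_trans[OF R(4) hq_sym[OF R(5)]]]) simp
qed

lemma Gam_cong:
 assumes "H0 X Y g g'"
 shows "Gam X Y g = Gam X Y g'"
proof -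
 have "Gam X Y g \<subseteq> Gam X Y g'" if h: "H0 X Y g g'" for g g' :: "'a wk"
 proof
  fix R assume R: "R \<in> Gam X Y g"
  then have r: "is_roof R" "rsrc R = X" by (auto simp: Gam_def)
  have "H0 (rmid R) Y (g' * dn R) (g * dn R)"
   using hq_right[OF hq_sym[OF h], of 0 "Oc (rmid R)" "dn R" 0] roof_facts(4)[OF r(1)] r(2) by simp
  then show "R \<in> Gam X Y g'" using R by (auto simp: Gam_def intro: hq_trans)
 qed
 then show ?thesis using assms hq_sym by blast
qed

lemma ce_ccomp:
 assumes "is_cplx X" "is_cplx Y" "is_cplx Z" "chain_map X Y f" "chain_map Y Z g"
 shows "st (ce X Z (ccomp g f)) = st (ce Y Z g) * st (ce X Y f)" "chain_map X Z (ccomp g f)"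
proof -
 note c = cme_ccomp[OF cplx_bd[OF assms(1)] cplx_bd[OF assms(2)] chain_cmc[OF assms(1,2,4)] chain_cmc[OF assms(2,3,5)]]
 show "chain_map X Z (ccomp g f)"
  using Sc_comp[OF chain_Sc[OF assms(1,2,4)] chain_Sc[OF assms(2,3,5)], of 0] c by (auto simp: chain_map_iff[OF assms(1,3)] simp del: so_sel)
 show "st (ce X Z (ccomp g f)) = st (ce Y Z g) * st (ce X Y f)"
  unfolding c(1) by (rule st_mult) (use chain_Sc assms in \<open>auto simp: Sc_def intro!: Sm_upr\<close>)
qed

lemma roof_eq_Gam:
 assumes g: "Z0 X Y g" and A: "A \<in> Gam X Y g" and eq: "roof_eq A B"
 shows "B \<in> Gam X Y g"
proof -
 have a: "is_roof A" "rsrc A = X" "rtgt A = Y" "H0 (rmid A) Y (g * dn A) (nu A)"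
  using A by (auto simp: Gam_def)
 from eq obtain W p q where e: "is_roof B" "rsrc B = X" "rtgt B = Y" "is_cplx W" "chain_map W (rmid A) p" "chain_map W (rmid B) q"
  "quasi_iso W X (ccomp (rden A) p)" "homotopic W X (ccomp (rden A) p) (ccomp (rden B) q)"
  "homotopic W Y (ccomp (rnum A) p) (ccomp (rnum B) q)"
  using a by (auto simp: roof_eq_def)
 note fA = roof_facts[OF a(1), unfolded a(2,3)] and fB = roof_facts[OF e(1), unfolded e(2,3)]
 define P Q where "P = st (ce W (rmid A) p)" and "Q = st (ce W (rmid B) q)"
 have PQ: "Z0 W (rmid A) P" "Z0 W (rmid B) Q"
  using chain_Zc e fA fB by (auto simp: P_def Q_def)
 have c1: "st (ce W X (ccomp (rden A) p)) = dn A * P" "chain_map W X (ccomp (rden A) p)"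
  using ce_ccomp[OF e(4) fA(2) fA(1) e(5) fA(6)] by (auto simp: dn_def P_def a)
 have c2: "st (ce W X (ccomp (rden B) q)) = dn B * Q" "chain_map W X (ccomp (rden B) q)"
  using ce_ccomp[OF e(4) fB(2) fB(1) e(6) fB(6)] by (auto simp: dn_def Q_def e)
 have c3: "st (ce W Y (ccomp (rnum A) p)) = nu A * P" "chain_map W Y (ccomp (rnum A) p)"
  using ce_ccomp[OF e(4) fA(2) fA(3) e(5) fA(7)] by (auto simp: nu_def P_def a)
 have c4: "st (ce W Y (ccomp (rnum B) q)) = nu B * Q" "chain_map W Y (ccomp (rnum B) q)"
  using ce_ccomp[OF e(4) fB(2) fB(3) e(6) fB(7)] by (auto simp: nu_def Q_def e)
 have h1: "H0 W X (dn A * P) (dn B * Q)"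
  using homotopic_hq[OF e(4) fA(1) c1(2) c2(2) e(8)] by (simp add: c1 c2)
 have h2: "H0 W Y (nu A * P) (nu B * Q)"
  using homotopic_hq[OF e(4) fA(3) c3(2) c4(2) e(9)] by (simp add: c3 c4)
 obtain t where t: "Z0 X W t" "H0 X X (dn A * P * t) (fst (Oc X))"
  using quasi_iso_inverse[OF e(4) fA(1) e(7)] by (auto simp: c1)
 obtain b where b: "Z0 X (rmid B) b" "H0 (rmid B) (rmid B) (b * dn B) (fst (Oc (rmid B)))"
  using roof_inverse[OF e(1)] e(2) by metis
 have dt: "H0 X X (dn B * Q * t) (fst (Oc X))"
  using hq_trans[OF hq_sym[OF hq_right[OF h1 t(1), of 0]] t(2)] by simp
 have tB: "Z0 (rmid B) W (t * dn B)" by (rule Zc_comp[OF fB(4) t(1)]) simp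
 \<comment> \<open>\<open>roof_eq\<close> asks for a quasi-isomorphism on the side of
   \<open>A\<close> only. Up to homotopy \<open>Q\<close> still gets the right inverse
   \<open>t * dn B\<close>, which is enough to cancel it.\<close>
 have inv: "H0 (rmid B) (rmid B) (Q * (t * dn B)) (fst (Oc (rmid B)))"
 proof (rule cancel_left[OF _ _ b(1,2)])
  show "Z0 (rmid B) (rmid B) (Q * (t * dn B))" by (rule Zc_comp[OF tB PQ(2)]) simp
  show "Z0 (rmid B) (rmid B) (fst (Oc (rmid B)))" by (rule Zc_id[OF ob_Oc[OF fB(2)]])
  have "H0 (rmid B) X (dn B * Q * t * dn B) (dn B)" by (rule hq_id_left[OF fB(4) dt])
  moreover have "dn B * fst (Oc (rmid B)) = dn B" using fB(4) by (simp add: Zc_def Cm_def)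
  ultimately show "H0 (rmid B) X (dn B * (Q * (t * dn B))) (dn B * fst (Oc (rmid B)))"
   by (simp add: mult.assoc)
 qed simp
 have "H0 (rmid B) Y (g * dn B) (nu B)"
 proof (rule cancel_right[OF _ fB(5) tB inv])
  show "Z0 (rmid B) Y (g * dn B)" by (rule Zc_comp[OF fB(4) g]) simp
  have "H0 W Y (g * dn B * Q) (g * dn A * P)"
   using hq_left[OF hq_sym[OF h1] g, of 0] by (simp add: mult.assoc)
  moreover have "H0 W Y (g * dn A * P) (nu A * P)" by (rule hq_right[OF a(4) PQ(1)]) simp
  ultimately show "H0 W Y (g * dn B * Q) (nu B * Q)" using h2 by (meson hq_trans)
 qed simp
 then show ?thesis using e by (simp add: Gam_def)
qed

text \<open>One resolution of \<open>X\<close> dominates all roofs out of \<open>X\<close>: the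
  inverse denominators lift to strict maps out of \<open>W\<close>, and equality of values becomes
  chain homotopy there.\<close>

lemma Gam_roof_eq:
 assumes g: "Z0 X Y g" and A: "A \<in> Gam X Y g" and B: "B \<in> Gam X Y g"
 shows "roof_eq A B"
proof -
 have a: "is_roof A" "rsrc A = X" "rtgt A = Y" "H0 (rmid A) Y (g * dn A) (nu A)"
  using A by (auto simp: Gam_def)
 have b: "is_roof B" "rsrc B = X" "rtgt B = Y" "H0 (rmid B) Y (g * dn B) (nu B)"
  using B by (auto simp: Gam_def)
 note fA = roof_facts[OF a(1), unfolded a(2,3)] and fB = roof_facts[OF b(1), unfolded b(2,3)]
 note X = fA(1) and Y = fA(3)
 obtain W r \<eta> where R: "resolution X W r \<eta>" using resolution_exists[OF X] by blast
 then have W: "is_cplx W" and r: "quasi_iso W X r" and eta: "Z0 X W \<eta>" "st (ce W X r) * \<eta> = fst (Oc X)"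
  by (auto simp: resolution_def)
 have rc: "chain_map W X r" by (rule quasi_iso_chain[OF r])
 have lift: "\<exists>p. chain_map W (rmid R') p \<and> chain_map W X (ccomp (rden R') p) \<and> chain_map W Y (ccomp (rnum R') p) \<and>
   H0 X X (st (ce W X (ccomp (rden R') p)) * \<eta>) (fst (Oc X)) \<and>
   H0 X Y (st (ce W Y (ccomp (rnum R') p)) * \<eta>) g"
  if a: "is_roof R'" "rsrc R' = X" "rtgt R' = Y" "H0 (rmid R') Y (g * dn R') (nu R')" for R'
 proof -
  note f = roof_facts[OF a(1), unfolded a(2,3)]
  obtain t where t: "Z0 X (rmid R') t" "H0 X X (dn R' * t) (fst (Oc X))"
   using roof_inverse[OF a(1)] a(2) by metis
  obtain x where x: "Sc 0 (so W) (so (rmid R')) x" "st x * \<eta> = t"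
   using R f(2) t(1) unfolding resolution_def by blast
  then obtain p where p: "chain_map W (rmid R') p" "x = ce W (rmid R') p" using Sc_ex[OF W f(2)] by blast
  note c1 = ce_ccomp[OF W f(2) X p(1) f(6)] and c2 = ce_ccomp[OF W f(2) Y p(1) f(7)]
  have "st (ce W X (ccomp (rden R') p)) * \<eta> = dn R' * t" "st (ce W Y (ccomp (rnum R') p)) * \<eta> = nu R' * t"
   unfolding c1(1) c2(1) mult.assoc p(2)[symmetric] x(2) by (simp_all add: dn_def nu_def a)
  moreover have "H0 X Y (nu R' * t) g"
  proof -
   have "H0 X Y (nu R' * t) (g * dn R' * t)" by (rule hq_right[OF hq_sym[OF a(4)] t(1)]) simp
   moreover have "H0 X Y (g * dn R' * t) g" using hq_id_right[OF g t(2)] by (simp add: mult.assoc)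
   ultimately show ?thesis by (rule hq_trans)
  qed
  ultimately show ?thesis using p(1) c1(2) c2(2) t(2) by auto
 qed
 obtain p where p: "chain_map W (rmid A) p" "chain_map W X (ccomp (rden A) p)" "chain_map W Y (ccomp (rnum A) p)"
   "H0 X X (st (ce W X (ccomp (rden A) p)) * \<eta>) (fst (Oc X))" "H0 X Y (st (ce W Y (ccomp (rnum A) p)) * \<eta>) g"
  using lift[OF a] by blast
 obtain q where q: "chain_map W (rmid B) q" "chain_map W X (ccomp (rden B) q)" "chain_map W Y (ccomp (rnum B) q)"
   "H0 X X (st (ce W X (ccomp (rden B) q)) * \<eta>) (fst (Oc X))" "H0 X Y (st (ce W Y (ccomp (rnum B) q)) * \<eta>) g"
  using lift[OF b] by blast
 have hd: "homotopic W X (ccomp (rden A) p) (ccomp (rden B) q)"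
  by (rule resolution_homotopy[OF X R X p(2) q(2) hq_trans[OF p(4) hq_sym[OF q(4)]]])
 have hn: "homotopic W Y (ccomp (rnum A) p) (ccomp (rnum B) q)"
  by (rule resolution_homotopy[OF X R Y p(3) q(3) hq_trans[OF p(5) hq_sym[OF q(5)]]])
 have hr: "H0 W X (st (ce W X (ccomp (rden A) p))) (st (ce W X r))"
  by (rule homotopic_hq[OF W X p(2) rc resolution_homotopy[OF X R X p(2) rc]])
   (use p(4) eta(2) in simp)
 obtain t where t: "Z0 X W t" "H0 W W (t * st (ce W X r)) (fst (Oc W))" "H0 X X (st (ce W X r) * t) (fst (Oc X))"
  using quasi_iso_inverse[OF W X r] by blast
 have qi: "quasi_iso W X (ccomp (rden A) p)"
  by (rule inverse_quasi_iso[OF W X p(2) t(1)])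
   (use hq_trans[OF hq_left[OF hr t(1), of 0] t(2)] hq_trans[OF hq_right[OF hr t(1), of 0] t(3)] in auto)
 show ?thesis unfolding roof_eq_def
  by (intro conjI exI[of _ W] exI[of _ p] exI[of _ q]) (simp_all add: a(1-3) b(1-3) W p(1) q(1) qi hd hn)
qed

lemma resolution_roof:
 assumes X: "is_cplx X" and Y: "is_cplx Y" and R: "resolution X W r \<eta>" and f: "chain_map W Y f"
  and g: "Z0 X Y g" "st (ce W Y f) * \<eta> = g"
 shows "\<lparr>rsrc = X, rmid = W, rtgt = Y, rden = r, rnum = f\<rparr> \<in> Gam X Y g"
proof -
 have W: "is_cplx W" and r: "quasi_iso W X r" and eta: "Z0 X W \<eta>" "st (ce W X r) * \<eta> = fst (Oc X)"
  using R by (auto simp: resolution_def)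
 obtain t where t: "Z0 X W t" "H0 W W (t * st (ce W X r)) (fst (Oc W))" "H0 X X (st (ce W X r) * t) (fst (Oc X))"
  using quasi_iso_inverse[OF W X r] by blast
 have r0: "Z0 W X (st (ce W X r))" by (rule chain_Zc[OF W X quasi_iso_chain[OF r]])
 have er: "H0 W W (\<eta> * st (ce W X r)) (fst (Oc W))"
 proof (rule cancel_left[OF _ _ t(1,2)])
  show "Z0 W W (\<eta> * st (ce W X r))" by (rule Zc_comp[OF r0 eta(1)]) simp
  show "Z0 W W (fst (Oc W))" by (rule Zc_id[OF ob_Oc[OF W]])
  have "st (ce W X r) * (\<eta> * st (ce W X r)) = st (ce W X r) * fst (Oc W)"
   using r0 eta(2) by (simp add: Zc_def Cm_def flip: mult.assoc)
  then show "H0 W X (st (ce W X r) * (\<eta> * st (ce W X r))) (st (ce W X r) * fst (Oc W))"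
   by (simp add: hq_refl)
 qed simp
 have "H0 W Y (g * st (ce W X r)) (st (ce W Y f))"
  using hq_id_right[OF chain_Zc[OF W Y f] er] by (simp add: g(2)[symmetric] mult.assoc)
 then show ?thesis using X Y W r f by (simp add: Gam_def is_roof_def dn_def nu_def)
qed

lemma resolution_lift:
 assumes X: "is_cplx X" and Y: "is_cplx Y" and R: "resolution X W r \<eta>" and g: "Z0 X Y g"
 obtains f where "chain_map W Y f" "st (ce W Y f) * \<eta> = g"
proof -
 have W: "is_cplx W" using R by (auto simp: resolution_def)
 obtain x where "Sc 0 (so W) (so Y) x" "st x * \<eta> = g" using R Y g unfolding resolution_def by blast
 then show thesis using Sc_ex[OF W Y] that by blast
qed

lemma Gam_nonempty:
 assumes X: "is_cplx X" and Y: "is_cplx Y" and g: "Z0 X Y g"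
 shows "\<exists>R. R \<in> Gam X Y g"
proof -
 obtain W r \<eta> where R: "resolution X W r \<eta>" using resolution_exists[OF X] by blast
 obtain f where "chain_map W Y f" "st (ce W Y f) * \<eta> = g" using resolution_lift[OF X Y R g] .
 then show ?thesis using resolution_roof[OF X Y R _ g] by blast
qed

lemma roof_class_Gam: "Z0 X Y g ==> R \<in> Gam X Y g ==> roof_class R = Gam X Y g"
 unfolding roof_class_def
proof (intro equalityI subsetI)
 fix B assume g: "Z0 X Y g" "R \<in> Gam X Y g"
 show "B \<in> Gam X Y g" if "B \<in> {B. roof_eq R B}" using roof_eq_Gam[OF g] that by simp
 show "B \<in> {B. roof_eq R B}" if "B \<in> Gam X Y g" using Gam_roof_eq[OF g that] by simp
qed

text \<open>Every roof has a value because its denominator is weakly invertible, and every closed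
  weak morphism is the value of a roof whose middle object is a resolution.\<close>

lemma Db_hom_Gam:
 assumes X: "is_cplx X" and Y: "is_cplx Y"
 shows "Db_hom X Y = {Gam X Y g | g. Z0 X Y g}"
proof (intro equalityI subsetI)
 fix c assume "c \<in> Db_hom X Y"
 then obtain R where R: "is_roof R" "rsrc R = X" "rtgt R = Y" "c = roof_class R" by (auto simp: Db_hom_def)
 then obtain g where "Z0 X Y g" "R \<in> Gam X Y g" using roof_in_Gam[OF R(1)] by auto
 then show "c \<in> {Gam X Y g | g. Z0 X Y g}" using roof_class_Gam R(4) by blast
next
 fix c assume "c \<in> {Gam X Y g | g. Z0 X Y g}"
 then obtain g where g: "Z0 X Y g" "c = Gam X Y g" by blast
 then obtain R where R: "R \<in> Gam X Y g" using Gam_nonempty[OF X Y] by blast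
 then have "is_roof R" "rsrc R = X" "rtgt R = Y" by (auto simp: Gam_def)
 then show "c \<in> Db_hom X Y" using roof_class_Gam[OF g(1) R] g(2) unfolding Db_hom_def by blast
qed

lemma Gam_eq_iff:
 assumes "is_cplx X" "is_cplx Y" "Z0 X Y g" "Z0 X Y g'"
 shows "Gam X Y g = Gam X Y g' \<longleftrightarrow> H0 X Y g g'"
 using Gam_nonempty[OF assms(1-3)] Gam_unique[OF assms(3,4)] Gam_cong by blast

lemma ce_cid: "st (ce X X (cid X)) = fst (Oc X)"
 by (simp add: oo_def)

lemma chain_cid:
 assumes "is_cplx X" shows "chain_map X X (cid X)"
 using Sc_id[OF sob_so[OF assms]] cmc_cid by (auto simp: chain_map_iff[OF assms assms])

lemma cid_quasi_iso:
 assumes "is_cplx X" shows "quasi_iso X X (cid X)"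
 by (rule inverse_quasi_iso[OF assms assms chain_cid[OF assms] Zc_id[OF ob_Oc[OF assms]]])
  (use ob_Oc[OF assms] in \<open>auto simp: ce_cid ob_def hq_refl\<close>)

lemma chain_roof_Gam:
 assumes X: "is_cplx X" and Y: "is_cplx Y" and f: "chain_map X Y f"
 shows "chain_roof X Y f = Gam X Y (st (ce X Y f))"
proof -
 note z = chain_Zc[OF X Y f]
 have "\<lparr>rsrc = X, rmid = X, rtgt = Y, rden = cid X, rnum = f\<rparr> \<in> Gam X Y (st (ce X Y f))"
  using X Y f cid_quasi_iso[OF X] z by (simp add: Gam_def is_roof_def dn_def nu_def ce_cid Zc_def Cm_def hq_refl)
 then show ?thesis unfolding chain_roof_def by (rule roof_class_Gam[OF z])
qed

lemma Db_comp_Gam: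
 assumes X: "is_cplx X" and Y: "is_cplx Y" and Z: "is_cplx Z"
  and g: "Z0 X Y g" and h: "Z0 Y Z h"
 shows "Db_comp (Gam Y Z h) (Gam X Y g) = Gam X Z (h * g)"
proof (intro equalityI subsetI)
 have hg: "Z0 X Z (h * g)" by (rule Zc_comp[OF g h]) simp
 fix R assume "R \<in> Db_comp (Gam Y Z h) (Gam X Y g)"
 then obtain A B V p q where A: "A \<in> Gam X Y g" and B: "B \<in> Gam Y Z h" and V: "is_cplx V"
  and p: "quasi_iso V (rmid A) p" and q: "chain_map V (rmid B) q"
  and hm: "homotopic V (rtgt A) (ccomp (rnum A) p) (ccomp (rden B) q)"
  and R: "roof_eq \<lparr>rsrc = rsrc A, rmid = V, rtgt = rtgt B, rden = ccomp (rden A) p, rnum = ccomp (rnum B) q\<rparr> R" (is "roof_eq ?C R")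
  unfolding Db_comp_def by blast
 have a: "is_roof A" "rsrc A = X" "rtgt A = Y" "H0 (rmid A) Y (g * dn A) (nu A)"
  using A by (auto simp: Gam_def)
 have b: "is_roof B" "rsrc B = Y" "rtgt B = Z" "H0 (rmid B) Z (h * dn B) (nu B)"
  using B by (auto simp: Gam_def)
 note fA = roof_facts[OF a(1), unfolded a(2,3)] and fB = roof_facts[OF b(1), unfolded b(2,3)]
 note pc = quasi_iso_chain[OF p]
 define P Q where "P = st (ce V (rmid A) p)" and "Q = st (ce V (rmid B) q)"
 have PQ: "Z0 V (rmid A) P" "Z0 V (rmid B) Q"
  using chain_Zc V pc q fA fB by (auto simp: P_def Q_def)
 have c1: "st (ce V X (ccomp (rden A) p)) = dn A * P"
  using ce_ccomp[OF V fA(2) fA(1) pc fA(6)] by (auto simp: dn_def P_def a)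
 have c2: "st (ce V Y (ccomp (rden B) q)) = dn B * Q" "chain_map V Y (ccomp (rden B) q)"
  using ce_ccomp[OF V fB(2) fB(1) q fB(6)] by (auto simp: dn_def Q_def b)
 have c3: "st (ce V Y (ccomp (rnum A) p)) = nu A * P" "chain_map V Y (ccomp (rnum A) p)"
  using ce_ccomp[OF V fA(2) fA(3) pc fA(7)] by (auto simp: nu_def P_def a)
 have c4: "st (ce V Z (ccomp (rnum B) q)) = nu B * Q"
  using ce_ccomp[OF V fB(2) fB(3) q fB(7)] by (auto simp: nu_def Q_def b)
 have h1: "H0 V Y (nu A * P) (dn B * Q)"
  using homotopic_hq[OF V fA(3) c3(2) c2(2)] hm by (simp add: c3 c2 a)
 have "H0 V Z (h * g * (dn A * P)) (nu B * Q)"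
 proof -
  have "H0 V Z (h * (g * dn A * P)) (h * (nu A * P))"
   by (rule hq_left[OF hq_right[OF a(4) PQ(1), of 0] h]) simp_all
  moreover have "H0 V Z (h * (nu A * P)) (h * (dn B * Q))"
   by (rule hq_left[OF h1 h]) simp
  moreover have "H0 V Z (h * (dn B * Q)) (nu B * Q)"
   using hq_right[OF b(4) PQ(2), of 0] by (simp add: mult.assoc)
  ultimately show ?thesis by (metis hq_trans mult.assoc)
 qed
 moreover have "is_roof ?C" using R unfolding roof_eq_def by (rule conjunct1)
 ultimately have "?C \<in> Gam X Z (h * g)"
  by (simp add: Gam_def a b dn_def nu_def c1 c4)
 then show "R \<in> Gam X Z (h * g)" using roof_eq_Gam[OF hg _ R] by blast
next
 have hg: "Z0 X Z (h * g)" by (rule Zc_comp[OF g h]) simp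
 fix R assume R: "R \<in> Gam X Z (h * g)"
 obtain W r \<eta> where W: "resolution X W r \<eta>" using resolution_exists[OF X] by blast
 obtain V s \<theta> where V: "resolution Y V s \<theta>" using resolution_exists[OF Y] by blast
 have Wc: "is_cplx W" "quasi_iso W X r" "Z0 X W \<eta>" using W by (auto simp: resolution_def)
 have Vc: "is_cplx V" "quasi_iso V Y s" "Z0 Y V \<theta>" "st (ce V Y s) * \<theta> = fst (Oc Y)" using V by (auto simp: resolution_def)
 note sc = quasi_iso_chain[OF Vc(2)]
 obtain a where a: "chain_map W Y a" "st (ce W Y a) * \<eta> = g" using resolution_lift[OF X Y W g] .
 obtain b where b: "chain_map V Z b" "st (ce V Z b) * \<theta> = h" using resolution_lift[OF Y Z V h] .
 \<comment> \<open>The Ore square: the resolution of \<open>Y\<close> receives a strict lift of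
   \<open>g\<close>, so no fibre product has to be formed, and the left denominator is an
   identity.\<close>
 have "Z0 X V (\<theta> * g)" by (rule Zc_comp[OF g Vc(3)]) simp
 from resolution_lift[OF X Vc(1) W this] obtain q where q: "chain_map W V q" "st (ce W V q) * \<eta> = \<theta> * g" .
 let ?A = "\<lparr>rsrc = X, rmid = W, rtgt = Y, rden = r, rnum = a\<rparr>"
 let ?B = "\<lparr>rsrc = Y, rmid = V, rtgt = Z, rden = s, rnum = b\<rparr>"
 have A: "?A \<in> Gam X Y g" by (rule resolution_roof[OF X Y W a(1) g a(2)])
 have B: "?B \<in> Gam Y Z h" by (rule resolution_roof[OF Y Z V b(1) h b(2)])
 note wid = chain_cid[OF Wc(1)] and rc = quasi_iso_chain[OF Wc(2)]
 have ri: "ccomp x (cid W) = x" if "chain_map W T x" "is_cplx T" for x and T :: "'a cplx"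
  using chain_cmc[OF Wc(1) that(2,1)] by (auto simp: ccomp_def cid_def cmc_def fun_eq_iff)
   (metis right_mult_one_mat)
 note c1 = ce_ccomp[OF Wc(1) Vc(1) Y q(1) sc] and c2 = ce_ccomp[OF Wc(1) Vc(1) Z q(1) b(1)]
 have "H0 X Y (st (ce W Y a) * \<eta>) (st (ce W Y (ccomp s q)) * \<eta>)"
 proof -
  have "st (ce W Y (ccomp s q)) * \<eta> = (st (ce V Y s) * \<theta>) * g"
   unfolding c1(1) mult.assoc q(2) by (simp only: mult.assoc)
  also have "\<dots> = g" using g unfolding Vc(4) by (simp add: Zc_def Cm_def)
  finally show ?thesis by (simp add: a(2) hq_refl)
 qed
 then have hm: "homotopic W Y (ccomp a (cid W)) (ccomp s q)"
  unfolding ri[OF a(1) Y] by (rule resolution_homotopy[OF X W Y a(1) c1(2)])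
 let ?C = "\<lparr>rsrc = X, rmid = W, rtgt = Z, rden = ccomp r (cid W), rnum = ccomp b q\<rparr>"
 have "st (ce W Z (ccomp b q)) * \<eta> = h * g"
  unfolding c2(1) mult.assoc q(2) by (simp only: b(2)[symmetric] mult.assoc)
 then have "?C \<in> Gam X Z (h * g)"
  unfolding ri[OF rc X] by (rule resolution_roof[OF X Z W c2(2) hg])
 then have "roof_eq ?C R" by (rule Gam_roof_eq[OF hg _ R])
 then show "R \<in> Db_comp (Gam Y Z h) (Gam X Y g)"
  unfolding Db_comp_def
  using A B Wc(1) cid_quasi_iso[OF Wc(1)] q(1) hm
  by (intro CollectI bexI[of _ ?A] bexI[of _ ?B] exI[of _ W] exI[of _ "cid W"] exI[of _ q]) auto
qed

lemma nu_linear: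
 assumes "is_cplx X" "is_cplx Y" "chain_map X Y f" "chain_map X Y f'"
 shows "st (ce X Y (cadd f f')) = st (ce X Y f) + st (ce X Y f')" "chain_map X Y (cadd f f')"
  "st (ce X Y (cscale c f)) = scw c (st (ce X Y f))" "chain_map X Y (cscale c f)"
proof -
 note b = cplx_bd[OF assms(1)] and m = chain_cmc[OF assms(1,2,3)] chain_cmc[OF assms(1,2,4)]
 note s = chain_Sc[OF assms(1,2,3)] chain_Sc[OF assms(1,2,4)]
 note e = cme_cadd[OF b m] cme_cscale[OF b m(1), of c]
 show "st (ce X Y (cadd f f')) = st (ce X Y f) + st (ce X Y f')" "st (ce X Y (cscale c f)) = scw c (st (ce X Y f))"
  by (simp_all add: e st_simps)
 show "chain_map X Y (cadd f f')" "chain_map X Y (cscale c f)"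
  unfolding chain_map_iff[OF assms(1,2)] e(1,3) using e(2,4) s
  by (auto simp: Sc_def Sm_def ring_dist dgr_add dgr_sc sc_mult_left sc_mult_right)
qed

lemma Db_add_Gam:
 assumes X: "is_cplx X" and Y: "is_cplx Y" and g: "Z0 X Y g" and h: "Z0 X Y h"
 shows "Db_add (Gam X Y g) (Gam X Y h) = Gam X Y (g + h)"
proof (intro equalityI subsetI)
 note gh = Zc_add[OF g h]
 fix R assume "R \<in> Db_add (Gam X Y g) (Gam X Y h)"
 then obtain A B where A: "A \<in> Gam X Y g" and B: "B \<in> Gam X Y h" and e: "rmid A = rmid B" "rden A = rden B"
  and R: "roof_eq (A\<lparr>rnum := cadd (rnum A) (rnum B)\<rparr>) R" (is "roof_eq ?C R") by (auto simp: Db_add_def)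
 have a: "is_roof A" "rsrc A = X" "rtgt A = Y" "H0 (rmid A) Y (g * dn A) (nu A)"
  using A by (auto simp: Gam_def)
 have b: "is_roof B" "rsrc B = X" "rtgt B = Y" "H0 (rmid B) Y (h * dn B) (nu B)"
  using B by (auto simp: Gam_def)
 note fA = roof_facts[OF a(1), unfolded a(2,3)] and fB = roof_facts[OF b(1), unfolded b(2,3)]
 have d: "dn B = dn A" by (simp add: dn_def a b e)
 have "H0 (rmid A) Y ((g + h) * dn A) (nu A + nu B)"
  using hq_add[OF a(4)] b(4) by (simp add: e d distrib_right)
 moreover have "dn ?C = dn A" "nu ?C = nu A + nu B"
  using nu_linear(1)[OF fA(2) Y fA(7), of "rnum B"] fB(7) by (simp_all add: dn_def nu_def e a b)
 moreover have "is_roof ?C" using R unfolding roof_eq_def by (rule conjunct1)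
 ultimately have "?C \<in> Gam X Y (g + h)" by (simp add: Gam_def a)
 then show "R \<in> Gam X Y (g + h)" using roof_eq_Gam[OF gh _ R] by blast
next
 note gh = Zc_add[OF g h]
 fix R assume R: "R \<in> Gam X Y (g + h)"
 obtain W r \<eta> where W: "resolution X W r \<eta>" using resolution_exists[OF X] by blast
 have Wc: "is_cplx W" using W by (auto simp: resolution_def)
 obtain a where a: "chain_map W Y a" "st (ce W Y a) * \<eta> = g" using resolution_lift[OF X Y W g] .
 obtain b where b: "chain_map W Y b" "st (ce W Y b) * \<eta> = h" using resolution_lift[OF X Y W h] .
 \<comment> \<open>Both summands are represented over the same resolution and so have the common
   denominator that \<open>Db_add\<close> demands.\<close>
 let ?A = "\<lparr>rsrc = X, rmid = W, rtgt = Y, rden = r, rnum = a\<rparr>"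
 let ?B = "\<lparr>rsrc = X, rmid = W, rtgt = Y, rden = r, rnum = b\<rparr>"
 have "?A \<in> Gam X Y g" "?B \<in> Gam X Y h"
  using resolution_roof[OF X Y W a(1) g a(2)] resolution_roof[OF X Y W b(1) h b(2)] .
 moreover have "\<lparr>rsrc = X, rmid = W, rtgt = Y, rden = r, rnum = cadd a b\<rparr> \<in> Gam X Y (g + h)"
  using nu_linear(1,2)[OF Wc Y a(1) b(1)] by (intro resolution_roof[OF X Y W _ gh]) (simp_all add: distrib_right a b)
 then have "roof_eq (?A\<lparr>rnum := cadd (rnum ?A) (rnum ?B)\<rparr>) R" using Gam_roof_eq[OF gh _ R] by simp
 ultimately show "R \<in> Db_add (Gam X Y g) (Gam X Y h)"
  unfolding Db_add_def by (intro CollectI bexI[of _ ?A] bexI[of _ ?B]) simp_all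
qed

lemma Db_scale_Gam:
 assumes X: "is_cplx X" and Y: "is_cplx Y" and g: "Z0 X Y g"
 shows "Db_scale c (Gam X Y g) = Gam X Y (scw c g)"
proof (intro equalityI subsetI)
 note cg = Zc_scw[OF g, of c]
 fix R assume "R \<in> Db_scale c (Gam X Y g)"
 then obtain A where A: "A \<in> Gam X Y g" and R: "roof_eq (A\<lparr>rnum := cscale c (rnum A)\<rparr>) R" (is "roof_eq ?C R")
  by (auto simp: Db_scale_def)
 have a: "is_roof A" "rsrc A = X" "rtgt A = Y" "H0 (rmid A) Y (g * dn A) (nu A)"
  using A by (auto simp: Gam_def)
 note fA = roof_facts[OF a(1), unfolded a(2,3)]
 have "H0 (rmid A) Y (scw c g * dn A) (scw c (nu A))"
  using hq_scw[OF a(4)] by (simp add: scw_mult_left)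
 moreover have "dn ?C = dn A" "nu ?C = scw c (nu A)"
  using nu_linear(3)[OF fA(2) Y fA(7) fA(7)] by (simp_all add: dn_def nu_def a)
 moreover have "is_roof ?C" using R unfolding roof_eq_def by (rule conjunct1)
 ultimately have "?C \<in> Gam X Y (scw c g)" by (simp add: Gam_def a)
 then show "R \<in> Gam X Y (scw c g)" using roof_eq_Gam[OF cg _ R] by blast
next
 note cg = Zc_scw[OF g, of c]
 fix R assume R: "R \<in> Gam X Y (scw c g)"
 obtain W r \<eta> where W: "resolution X W r \<eta>" using resolution_exists[OF X] by blast
 have Wc: "is_cplx W" using W by (auto simp: resolution_def)
 obtain a where a: "chain_map W Y a" "st (ce W Y a) * \<eta> = g" using resolution_lift[OF X Y W g] .
 let ?A = "\<lparr>rsrc = X, rmid = W, rtgt = Y, rden = r, rnum = a\<rparr>"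
 have "?A \<in> Gam X Y g" using resolution_roof[OF X Y W a(1) g a(2)] .
 moreover have "\<lparr>rsrc = X, rmid = W, rtgt = Y, rden = r, rnum = cscale c a\<rparr> \<in> Gam X Y (scw c g)"
  using nu_linear(3,4)[OF Wc Y a(1) a(1)] by (intro resolution_roof[OF X Y W _ cg]) (simp_all add: scw_mult_left a)
 then have "roof_eq (?A\<lparr>rnum := cscale c (rnum ?A)\<rparr>) R" using Gam_roof_eq[OF cg _ R] by simp
 ultimately show "R \<in> Db_scale c (Gam X Y g)"
  unfolding Db_scale_def by (intro CollectI bexI[of _ ?A]) simp_all
qed

section \<open>Supertraces and the gluing of homotopies for the two differentials\<close>

section \<open>Duality\<close>

text \<open>The grading operator: the trace of \<open>epm U * x\<close> is the supertrace of
  \<open>x\<close>.\<close>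

definition epm :: "idx set \<Rightarrow> 'k::field bm" where
 "epm U = Abs_fm (\<lambda>i j. if i = j \<and> i \<in> U then sgn1 (td i) else 0)"

lemma ent_epm_times: "finite U ==> ent (epm U * (x :: 'k::field bm)) i j = (if i \<in> U then sgn1 (td i) * ent x i j else 0)"
proof -
 assume U: "finite U"
 have "ent (epm U) i j = (if i = j \<and> i \<in> U then sgn1 (td i) else 0 :: 'k)" for i j
  unfolding epm_def by (subst ent_Abs_fm[OF U]) (auto split: if_splits)
 then show ?thesis by (subst ent_times_sup[of "{i}"]) auto
qed

lemma ent_times_epm: "finite U ==> ent ((x :: 'k::field bm) * epm U) i j = (if j \<in> U then sgn1 (td j) * ent x i j else 0)"
proof -
 assume U: "finite U"
 have "ent (epm U) i j = (if i = j \<and> i \<in> U then sgn1 (td i) else 0 :: 'k)" for i j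
  unfolding epm_def by (subst ent_Abs_fm[OF U]) (auto split: if_splits)
 then show ?thesis by (subst ent_times_sup[of "{j}"]) auto
qed

lemma epm_commute:
 fixes x :: "'k::field bm"
 assumes U: "finite U" and x: "dgr p x" "pr U * x = x" "x * pr U = x"
 shows "epm U * x = sg p (x * epm U)"
proof (rule fm_eqI)
 fix i j
 show "ent (epm U * x) i j = ent (sg p (x * epm U)) i j"
 proof (cases "ent x i j = 0")
  case True
  then show ?thesis by (simp add: ent_epm_times[OF U] ent_times_epm[OF U] ent_sg)
 next
  case False
  have "i \<in> U" "j \<in> U"
   using False arg_cong[OF x(2), of "\<lambda>x. ent x i j"] arg_cong[OF x(3), of "\<lambda>x. ent x i j"]
   by (auto simp: ent_pr_times[OF U] ent_times_pr[OF U] split: if_splits)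
  moreover have "td i = td j + p" using False x(1) by (simp add: dgr_def)
  ultimately show ?thesis
   by (simp add: ent_epm_times[OF U] ent_times_epm[OF U] ent_sg sg_def sgn1_def)
 qed
qed

lemma epm_square: "finite U ==> pr U * x = x ==> epm U * (epm U * x) = x"
proof (rule fm_eqI)
 fix i j assume U: "finite U" and x: "pr U * x = x"
 show "ent (epm U * (epm U * x)) i j = ent x i j"
  using arg_cong[OF x, of "\<lambda>x. ent x i j"]
  by (auto simp: ent_pr_times[OF U] ent_epm_times[OF U] sgn1_def split: if_splits)
qed

lemma tr_epm_dia:
 fixes x y :: "'k::field bm"
 shows "finite U ==> dia x = dia y ==> tr (epm U * x) = tr (epm U * y)"
proof -
 assume U: "finite U" and d: "dia x = dia y"
 have "ent x i i = ent y i i" for i using arg_cong[OF d, of "\<lambda>x. ent x i i"] by simp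
 then have "(\<Sum>i\<in>U. ent (epm U * x) i i) = (\<Sum>i\<in>U. ent (epm U * y) i i)"
  by (simp add: ent_epm_times[OF U])
 moreover have "tr (epm U * z) = (\<Sum>i\<in>U. ent (epm U * z) i i)" for z :: "'k bm"
  by (rule tr_sup[OF U]) (simp add: ent_epm_times[OF U])
 ultimately show ?thesis by simp
qed

text \<open>Nondegeneracy of the trace pairing in a fixed degree. \<open>X\<close> is the transposed
  table of the values of \<open>l\<close> on matrix units of degree \<open>p\<close>.\<close>

lemma linear_functional_trace:
 fixes l :: "'k::field bm \<Rightarrow> 'k"
 assumes add: "!!x y. l (x + y) = l x + l y" and scl: "!!c x. l (sc c x) = c * l x" and U: "finite U"
 shows "\<exists>X. dgr (- p) X \<and> pr U * X = X \<and> X * pr U = X \<and>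
  (\<forall>i\<in>U. \<forall>j\<in>U. td i = td j + p --> ent X j i = l (Em i j)) \<and>
  (\<forall>x. dgr p x --> pr U * x = x --> x * pr U = x --> l x = tr (X * x))"
proof -
 define X where "X = Abs_fm (\<lambda>j i. if i \<in> U \<and> j \<in> U \<and> td i = td j + p then l (Em i j) else 0)"
 have X: "ent X j i = (if i \<in> U \<and> j \<in> U \<and> td i = td j + p then l (Em i j) else 0)" for i j
  unfolding X_def by (subst ent_Abs_fm[OF U]) (auto split: if_splits)
 have l0: "l 0 = 0" using scl[of 0 0] by (simp add: sc_simps)
 have ls: "l (sum f A) = (\<Sum>a\<in>A. l (f a))" if "finite A" for f and A :: "(idx \<times> idx) set"
  using that by (induction A) (auto simp: add l0)
 have ts: "tr (X * sum f A) = (\<Sum>a\<in>A. tr (X * f a))" if "finite A" for f and A :: "(idx \<times> idx) set"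
  using that by (induction A) (auto simp: tr_add distrib_left, simp add: tr_def)
 have "l x = tr (X * x)" if x: "dgr p x" "pr U * x = x" "x * pr U = x" for x
 proof -
  have supp: "i \<in> U \<and> j \<in> U \<and> td i = td j + p" if "ent x i j \<noteq> 0" for i j
   using that x(1) arg_cong[OF x(2), of "\<lambda>x. ent x i j"] arg_cong[OF x(3), of "\<lambda>x. ent x i j"]
   by (auto simp: ent_pr_times[OF U] ent_times_pr[OF U] dgr_def split: if_splits)
  have dec: "x = (\<Sum>q\<in>U \<times> U. sc (ent x (fst q) (snd q)) (Em (fst q) (snd q)))"
   by (rule fm_decomp[OF U]) (use supp in auto)
  have "l x = (\<Sum>q\<in>U \<times> U. ent x (fst q) (snd q) * l (Em (fst q) (snd q)))"
   by (subst dec) (simp add: ls U scl)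
  also have "\<dots> = (\<Sum>q\<in>U \<times> U. ent x (fst q) (snd q) * tr (X * Em (fst q) (snd q)))"
  proof (rule sum.cong[OF refl])
   fix q assume "q \<in> U \<times> U"
   have "tr (X * Em (fst q) (snd q)) = ent X (snd q) (fst q)"
    by (subst tr_mult_commute) (simp add: tr_Em_times)
   then show "ent x (fst q) (snd q) * l (Em (fst q) (snd q)) = ent x (fst q) (snd q) * tr (X * Em (fst q) (snd q))"
    using supp[of "fst q" "snd q"] by (cases "ent x (fst q) (snd q) = 0") (auto simp: X)
  qed
  also have "\<dots> = (\<Sum>q\<in>U \<times> U. tr (X * sc (ent x (fst q) (snd q)) (Em (fst q) (snd q))))"
   by (simp add: sc_mult_right tr_sc)
  also have "\<dots> = tr (X * (\<Sum>q\<in>U \<times> U. sc (ent x (fst q) (snd q)) (Em (fst q) (snd q))))"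
   by (simp add: ts U)
  also have "\<dots> = tr (X * x)" by (simp only: dec[symmetric])
  finally show ?thesis .
 qed
 moreover have "dgr (- p) X" by (auto simp: dgr_def X)
 moreover have "pr U * X = X" by (rule fm_eqI) (simp add: ent_pr_times[OF U] X)
 moreover have "X * pr U = X" by (rule fm_eqI) (simp add: ent_times_pr[OF U] X)
 ultimately show ?thesis using X by (intro exI[of _ X]) auto
qed

text \<open>A closed morphism that is null-homotopic for each of the two differentials separately is
 null-homotopic as soon as there are no obstructing morphisms in the dual degree: a pair of
 homotopies defines a functional on these through the difference of two supertraces, and it can be
 corrected to a single homotopy exactly when this functional comes from the next degree.\<close>

lemma duality_lemma:
 fixes S :: "'k::field so"
 assumes S: "sob S" "se S = pr U" "finite U"
  and g: "Zc n (oo S) (oo S) g"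
  and k: "dgr (- 1) k" "se S * k = k" "k * se S = k" "(sd S + sB S) * k + k * (sd S + sB S) = se S"
  and s': "dgr (n - 1) s'" "se S * s' = s'" "s' * se S = s'" "w2 g = (sd S + sA S) * s' + sg n (s' * (sd S + sA S))"
  and ex: "!!x. Zc (1 - n) (oo S) (oo S) x ==> Nl (1 - n) (oo S) (oo S) x"
 shows "Nl n (oo S) (oo S) g"
proof -
 note sS = S(1)[unfolded sob_def]
 define e D D' where e: "e = se S" and D: "D = sd S + sB S" and D': "D' = sd S + sA S"
 have DD: "D * D = 0" "D' * D' = 0" "dgr 1 D" "dgr 1 D'" "e * D = D" "D * e = D" "e * D' = D'" "D' * e = D'" "e * e = e"
  "dgr 0 e"
  using sS by (auto simp: e D D' ring_dist intro!: dgr_add)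
 have w: "w1 (fst (oo S)) = e" "w2 (fst (oo S)) = e" "w1 (snd (oo S)) = D" "w2 (snd (oo S)) = D'"
  using w_oo[OF S(1)] by (auto simp: e D D')
 have eU: "pr U = e" using S(2) by (simp add: e)
 have gg: "dgr n (w1 g)" "D * w1 g = sg n (w1 g * D)" "e * w1 g = w1 g" "w1 g * e = w1 g"
  using g arg_cong[of _ _ w1] by (auto simp: Zc_def Cm_def dg_def w dest: arg_cong[of _ _ w1])
 \<comment> \<open>The contraction \<open>k\<close> of the first differential makes the first
   component null, with this homotopy.\<close>
 define s where "s = k * w1 g"
 have s: "dgr (n - 1) s" "e * s = s" "s * e = s"
  using dgr_mult[OF k(1) gg(1)] k(2) gg by (simp_all add: s_def e mult.assoc flip: mult.assoc[of "se S" k])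
 have sg1: "w1 g = D * s + sg n (s * D)"
 proof -
  have "sg n (s * D) = k * (D * w1 g)" by (simp add: s_def gg(2) sg_mult_right mult.assoc)
  then have "D * s + sg n (s * D) = (D * k + k * D) * w1 g" by (simp add: s_def distrib_right mult.assoc)
  also have "\<dots> = w1 g" using k(4) gg(3) by (simp add: D e)
  finally show ?thesis by simp
 qed
 interpret V: vector_space "\<lambda>c (x :: 'k bm \<times> 'k bm). (sc c (fst x), sc c (snd x))"
  by unfold_locales (auto simp: sc_simps prod_eq_iff)
 define M where "M = {q :: 'k bm. dgr (n - 2) q \<and> e * q = q \<and> q * e = q}"
 \<comment> \<open>Weak homotopies, changed by boundaries independently in the two components. Such
   boundaries do not alter what the homotopies bound, so membership of \<open>(s, s')\<close> yields
   a common weak homotopy.\<close>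
 define AA where "AA = {(w1 u + (D * q + sg (n - 1) (q * D)), w2 u + (D' * q' + sg (n - 1) (q' * D'))) | u q q'.
   Cm (n - 1) (oo S) (oo S) u \<and> q \<in> M \<and> q' \<in> M}"
 have M: "0 \<in> M" "!!x y. x \<in> M ==> y \<in> M ==> x + y \<in> M" "!!c x. x \<in> M ==> sc c x \<in> M"
  by (auto simp: M_def dgr_add dgr_sc ring_dist sc_mult_left sc_mult_right)
 have AAI: "(w1 u + (D * q + sg (n - 1) (q * D)), w2 u + (D' * q' + sg (n - 1) (q' * D'))) \<in> AA"
  if "Cm (n - 1) (oo S) (oo S) u" "q \<in> M" "q' \<in> M" for u q q' using that by (auto simp: AA_def)
 have sub: "V.subspace AA"
 proof (rule V.subspaceI)
  show "0 \<in> AA" using AAI[OF Cm_0 M(1) M(1)] by (simp add: zero_prod_def)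
  fix x y assume "x \<in> AA" "y \<in> AA"
  then obtain u q q' v r r' where h: "Cm (n - 1) (oo S) (oo S) u" "q \<in> M" "q' \<in> M" "Cm (n - 1) (oo S) (oo S) v" "r \<in> M" "r' \<in> M"
   and xy: "x = (w1 u + (D * q + sg (n - 1) (q * D)), w2 u + (D' * q' + sg (n - 1) (q' * D')))"
    "y = (w1 v + (D * r + sg (n - 1) (r * D)), w2 v + (D' * r' + sg (n - 1) (r' * D')))"
   by (auto simp: AA_def)
  show "x + y \<in> AA"
   using AAI[OF Cm_add[OF h(1,4)] M(2)[OF h(2,5)] M(2)[OF h(3,6)]] by (simp add: xy ring_dist sgs add_ac)
 next
  fix c x assume "x \<in> AA"
  then obtain u q q' where h: "Cm (n - 1) (oo S) (oo S) u" "q \<in> M" "q' \<in> M"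
   and x: "x = (w1 u + (D * q + sg (n - 1) (q * D)), w2 u + (D' * q' + sg (n - 1) (q' * D')))"
   by (auto simp: AA_def)
  have sgsc: "sg m (sc c z) = sc c (sg m z)" for m and z :: "'k bm" by (simp add: sg_def sc_simps)
  show "(sc c (fst x), sc c (snd x)) \<in> AA"
   using AAI[OF Cm_scw[OF h(1), of c] M(3)[OF h(2)] M(3)[OF h(3)], of c c]
   by (simp add: x sc_simps sc_mult_left sc_mult_right sgsc)
 qed
 have "(s, s') \<in> AA"
 proof (rule ccontr)
  assume "(s, s') \<notin> AA"
  from V.separating_functional[OF sub this] obtain l :: "'k bm \<times> 'k bm \<Rightarrow> 'k"
   where ladd: "!!x y. l (x + y) = l x + l y" and lsc: "!!c x. l (sc c (fst x), sc c (snd x)) = c * l x"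
    and lA: "!!x. x \<in> AA ==> l x = 0" and l1: "l (s, s') = 1" by blast
  define l1 l2 where "l1 x = l (x, 0)" and "l2 x = l (0, x)" for x
  have lsplit: "l (x, y) = l1 x + l2 y" for x y
   using ladd[of "(x, 0)" "(0, y)"] by (simp add: l1_def l2_def)
  have lin1: "l1 (x + y) = l1 x + l1 y" "l1 (sc c x) = c * l1 x" for x y c
   using ladd[of "(x, 0)" "(y, 0)"] lsc[of c "(x, 0)"] by (simp_all add: l1_def sc_simps)
  have lin2: "l2 (x + y) = l2 x + l2 y" "l2 (sc c x) = c * l2 x" for x y c
   using ladd[of "(0, x)" "(0, y)"] lsc[of c "(0, x)"] by (simp_all add: l2_def sc_simps)
  obtain X1 where X1: "dgr (- (n - 1)) X1" "e * X1 = X1" "X1 * e = X1"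
   "!!i j. i \<in> U ==> j \<in> U ==> td i = td j + (n - 1) ==> ent X1 j i = l1 (Em i j)"
   "!!x. dgr (n - 1) x ==> e * x = x ==> x * e = x ==> l1 x = tr (X1 * x)"
   using linear_functional_trace[of l1 U "n - 1", OF lin1 S(3)] unfolding eU by blast
  obtain X2 where X2: "dgr (- (n - 1)) X2" "e * X2 = X2" "X2 * e = X2"
   "!!i j. i \<in> U ==> j \<in> U ==> td i = td j + (n - 1) ==> ent X2 j i = l2 (Em i j)"
   "!!x. dgr (n - 1) x ==> e * x = x ==> x * e = x ==> l2 x = tr (X2 * x)"
   using linear_functional_trace[of l2 U "n - 1", OF lin2 S(3)] unfolding eU by blast
  have suppX: "i \<in> U \<and> j \<in> U \<and> td i = td j + (n - 1)" if "X = X1 \<or> X = X2" "ent X j i \<noteq> 0" for X i j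
  proof -
   have h: "pr U * X = X" "X * pr U = X" "dgr (- (n - 1)) X" using that X1 X2 eU by auto
   show ?thesis
    using that(2) arg_cong[OF h(1), of "\<lambda>x. ent x j i"] arg_cong[OF h(2), of "\<lambda>x. ent x j i"] h(3)
    by (auto simp: ent_pr_times[OF S(3)] ent_times_pr[OF S(3)] dgr_def split: if_splits)
  qed
  have Em_e: "e * Em i j = Em i j" "Em i j * e = Em i j" if "i \<in> U" "j \<in> U" for i j
   using that unfolding eU[symmetric]
   by (auto intro!: fm_eqI simp: ent_pr_times[OF S(3)] ent_times_pr[OF S(3)])
  have Em_d: "dgr p (Em i j)" if "td i = td j + p" for i j p using that by (auto simp: dgr_def)
  have Cmwk: "Cm (n - 1) (oo S) (oo S) (wk x y)" if "upr x" "upr y" "dia x = dia y" "dgr (n - 1) x" "dgr (n - 1) y"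
   "e * x = x" "x * e = x" "e * y = y" "y * e = y" for x y
   using that w_wk[OF that(1-3)] by (auto simp: Cm_def dg_def w intro!: wk_eqI)
  have lC: "l (w1 u, w2 u) = 0" if "Cm (n - 1) (oo S) (oo S) u" for u
   using lA[OF AAI[OF that M(1) M(1)]] by simp
  \<comment> \<open>Since \<open>l\<close> vanishes on weak pairs, testing on matrix units shows
    that \<open>X1\<close> and \<open>X2\<close> are triangular with opposite diagonals: up to signs
    they form a weak morphism.\<close>
  have u12: "upr X1" "upr X2"
  proof -
   have "vn (vt i) \<le> vn (vt j)" if X: "X = X1 \<or> X = X2" and nz: "ent X j i \<noteq> 0" for X i j
   proof (rule ccontr)
    assume v: "\<not> vn (vt i) \<le> vn (vt j)"
    note b = suppX[OF X nz]
    have up: "upr (Em i j :: 'k bm)" "dia (Em i j :: 'k bm) = 0"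
     using v by (auto simp: upr_def intro!: fm_eqI)
    have E: "e * Em i j = Em i j" "Em i j * e = Em i j" "dgr (n - 1) (Em i j :: 'k bm)"
     using Em_e[of i j] Em_d[of i j "n - 1"] b by blast+
    have W: "w1 (wk (Em i j) 0) = (Em i j :: 'k bm)" "w2 (wk (Em i j) 0) = (0 :: 'k bm)"
     "w1 (wk 0 (Em i j)) = (0 :: 'k bm)" "w2 (wk 0 (Em i j)) = (Em i j :: 'k bm)"
     using up w_wk[of "Em i j :: 'k bm" 0] w_wk[of 0 "Em i j :: 'k bm"] by simp_all
    have "l (Em i j, 0) = 0" "l (0, Em i j) = 0"
     using lC[OF Cmwk[of "Em i j" 0]] lC[OF Cmwk[of 0 "Em i j"]] by (simp_all add: up E W)
    then show False using X1(4)[of i j] X2(4)[of i j] b nz X by (auto simp: l1_def l2_def)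
   qed
   then show "upr X1" "upr X2" unfolding upr_def by blast+
  qed
  have d12: "dia X1 = - dia X2"
  proof (rule fm_eqI)
   fix j i
   show "ent (dia X1) j i = ent (- dia X2) j i"
   proof (cases "i \<in> U \<and> j \<in> U \<and> td i = td j + (n - 1) \<and> vt j = vt i")
    case True
    have up: "upr (Em i j :: 'k bm)" using True by (auto simp: upr_def)
    have E: "e * Em i j = Em i j" "Em i j * e = Em i j" "dgr (n - 1) (Em i j :: 'k bm)"
     using Em_e[of i j] Em_d[of i j "n - 1"] True by blast+
    have W: "w1 (wk (Em i j) (Em i j)) = (Em i j :: 'k bm)" "w2 (wk (Em i j) (Em i j)) = (Em i j :: 'k bm)"
     using up w_wk[of "Em i j :: 'k bm" "Em i j"] by simp_all
    have "l (Em i j, Em i j) = 0"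
     using lC[OF Cmwk[of "Em i j" "Em i j"]] by (simp add: up E W)
    then show ?thesis using X1(4)[of i j] X2(4)[of i j] True lsplit[of "Em i j" "Em i j"]
     by (simp add: add_eq_0_iff2)
   next
    case False
    then show ?thesis using suppX[of X1 j i] suppX[of X2 j i]
     by (cases "ent X1 j i = 0"; cases "ent X2 j i = 0"; cases "vt j = vt i") auto
   qed
  qed
  \<comment> \<open>Orthogonality to the boundaries of \<open>M\<close> means, by cyclicity of the
    trace, that the representing matrix commutes with the differential up to sign.\<close>
  have comm: "D1 * X = sg n (X * D1)"
   if X: "dgr (- (n - 1)) X" "e * X = X" "X * e = X" and D1: "dgr 1 D1" "e * D1 = D1" "D1 * e = D1"
    and z: "!!q. q \<in> M ==> tr (X * (D1 * q + sg (n - 1) (q * D1))) = 0" for X D1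
  proof -
   define Z where "Z = X * D1 + sg (n - 1) (D1 * X)"
   have Zs: "dgr (2 - n) Z" "e * Z = Z" "Z * e = Z"
   proof -
    show "dgr (2 - n) Z"
     using dgr_mult[OF X(1) D1(1)] dgr_mult[OF D1(1) X(1)] by (auto simp: Z_def algebra_simps intro!: dgr_add)
    show "e * Z = Z" using X D1 by (simp add: Z_def distrib_left sg_mult_right flip: mult.assoc)
    show "Z * e = Z" using X D1 by (simp add: Z_def distrib_right sg_mult_left mult.assoc)
   qed
   have zt: "tr (Z * q) = 0" if "q \<in> M" for q
   proof -
    have "tr (sg (n - 1) (X * q * D1)) = tr (sg (n - 1) (D1 * X * q))"
     using tr_mult_commute[of "X * q" D1] by (simp add: sg_def tr_uminus mult.assoc)
    then show ?thesis using z[OF that]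
     by (simp add: Z_def distrib_left distrib_right tr_add sg_mult_right sg_mult_left mult.assoc)
   qed
   have "Z = 0"
   proof (rule fm_eqI, rule ccontr)
    fix j i assume nz: "ent Z j i \<noteq> ent 0 j i"
    have b: "i \<in> U" "j \<in> U"
     using nz arg_cong[OF Zs(2), of "\<lambda>x. ent x j i"] arg_cong[OF Zs(3), of "\<lambda>x. ent x j i"]
     unfolding eU[symmetric] by (auto simp: ent_pr_times[OF S(3)] ent_times_pr[OF S(3)] split: if_splits)
    have "td j = td i + (2 - n)" using nz Zs(1) by (simp add: dgr_def)
    then have "Em i j \<in> M" using Em_e[OF b] Em_d[of i j "n - 2"] by (simp add: M_def)
    from zt[OF this] have "ent Z j i = 0" by (subst (asm) tr_mult_commute) (simp add: tr_Em_times)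
    then show False using nz by simp
   qed
   then have "X * D1 = - sg (n - 1) (D1 * X)" by (simp add: Z_def add_eq_0_iff2)
   then show ?thesis by (simp add: sg_def)
  qed
  have dQ: "dgr (n - 1) (D1 * q + sg (n - 1) (q * D1))" "e * (D1 * q + sg (n - 1) (q * D1)) = D1 * q + sg (n - 1) (q * D1)"
   "(D1 * q + sg (n - 1) (q * D1)) * e = D1 * q + sg (n - 1) (q * D1)"
   if "q \<in> M" "dgr 1 D1" "e * D1 = D1" "D1 * e = D1" for q D1
  proof -
   have q: "dgr (n - 2) q" "e * q = q" "q * e = q" using that by (auto simp: M_def)
   show "dgr (n - 1) (D1 * q + sg (n - 1) (q * D1))"
    using dgr_mult[OF that(2) q(1)] dgr_mult[OF q(1) that(2)] by (auto intro!: dgr_add)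
   show "e * (D1 * q + sg (n - 1) (q * D1)) = D1 * q + sg (n - 1) (q * D1)"
    using q that by (simp add: distrib_left sg_mult_right flip: mult.assoc)
   show "(D1 * q + sg (n - 1) (q * D1)) * e = D1 * q + sg (n - 1) (q * D1)"
    using q that by (simp add: distrib_right sg_mult_left mult.assoc)
  qed
  have l20: "l1 0 = 0" "l2 0 = 0" using lin1(2)[of 0 0] lin2(2)[of 0 0] by (simp_all add: sc_simps)
  have c1: "D * X1 = sg n (X1 * D)"
  proof (rule comm[OF X1(1-3) DD(3,5,6)])
   fix q assume q: "q \<in> M"
   have "l1 (D * q + sg (n - 1) (q * D)) = 0"
    using lA[OF AAI[OF Cm_0 q M(1)]] l20 by (simp add: lsplit)
   then show "tr (X1 * (D * q + sg (n - 1) (q * D))) = 0"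
    using X1(5)[OF dQ[OF q DD(3,5,6)]] by simp
  qed
  have c2: "D' * X2 = sg n (X2 * D')"
  proof (rule comm[OF X2(1-3) DD(4,7,8)])
   fix q assume q: "q \<in> M"
   have "l2 (D' * q + sg (n - 1) (q * D')) = 0"
    using lA[OF AAI[OF Cm_0 M(1) q]] l20 by (simp add: lsplit)
   then show "tr (X2 * (D' * q + sg (n - 1) (q * D'))) = 0"
    using X2(5)[OF dQ[OF q DD(4,7,8)]] by simp
  qed
  define \<epsilon> where "\<epsilon> = (epm U :: 'k bm)"
  have \<epsilon>c: "\<epsilon> * x = sg p (x * \<epsilon>)" if "dgr p x" "e * x = x" "x * e = x" for p x
   using epm_commute[OF S(3) that(1)] that eU by (simp add: \<epsilon>_def)
  have \<epsilon>2: "\<epsilon> * (\<epsilon> * x) = x" if "e * x = x" for x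
  proof -
   have "pr U * x = x" using that by (simp only: eU)
   then show ?thesis unfolding \<epsilon>_def by (rule epm_square[OF S(3)])
  qed
  have \<epsilon>d: "dia \<epsilon> = \<epsilon>" "dgr 0 \<epsilon>" "e * \<epsilon> = \<epsilon>"
  proof -
   have ee: "ent \<epsilon> i j = (if i = j \<and> i \<in> U then sgn1 (td i) else 0)" for i j
    unfolding \<epsilon>_def epm_def by (subst ent_Abs_fm[OF S(3)]) (auto split: if_splits)
   show "dia \<epsilon> = \<epsilon>" by (rule fm_eqI) (auto simp: ee)
   show "dgr 0 \<epsilon>" by (auto simp: dgr_def ee split: if_splits)
   show "e * \<epsilon> = \<epsilon>" unfolding eU[symmetric] by (rule fm_eqI) (simp add: ent_pr_times[OF S(3)] ee)
  qed
  \<comment> \<open>Multiplication by the grading operator corrects the sign of the commutation and,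
    with the minus sign, makes the diagonals equal. The result is a closed weak morphism of degree 1
    - n, to which \<open>ex\<close> applies.\<close>
  define y1 y2 where "y1 = \<epsilon> * X1" and "y2 = - (\<epsilon> * X2)"
  have Dy: "D * y1 = sg (1 - n) (y1 * D)" "D' * y2 = sg (1 - n) (y2 * D')"
  proof -
   have a: "D1 * (\<epsilon> * x) = - (\<epsilon> * (D1 * x))" if "dgr 1 D1" "e * D1 = D1" "D1 * e = D1" for D1 x
    using \<epsilon>c[OF that] by (simp flip: mult.assoc)
   show "D * y1 = sg (1 - n) (y1 * D)" "D' * y2 = sg (1 - n) (y2 * D')"
    using a[OF DD(3,5,6), of X1] a[OF DD(4,7,8), of X2] by (simp_all add: y1_def y2_def c1 c2 sg_def mult.assoc)
  qed
  have ye: "e * y1 = y1" "y1 * e = y1" "e * y2 = y2" "y2 * e = y2" "dgr (1 - n) y1" "dgr (1 - n) y2"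
   using \<epsilon>d X1 X2 dgr_mult[OF \<epsilon>d(2) X1(1)] dgr_mult[OF \<epsilon>d(2) X2(1)]
   by (auto simp: y1_def y2_def mult.assoc mult_assoc_eq[OF \<epsilon>d(3)])
  have yu: "upr y1" "upr y2" "dia y1 = dia y2"
   using u12 d12 \<epsilon>d(1) dia_upr[OF \<epsilon>d(1)] by (auto simp: y1_def y2_def dia_mult_left intro!: upr_mult)
  define Y where "Y = wk y1 y2"
  have wY: "w1 Y = y1" "w2 Y = y2" using w_wk[OF yu] by (auto simp: Y_def)
  have "Zc (1 - n) (oo S) (oo S) Y"
   unfolding Zc_def Cm_def using ye Dy by (auto simp: dg_def wY w intro!: wk_eqI)
  then obtain h where h: "Cm (1 - n - 1) (oo S) (oo S) h" "Y = snd (oo S) * h + sg (1 - n) (h * snd (oo S))"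
   using ex unfolding Nl_def by blast
  have y: "y1 = D * w1 h + sg (1 - n) (w1 h * D)" "y2 = D' * w2 h + sg (1 - n) (w2 h * D')"
   using arg_cong[OF h(2), of w1] arg_cong[OF h(2), of w2] by (simp_all add: wY w)
  \<comment> \<open>Integration by parts: under the supertrace the differential moves from one
    factor to the other.\<close>
  have key: "tr (\<epsilon> * (y * t)) = - (sg n (tr (\<epsilon> * (z * f))))"
   if y: "y = D1 * z + sg (1 - n) (z * D1)" and f: "f = D1 * t + sg n (t * D1)" and D1: "dgr 1 D1" "e * D1 = D1" "D1 * e = D1" for y z t f D1
  proof -
   have "\<epsilon> * (D1 * x) = - (D1 * (\<epsilon> * x))" for x using \<epsilon>c[OF D1] by (simp flip: mult.assoc)
   then have "tr (\<epsilon> * (D1 * (z * t))) = - tr (D1 * (\<epsilon> * (z * t)))" by (simp add: tr_uminus)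
   also have "tr (D1 * (\<epsilon> * (z * t))) = tr (\<epsilon> * (z * (t * D1)))" by (subst tr_mult_commute) (simp add: mult.assoc)
   finally have "tr (\<epsilon> * (D1 * (z * t))) = - tr (\<epsilon> * (z * (t * D1)))" .
   then show ?thesis
    by (simp add: y f distrib_left distrib_right mult.assoc tr_add sg_def tr_uminus)
  qed
  have k1: "tr (\<epsilon> * (y1 * s)) = - (sg n (tr (\<epsilon> * (w1 h * w1 g))))"
   by (rule key[OF y(1) sg1 DD(3,5,6)])
  have k2: "tr (\<epsilon> * (y2 * s')) = - (sg n (tr (\<epsilon> * (w2 h * w2 g))))"
   by (rule key[OF y(2) _ DD(4,7,8)]) (use s'(4) in \<open>simp add: D'\<close>)
  \<comment> \<open>The supertrace sees only diagonals, which are common to both components. Hence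
    the two contributions to \<open>l (s, s')\<close> cancel.\<close>
  have "tr (\<epsilon> * (w1 h * w1 g)) = tr (\<epsilon> * (w2 h * w2 g))"
   unfolding \<epsilon>_def by (rule tr_epm_dia[OF S(3)]) (simp add: dia_mult dia_w)
  then have eq: "tr (\<epsilon> * (y1 * s)) = tr (\<epsilon> * (y2 * s'))" using k1 k2 by simp
  have "l (s, s') = tr (X1 * s) + tr (X2 * s')"
   using X1(5)[OF s] X2(5)[of s'] s' by (simp add: lsplit e)
  moreover have "X1 * s = \<epsilon> * (y1 * s)" "X2 * s' = - (\<epsilon> * (y2 * s'))"
   using \<epsilon>2[OF X1(2)] \<epsilon>2[OF X2(2)] by (simp_all add: y1_def y2_def flip: mult.assoc)
  ultimately show False using eq l1 by (simp add: tr_uminus)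
 qed
 then obtain u q q' where u: "Cm (n - 1) (oo S) (oo S) u"
  and s2: "s = w1 u + (D * q + sg (n - 1) (q * D))" "s' = w2 u + (D' * q' + sg (n - 1) (q' * D'))"
  by (auto simp: AA_def)
 have z: "D1 * (D1 * q + sg (n - 1) (q * D1)) + sg n ((D1 * q + sg (n - 1) (q * D1)) * D1) = 0" if "D1 * D1 = 0" for D1 q :: "'k bm"
  using that by (simp add: ring_dist sg_def mult.assoc) (simp add: that flip: mult.assoc)
 have "w1 g = D * w1 u + sg n (w1 u * D)"
  using z[OF DD(1), of q] unfolding sg1 s2(1) by (simp add: ring_dist sgs)
 moreover have "w2 g = D' * w2 u + sg n (w2 u * D')"
  using z[OF DD(2), of q'] s'(4) unfolding s2(2) D'[symmetric] by (simp add: ring_dist sgs)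
 ultimately have "g = snd (oo S) * u + sg n (u * snd (oo S))"
  by (intro wk_eqI) (simp_all add: w)
 then show ?thesis using u unfolding Nl_def by blast
qed

section \<open>Hom from \<open>P\<close> as cohomology of \<open>d + B\<close>, its dual as Hom to
  \<open>Q\<close>, and the groups between \<open>P\<close> and \<open>Q\<close>\<close>

section \<open>Morphisms from and to the two string modules\<close>

abbreviation o1 :: idx where "o1 \<equiv> ((0, V1), 0)"
abbreviation o2 :: idx where "o2 \<equiv> ((0, V2), 0)"
abbreviation o3 :: idx where "o3 \<equiv> ((0, V3), 0)"

definition Ps :: "'k::field so" where
 "Ps = \<lparr>se = Em o1 o1 + Em o2 o2 + Em o3 o3, sd = 0, sA = Em o2 o1, sB = Em o3 o2\<rparr>"

text \<open>Exchanging the \<alpha> and \<beta> arrows is a symmetry of the quiver and its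
  relations. It swaps the two arrow classes and the two string modules, so only \<open>P\<close> has
  to be computed.\<close>

definition swp :: "'k::field so \<Rightarrow> 'k so" where
 "swp S = \<lparr>se = se S, sd = sd S, sA = sB S, sB = sA S\<rparr>"

definition Qs :: "'k::field so" where "Qs = swp Ps"

definition sw :: "'k::field wk \<Rightarrow> 'k wk" where "sw g = wk (w2 g) (w1 g)"

lemma swp_sel [simp]: "se (swp S) = se S" "sd (swp S) = sd S" "sA (swp S) = sB S" "sB (swp S) = sA S" "swp (swp S) = S"
 by (simp_all add: swp_def)

lemma Ps_sel [simp]: "se Ps = Em o1 o1 + Em o2 o2 + Em o3 o3" "sd Ps = 0" "sA Ps = Em o2 o1" "sB Ps = Em o3 o2"
 by (simp_all add: Ps_def)

lemma swp_Ps: "swp Ps = Qs" "swp Qs = Ps"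
 by (simp_all add: Qs_def)

lemma Qs_sel [simp]: "se Qs = Em o1 o1 + Em o2 o2 + Em o3 o3" "sd Qs = 0" "sA Qs = Em o3 o2" "sB Qs = Em o2 o1"
 by (simp_all add: Qs_def)

lemma sob_Ps: "sob (Ps :: 'k::field so)"
proof -
 have "dgr 0 (se Ps :: 'k bm)" by (auto simp: dgr_def split: if_splits)
 moreover have "dia (se Ps :: 'k bm) = se Ps" by (rule fm_eqI) auto
 ultimately show ?thesis
  by (simp add: sob_def distrib_left distrib_right Em_times_Em) (auto simp: dgr_def vst_def)
qed

lemma sob_swp [simp]: "sob (swp S) \<longleftrightarrow> sob S"
 by (auto simp: sob_def)

lemma sob_Qs: "sob Qs"
 by (simp add: Qs_def sob_Ps)

lemma w_sw [simp]: "w1 (sw g) = w2 g" "w2 (sw g) = w1 g"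
 using w_wk[of "w2 g" "w1 g"] by (auto simp: sw_def dia_w)

lemma sw_simps: "sw (x * y) = sw x * sw y" "sw (x + y) = sw x + sw y" "sw (x - y) = sw x - sw y" "sw (sg p x) = sg p (sw x)"
 "sw (scw c x) = scw c (sw x)"
 by (rule wk_eqI; simp)+

lemma sw_sw [simp]: "sw (sw x) = x"
 by (rule wk_eqI; simp)

lemma sw_eq: "sw x = sw y \<longleftrightarrow> x = y"
 by (metis sw_sw)

lemma oo_swp: "sob S ==> fst (oo (swp S)) = sw (fst (oo S)) \<and> snd (oo (swp S)) = sw (snd (oo S))"
 by (auto intro!: wk_eqI simp: w_oo)

lemma Cm_swp: "sob S ==> sob T ==> Cm p (oo (swp S)) (oo (swp T)) (sw g) \<longleftrightarrow> Cm p (oo S) (oo T) g"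
 by (auto simp: Cm_def oo_swp dg_def sw_eq simp flip: sw_simps)

lemma Zc_swp: "sob S ==> sob T ==> Zc p (oo (swp S)) (oo (swp T)) (sw g) \<longleftrightarrow> Zc p (oo S) (oo T) g"
 by (auto simp: Zc_def Cm_swp) (simp_all add: oo_swp sw_eq flip: sw_simps)

lemma Nl_swp:
 assumes "sob S" "sob T"
 shows "Nl p (oo (swp S)) (oo (swp T)) (sw g) \<longleftrightarrow> Nl p (oo S) (oo T) g"
proof -
 have a: "Nl p (oo (swp S)) (oo (swp T)) (sw g)" if nl: "Nl p (oo S) (oo T) g" and ST: "sob S" "sob T" for S T :: "'a so" and g
 proof -
  obtain h where h: "Cm (p - 1) (oo S) (oo T) h" "g = snd (oo T) * h + sg p (h * snd (oo S))"
   using nl unfolding Nl_def by blast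
  have "Cm (p - 1) (oo (swp S)) (oo (swp T)) (sw h)" using h(1) ST by (simp add: Cm_swp)
  moreover have "sw g = snd (oo (swp T)) * sw h + sg p (sw h * snd (oo (swp S)))"
   using ST by (simp add: h(2) oo_swp sw_simps)
  ultimately show ?thesis unfolding Nl_def by blast
 qed
 show ?thesis using a[of S T g] a[of "swp S" "swp T" "sw g"] assms by auto
qed

lemma Zc_Qs: "sob T ==> Zc p (oo Qs) (oo T) x \<longleftrightarrow> Zc p (oo Ps) (oo (swp T)) (sw x)"
 using Zc_swp[OF sob_Ps, of "swp T" p "sw x"] by (simp add: swp_Ps)

lemma Nl_Qs: "sob T ==> Nl p (oo Qs) (oo T) x \<longleftrightarrow> Nl p (oo Ps) (oo (swp T)) (sw x)"
 using Nl_swp[OF sob_Ps, of "swp T" p "sw x"] by (simp add: swp_Ps)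

lemma vn_bounds: "1 \<le> vn v" "vn v \<le> 3"
 by (cases v; simp)+

lemma upr_column1: "x * Em o1 o1 = x ==> upr x"
 unfolding upr_def
proof (intro allI impI)
 fix i j assume h: "x * Em o1 o1 = x" and nz: "ent x i j \<noteq> 0"
 have "ent (x * Em o1 o1) i j \<noteq> 0" unfolding h by (rule nz)
 then have "j = o1" by (simp add: ent_times_Em split: if_splits)
 then show "vn (vt j) \<le> vn (vt i)" using vn_bounds(1)[of "vt i"] by simp
qed

lemma upr_row3: "Em o3 o3 * x = x ==> upr x"
 unfolding upr_def
proof (intro allI impI)
 fix i j assume h: "Em o3 o3 * x = x" and nz: "ent x i j \<noteq> 0"
 have "ent (Em o3 o3 * x) i j \<noteq> 0" unfolding h by (rule nz)
 then have "i = o3" by (simp add: ent_Em_times split: if_splits)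
 then show "vn (vt j) \<le> vn (vt i)" using vn_bounds(2)[of "vt j"] by simp
qed

lemma w_oo_Ps: "w1 (fst (oo Ps)) = Em o1 o1 + Em o2 o2 + Em o3 o3" "w2 (fst (oo Ps)) = Em o1 o1 + Em o2 o2 + Em o3 o3"
  "w1 (snd (oo Ps)) = Em o3 o2" "w2 (snd (oo Ps)) = Em o2 o1"
 using w_oo[OF sob_Ps] by simp_all

lemma w_oo_Qs: "w1 (fst (oo Qs)) = Em o1 o1 + Em o2 o2 + Em o3 o3" "w2 (fst (oo Qs)) = Em o1 o1 + Em o2 o2 + Em o3 o3"
  "w1 (snd (oo Qs)) = Em o2 o1" "w2 (snd (oo Qs)) = Em o3 o2"
 using w_oo[OF sob_Qs] by simp_all

lemma Zc_w:
 assumes "sob S" "sob T" "Zc p (oo S) (oo T) x"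
 shows "dgr p (w1 x)" "dgr p (w2 x)" "se T * w1 x = w1 x" "se T * w2 x = w2 x" "w1 x * se S = w1 x" "w2 x * se S = w2 x"
  "(sd T + sB T) * w1 x = sg p (w1 x * (sd S + sB S))" "(sd T + sA T) * w2 x = sg p (w2 x * (sd S + sA S))"
proof -
 have h: "fst (oo T) * x = x" "x * fst (oo S) = x" "snd (oo T) * x = sg p (x * snd (oo S))" "dg p x"
  using assms(3) by (auto simp: Zc_def Cm_def)
 show "dgr p (w1 x)" "dgr p (w2 x)" using h(4) by (auto simp: dg_def)
 show "se T * w1 x = w1 x" "se T * w2 x = w2 x" using arg_cong[OF h(1), of w1] arg_cong[OF h(1), of w2] by (simp_all add: w_oo assms)
 show "w1 x * se S = w1 x" "w2 x * se S = w2 x" using arg_cong[OF h(2), of w1] arg_cong[OF h(2), of w2] by (simp_all add: w_oo assms)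
 show "(sd T + sB T) * w1 x = sg p (w1 x * (sd S + sB S))" "(sd T + sA T) * w2 x = sg p (w2 x * (sd S + sA S))"
  using arg_cong[OF h(3), of w1] arg_cong[OF h(3), of w2] by (simp_all add: w_oo assms)
qed

lemma Zc_wI:
 assumes "sob S" "sob T" "upr a" "upr b" "dia a = dia b"
  "dgr p a" "dgr p b" "se T * a = a" "se T * b = b" "a * se S = a" "b * se S = b"
  "(sd T + sB T) * a = sg p (a * (sd S + sB S))" "(sd T + sA T) * b = sg p (b * (sd S + sA S))"
 shows "Zc p (oo S) (oo T) (wk a b)" "w1 (wk a b) = a" "w2 (wk a b) = b"
proof -
 show w: "w1 (wk a b) = a" "w2 (wk a b) = b" using w_wk[OF assms(3-5)] by auto
 show "Zc p (oo S) (oo T) (wk a b)" using assms(6-) by (auto simp: Zc_def Cm_def dg_def w w_oo assms(1,2) intro!: wk_eqI)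
qed

lemma Cm_wI:
 assumes "sob S" "sob T" "upr a" "upr b" "dia a = dia b"
  "dgr p a" "dgr p b" "se T * a = a" "se T * b = b" "a * se S = a" "b * se S = b"
 shows "Cm p (oo S) (oo T) (wk a b)" "w1 (wk a b) = a" "w2 (wk a b) = b"
proof -
 show w: "w1 (wk a b) = a" "w2 (wk a b) = b" using w_wk[OF assms(3-5)] by auto
 show "Cm p (oo S) (oo T) (wk a b)" using assms(6-) by (auto simp: Cm_def dg_def w w_oo assms(1,2) intro!: wk_eqI)
qed

lemma Nl_step:
 assumes S: "sob S" "sob T" and x: "Zc p (oo S) (oo T) x" and h: "Cm (p - 1) (oo S) (oo T) h"
  and r: "!!y. Zc p (oo S) (oo T) y ==>
   w1 y = w1 x - ((sd T + sB T) * w1 h + sg p (w1 h * (sd S + sB S))) ==>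
   w2 y = w2 x - ((sd T + sA T) * w2 h + sg p (w2 h * (sd S + sA S))) ==> Nl p (oo S) (oo T) y"
 shows "Nl p (oo S) (oo T) x"
proof -
 let ?d = "snd (oo T) * h + sg p (h * snd (oo S))"
 have n: "Nl p (oo S) (oo T) ?d" using h unfolding Nl_def by blast
 have "Zc p (oo S) (oo T) (x - ?d)"
  by (rule Zc_diff[OF x Nl_Zc[OF n ob_oo[OF S(1)] ob_oo[OF S(2)]]])
 then have "Nl p (oo S) (oo T) (x - ?d)" by (rule r) (simp_all add: w_oo S)
 from Nl_add[OF this n] show ?thesis by simp
qed

lemma vanishing_columns:
 assumes "x * (Em i1 i1 + Em i2 i2 + Em i3 i3) = x" "x * Em i1 i1 = 0" "x * Em i2 i2 = 0" "x * Em i3 i3 = 0"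
 shows "x = 0"
 using assms by (simp add: distrib_left)

text \<open>The other columns are peeled off in turn. Closedness kills column \<open>o2\<close> of
  the second component, a homotopy in column \<open>o3\<close> removes column \<open>o2\<close> of
  the first, and closedness then kills its column \<open>o3\<close>. Column \<open>o3\<close> of the
  second component consists of diagonal entries only, which are shared.\<close>

lemma P_boundary0:
 fixes T :: "'k::field so"
 assumes T: "sob T" and x: "Zc p (oo Ps) (oo T) x" and z: "w1 x * Em o1 o1 = 0" "w2 x * Em o1 o1 = 0"
 shows "Nl p (oo Ps) (oo T) x"
proof -
 note c = Zc_w[OF sob_Ps T x, simplified]
 have "sg p (w2 x * Em o2 o1 * Em o1 o1) = (sd T + sA T) * (w2 x * Em o1 o1)"
  using c(8) by (simp add: sg_mult_left flip: mult.assoc)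
 then have "w2 x * Em o2 o1 = 0" by (simp add: z mult.assoc Em_times_Em)
 then have "w2 x * Em o2 o1 * Em o1 o2 = 0" by simp
 then have z2: "w2 x * Em o2 o2 = 0" by (simp add: mult.assoc Em_times_Em)
 define y where "y = w1 x * Em o2 o3"
 \<comment> \<open>Triangularity leaves rows at \<open>V2\<close> and \<open>V3\<close>, and those
   at \<open>V2\<close> are shared with the second component, where the column vanishes. Hence
   moving the column to \<open>o3\<close> gives a diagonal matrix.\<close>
 have d0: "ent (w1 x) i o2 = 0" if "vt i \<noteq> V3" for i
 proof (rule ccontr)
  assume nz: "ent (w1 x) i o2 \<noteq> 0"
  then have "vn (vt o2) \<le> vn (vt i)" using upr_w(1)[of x] unfolding upr_def by blast
  then have "vt i = V2" using that by (cases "vt i") auto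
  then have "ent (w2 x) i o2 \<noteq> 0" using nz arg_cong[OF dia_w[of x], of "\<lambda>x. ent x i o2"] by simp
  then show False using arg_cong[OF z2, of "\<lambda>x. ent x i o2"] by (simp add: ent_times_Em)
 qed
 have y: "upr y" "dia y = y" "dgr (p - 1) y" "se T * y = y" "y * se Ps = y"
 proof -
  show yd: "dia y = y" by (rule fm_eqI) (auto simp: y_def ent_times_Em d0)
  then show "upr y" by (rule dia_upr)
  have "dgr (- 1) (Em o2 o3 :: 'k bm)" by (simp add: dgr_def)
  then show "dgr (p - 1) y" unfolding y_def using dgr_mult[OF c(1)] by fastforce
  show "se T * y = y" using c(3) by (simp add: y_def flip: mult.assoc)
  show "y * se Ps = y" by (simp add: y_def mult.assoc distrib_left Em_times_Em)
 qed
 have h: "Cm (p - 1) (oo Ps) (oo T) (wk (sg p y) (sg p y))" "w1 (wk (sg p y) (sg p y)) = sg p y" "w2 (wk (sg p y) (sg p y)) = sg p y"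
  using Cm_wI[OF sob_Ps T, of "sg p y" "sg p y" "p - 1"] y by (auto simp: sg_def)
 show ?thesis
 proof (rule Nl_step[OF sob_Ps T x h(1)], simp only: h(2,3))
  fix r assume r: "Zc p (oo Ps) (oo T) r"
   and r1: "w1 r = w1 x - ((sd T + sB T) * sg p y + sg p (sg p y * (sd Ps + sB Ps)))"
   and r2: "w2 r = w2 x - ((sd T + sA T) * sg p y + sg p (sg p y * (sd Ps + sA Ps)))"
  note cr = Zc_w[OF sob_Ps T r, simplified]
  have a: "w1 r * Em o1 o1 = 0" "w1 r * Em o2 o2 = 0" "w2 r * Em o1 o1 = 0" "w2 r * Em o2 o2 = 0"
   using z z2 by (simp_all add: r1 r2 y_def left_diff_distrib distrib_right sgs mult.assoc Em_times_Em)
  have "sg p (w1 r * Em o3 o2 * Em o2 o2) = (sd T + sB T) * (w1 r * Em o2 o2)"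
   using cr(7) by (simp add: sg_mult_left flip: mult.assoc)
  then have "w1 r * Em o3 o2 = 0" by (simp add: a mult.assoc Em_times_Em)
  then have "w1 r * Em o3 o2 * Em o2 o3 = 0" by simp
  then have "w1 r * Em o3 o3 = 0" by (simp add: mult.assoc Em_times_Em)
  then have w1r: "w1 r = 0" using vanishing_columns[OF cr(5)] a by blast
  have "w2 r * Em o3 o3 = 0"
  proof (rule fm_eqI)
   fix i j
   have "ent (w2 r) i o3 = 0"
   proof (rule ccontr)
    assume nz: "ent (w2 r) i o3 \<noteq> 0"
    then have "vn (vt o3) \<le> vn (vt i)" using upr_w(2)[of r] unfolding upr_def by blast
    then have "vt i = V3" by (cases "vt i") auto
    then show False using nz arg_cong[OF dia_w[of r], of "\<lambda>x. ent x i o3"] by (simp add: w1r)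
   qed
   then show "ent (w2 r * Em o3 o3) i j = ent 0 i j" by (simp add: ent_times_Em)
  qed
  then have "w2 r = 0" using vanishing_columns[OF cr(6)] a by blast
  then have "r = 0" using w1r by (intro wk_eqI) simp_all
  then show "Nl p (oo Ps) (oo T) r" by (simp add: Nl_0)
 qed
qed

text \<open>Column \<open>o1\<close> of the second component is moved to \<open>o2\<close>, from
  where \<open>sA Ps\<close> brings it back as a boundary. The diagonal of this homotopy must also
  enter the first component, but it leaves column \<open>o1\<close> there untouched.\<close>

lemma P_boundary1:
 fixes T :: "'k::field so"
 assumes T: "sob T" and x: "Zc p (oo Ps) (oo T) x" and z: "w1 x * Em o1 o1 = 0"
 shows "Nl p (oo Ps) (oo T) x"
proof -
 note c = Zc_w[OF sob_Ps T x, simplified]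
 have T': "dia (se T) = se T" using T by (simp add: sob_def)
 define y where "y = sg p (w2 x * Em o1 o2)"
 have y: "upr y" "dgr (p - 1) y" "se T * y = y" "y * se Ps = y"
 proof -
  show "upr y" unfolding upr_def
  proof (intro allI impI)
   fix i j assume nz: "ent y i j \<noteq> 0"
   then have j: "j = o2" and nz: "ent (w2 x) i o1 \<noteq> 0" by (auto simp: y_def ent_sg ent_times_Em split: if_splits)
   have "vt i \<noteq> V1"
   proof
    assume "vt i = V1"
    then have "ent (w1 x) i o1 \<noteq> 0" using nz arg_cong[OF dia_w[of x], of "\<lambda>x. ent x i o1"] by simp
    then show False using arg_cong[OF z, of "\<lambda>x. ent x i o1"] by (simp add: ent_times_Em)
   qed
   then show "vn (vt j) \<le> vn (vt i)" by (cases "vt i") (auto simp: j)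
  qed
  have "dgr (- 1) (Em o1 o2 :: 'k bm)" by (simp add: dgr_def)
  then show "dgr (p - 1) y" unfolding y_def using dgr_mult[OF c(2)] by fastforce
  show "se T * y = y" using c(4) by (simp add: y_def sg_mult_right flip: mult.assoc)
  show "y * se Ps = y" by (simp add: y_def sg_mult_left mult.assoc distrib_left Em_times_Em)
 qed
 have dd: "dia (se Ps :: 'k bm) = se Ps" using sob_Ps unfolding sob_def by blast
 have h: "Cm (p - 1) (oo Ps) (oo T) (wk (dia y) y)" "w1 (wk (dia y) y) = dia y" "w2 (wk (dia y) y) = y"
  using Cm_wI[OF sob_Ps T upr_dia y(1) _ dgr_dia[OF y(2)] y(2) _ y(3) _ y(4)]
   dia_mult_left[OF T', of y] dia_mult_right[OF dd, of y] y by auto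
 have yE: "dia y * Em o1 o1 = 0"
 proof -
  have "y * Em o1 o1 = 0" by (simp add: y_def sg_mult_left mult.assoc Em_times_Em)
  moreover have "dia (Em o1 o1 :: 'k bm) = Em o1 o1" by (rule fm_eqI) auto
  ultimately show ?thesis using dia_mult_right[of "Em o1 o1" y] by simp
 qed
 show ?thesis
 proof (rule Nl_step[OF sob_Ps T x h(1)], simp only: h(2,3))
  fix r assume r: "Zc p (oo Ps) (oo T) r"
   and r1: "w1 r = w1 x - ((sd T + sB T) * dia y + sg p (dia y * (sd Ps + sB Ps)))"
   and r2: "w2 r = w2 x - ((sd T + sA T) * y + sg p (y * (sd Ps + sA Ps)))"
  have "w1 r * Em o1 o1 = 0"
   using z yE by (simp add: r1 left_diff_distrib distrib_right sgs mult.assoc Em_times_Em)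
  moreover have "w2 r * Em o1 o1 = 0"
   by (simp add: r2 y_def left_diff_distrib distrib_right sgs mult.assoc Em_times_Em)
  ultimately show "Nl p (oo Ps) (oo T) r" by (rule P_boundary0[OF T r])
 qed
qed

text \<open>Together with \<open>P_null\<close> and \<open>P_cycle\<close> this identifies Hom(P,
  T[p]) with cohomology of \<open>d + B\<close> on \<open>T\<close>: a closed morphism is determined
  by column \<open>o1\<close> of its first component.\<close>

lemma P_boundary:
 fixes T :: "'k::field so"
 assumes T: "sob T" and x: "Zc p (oo Ps) (oo T) x"
  and w: "dgr (p - 1) w" "se T * w = w" "w * Em o1 o1 = w" "w1 x * Em o1 o1 = (sd T + sB T) * w"
 shows "Nl p (oo Ps) (oo T) x"
proof -
 have T': "dia (se T) = se T" using T by (simp add: sob_def)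
 have dd: "dia (se Ps :: 'k bm) = se Ps" using sob_Ps unfolding sob_def by blast
 have we: "w * se Ps = w"
 proof -
  have "w * Em o1 o1 * se Ps = w * Em o1 o1" by (simp add: mult.assoc distrib_left Em_times_Em)
  then show ?thesis by (simp add: w(3))
 qed
 have h: "Cm (p - 1) (oo Ps) (oo T) (wk w (dia w))" "w1 (wk w (dia w)) = w" "w2 (wk w (dia w)) = dia w"
  using Cm_wI[OF sob_Ps T upr_column1[OF w(3)] upr_dia _ w(1) dgr_dia[OF w(1)] w(2) _ we]
   dia_mult_left[OF T', of w] dia_mult_right[OF dd, of w] w we by auto
 show ?thesis
 proof (rule Nl_step[OF sob_Ps T x h(1)], simp only: h(2,3))
  fix r assume r: "Zc p (oo Ps) (oo T) r"
   and r1: "w1 r = w1 x - ((sd T + sB T) * w + sg p (w * (sd Ps + sB Ps)))"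
  have "w1 r * Em o1 o1 = 0"
   using w(3,4) by (simp add: r1 left_diff_distrib distrib_right sgs mult.assoc Em_times_Em)
  then show "Nl p (oo Ps) (oo T) r" by (rule P_boundary1[OF T r])
 qed
qed

lemma P_null:
 fixes T :: "'k::field so"
 assumes T: "sob T" and x: "Nl p (oo Ps) (oo T) x"
 obtains w where "dgr (p - 1) w" "se T * w = w" "w * Em o1 o1 = w" "w1 x * Em o1 o1 = (sd T + sB T) * w"
proof -
 obtain h where h: "Cm (p - 1) (oo Ps) (oo T) h" "x = snd (oo T) * h + sg p (h * snd (oo Ps))"
  using x by (auto simp: Nl_def)
 have "dgr 0 (Em o1 o1 :: 'k bm)" by (simp add: dgr_def)
 then have "dgr (p - 1) (w1 h * Em o1 o1)" using h(1) dgr_mult[of "p - 1" "w1 h" 0] by (simp add: Cm_def dg_def)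
 moreover have "se T * (w1 h * Em o1 o1) = w1 h * Em o1 o1"
 proof -
  have "fst (oo T) * h = h" using h(1) by (simp add: Cm_def)
  from arg_cong[OF this, of w1] show ?thesis by (simp add: w_oo T flip: mult.assoc)
 qed
 moreover have "w1 h * Em o1 o1 * Em o1 o1 = w1 h * Em o1 o1" by (simp add: mult.assoc Em_times_Em)
 moreover have "w1 x * Em o1 o1 = (sd T + sB T) * (w1 h * Em o1 o1)"
  by (simp add: h(2) w_oo T w_oo_Ps distrib_right sgs mult.assoc Em_times_Em)
 ultimately show thesis by (rule that)
qed

lemma vst_triple: "vst x ==> vst y ==> vst z ==> x * (y * z) = 0"
proof (rule fm_eqI, rule ccontr)
 fix i j assume v: "vst x" "vst y" "vst z" and nz: "ent (x * (y * z)) i j \<noteq> ent 0 i j"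
 then obtain k l where "ent x i k \<noteq> 0" "ent y k l \<noteq> 0" "ent z l j \<noteq> 0"
  using ent_times_nonzero[of x "y * z" i j] ent_times_nonzero[of y z] by fastforce
 then have "vn (vt i) = vn (vt k) + 1" "vn (vt k) = vn (vt l) + 1" "vn (vt l) = vn (vt j) + 1"
  using v unfolding vst_def by blast+
 then show False using vn_bounds[of "vt i"] vn_bounds[of "vt j"] by simp
qed

text \<open>The missing columns are forced by the two arrows of \<open>P\<close>: the diagonal part
  of the cycle is pushed by \<open>A\<close> into column \<open>o2\<close> and then by
  \<open>B\<close> into column \<open>o3\<close>. A third arrow gives zero, as there are only three
  vertices.\<close>

lemma P_cycle:
 fixes T :: "'k::field so"
 assumes T: "sob T" and y: "dgr p y" "se T * y = y" "y * Em o1 o1 = y" "(sd T + sB T) * y = 0"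
 obtains x where "Zc p (oo Ps) (oo T) x" "w1 x * Em o1 o1 = y"
proof -
 note sT = T[unfolded sob_def]
 define A B d where "A = sA T" and "B = sB T" and "d = sd T"
 define z where "z = dia y"
 have zy: "d * z = 0"
 proof -
  have "d * z = dia ((d + B) * y)"
   using dia_mult[of "d + B" y] upr_column1[OF y(3)] sT by (simp add: z_def d_def B_def vst_dia upr_add dia_upr vst_upr)
  then show ?thesis by (simp add: y(4) d_def B_def)
 qed
 have zy': "d * (z * x) = 0" for x by (simp add: zy flip: mult.assoc)
 have zz: "z * Em o1 o1 = z" "se T * z = z" "dgr p z"
 proof -
  have "dia (Em o1 o1 :: 'k bm) = Em o1 o1" by (rule fm_eqI) auto
  then show "z * Em o1 o1 = z" "se T * z = z" "dgr p z" using y sT dia_mult_left[of "se T" y] dia_mult_right[of "Em o1 o1" y]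
   by (simp_all add: z_def dgr_dia)
 qed
 have dA: "d * (A * x) = - (A * (d * x))" "d * (B * x) = - (B * (d * x))" "A * (A * x) = 0" "B * (B * x) = 0" for x
  using sT by (simp_all add: A_def B_def d_def flip: mult.assoc)
 have ABA: "A * (B * (A * x)) = 0" for x
  using vst_triple[of A B A] sT by (simp add: A_def B_def flip: mult.assoc)
 define a where "a = y + sg p (A * z * Em o1 o2) + B * A * z * Em o1 o3"
 define b where "b = z + sg p (A * z * Em o1 o2) + B * A * z * Em o1 o3"
 have zc: "vt i = V1 \<and> j = o1" if nz: "ent z i j \<noteq> 0" for i j
 proof -
  have "ent (z * Em o1 o1) i j \<noteq> 0" unfolding zz(1) by (rule nz)
  then have "j = o1" by (simp add: ent_times_Em split: if_splits)
  moreover have "vt i = vt j" using nz unfolding z_def by (simp split: if_splits)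
  ultimately show ?thesis by simp
 qed
 have Az: "dia (A * z * Em o1 o2) = A * z * Em o1 o2"
 proof (rule fm_eqI)
  fix i j
  have "ent (A * z * Em o1 o2) i j \<noteq> 0 ==> vt i = vt j"
  proof -
   assume nz: "ent (A * z * Em o1 o2) i j \<noteq> 0"
   then have j: "j = o2" and "ent (A * z) i o1 \<noteq> 0" by (auto simp: ent_times_Em split: if_splits)
   then obtain k where k: "ent A i k \<noteq> 0" "ent z k o1 \<noteq> 0" using ent_times_nonzero[of A z i o1] by blast
   have "vn (vt i) = vn (vt k) + 1" using k(1) sT unfolding vst_def A_def by blast
   then have "vn (vt i) = 2" using zc[OF k(2)] by simp
   then show "vt i = vt j" using vn_inject[of "vt i" V2] by (simp add: j)
  qed
  then show "ent (dia (A * z * Em o1 o2)) i j = ent (A * z * Em o1 o2) i j" by auto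
 qed
 have BAz: "dia (B * A * z * Em o1 o3) = B * A * z * Em o1 o3"
 proof (rule fm_eqI)
  fix i j
  have "ent (B * A * z * Em o1 o3) i j \<noteq> 0 ==> vt i = vt j"
  proof -
   assume nz: "ent (B * A * z * Em o1 o3) i j \<noteq> 0"
   then have j: "j = o3" and "ent (B * A * z) i o1 \<noteq> 0" by (auto simp: ent_times_Em split: if_splits)
   then obtain k where k: "ent (B * A) i k \<noteq> 0" "ent z k o1 \<noteq> 0" using ent_times_nonzero[of "B * A" z i o1] by blast
   obtain l where "ent B i l \<noteq> 0" "ent A l k \<noteq> 0" using ent_times_nonzero[OF k(1)] by blast
   then have "vn (vt i) = vn (vt l) + 1" "vn (vt l) = vn (vt k) + 1" using sT unfolding vst_def A_def B_def by blast+
   then have "vn (vt i) = 3" using zc[OF k(2)] by simp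
   then show "vt i = vt j" using vn_inject[of "vt i" V3] by (simp add: j)
  qed
  then show "ent (dia (B * A * z * Em o1 o3)) i j = ent (B * A * z * Em o1 o3) i j" by auto
 qed
 have dg1: "dgr p (sg p (A * z * Em o1 o2))" "dgr p (B * A * z * Em o1 o3)"
 proof -
  have E: "dgr (- 1) (Em o1 o2 :: 'k bm)" "dgr (- 2) (Em o1 o3 :: 'k bm)" by (simp_all add: dgr_def)
  have AB: "dgr 1 A" "dgr 1 B" using sT by (auto simp: A_def B_def)
  show "dgr p (sg p (A * z * Em o1 o2))" using dgr_mult[OF dgr_mult[OF AB(1) zz(3)] E(1)] by simp
  show "dgr p (B * A * z * Em o1 o3)" using dgr_mult[OF dgr_mult[OF dgr_mult[OF AB(2,1)] zz(3)] E(2)] by simp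
 qed
 have yd: "d * y = - (B * y)" using y(4) by (simp add: d_def B_def distrib_right add_eq_0_iff2)
 have seA: "se T * (A * x) = A * x" "se T * (B * x) = B * x" for x
  using sT by (simp_all add: A_def B_def flip: mult.assoc)
 have ye: "y * se Ps = y" "z * se Ps = z"
 proof -
  have "v * Em o1 o1 * se Ps = v * Em o1 o1" for v :: "'k bm" by (simp add: mult.assoc distrib_left Em_times_Em)
  from this[of y] this[of z] show "y * se Ps = y" "z * se Ps = z" by (simp_all add: y(3) zz(1))
 qed
 have yE: "y * Em o3 o2 = 0" "z * Em o2 o1 = 0" "y * Em o1 o1 = y"
 proof -
  have "v * Em o1 o1 * Em o3 o2 = 0" "v * Em o1 o1 * Em o2 o1 = 0" for v :: "'k bm" by (simp_all add: mult.assoc Em_times_Em)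
  from this(1)[of y] this(2)[of z] show "y * Em o3 o2 = 0" "z * Em o2 o1 = 0" by (simp_all add: y(3) zz(1))
 qed (rule y(3))
 have "Zc p (oo Ps) (oo T) (wk a b)" "w1 (wk a b) = a"
 proof -
  have P: "upr a" "upr b" "dia a = dia b"
   using upr_column1[OF y(3)] dia_upr[OF Az] dia_upr[OF BAz] Az BAz
   by (auto simp: a_def b_def z_def sg_def intro!: upr_add upr_diff)
  have Q: "dgr p a" "dgr p b" unfolding a_def b_def by (intro dgr_add y(1) zz(3) dg1)+
  have R: "se T * a = a" "se T * b = b" using y(2) zz(2) by (simp_all add: a_def b_def distrib_left sgs mult.assoc seA)
  have R': "a * se Ps = a" "b * se Ps = b" unfolding a_def b_def distrib_right ye
   by (simp_all add: distrib_left sgs mult.assoc Em_times_Em)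
  have c1: "(sd T + sB T) * a = sg p (a * (sd Ps + sB Ps))"
   by (simp add: a_def distrib_right distrib_left sgs mult.assoc Em_times_Em yd yE(1) dA zy zy' flip: A_def B_def d_def)
  have c2: "(sd T + sA T) * b = sg p (b * (sd Ps + sA Ps))"
   using arg_cong[OF zz(1), of "\<lambda>x. A * x"]
   by (simp add: b_def distrib_right distrib_left sgs mult.assoc Em_times_Em yE(2) dA zy zy' ABA flip: A_def B_def d_def)
  show "Zc p (oo Ps) (oo T) (wk a b)" "w1 (wk a b) = a"
   using Zc_wI[OF sob_Ps T P Q R R' c1 c2] by blast+
 qed
 moreover have "a * Em o1 o1 = y" by (simp add: a_def distrib_right sgs mult.assoc Em_times_Em yE(3))
 ultimately show thesis using that by metis
qed

text \<open>The transposed form of \<open>P_cycle\<close>: a row at \<open>o3\<close> killed by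
  \<open>d + B\<close> on the right extends to a morphism to \<open>Q\<close> by going backwards
  along the arrows of \<open>Q\<close>.\<close>

lemma row_cocycle:
 fixes T :: "'k::field so"
 assumes T: "sob T" and r: "dgr q r" "Em o3 o3 * r = r" "r * se T = r" "r * (sd T + sB T) = 0"
 obtains g where "Zc q (oo T) (oo Qs) g" "Em o3 o3 * w1 g = r"
proof -
 note sT = T[unfolded sob_def]
 define A B d where "A = sA T" and "B = sB T" and "d = sd T"
 define z where "z = dia r"
 have zd: "z * d = 0"
 proof -
  have "z * d = dia (r * (d + B))"
   using dia_mult[of r "d + B"] upr_row3[OF r(2)] sT by (simp add: z_def d_def B_def vst_dia upr_add dia_upr vst_upr)
  then show ?thesis by (simp add: r(4) d_def B_def)
 qed
 have zd': "z * (d * x) = 0" for x by (simp add: zd flip: mult.assoc)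
 have zz: "Em o3 o3 * z = z" "z * se T = z" "dgr q z"
 proof -
  have "dia (Em o3 o3 :: 'k bm) = Em o3 o3" by (rule fm_eqI) auto
  then show "Em o3 o3 * z = z" "z * se T = z" "dgr q z" using r sT dia_mult_right[of "se T" r] dia_mult_left[of "Em o3 o3" r]
   by (simp_all add: z_def dgr_dia)
 qed
 have dA0: "A * d = - (d * A)" "B * d = - (d * B)" "A * A = 0" "B * B = 0"
  using sT by (simp_all add: A_def B_def d_def)
 have dA: "A * (d * x) = - (d * (A * x))" "B * (d * x) = - (d * (B * x))" "A * (A * x) = 0" "B * (B * x) = 0" for x
  using dA0 by (simp_all flip: mult.assoc)
 have ABA: "A * (B * A) = 0"
  using vst_triple[of A B A] sT by (simp add: A_def B_def)
 define f where "f = sg q (Em o2 o3 * z * A) + Em o1 o3 * z * A * B"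
 define a where "a = r + f"
 define b where "b = z + f"
 have zc: "vt j = V3 \<and> i = o3" if nz: "ent z i j \<noteq> 0" for i j
 proof -
  have "ent (Em o3 o3 * z) i j \<noteq> 0" unfolding zz(1) by (rule nz)
  then have "i = o3" by (simp add: ent_Em_times split: if_splits)
  moreover have "vt i = vt j" using nz unfolding z_def by (simp split: if_splits)
  ultimately show ?thesis by simp
 qed
 have Az: "dia (Em o2 o3 * z * A) = Em o2 o3 * z * A"
 proof (rule fm_eqI)
  fix i j
  have "ent (Em o2 o3 * z * A) i j \<noteq> 0 ==> vt i = vt j"
  proof -
   assume nz: "ent (Em o2 o3 * z * A) i j \<noteq> 0"
   then have j: "i = o2" and "ent (z * A) o3 j \<noteq> 0" by (auto simp: ent_Em_times mult.assoc split: if_splits)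
   then obtain k where k: "ent z o3 k \<noteq> 0" "ent A k j \<noteq> 0" using ent_times_nonzero[of z A o3 j] by blast
   then have "vn (vt k) = vn (vt j) + 1" using sT unfolding vst_def A_def by blast
   then have "vn (vt j) = 2" using zc[OF k(1)] by simp
   then show "vt i = vt j" using vn_inject[of "vt j" V2] by (simp add: j)
  qed
  then show "ent (dia (Em o2 o3 * z * A)) i j = ent (Em o2 o3 * z * A) i j" by auto
 qed
 have BAz: "dia (Em o1 o3 * z * A * B) = Em o1 o3 * z * A * B"
 proof (rule fm_eqI)
  fix i j
  have "ent (Em o1 o3 * z * A * B) i j \<noteq> 0 ==> vt i = vt j"
  proof -
   assume nz: "ent (Em o1 o3 * z * A * B) i j \<noteq> 0"
   then have j: "i = o1" and "ent (z * (A * B)) o3 j \<noteq> 0" by (auto simp: ent_Em_times mult.assoc split: if_splits)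
   then obtain k where k: "ent z o3 k \<noteq> 0" "ent (A * B) k j \<noteq> 0" using ent_times_nonzero[of z "A * B" o3 j] by blast
   obtain l where "ent A k l \<noteq> 0" "ent B l j \<noteq> 0" using ent_times_nonzero[OF k(2)] by blast
   then have "vn (vt k) = vn (vt l) + 1" "vn (vt l) = vn (vt j) + 1" using sT unfolding vst_def A_def B_def by blast+
   then have "vn (vt j) = 1" using zc[OF k(1)] by simp
   then show "vt i = vt j" using vn_inject[of "vt j" V1] by (simp add: j)
  qed
  then show "ent (dia (Em o1 o3 * z * A * B)) i j = ent (Em o1 o3 * z * A * B) i j" by auto
 qed
 have fd: "dia f = f"
  using Az BAz by (simp add: f_def sg_def)
 have fg: "dgr q f"
 proof -
  have E: "dgr (- 1) (Em o2 o3 :: 'k bm)" "dgr (- 2) (Em o1 o3 :: 'k bm)" by (simp_all add: dgr_def)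
  have AB: "dgr 1 A" "dgr 1 B" using sT by (auto simp: A_def B_def)
  have "dgr q (sg q (Em o2 o3 * z * A))" using dgr_mult[OF dgr_mult[OF E(1) zz(3)] AB(1)] by simp
  moreover have "dgr q (Em o1 o3 * z * A * B)" using dgr_mult[OF dgr_mult[OF dgr_mult[OF E(2) zz(3)] AB(1)] AB(2)] by simp
  ultimately show ?thesis unfolding f_def by (rule dgr_add)
 qed
 have rd: "r * d = - (r * B)" using r(4) by (simp add: d_def B_def distrib_left add_eq_0_iff2)
 have seA: "A * se T = A" "B * se T = B" using sT by (simp_all add: A_def B_def)
 have rE: "Em i o1 * r = 0" "Em i o2 * r = 0" "Em i o1 * z = 0" "Em i o2 * z = 0" for i
 proof -
  have "Em i o1 * (Em o3 o3 * v) = 0" "Em i o2 * (Em o3 o3 * v) = 0" for v :: "'k bm"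
   by (simp_all add: Em_times_Em flip: mult.assoc)
  from this[of r] this[of z] show "Em i o1 * r = 0" "Em i o2 * r = 0" "Em i o1 * z = 0" "Em i o2 * z = 0" by (simp_all only: r(2) zz(1))
 qed
 have EE: "Em i j * (Em k l * x) = (if j = k then Em i l * x else 0)" for i j k l :: idx and x :: "'k bm"
  by (simp add: Em_times_Em flip: mult.assoc)
 have z3: "Em o3 o3 * (z * x) = z * x" for x using zz(1) by (simp flip: mult.assoc)
 have Qe: "(sd Qs + sB Qs :: 'k bm) = Em o2 o1" "(sd Qs + sA Qs :: 'k bm) = Em o3 o2" by simp_all
 have P: "upr a" "upr b" "dia a = dia b"
  using upr_row3[OF r(2)] dia_upr[OF fd] fd by (auto simp: a_def b_def z_def intro!: upr_add)
 have Q: "dgr q a" "dgr q b" unfolding a_def b_def by (intro dgr_add r(1) zz(3) fg)+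
 have fe: "f * se T = f" "se Qs * f = f"
  by (simp_all add: f_def distrib_right distrib_left sgs mult.assoc seA EE)
 have re: "se Qs * r = r" "se Qs * z = z" using r(2) zz(1) by (simp_all add: distrib_right rE)
 have R: "se Qs * a = a" "se Qs * b = b" "a * se T = a" "b * se T = b"
  using fe re r(3) zz(2) by (simp_all only: a_def b_def distrib_left distrib_right)
 have f1: "Em o2 o1 * f = Em o2 o3 * z * A * B" "Em o3 o2 * f = sg q (z * A)"
  by (simp_all add: f_def distrib_left sgs mult.assoc EE z3)
 have f2: "f * (d + B) = sg q (Em o2 o3 * z * A * B)" "f * (d + A) = 0"
  by (simp_all add: f_def distrib_right distrib_left sgs mult.assoc dA0 dA zd zd' ABA)
 have c1: "(sd Qs + sB Qs) * a = sg q (a * (sd T + sB T))"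
  unfolding Qe a_def distrib_left[of "Em o2 o1"] distrib_right[of r f] f1 rE(1) r(4) f2(1)[unfolded d_def B_def]
  by (simp add: B_def)
 have c2: "(sd Qs + sA Qs) * b = sg q (b * (sd T + sA T))"
  unfolding Qe b_def distrib_left[of "Em o3 o2"] distrib_right[of z f] f1 rE(4) f2(2)[unfolded d_def A_def]
  using zd by (simp add: distrib_left A_def d_def)
 have "Zc q (oo T) (oo Qs) (wk a b)" "w1 (wk a b) = a"
  using Zc_wI[OF T sob_Qs P Q R c1 c2] by blast+
 moreover have "Em o3 o3 * a = r" by (simp add: a_def f_def distrib_left sgs mult.assoc EE r(2))
 ultimately show thesis using that by metis
qed

text \<open>Half of Serre duality for \<open>P\<close>, made explicit with \<open>Q[2]\<close> as
  its Serre dual: rows that kill the boundaries of \<open>d + B\<close> separate its cohomology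
  classes. The degree 2 is the difference of the total degrees of \<open>o3\<close> and
  \<open>o1\<close>.\<close>

lemma P_detect:
 fixes T :: "'k::field so"
 assumes T: "sob T" and x: "Zc p (oo Ps) (oo T) x" and nz: "\<not> Nl p (oo Ps) (oo T) x"
 obtains g where "Zc (2 - p) (oo T) (oo Qs) g" "\<not> Nl 2 (oo Ps) (oo Qs) (g * x)"
proof -
 note sT = T[unfolded sob_def]
 note c = Zc_w[OF sob_Ps T x, simplified]
 define D where "D = sd T + sB T"
 have D: "dgr 1 D" "se T * D = D" "D * se T = D" using sT by (auto simp: D_def distrib_left distrib_right intro!: dgr_add)
 have d0: "dgr 0 (se T)" "se T * se T = se T" using sT by auto
 define y where "y = w1 x * Em o1 o1"
 have E0: "dgr 0 (Em o1 o1 :: 'k bm)" "dgr 0 (Em o3 o3 :: 'k bm)" by (simp_all add: dgr_def)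
 have y: "dgr p y" "se T * y = y" "y * Em o1 o1 = y"
  using dgr_mult[OF c(1) E0(1)] c(3) by (simp_all add: y_def mult.assoc Em_times_Em) (simp flip: mult.assoc)
 obtain q0 where q0: "D * q0 * D = D" using quasi_inverse by blast
 have "\<exists>i. ent (y - D * q0 * y) i o1 \<noteq> 0"
 proof (rule ccontr)
  assume a: "\<not> ?thesis"
  have "y - D * q0 * y = (y - D * q0 * y) * Em o1 o1"
   by (simp add: left_diff_distrib mult.assoc y(3))
  then have e: "y = D * (q0 * y)"
   using a by (intro fm_eqI) (metis (no_types, lifting) ent_times_Em eq_iff_diff_eq_0 ent_minus mult.assoc)
  define v where "v = gc (p - 1) (q0 * y)"
  have "D * v = y"
   using gc_mult_right[OF D(1), of "p - 1" "q0 * y"] e y(1) by (simp add: v_def gc_id)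
  then have "D * (se T * v) = y" using D(3) by (simp flip: mult.assoc)
  moreover have "v * Em o1 o1 = v"
   using gc_mult_left[OF E0(1), of "p - 1" "q0 * y"] y(3) by (simp add: v_def mult.assoc)
  moreover have "dgr (p - 1) (se T * v)" using dgr_mult[OF d0(1), of "p - 1" v] by (simp add: v_def)
  ultimately have "Nl p (oo Ps) (oo T) x"
   using d0(2) by (intro P_boundary[OF T x, of "se T * v"]) (simp_all add: D_def y_def mult.assoc, simp flip: mult.assoc)
  then show False using nz by blast
 qed
 then obtain i where i: "ent (y - D * q0 * y) i o1 \<noteq> 0" by blast
 \<comment> \<open>Row \<open>i\<close> of the projector with kernel the boundaries of
   \<open>D\<close>, relabelled as row \<open>o3\<close>; by the choice of \<open>i\<close> it does
   not kill \<open>y\<close>.\<close>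
 define u where "u = Em o3 i * (se T - D * q0 * se T)"
 define r where "r = gc (2 - p) u"
 have uD: "u * D = 0"
 proof -
  have "u * D = Em o3 i * (D - D * q0 * D)" by (simp add: u_def left_diff_distrib mult.assoc D(2))
  then show ?thesis by (simp add: q0)
 qed
 have ue: "u * se T = u" "Em o3 o3 * u = u"
  using d0(2) by (simp_all add: u_def left_diff_distrib mult.assoc Em_times_Em flip: mult.assoc[of "Em o3 o3" "Em o3 i"])
 have r: "dgr (2 - p) r" "Em o3 o3 * r = r" "r * se T = r" "r * D = 0"
  using gc_mult_right[OF E0(2), of "2 - p" u] gc_mult_left[OF d0(1), of "2 - p" u] gc_mult_left[OF D(1), of "2 - p" u] uD ue
  by (simp_all add: r_def gc_simps)
 have ry: "ent (r * y) o3 o1 \<noteq> 0"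
 proof -
  have "r * y = gc 2 (u * y)" using gc_mult_left[OF y(1), of "2 - p" u] by (simp add: r_def)
  moreover have "u * y = Em o3 i * (y - D * q0 * y)"
   by (simp add: u_def left_diff_distrib mult.assoc y(2))
  ultimately show ?thesis using i by (simp add: ent_Em_times)
 qed
 obtain g where g: "Zc (2 - p) (oo T) (oo Qs) g" "Em o3 o3 * w1 g = r"
  using row_cocycle[OF T r(1-3)] r(4) by (auto simp: D_def)
 have "\<not> Nl 2 (oo Ps) (oo Qs) (g * x)"
 proof
  assume "Nl 2 (oo Ps) (oo Qs) (g * x)"
  then obtain w where "w1 (g * x) * Em o1 o1 = (sd Qs + sB Qs) * w" using P_null[OF sob_Qs] by blast
  then have "w1 g * y = Em o2 o1 * w" by (simp add: y_def mult.assoc)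
  then have "Em o3 o3 * w1 g * y = Em o3 o3 * Em o2 o1 * w" by (simp add: mult.assoc)
  then show False using ry by (simp add: g(2) Em_times_Em)
 qed
 then show thesis using that g(1) by blast
qed

lemma column_decomp:
 fixes y :: "'k::field bm"
 assumes "(Em o1 o1 + Em o2 o2 + Em o3 o3) * y = y" "y * Em o1 o1 = y"
 shows "y = sc (ent y o1 o1) (Em o1 o1) + sc (ent y o2 o1) (Em o2 o1) + sc (ent y o3 o1) (Em o3 o1)"
proof (rule fm_eqI)
 fix i j
 have a: "ent y i j = (if j = o1 then ent y i o1 else 0)"
 proof -
  have "ent y i j = ent (y * Em o1 o1) i j" by (simp only: assms(2))
  then show ?thesis by (simp only: ent_times_Em)
 qed
 have b: "ent y i o1 = (if i = o1 then ent y o1 o1 else 0) + (if i = o2 then ent y o2 o1 else 0) + (if i = o3 then ent y o3 o1 else 0)"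
 proof -
  have "ent y i o1 = ent ((Em o1 o1 + Em o2 o2 + Em o3 o3) * y) i o1" by (simp only: assms(1))
  then show ?thesis by (simp only: distrib_right ent_plus ent_Em_times)
 qed
 show "ent y i j = ent (sc (ent y o1 o1) (Em o1 o1) + sc (ent y o2 o1) (Em o2 o1) + sc (ent y o3 o1) (Em o3 o1)) i j"
  unfolding a b by (cases "i = o1"; cases "i = o2"; cases "i = o3"; cases "j = o1") simp_all
qed

text \<open>On the coordinates of \<open>P\<close> the operator \<open>sB\<close> sends
  \<open>o2\<close> to \<open>o3\<close>, so only \<open>o1\<close> survives in cohomology.\<close>

lemma P_to_P_entry:
 assumes x: "Zc p (oo Ps) (oo Ps) x" and z: "ent (w1 x) o1 o1 = 0"
 shows "Nl p (oo Ps) (oo (Ps :: 'k::field so)) x"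
proof -
 note c = Zc_w[OF sob_Ps sob_Ps x, simplified]
 define y where "y = w1 x * Em o1 o1"
 have ey: "ent y i o1 = ent (w1 x) i o1" for i by (simp add: y_def ent_times_Em)
 have "Em o3 o2 * y = 0"
 proof -
  have "Em o3 o2 * w1 x * Em o1 o1 = 0" unfolding c(7) by (simp add: sg_mult_left mult.assoc Em_times_Em)
  then show ?thesis by (simp add: y_def mult.assoc)
 qed
 from arg_cong[OF this, of "\<lambda>x. ent x o3 o1"] have "ent y o2 o1 = 0" by (simp add: ent_Em_times)
 moreover have "(Em o1 o1 + Em o2 o2 + Em o3 o3) * y = y" "y * Em o1 o1 = y"
  using c(3) by (simp_all add: y_def mult.assoc Em_times_Em) (simp flip: mult.assoc)
 ultimately have y: "y = sc (ent y o3 o1) (Em o3 o1)" using column_decomp[of y] z by (simp add: ey sc_simps)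
 have "ent y o3 o1 \<noteq> 0 ==> p = 2"
  using c(1)[unfolded dgr_def, rule_format, of o3 o1] by (simp add: ey)
 then have "dgr (p - 1) (sc (ent y o3 o1) (Em o2 o1))" by (auto simp: dgr_def)
 then show ?thesis
  by (rule P_boundary[OF sob_Ps x])
   (simp_all add: sc_mult_left sc_mult_right distrib_right Em_times_Em y[symmetric] flip: y_def)
qed

text \<open>On the coordinates of \<open>Q\<close> the operator \<open>sB\<close> sends
  \<open>o1\<close> to \<open>o2\<close>, so only \<open>o3\<close> survives in cohomology.\<close>

lemma P_to_Q_entry:
 assumes x: "Zc p (oo Ps) (oo Qs) x" and z: "ent (w1 x) o3 o1 = 0"
 shows "Nl p (oo Ps) (oo (Qs :: 'k::field so)) x"
proof -
 note c = Zc_w[OF sob_Ps sob_Qs x, simplified]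
 define y where "y = w1 x * Em o1 o1"
 have ey: "ent y i o1 = ent (w1 x) i o1" for i by (simp add: y_def ent_times_Em)
 have "Em o2 o1 * y = 0"
 proof -
  have "Em o2 o1 * w1 x * Em o1 o1 = 0" unfolding c(7) by (simp add: sg_mult_left mult.assoc Em_times_Em)
  then show ?thesis by (simp add: y_def mult.assoc)
 qed
 from arg_cong[OF this, of "\<lambda>x. ent x o2 o1"] have "ent y o1 o1 = 0" by (simp add: ent_Em_times)
 moreover have "(Em o1 o1 + Em o2 o2 + Em o3 o3) * y = y" "y * Em o1 o1 = y"
  using c(3) by (simp_all add: y_def mult.assoc Em_times_Em) (simp flip: mult.assoc)
 ultimately have y: "y = sc (ent y o2 o1) (Em o2 o1)" using column_decomp[of y] z by (simp add: ey sc_simps)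
 have "ent y o2 o1 \<noteq> 0 ==> p = 1"
  using c(1)[unfolded dgr_def, rule_format, of o2 o1] by (simp add: ey)
 then have "dgr (p - 1) (sc (ent y o2 o1) (Em o1 o1))" by (auto simp: dgr_def)
 then show ?thesis
  by (rule P_boundary[OF sob_Qs x])
   (simp_all add: sc_mult_left sc_mult_right distrib_right Em_times_Em y[symmetric] flip: y_def)
qed

lemma P_to_P:
 fixes x :: "'k::field wk"
 assumes x: "Zc p (oo Ps) (oo Ps) x"
 shows "p \<noteq> 0 ==> Nl p (oo Ps) (oo Ps) x" "p = 0 ==> \<exists>c. hq 0 (oo Ps) (oo Ps) x (scw c (fst (oo Ps)))"
proof -
 have d: "dgr p (w1 x)" using x by (simp add: Zc_def Cm_def dg_def)
 show "p \<noteq> 0 ==> Nl p (oo Ps) (oo Ps) x"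
  using d[unfolded dgr_def, rule_format, of o1 o1] by (intro P_to_P_entry[OF x]) auto
 assume p: "p = 0"
 have "Zc 0 (oo Ps) (oo Ps) (x - scw (ent (w1 x) o1 o1) (fst (oo Ps)))"
  using x p by (intro Zc_diff Zc_scw Zc_id ob_oo sob_Ps) auto
 then have "Nl 0 (oo Ps) (oo Ps) (x - scw (ent (w1 x) o1 o1) (fst (oo Ps)))"
  by (rule P_to_P_entry) (simp add: w_oo_Ps)
 then show "\<exists>c. hq 0 (oo Ps) (oo Ps) x (scw c (fst (oo Ps)))" unfolding hq_def by blast
qed

lemma P_to_Q:
 fixes x :: "'k::field wk"
 assumes x: "Zc p (oo Ps) (oo Qs) x"
 shows "p \<noteq> 2 ==> Nl p (oo Ps) (oo Qs) x"
  "p = 2 ==> Zc 2 (oo Ps) (oo Qs) y ==> \<not> Nl 2 (oo Ps) (oo Qs) y ==> \<exists>c. hq 2 (oo Ps) (oo Qs) x (scw c y)"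
proof -
 have d: "dgr p (w1 x)" using x by (simp add: Zc_def Cm_def dg_def)
 show "p \<noteq> 2 ==> Nl p (oo Ps) (oo Qs) x"
  using d[unfolded dgr_def, rule_format, of o3 o1] by (intro P_to_Q_entry[OF x]) auto
 assume p: "p = 2" and y: "Zc 2 (oo Ps) (oo Qs) y" "\<not> Nl 2 (oo Ps) (oo Qs) y"
 have nz: "ent (w1 y) o3 o1 \<noteq> 0" using P_to_Q_entry[OF y(1)] y(2) by blast
 define c where "c = ent (w1 x) o3 o1 / ent (w1 y) o3 o1"
 have "Zc 2 (oo Ps) (oo Qs) (x - scw c y)"
  using x p y by (intro Zc_diff Zc_scw) auto
 then have "Nl 2 (oo Ps) (oo Qs) (x - scw c y)"
  by (rule P_to_Q_entry) (simp add: c_def nz)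
 then show "\<exists>c. hq 2 (oo Ps) (oo Qs) x (scw c y)" unfolding hq_def by blast
qed

lemma P_id_nonzero: "\<not> Nl 0 (oo Ps) (oo Ps) (fst (oo (Ps :: 'k::field so)))"
proof
 assume "Nl 0 (oo Ps) (oo Ps) (fst (oo (Ps :: 'k so)))"
 then obtain w :: "'k bm" where "w1 (fst (oo Ps)) * Em o1 o1 = (sd Ps + sB Ps) * w" using P_null[OF sob_Ps] by metis
 then have "Em o1 o1 = Em o3 o2 * w" by (simp add: w_oo_Ps distrib_right Em_times_Em)
 from arg_cong[OF this, of "\<lambda>x. ent x o1 o1"] show False by (simp add: ent_Em_times)
qed

lemma sw_id: "sw (fst (oo Qs)) = fst (oo Ps)"
 by (rule wk_eqI) (simp_all add: w_oo_Ps w_oo_Qs)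

lemma Q_to_Q:
 fixes x :: "'k::field wk"
 assumes x: "Zc p (oo Qs) (oo Qs) x"
 shows "p \<noteq> 0 ==> Nl p (oo Qs) (oo Qs) x" "p = 0 ==> \<exists>c. hq 0 (oo Qs) (oo Qs) x (scw c (fst (oo Qs)))"
 using P_to_P[of p "sw x"] x
 by (simp_all add: Zc_Qs[OF sob_Qs] Nl_Qs[OF sob_Qs] swp_Ps hq_def sw_simps sw_id)

lemma Q_to_P:
 fixes x :: "'k::field wk"
 assumes x: "Zc p (oo Qs) (oo Ps) x"
 shows "p \<noteq> 2 ==> Nl p (oo Qs) (oo Ps) x"
 using P_to_Q(1)[of p "sw x"] x by (simp add: Zc_Qs[OF sob_Ps] Nl_Qs[OF sob_Ps] swp_Ps)

lemma Q_to_P_nonzero: "\<exists>x :: 'k::field wk. Zc 2 (oo Qs) (oo Ps) x \<and> \<not> Nl 2 (oo Qs) (oo Ps) x"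
proof -
 obtain g :: "'k wk" where g: "Zc 2 (oo Ps) (oo Qs) g" "\<not> Nl 2 (oo Ps) (oo Qs) (g * fst (oo Ps))"
  using P_detect[OF sob_Ps Zc_id[OF ob_oo[OF sob_Ps]] P_id_nonzero] by auto
 have "g * fst (oo Ps) = g" using g(1) by (simp add: Zc_def Cm_def)
 then show ?thesis using g
  by (intro exI[of _ "sw g"]) (simp add: Zc_Qs[OF sob_Ps] Nl_Qs[OF sob_Ps] swp_Ps)
qed

text \<open>Reduces a matrix of cycles to homogeneous single columns, relabelled as
  \<open>o1\<close>. A preimage for the whole matrix is given uniformly by a generalised inverse
  \<open>q\<close> of \<open>D\<close>, so only an identity of entries is left to check.\<close>

lemma cycle_boundary:
 fixes D G e z :: "'k::field bm"
 assumes D: "dgr 1 D" "dgr n G" "dgr 0 e"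
  and ex: "!!p y. dgr p y ==> e * y = y ==> y * Em o1 o1 = y ==> D * y = 0 ==> \<exists>w. G * y = D * w"
  and z: "e * z = z" "D * z = 0"
 shows "\<exists>w. G * z = D * w"
proof -
 obtain q0 where q0: "D * q0 * D = D" using quasi_inverse by blast
 define q where "q = gc (- 1) q0"
 have q: "D * q * D = D"
  using gc_mult_left[OF D(1), of 0 "D * q0"] gc_mult_right[OF D(1), of "- 1" q0] q0 D(1) by (simp add: q_def gc_id)
 have "G * z = D * (q * (G * z))"
 proof (rule fm_eqI)
  fix i j
  \<comment> \<open>The degree for which the entry in row \<open>i\<close> and column
    \<open>o1\<close> of \<open>G * y\<close> survives; the total degree of \<open>o1\<close> is
    1.\<close>
  define p where "p = td i - 1 - n"
  define y where "y = gc p (z * Em j o1)"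
  have E0: "dgr 0 (Em o1 o1 :: 'k bm)" by (simp add: dgr_def)
  have "dgr p y" by (simp add: y_def)
  moreover have "e * y = y" using gc_mult_right[OF D(3), of p "z * Em j o1"] z(1) by (simp add: y_def flip: mult.assoc)
  moreover have "y * Em o1 o1 = y" using gc_mult_left[OF E0, of p "z * Em j o1"] by (simp add: y_def mult.assoc Em_times_Em)
  moreover have "D * y = 0" using gc_mult_right[OF D(1), of p "z * Em j o1"] z(2) by (simp add: y_def gc_simps flip: mult.assoc)
  ultimately obtain w where w: "G * y = D * w" using ex by blast
  have "D * (q * (G * y)) = G * y" unfolding w using q by (simp flip: mult.assoc)
  moreover have Gy: "G * y = gc (n + p) (G * (z * Em j o1))" by (simp add: y_def gc_mult_right[OF D(2)])
  moreover have "D * (q * (G * y)) = gc (1 + (- 1 + (n + p))) (D * (q * (G * (z * Em j o1))))"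
  proof -
   have "dgr (- 1) q" by (simp add: q_def)
   then show ?thesis unfolding Gy by (simp only: gc_mult_right[OF D(1)] gc_mult_right[of "- 1" q])
  qed
  ultimately have "ent (gc (n + p) (D * (q * (G * (z * Em j o1))))) i o1 = ent (gc (n + p) (G * (z * Em j o1))) i o1" by simp
  then have "ent (D * (q * (G * z)) * Em j o1) i o1 = ent (G * z * Em j o1) i o1"
   by (simp add: p_def mult.assoc)
  then show "ent (G * z) i j = ent (D * (q * (G * z))) i j" by (simp add: ent_times_Em)
 qed
 then show ?thesis by blast
qed

text \<open>Exactness of the columns of \<open>F\<close> provides the contraction needed for duality, and a
 morphism annihilated by all maps from the second string module is a boundary in the second component.\<close>

lemma endomorphism_detect:
 fixes F :: "'k::field so"
 assumes F: "sob F" "se F = pr U" "finite U"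
  and orth: "!!p x. Zc p (oo Ps) (oo F) x ==> Nl p (oo Ps) (oo F) x"
  and ex: "!!x. Zc (1 - n) (oo F) (oo F) x ==> Nl (1 - n) (oo F) (oo F) x"
  and g: "Zc n (oo F) (oo F) g" and nz: "\<not> Nl n (oo F) (oo F) g"
 shows "\<exists>m x. Zc m (oo Qs) (oo F) x \<and> \<not> Nl (n + m) (oo Qs) (oo F) (g * x)"
proof (rule ccontr)
 assume "\<not> ?thesis"
 then have all: "Nl (n + m) (oo Qs) (oo F) (g * x)" if "Zc m (oo Qs) (oo F) x" for m x using that by blast
 note sF = F(1)[unfolded sob_def]
 define e D D' g' where "e = se F" and "D = sd F + sB F" and "D' = sd F + sA F" and "g' = w2 g"
 have w0: "w1 (snd (oo F)) = D" "w2 (snd (oo F)) = D'" using F(1) by (simp_all add: D_def D'_def w_oo)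
 have DD: "D * D = 0" "D' * D' = 0" "dgr 1 D" "dgr 1 D'" "e * D = D" "D * e = D" "e * D' = D'" "D' * e = D'" "e * e = e" "dgr 0 e"
  using sF by (auto simp: D_def D'_def e_def ring_dist intro!: dgr_add)
 have "\<exists>w. z = D * w" if z: "e * z = z" "D * z = 0" for z
 proof -
  have "\<exists>w. e * z = D * w"
  proof (rule cycle_boundary[OF DD(3,10,10) _ z])
   fix p y assume y: "dgr p y" "e * y = y" "y * Em o1 o1 = y" "D * y = 0"
   obtain x where x: "Zc p (oo Ps) (oo F) x" "w1 x * Em o1 o1 = y"
    using P_cycle[OF F(1) y(1) _ y(3)] y(2,4) by (auto simp: e_def D_def)
   obtain w where "w1 x * Em o1 o1 = (sd F + sB F) * w" using P_null[OF F(1) orth[OF x(1)]] by blast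
   then show "\<exists>w. e * y = D * w" using x(2) y(2) by (auto simp: D_def)
  qed
  then show ?thesis by (simp add: z)
 qed
 from exact_contraction[OF DD(1,9,5,6) this] obtain k0 where "e * k0 = k0" "k0 * e = k0" "D * k0 + k0 * D = e" by blast
 from graded_contraction[OF DD(3,10) this] obtain k where
  k: "dgr (- 1) k" "e * k = k" "k * e = k" "D * k + k * D = e" by blast
 note cg = Zc_w[OF F(1) F(1) g, folded e_def D_def D'_def g'_def]
 \<comment> \<open>\<open>D'\<close> itself need not be exact. But its cycles are morphisms from
   \<open>Q\<close> to \<open>F\<close>, and composites of these with \<open>g\<close> are null by
   assumption.\<close>
 have Q: "\<exists>w. g' * z = D' * w" if z: "e * z = z" "D' * z = 0" for z
 proof (rule cycle_boundary[OF DD(4) cg(2) DD(10) _ z])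
  fix p y assume y: "dgr p y" "e * y = y" "y * Em o1 o1 = y" "D' * y = 0"
  have F': "sob (swp F)" using F(1) by simp
  obtain x where x: "Zc p (oo Ps) (oo (swp F)) x" "w1 x * Em o1 o1 = y"
   using P_cycle[OF F' y(1) _ y(3)] y(2,4) by (auto simp: e_def D'_def)
  have "Zc p (oo Qs) (oo F) (sw x)" using x(1) by (simp add: Zc_Qs[OF F(1)])
  from all[OF this] have "Nl (n + p) (oo Ps) (oo (swp F)) (sw g * x)" by (simp add: Nl_Qs[OF F(1)] sw_simps)
  then obtain w where "w1 (sw g * x) * Em o1 o1 = (sd (swp F) + sB (swp F)) * w" using P_null[OF F'] by blast
  then have "g' * y = D' * w" by (simp add: g'_def D'_def mult.assoc flip: x(2))
  then show "\<exists>w. g' * y = D' * w" by blast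
 qed
 obtain q where q: "D' * q * D' = D'" using quasi_inverse by blast
 have "D' * (e - e * q * D') = 0"
 proof -
  have "D' * (e - e * q * D') = D' * e - (D' * e) * q * D'" by (simp add: right_diff_distrib mult.assoc)
  then show ?thesis by (simp add: DD(8) q)
 qed
 moreover have "e * (e - e * q * D') = e - e * q * D'" using DD(9) by (simp add: right_diff_distrib flip: mult.assoc)
 ultimately obtain v where v: "g' * (e - e * q * D') = D' * v" using Q by blast
 have gv: "g' = D' * v + g' * q * D'"
 proof -
  have "g' * (e - e * q * D') = g' * e - (g' * e) * q * D'" by (simp add: right_diff_distrib mult.assoc)
  then show ?thesis using v by (simp add: cg(6) algebra_simps)
 qed
 \<comment> \<open>Over a field a map that sends cycles to boundaries is null. Here \<open>t\<close>
   absorbs the part \<open>g' * q * D'\<close>; the rest \<open>r\<close> lands in the boundaries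
   and kills them, so \<open>q * r\<close> is a homotopy for it.\<close>
 define t where "t = sg n (g' * q)"
 define r where "r = g' - (D' * t + sg n (t * D'))"
 have r1: "r = D' * (v - t)"
  using gv by (simp add: r_def t_def sgs right_diff_distrib mult.assoc) (metis add_diff_cancel_right' diff_diff_eq2 diff_add_eq add.commute diff_diff_eq)
 have r2: "r * D' = 0"
 proof -
  have "D' * t * D' = g' * D' * q * D'" by (simp add: t_def sgs cg(8) flip: mult.assoc)
  also have "\<dots> = g' * (D' * q * D')" by (simp only: mult.assoc)
  finally have "D' * t * D' = g' * D'" by (simp only: q)
  moreover have "t * D' * D' = 0" by (simp add: mult.assoc DD(2))
  ultimately show ?thesis by (simp add: r_def left_diff_distrib distrib_right sgs)
 qed
 define s0 where "s0 = t + q * r"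
 have "D' * (q * r) = r" unfolding r1 using q by (simp flip: mult.assoc)
 moreover have "q * r * D' = 0" by (simp add: mult.assoc r2)
 ultimately have gs: "g' = D' * s0 + sg n (s0 * D')"
  by (simp add: s0_def distrib_left distrib_right sgs) (simp add: r_def)
 define s' where "s' = gc (n - 1) (e * s0 * e)"
 have s': "dgr (n - 1) s'" "e * s' = s'" "s' * e = s'"
  using gc_mult_right[OF DD(10), of "n - 1" "e * s0 * e"] gc_mult_left[OF DD(10), of "n - 1" "e * s0 * e"] DD(9)
  by (simp_all add: s'_def mult.assoc) (simp flip: mult.assoc)
 have "D' * s' = gc n (D' * s0 * e)"
  using gc_mult_right[OF DD(4), of "n - 1" "e * s0 * e"] DD(8) by (simp add: s'_def flip: mult.assoc)
 moreover have "s' * D' = gc n (e * s0 * D')"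
  using gc_mult_left[OF DD(4), of "n - 1" "e * s0 * e"] DD(7) by (simp add: s'_def mult.assoc)
 moreover have "g' = D' * s0 * e + sg n (e * s0 * D')"
 proof -
  have "g' = e * g' * e" using cg by simp
  also have "\<dots> = (e * D') * s0 * e + sg n (e * s0 * (D' * e))" by (subst gs) (simp add: distrib_left distrib_right sgs mult.assoc)
  finally show ?thesis by (simp add: DD)
 qed
 ultimately have s4: "g' = D' * s' + sg n (s' * D')"
  using gc_id[OF cg(2)] by (metis (no_types, lifting) gc_simps(1) gc_simps(3) sg_def)
 have "Nl n (oo F) (oo F) g"
  by (rule duality_lemma[OF F g, of k s']) (use k s' s4 ex in \<open>simp_all add: e_def D_def D'_def g'_def\<close>)
 then show False using nz by blast
qed

section \<open>Equivalences of arbitrary degree, exact sequences of a cone, the object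
  \<open>E\<close>, and spherical objects\<close>

section \<open>Cones and the classification argument\<close>

text \<open>An isomorphism from \<open>X\<close> to \<open>Y[p]\<close> with inverse
  \<open>t\<close>, kept as a closed morphism of degree \<open>p\<close> so that the classification
  argument never shifts an object.\<close>

definition weqv :: "int \<Rightarrow> 'k::field ob \<Rightarrow> 'k ob \<Rightarrow> 'k wk \<Rightarrow> 'k wk \<Rightarrow> bool" where
 "weqv p X Y s t \<longleftrightarrow> Zc p X Y s \<and> Zc (- p) Y X t \<and> hq 0 X X (t * s) (fst X) \<and> hq 0 Y Y (s * t) (fst Y)"

lemma Nl_hq: "hq p X Y a b ==> Nl p X Y a \<longleftrightarrow> Nl p X Y b"
 using hq_Nl hq_sym by blast

lemma hq_0: "hq p X Y a 0 \<longleftrightarrow> Nl p X Y a"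
 by (simp add: hq_def)

lemma Zc_fst: "Zc p X Y g ==> fst Y * g = g" "Zc p X Y g ==> g * fst X = g"
 by (simp_all add: Zc_def Cm_def)

lemma weqv_sym: "weqv p X Y s t ==> weqv (- p) Y X t s"
 by (simp add: weqv_def)

lemma weqv_trans:
 assumes "weqv p X Y s t" "weqv q Y Z s' t'" "r = p + q"
 shows "weqv r X Z (s' * s) (t * t')"
proof -
 have a: "Zc p X Y s" "Zc (- p) Y X t" "hq 0 X X (t * s) (fst X)" "hq 0 Y Y (s * t) (fst Y)"
  and b: "Zc q Y Z s'" "Zc (- q) Z Y t'" "hq 0 Y Y (t' * s') (fst Y)" "hq 0 Z Z (s' * t') (fst Z)"
  using assms by (auto simp: weqv_def)
 have 1: "Zc r X Z (s' * s)" "Zc (- r) Z X (t * t')"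
  by (rule Zc_comp[OF a(1) b(1)], simp add: assms) (rule Zc_comp[OF b(2) a(2)], simp add: assms)
 have "hq p X Y (t' * s' * s) s" by (rule hq_id_left[OF a(1) b(3)])
 from hq_left[OF this a(2), of 0] have "hq 0 X X (t * (t' * s' * s)) (t * s)" by simp
 then have 2: "hq 0 X X (t * t' * (s' * s)) (fst X)" using hq_trans[OF _ a(3)] by (simp add: mult.assoc)
 have "hq (- q) Z Y (s * t * t') t'" by (rule hq_id_left[OF b(2) a(4)])
 from hq_left[OF this b(1), of 0] have "hq 0 Z Z (s' * (s * t * t')) (s' * t')" by simp
 then have "hq 0 Z Z (s' * s * (t * t')) (fst Z)" using hq_trans[OF _ b(4)] by (simp add: mult.assoc)
 then show ?thesis using 1 2 by (simp add: weqv_def)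
qed

lemma weqv_Nl_left:
 assumes w: "weqv p X Y s t" and x: "Zc r T X x" and n: "Nl m T Y (s * x)" "m = p + r"
 shows "Nl r T X x"
proof -
 have t: "Zc (- p) Y X t" "hq 0 X X (t * s) (fst X)" using w by (auto simp: weqv_def)
 have "Nl r T X (t * (s * x))" by (rule Nl_comp_left[OF n(1) t(1)]) (simp add: n(2))
 moreover have "hq r T X (t * s * x) x" by (rule hq_id_left[OF x t(2)])
 ultimately show ?thesis by (simp add: Nl_hq mult.assoc)
qed

lemma weqv_Nl_right:
 assumes w: "weqv p X Y s t" and x: "Zc r Y T x" and n: "Nl m X T (x * s)" "m = r + p"
 shows "Nl r Y T x"
proof -
 have t: "Zc (- p) Y X t" "hq 0 Y Y (s * t) (fst Y)" using w by (auto simp: weqv_def)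
 have "Nl r Y T (x * s * t)" by (rule Nl_comp_right[OF n(1) t(1)]) (simp add: n(2))
 moreover have "hq r Y T (x * (s * t)) x" by (rule hq_id_right[OF x t(2)])
 ultimately show ?thesis by (simp add: Nl_hq mult.assoc)
qed

text \<open>Bracketing \<open>x * y * x\<close> in the two possible ways gives two multiples of
  \<open>x\<close>.\<close>

lemma scalars_agree:
 assumes x: "Zc r Y F x" and y: "Zc (- r) F Y y" and k: "hq 0 F F (x * y) (scw k (fst F))" and l: "hq 0 Y Y (y * x) (scw l (fst Y))"
  and nz: "\<not> Nl r Y F x"
 shows "k = l"
proof (rule ccontr)
 have "hq r Y F (x * y * x) (scw k x)"
  using hq_right[OF k x, of r] by (simp add: scw_mult_left Zc_fst(1)[OF x])
 moreover have "hq r Y F (x * (y * x)) (scw l x)"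
  using hq_left[OF l x, of r] by (simp add: scw_mult_right Zc_fst(2)[OF x])
 ultimately have "hq r Y F (scw k x) (scw l x)" using hq_trans[OF hq_sym] by (metis mult.assoc)
 then have kl: "Nl r Y F (scw (k - l) x)"
  by (simp add: hq_def) (metis scw_simps(4) add_diff_cancel_right' diff_add_cancel)
 assume "k \<noteq> l"
 then show False using Nl_scw[OF kl, of "1 / (k - l)"] nz by (simp add: scw_simps)
qed

lemma scalar_weqv:
 assumes x: "Zc r Y F x" and y: "Zc (- r) F Y y" and k: "hq 0 F F (x * y) (scw k (fst F))" and l: "hq 0 Y Y (y * x) (scw l (fst Y))"
  and nz: "\<not> Nl r Y F x" and l0: "l \<noteq> 0"
 shows "weqv r Y F x (scw (1 / l) y)"
proof -
 have "hq 0 Y Y (scw (1 / l) y * x) (fst Y)" "hq 0 F F (x * scw (1 / l) y) (fst F)"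
  using hq_scw[OF l, of "1 / l"] hq_scw[OF k, of "1 / l"] l0 scalars_agree[OF x y k l nz]
  by (simp_all add: scw_mult_left scw_mult_right scw_simps)
 then show ?thesis using x Zc_scw[OF y] by (simp add: weqv_def)
qed

text \<open>The cone \<open>C\<close> of \<open>f\<close> with its summands \<open>X[1]\<close>,
  through \<open>J\<close> and \<open>p\<close>, and \<open>Y\<close>, through \<open>I\<close> and
  \<open>q\<close>. In general \<open>J\<close> and \<open>q\<close> are not closed; their
  boundaries produce \<open>f\<close>.\<close>

locale cone_triangle =
 fixes X Y C :: "'k::field ob" and f J I p q :: "'k wk"
 assumes obs: "ob X" "ob Y" "ob C" and f: "Zc 0 X Y f"
  and J: "Cm (- 1) X C J" and I: "Cm 0 Y C I" and p: "Cm 1 C X p" and q: "Cm 0 C Y q"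
  and pJ: "p * J = fst X" and qI: "q * I = fst Y" and pI: "p * I = 0" and qJ: "q * J = 0"
  and sum_id: "J * p + I * q = fst C"
  and diff: "snd C = I * snd Y * q + I * f * p - J * snd X * p"
begin

lemma units:
 "fst C * J = J" "J * fst X = J" "fst C * I = I" "I * fst Y = I" "fst X * p = p" "p * fst C = p" "fst Y * q = q" "q * fst C = q"
 "fst Y * f = f" "f * fst X = f" "fst X * snd X = snd X" "snd X * fst X = snd X" "fst Y * snd Y = snd Y" "snd Y * fst Y = snd Y"
 using J I p q f obs by (auto simp: Cm_def Zc_def ob_def)

lemma assocs: "p * (J * z) = fst X * z" "q * (I * z) = fst Y * z" "p * (I * z) = 0" "q * (J * z) = 0"
 "fst X * (snd X * z) = snd X * z" "fst Y * (snd Y * z) = snd Y * z" "fst Y * (f * z) = f * z"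
 using pJ qI pI qJ units by (simp_all flip: mult.assoc)

lemma DI: "snd C * I = I * snd Y"
 by (simp add: diff ring_dist mult.assoc qI pI units)

lemma pD: "p * snd C = - (snd X * p)"
 by (simp add: diff ring_dist mult.assoc assocs)

lemma qD: "q * snd C = snd Y * q + f * p"
 by (simp add: diff ring_dist mult.assoc assocs)

lemma DJ: "snd C * J = I * f - J * snd X"
 by (simp add: diff ring_dist mult.assoc qJ pJ units)

lemma ZI: "Zc 0 Y C I"
 using I DI by (simp add: Zc_def)

lemma Zp: "Zc 1 C X p"
 using p pD by (simp add: Zc_def)

lemma fp_null: "Nl 1 C Y (f * p)"
 unfolding Nl_def by (rule exI[of _ "- q"]) (simp add: Cm_uminus q qD)

text \<open>Exactness of Hom(T, -) at \<open>Y\<close>: the \<open>p\<close> component of a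
  null-homotopy of \<open>I * y\<close> is the lift, and the \<open>q\<close> component compares it
  with \<open>y\<close>.\<close>

lemma lift_I:
 assumes y: "Zc m T Y y" and n: "Nl m T C (I * y)"
 shows "\<exists>x. Zc m T X x \<and> hq m T Y y (f * x)"
proof -
 obtain h where h: "Cm (m - 1) T C h" "I * y = snd C * h + sg m (h * snd T)" using n by (auto simp: Nl_def)
 have ph: "Cm m T X (p * h)" "Cm (m - 1) T Y (q * h)"
  by (rule Cm_comp[OF h(1) p], simp) (rule Cm_comp[OF h(1) q], simp)
 have "p * (snd C * h + sg m (h * snd T)) = 0" unfolding h(2)[symmetric] by (simp add: assocs)
 then have "snd X * (p * h) = sg m (p * h * snd T)"
  using pD by (simp add: distrib_left sg_mult_right add_eq_0_iff2 flip: mult.assoc)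
 then have z: "Zc m T X (p * h)" using ph by (simp add: Zc_def)
 have "y = q * (I * y)" using y by (simp add: assocs Zc_def Cm_def)
 also have "\<dots> = q * snd C * h + sg m (q * h * snd T)" by (simp add: h(2) distrib_left sg_mult_right mult.assoc)
 also have "\<dots> = snd Y * (q * h) + sg m (q * h * snd T) + f * (p * h)" by (simp add: qD distrib_right mult.assoc)
 finally have "y - f * (p * h) = snd Y * (q * h) + sg m (q * h * snd T)" by simp
 then have "hq m T Y y (f * (p * h))" unfolding hq_def Nl_def using ph(2) by blast
 then show ?thesis using z by blast
qed

text \<open>Exactness of Hom(T, -) at \<open>C\<close>: adding the boundary of \<open>J * h\<close>
  kills the component in \<open>X[1]\<close>, after which the morphism factors through
  \<open>I\<close>.\<close>

lemma lift_p:
 assumes T: "ob T" and z: "Zc m T C z" and n: "Nl (m + 1) T X (p * z)"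
 shows "\<exists>y. Zc m T Y y \<and> hq m T C z (I * y)"
proof -
 obtain h where h: "Cm m T X h" "p * z = snd X * h + sg (m + 1) (h * snd T)" using n by (auto simp: Nl_def)
 define \<delta> where "\<delta> = snd C * (J * h) + sg m (J * h * snd T)"
 have "Cm (m - 1) T C (J * h)" by (rule Cm_comp[OF h(1) J]) simp
 then have nd: "Nl m T C \<delta>" unfolding Nl_def \<delta>_def by blast
 define z' where "z' = z + \<delta>"
 have z': "Zc m T C z'" unfolding z'_def by (rule Zc_add[OF z Nl_Zc[OF nd T obs(3)]])
 have hX: "fst X * h = h" using h(1) by (simp add: Cm_def)
 have pz: "p * z' = 0"
 proof -
  have "p * \<delta> = p * snd C * (J * h) + sg m (p * (J * (h * snd T)))" by (simp add: \<delta>_def distrib_left sg_mult_right mult.assoc)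
  also have "\<dots> = - (snd X * h) + sg m (h * snd T)"
   using hX by (simp add: pD assocs mult.assoc) (simp flip: mult.assoc)
  finally show ?thesis by (simp add: z'_def distrib_left h(2) sg_def)
 qed
 have "z' = (J * p + I * q) * z'" using z' by (simp add: sum_id Zc_fst)
 then have zI: "z' = I * (q * z')" by (simp add: distrib_right mult.assoc pz)
 have "snd Y * (q * z') = q * snd C * z'" by (simp add: qD distrib_right mult.assoc pz)
 also have "\<dots> = sg m (q * z' * snd T)" using z' by (simp add: Zc_def mult.assoc sg_mult_right)
 finally have "Zc m T Y (q * z')" using Cm_comp[of m T C z' 0 Y q m] z' q by (simp add: Zc_def)
 moreover have "hq m T C z (I * (q * z'))"
 proof -
  have "z - I * (q * z') = - \<delta>" by (simp only: zI[symmetric]) (simp add: z'_def)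
  then show ?thesis unfolding hq_def using Nl_uminus[OF nd] by simp
 qed
 ultimately show ?thesis by blast
qed

text \<open>Exactness of Hom(-, T) at \<open>Y\<close>: a null-homotopy of \<open>y * f\<close>
  serves, up to sign, as the extension on the summand \<open>X[1]\<close>.\<close>

lemma extend_I:
 assumes y: "Zc m Y T y" and n: "Nl m X T (y * f)"
 shows "\<exists>z. Zc m C T z \<and> z * I = y"
proof -
 obtain h where h: "Cm (m - 1) X T h" "y * f = snd T * h + sg m (h * snd X)" using n by (auto simp: Nl_def)
 define z where "z = y * q + sg m (h * p)"
 have y': "Cm m Y T y" "snd T * y = sg m (y * snd Y)" "y * fst Y = y" using y by (auto simp: Zc_def Cm_def)
 have "Cm m C T (y * q)" by (rule Cm_comp[OF q y'(1)]) simp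
 moreover have "Cm m C T (h * p)" by (rule Cm_comp[OF p h(1)]) simp
 ultimately have c: "Cm m C T z" unfolding z_def by (intro Cm_add Cm_sg)
 have "sg m (z * snd C) = sg m (y * (q * snd C)) + h * (p * snd C)" by (simp add: z_def distrib_right sgs mult.assoc)
 also have "\<dots> = sg m (y * snd Y * q) + sg m (y * f * p) - h * snd X * p"
  by (simp add: qD pD distrib_left sg_add mult.assoc)
 also have "sg m (y * f * p) = sg m (snd T * h * p) + h * snd X * p" by (simp add: h(2) distrib_right sgs)
 finally have "snd T * z = sg m (z * snd C)" by (simp add: z_def distrib_left sgs y'(2) flip: mult.assoc)
 moreover have "z * I = y" by (simp add: z_def distrib_right sgs mult.assoc qI pI y')
 ultimately show ?thesis using c by (auto simp: Zc_def)
qed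

text \<open>Exactness of Hom(-, T) at \<open>X\<close>: a null-homotopy of \<open>x * p\<close>,
  restricted along \<open>I\<close>, is the factor through \<open>f\<close> up to sign; restricted
  along \<open>J\<close>, it is the comparing homotopy.\<close>

lemma extend_p:
 assumes x: "Zc m X T x" and n: "Nl (m + 1) C T (x * p)"
 shows "\<exists>y. Zc m Y T y \<and> hq m X T x (y * f)"
proof -
 obtain h where h: "Cm m C T h" "x * p = snd T * h + sg (m + 1) (h * snd C)" using n by (auto simp: Nl_def)
 define y where "y = sg (m + 1) (h * I)"
 have c: "Cm m Y T (h * I)" "Cm (m - 1) X T (h * J)"
  by (rule Cm_comp[OF I h(1)], simp) (rule Cm_comp[OF J h(1)], simp)
 have "(x * p) * I = 0" by (simp add: mult.assoc pI)
 then have "snd T * (h * I) + sg (m + 1) (h * (snd C * I)) = 0" by (simp add: h(2) distrib_right sgs mult.assoc)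
 then have "snd T * (h * I) = sg m (h * I * snd Y)" by (simp add: DI sg_def mult.assoc add_eq_0_iff2 split: if_splits)
 then have z: "Zc m Y T y" unfolding y_def using c by (intro Zc_sg) (simp add: Zc_def)
 have "x = (x * p) * J" using x by (simp add: mult.assoc pJ Zc_fst)
 also have "\<dots> = snd T * (h * J) + sg (m + 1) (h * (snd C * J))" by (simp add: h(2) distrib_right sgs mult.assoc)
 also have "\<dots> = snd T * (h * J) + sg m (h * J * snd X) + y * f"
  by (simp add: DJ y_def right_diff_distrib sg_def mult.assoc)
 finally have "x - y * f = snd T * (h * J) + sg m (h * J * snd X)" by simp
 then have "hq m X T x (y * f)" unfolding hq_def Nl_def using c(2) by blast
 then show ?thesis using z by blast
qed

end

text \<open>The triangle from \<open>Q[1]\<close> through \<open>Y\<close> to \<open>P\<close>, with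
  nonzero connecting morphism \<open>p * c\<close>. As \<open>S(P)\<close> is \<open>Q[2]\<close>,
  the object \<open>Y\<close> is \<open>E\<close> up to isomorphism.\<close>

locale spherical_cone = cone_triangle X Y C f J I p q
 for X Y C :: "'k::field ob" and f J I p q +
 fixes s t c d :: "'k wk"
 assumes s: "weqv (- 1) (oo Qs) X s t" and c: "weqv 0 (oo Ps) C c d"
  and nonzero: "\<not> Nl 1 (oo Ps) X (p * c)"
begin

lemma st: "Zc (- 1) (oo Qs) X s" "Zc 1 X (oo Qs) t" "hq 0 (oo Qs) (oo Qs) (t * s) (fst (oo Qs))" "hq 0 X X (s * t) (fst X)"
 and cd: "Zc 0 (oo Ps) C c" "Zc 0 C (oo Ps) d" "hq 0 (oo Ps) (oo Ps) (d * c) (fst (oo Ps))" "hq 0 C C (c * d) (fst C)"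
 and obPQ: "ob (oo Ps :: 'k ob)" "ob (oo Qs :: 'k ob)"
 using s c ob_oo[OF sob_Ps] ob_oo[OF sob_Qs] by (simp_all add: weqv_def)

lemma t_eqv: "weqv 1 X (oo Qs) t s" and d_eqv: "weqv 0 C (oo Ps) d c"
 using weqv_sym[OF s] weqv_sym[OF c] by simp_all

lemma pc: "Zc 1 (oo Ps) X (p * c)"
 by (rule Zc_comp[OF cd(1) Zp]) simp

text \<open>In the long exact sequence of Hom(P, -), the groups for \<open>C\<close> and
  \<open>X\<close> are lines in degrees 0 and 1, and the connecting morphism identifies them because
  it is nonzero.\<close>

lemma Y_orth:
 assumes x: "Zc r (oo Ps) Y x"
 shows "Nl r (oo Ps) Y x"
proof -
 have Ix: "Zc r (oo Ps) C (I * x)" by (rule Zc_comp[OF x ZI]) simp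
 have z: "Zc r (oo Ps) (oo Ps) (d * (I * x))" by (rule Zc_comp[OF Ix cd(2)]) simp
 have "Nl r (oo Ps) (oo Ps) (d * (I * x))"
 proof (cases "r = 0")
  case False
  then show ?thesis by (rule P_to_P(1)[OF z])
 next
  case True
  then obtain k where k: "hq 0 (oo Ps) (oo Ps) (d * (I * x)) (scw k (fst (oo Ps)))" using P_to_P(2)[OF z] by blast
  have "hq 0 (oo Ps) C (c * (d * (I * x))) (c * scw k (fst (oo Ps)))" by (rule hq_left[OF k cd(1)]) simp
  moreover have "hq 0 (oo Ps) C (c * d * (I * x)) (I * x)" using hq_id_left[OF Ix cd(4)] True by simp
  ultimately have "hq 0 (oo Ps) C (I * x) (scw k c)"
   using hq_trans[OF hq_sym] by (simp add: scw_mult_right mult.assoc Zc_fst(2)[OF cd(1)])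
  from hq_left[OF this Zp, of 1] have "hq 1 (oo Ps) X 0 (scw k (p * c))" by (simp add: assocs scw_mult_right)
  then have n: "Nl 1 (oo Ps) X (scw k (p * c))" using hq_sym hq_0 by blast
  have "k = 0"
  proof (rule ccontr)
   assume "k \<noteq> 0"
   then show False using Nl_scw[OF n, of "1 / k"] nonzero by (simp add: scw_simps)
  qed
  then show ?thesis using k True by (simp add: scw_simps hq_0)
 qed
 then have "Nl r (oo Ps) C (I * x)" by (rule weqv_Nl_left[OF d_eqv Ix]) simp
 from lift_I[OF x this] obtain z where z: "Zc r (oo Ps) X z" "hq r (oo Ps) Y x (f * z)" by blast
 have tz: "Zc (r + 1) (oo Ps) (oo Qs) (t * z)" by (rule Zc_comp[OF z(1) st(2)]) simp
 have "Nl r (oo Ps) Y (f * z)"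
 proof (cases "r + 1 = 2")
  case False
  have "Nl r (oo Ps) X z" by (rule weqv_Nl_left[OF t_eqv z(1) P_to_Q(1)[OF tz False]]) simp
  then show ?thesis by (rule Nl_comp_left[OF _ f]) simp
 next
  case True
  have r: "r = 1" using True by simp
  have tp: "Zc 2 (oo Ps) (oo Qs) (t * (p * c))" by (rule Zc_comp[OF pc st(2)]) simp
  have "\<not> Nl 2 (oo Ps) (oo Qs) (t * (p * c))" using weqv_Nl_left[OF t_eqv pc] nonzero by fastforce
  from P_to_Q(2)[OF tz True tp this] obtain k where "hq 2 (oo Ps) (oo Qs) (t * z) (scw k (t * (p * c)))" by blast
  then have "Nl 2 (oo Ps) (oo Qs) (t * (z - scw k (p * c)))" by (simp add: hq_def right_diff_distrib scw_mult_right)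
  moreover have "Zc 1 (oo Ps) X (z - scw k (p * c))" using z(1) r pc by (intro Zc_diff Zc_scw) auto
  ultimately have "Nl 1 (oo Ps) X (z - scw k (p * c))" by (intro weqv_Nl_left[OF t_eqv]) auto
  from Nl_comp_left[OF this f, of 1] have "Nl 1 (oo Ps) Y (f * z - scw k (f * p * c))"
   by (simp add: right_diff_distrib scw_mult_right mult.assoc)
  moreover have "Nl 1 (oo Ps) Y (scw k (f * p * c))" by (rule Nl_scw[OF Nl_comp_right[OF fp_null cd(1)]]) simp
  ultimately have "Nl 1 (oo Ps) Y (f * z)" using Nl_add by fastforce
  then show ?thesis by (simp add: r)
 qed
 then show ?thesis using z(2) by (simp add: Nl_hq)
qed

lemma C_to_orth:
 assumes T: "!!r x. Zc r (oo Ps) T x ==> Nl r (oo Ps) T x" and z: "Zc r C T z"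
 shows "Nl r C T z"
proof (rule weqv_Nl_right[OF c z])
 show "Nl r (oo Ps) T (z * c)" by (rule T[OF Zc_comp[OF cd(1) z]]) simp
qed simp

text \<open>Morphisms from \<open>Q\<close> to \<open>P\<close> occur in degree 2 only, so
  \<open>I * (e * f)\<close> is null and \<open>e * f\<close> lifts to an endomorphism of
  \<open>X\<close>, which is a scalar \<open>k\<close>. Then \<open>e - k\<close> kills
  \<open>f\<close>, hence extends over \<open>C\<close>, and is null since \<open>Y\<close> is
  orthogonal to \<open>P\<close>.\<close>

lemma Y_End:
 assumes e: "Zc 0 Y Y e"
 shows "\<exists>k. hq 0 Y Y e (scw k (fst Y))"
proof -
 have ef: "Zc 0 X Y (e * f)" by (rule Zc_comp[OF f e]) simp
 have Ief: "Zc 0 X C (I * (e * f))" by (rule Zc_comp[OF ef ZI]) simp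
 have Ies: "Zc (- 1) (oo Qs) C (I * (e * f) * s)" by (rule Zc_comp[OF st(1) Ief]) simp
 have "Zc (- 1) (oo Qs) (oo Ps) (d * (I * (e * f) * s))" by (rule Zc_comp[OF Ies cd(2)]) simp
 then have "Nl (- 1) (oo Qs) (oo Ps) (d * (I * (e * f) * s))" by (rule Q_to_P) simp
 then have "Nl (- 1) (oo Qs) C (I * (e * f) * s)" by (rule weqv_Nl_left[OF d_eqv Ies]) simp
 then have "Nl 0 X C (I * (e * f))" by (rule weqv_Nl_right[OF s Ief]) simp
 from lift_I[OF ef this] obtain a where a: "Zc 0 X X a" "hq 0 X Y (e * f) (f * a)" by blast
 have as: "Zc (- 1) (oo Qs) X (a * s)" by (rule Zc_comp[OF st(1) a(1)]) simp
 have tas: "Zc 0 (oo Qs) (oo Qs) (t * (a * s))" by (rule Zc_comp[OF as st(2)]) simp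
 obtain k where k: "hq 0 (oo Qs) (oo Qs) (t * (a * s)) (scw k (fst (oo Qs)))" using Q_to_Q(2)[OF tas] by blast
 have k': "hq 0 (oo Qs) (oo Qs) (scw k (t * s)) (scw k (fst (oo Qs)))" by (rule hq_scw[OF st(3)])
 define b where "b = a - scw k (fst X)"
 have b: "Zc 0 X X b" unfolding b_def by (intro Zc_diff a Zc_scw Zc_id obs)
 have bs: "Zc (- 1) (oo Qs) X (b * s)" by (rule Zc_comp[OF st(1) b]) simp
 have "Nl 0 (oo Qs) (oo Qs) (t * (b * s))"
  using hq_trans[OF k hq_sym[OF k']] by (simp add: hq_def b_def ring_dist scw_mult_left scw_mult_right Zc_fst(1)[OF st(1)])
 then have "Nl (- 1) (oo Qs) X (b * s)" by (rule weqv_Nl_left[OF t_eqv bs]) simp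
 then have "Nl 0 X X b" by (rule weqv_Nl_right[OF s b]) simp
 from Nl_comp_left[OF this f, of 0] have "hq 0 X Y (f * a) (scw k f)"
  by (simp add: hq_def b_def right_diff_distrib scw_mult_right units)
 from hq_trans[OF a(2) this] have n: "Nl 0 X Y ((e - scw k (fst Y)) * f)"
  by (simp add: hq_def left_diff_distrib scw_mult_left units)
 have "Zc 0 Y Y (e - scw k (fst Y))" by (intro Zc_diff e Zc_scw Zc_id obs)
 from extend_I[OF this n] obtain z where z: "Zc 0 C Y z" "z * I = e - scw k (fst Y)" by blast
 have "Nl 0 C Y z" using C_to_orth[where T = Y] Y_orth z(1) by blast
 from Nl_comp_right[OF this ZI, of 0] show ?thesis unfolding z(2) hq_def by auto
qed

text \<open>The nonzero morphism from \<open>Q\<close> to \<open>P\<close> of degree 2 gives one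
  from \<open>X\<close> to \<open>C\<close> of degree 3. It lifts to \<open>Y\<close> because Hom(X,
  X) vanishes in degree 4, and the lift factors through \<open>f\<close> because Hom(C, Y)
  vanishes.\<close>

lemma Y_H3: "\<exists>y. Zc 3 Y Y y \<and> \<not> Nl 3 Y Y y"
proof -
 obtain k0 :: "'k wk" where k0: "Zc 2 (oo Qs) (oo Ps) k0" "\<not> Nl 2 (oo Qs) (oo Ps) k0" using Q_to_P_nonzero by blast
 have ck: "Zc 2 (oo Qs) C (c * k0)" by (rule Zc_comp[OF k0(1) cd(1)]) simp
 define k where "k = c * k0 * t"
 have k: "Zc 3 X C k" unfolding k_def by (rule Zc_comp[OF st(2) ck]) simp
 have nk: "\<not> Nl 3 X C k"
 proof
  assume "Nl 3 X C k"
  then have "Nl 2 (oo Qs) C (c * k0)" unfolding k_def by (intro weqv_Nl_right[OF t_eqv ck]) auto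
  then have "Nl 2 (oo Qs) (oo Ps) k0" by (intro weqv_Nl_left[OF c k0(1)]) auto
  then show False using k0 by blast
 qed
 have pk: "Zc 4 X X (p * k)" by (rule Zc_comp[OF k Zp]) simp
 have pks: "Zc 3 (oo Qs) X (p * k * s)" by (rule Zc_comp[OF st(1) pk]) simp
 have "Zc 4 (oo Qs) (oo Qs) (t * (p * k * s))" by (rule Zc_comp[OF pks st(2)]) simp
 then have "Nl 4 (oo Qs) (oo Qs) (t * (p * k * s))" by (rule Q_to_Q(1)) simp
 then have "Nl 3 (oo Qs) X (p * k * s)" by (rule weqv_Nl_left[OF t_eqv pks]) simp
 then have "Nl 4 X X (p * k)" by (rule weqv_Nl_right[OF s pk]) simp
 then have "Nl (3 + 1) X X (p * k)" by simp
 from lift_p[OF obs(1) k this] obtain l where l: "Zc 3 X Y l" "hq 3 X C k (I * l)" by blast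
 have "Zc 4 C Y (l * p)" by (rule Zc_comp[OF Zp l(1)]) simp
 then have "Nl 4 C Y (l * p)" using C_to_orth[where T = Y] Y_orth by blast
 then have "Nl (3 + 1) C Y (l * p)" by simp
 from extend_p[OF l(1) this] obtain y where y: "Zc 3 Y Y y" "hq 3 X Y l (y * f)" by blast
 have "\<not> Nl 3 Y Y y"
 proof
  assume "Nl 3 Y Y y"
  from Nl_comp_right[OF this f, of 3] have "Nl 3 X Y l" using y(2) by (simp add: Nl_hq)
  from Nl_comp_left[OF this ZI, of 3] have "Nl 3 X C k" using l(2) by (simp add: Nl_hq)
  then show False using nk by blast
 qed
 then show ?thesis using y(1) by blast
qed

text \<open>A morphism from \<open>Q\<close> that detects \<open>g\<close> factors through
  \<open>f\<close>, since Hom(C, F) vanishes for \<open>F\<close> orthogonal to \<open>P\<close>.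
  Serre duality, in the form of \<open>serre\<close>, supplies the way back from \<open>F\<close> to
  \<open>Y\<close>.\<close>

lemma factor_through_Y:
 fixes F :: "'k so"
 assumes F: "sob F" "se F = pr U" "finite U"
  and orth: "!!r x. Zc r (oo Ps) (oo F) x ==> Nl r (oo Ps) (oo F) x"
  and ex: "!!x. Zc (1 - n) (oo F) (oo F) x ==> Nl (1 - n) (oo F) (oo F) x"
  and serre: "!!r h. Zc r Y (oo F) h ==> \<not> Nl r Y (oo F) h ==> \<exists>v. Zc (n - r) (oo F) Y v \<and> \<not> Nl n (oo F) (oo F) (h * v)"
  and g: "Zc n (oo F) (oo F) g" "\<not> Nl n (oo F) (oo F) g"
 shows "\<exists>r x y. Zc r Y (oo F) x \<and> Zc (- r) (oo F) Y y \<and> \<not> Nl n (oo F) (oo F) (g * (x * y))"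
proof -
 obtain m x1 where x1: "Zc m (oo Qs) (oo F) x1" "\<not> Nl (n + m) (oo Qs) (oo F) (g * x1)"
  using endomorphism_detect[OF F orth ex g] by blast
 have x2: "Zc (m + 1) X (oo F) (x1 * t)" by (rule Zc_comp[OF st(2) x1(1)]) simp
 have gx1: "Zc (n + m) (oo Qs) (oo F) (g * x1)" by (rule Zc_comp[OF x1(1) g(1)]) simp
 have n2: "\<not> Nl (n + m + 1) X (oo F) (g * (x1 * t))"
  using weqv_Nl_right[OF t_eqv gx1] x1(2) by (auto simp: mult.assoc)
 have "Zc (m + 1 + 1) C (oo F) (x1 * t * p)" by (rule Zc_comp[OF Zp x2]) simp
 then have "Nl (m + 1 + 1) C (oo F) (x1 * t * p)" using C_to_orth[where T = "oo F"] orth by blast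
 from extend_p[OF x2 this] obtain x where x: "Zc (m + 1) Y (oo F) x" "hq (m + 1) X (oo F) (x1 * t) (x * f)" by blast
 have gx: "Zc (n + m + 1) Y (oo F) (g * x)" by (rule Zc_comp[OF x(1) g(1)]) simp
 have "\<not> Nl (n + m + 1) Y (oo F) (g * x)"
 proof
  assume "Nl (n + m + 1) Y (oo F) (g * x)"
  from Nl_comp_right[OF this f, of "n + m + 1"] have "Nl (n + m + 1) X (oo F) (g * (x * f))" by (simp add: mult.assoc)
  moreover have "hq (n + m + 1) X (oo F) (g * (x1 * t)) (g * (x * f))" by (rule hq_left[OF x(2) g(1)]) simp
  ultimately show False using n2 by (simp add: Nl_hq)
 qed
 from serre[OF gx this] obtain y where y: "Zc (n - (n + m + 1)) (oo F) Y y" "\<not> Nl n (oo F) (oo F) (g * x * y)" by blast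
 have "Zc (- (m + 1)) (oo F) Y y" using y(1) by (simp add: algebra_simps)
 then show ?thesis using x(1) y(2) by (intro exI[of _ "m + 1"] exI[of _ x] exI[of _ y]) (simp add: mult.assoc)
qed

theorem spherical_objects:
 fixes F :: "'k so"
 assumes F: "sob F" "se F = pr U" "finite U"
  and orth: "!!r x. Zc r (oo Ps) (oo F) x ==> Nl r (oo Ps) (oo F) x"
  and serre: "!!r h. Zc r Y (oo F) h ==> \<not> Nl r Y (oo F) h ==> \<exists>v. Zc (n - r) (oo F) Y v \<and> \<not> Nl n (oo F) (oo F) (h * v)"
  and zero: "!!i x. i \<noteq> 0 ==> i \<noteq> n ==> Zc i (oo F) (oo F) x ==> Nl i (oo F) (oo F) x"
  and one: "!!x. n \<noteq> 0 ==> Zc 0 (oo F) (oo F) x ==> \<exists>k. hq 0 (oo F) (oo F) x (scw k (fst (oo F)))"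
  and two: "!!a b. n = 0 ==> Zc 0 (oo F) (oo F) a ==> \<not> Nl 0 (oo F) (oo F) a ==> Nl 0 (oo F) (oo F) (a * a) ==>
   Zc 0 (oo F) (oo F) b ==> \<exists>k l. hq 0 (oo F) (oo F) b (scw k (fst (oo F)) + scw l a)"
  and nz: "\<exists>g. Zc n (oo F) (oo F) g \<and> \<not> Nl n (oo F) (oo F) g"
  and n: "n \<noteq> 1"
 shows "\<exists>r x y. weqv r Y (oo F) x y"
proof -
 have obF: "ob (oo F)" by (rule ob_oo[OF F(1)])
 \<comment> \<open>Parity excludes 1 - n = n, so the obstructing degree misses both degrees of the
   sphere.\<close>
 have "2 * n \<noteq> 1" by presburger
 then have "1 - n \<noteq> 0" "1 - n \<noteq> n" using n by auto
 then have ex: "!!x. Zc (1 - n) (oo F) (oo F) x ==> Nl (1 - n) (oo F) (oo F) x" using zero by blast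
 have factor: "\<exists>r x y. Zc r Y (oo F) x \<and> Zc (- r) (oo F) Y y \<and> \<not> Nl n (oo F) (oo F) (g * (x * y))"
  if "Zc n (oo F) (oo F) g" "\<not> Nl n (oo F) (oo F) g" for g
  by (rule factor_through_Y[OF F _ _ _ that]; (rule orth | rule ex | rule serre); assumption)
 obtain g where g: "Zc n (oo F) (oo F) g" "\<not> Nl n (oo F) (oo F) g" using nz by blast
 have idF: "Zc 0 (oo F) (oo F) (fst (oo F))" by (rule Zc_id[OF obF])
 have idnz: "\<not> Nl 0 (oo F) (oo F) (fst (oo F))"
 proof
  assume "Nl 0 (oo F) (oo F) (fst (oo F))"
  from Nl_comp_left[OF this g(1), of n] show False using g by (simp add: Zc_fst)
 qed
 have xy: "Zc 0 (oo F) (oo F) (x * y)" if "Zc r Y (oo F) x" "Zc (- r) (oo F) Y y" for r x y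
  by (rule Zc_comp[OF that(2,1)]) simp
 have yx: "Zc 0 Y Y (y * x)" if "Zc r Y (oo F) x" "Zc (- r) (oo F) Y y" for r x y
  by (rule Zc_comp[OF that]) simp
 show ?thesis
 proof (cases "n = 0")
  case False
  obtain r x y where x: "Zc r Y (oo F) x" and y: "Zc (- r) (oo F) Y y" and gxy: "\<not> Nl n (oo F) (oo F) (g * (x * y))"
   using factor[OF g] by blast
  obtain k where k: "hq 0 (oo F) (oo F) (x * y) (scw k (fst (oo F)))" using one[OF False xy[OF x y]] by blast
  obtain l where l: "hq 0 Y Y (y * x) (scw l (fst Y))" using Y_End[OF yx[OF x y]] by blast
  have nx: "\<not> Nl r Y (oo F) x"
  proof
   assume "Nl r Y (oo F) x"
   from Nl_comp_right[OF this y, of 0] have "Nl 0 (oo F) (oo F) (x * y)" by simp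
   from Nl_comp_left[OF this g(1), of n] show False using gxy by simp
  qed
  have "k \<noteq> 0"
  proof
   assume "k = 0"
   then have "Nl 0 (oo F) (oo F) (x * y)" using k by (simp add: scw_simps hq_0)
   from Nl_comp_left[OF this g(1), of n] show False using gxy by simp
  qed
  then have "weqv r Y (oo F) x (scw (1 / l) y)"
   using scalar_weqv[OF x y k l nx] scalars_agree[OF x y k l nx] by simp
  then show ?thesis by blast
 next
  case n0: True
  \<comment> \<open>If \<open>y * x\<close> is the scalar \<open>k\<close> and \<open>z\<close> is a
    nonzero class of degree 3, then \<open>x * z * y\<close> is null because \<open>F\<close> has no
    degree 3 endomorphisms. Hence k^2 z is null and k = 0.\<close>
  have yx0: "Nl 0 Y Y (y * x)" if x: "Zc r Y (oo F) x" and y: "Zc (- r) (oo F) Y y" for r x y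
  proof -
   obtain k where k: "hq 0 Y Y (y * x) (scw k (fst Y))" using Y_End[OF yx[OF x y]] by blast
   obtain z where z: "Zc 3 Y Y z" "\<not> Nl 3 Y Y z" using Y_H3 by blast
   have zy: "Zc (3 - r) (oo F) Y (z * y)" by (rule Zc_comp[OF y z(1)]) simp
   have "Zc 3 (oo F) (oo F) (x * (z * y))" by (rule Zc_comp[OF zy x]) simp
   then have "Nl 3 (oo F) (oo F) (x * (z * y))" by (rule zero[rotated 2]) (simp_all add: n0)
   from Nl_comp_right[OF Nl_comp_left[OF this y, of "3 - r"] x, of 3] have n3: "Nl 3 Y Y (y * x * (z * (y * x)))"
    by (simp add: mult.assoc)
   have "hq 3 Y Y (y * x * (z * (y * x))) (scw k (z * (y * x)))"
    using hq_right[OF k Zc_comp[OF yx[OF x y] z(1), of 3], of 3] by (simp add: scw_mult_left mult.assoc[symmetric] Zc_fst(1)[OF z(1)])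
   moreover have "hq 3 Y Y (scw k (z * (y * x))) (scw k (scw k z))"
    using hq_scw[OF hq_left[OF k z(1), of 3], of k] by (simp add: scw_mult_right Zc_fst(2)[OF z(1)])
   ultimately have n4: "Nl 3 Y Y (scw (k * k) z)" using n3 by (simp add: Nl_hq scw_simps)
   have "k = 0"
   proof (rule ccontr)
    assume "k \<noteq> 0"
    then show False using Nl_scw[OF n4, of "1 / (k * k)"] z(2) by (simp add: scw_simps)
   qed
   then show ?thesis using k by (simp add: scw_simps hq_0)
  qed
  have sq: "Nl 0 (oo F) (oo F) (x * y * (x * y))" if x: "Zc r Y (oo F) x" and y: "Zc (- r) (oo F) Y y" for r x y
   using Nl_comp_right[OF Nl_comp_left[OF yx0[OF x y] x, of r] y, of 0] by (simp add: mult.assoc)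
  obtain r x y where x: "Zc r Y (oo F) x" and y: "Zc (- r) (oo F) Y y" and a0: "\<not> Nl n (oo F) (oo F) (fst (oo F) * (x * y))"
   using factor[of "fst (oo F)"] idF idnz by (auto simp: n0)
  define a where "a = x * y"
  have a: "Zc 0 (oo F) (oo F) a" "\<not> Nl 0 (oo F) (oo F) a" "Nl 0 (oo F) (oo F) (a * a)"
   using xy[OF x y] a0 sq[OF x y] by (simp_all add: a_def n0 Zc_fst(1)[OF xy[OF x y]])
  obtain r' x' y' where x': "Zc r' Y (oo F) x'" and y': "Zc (- r') (oo F) Y y'" and ab0: "\<not> Nl n (oo F) (oo F) (a * (x' * y'))"
   using factor[of a] a by (auto simp: n0)
  define b where "b = x' * y'"
  have b: "Zc 0 (oo F) (oo F) b" "Nl 0 (oo F) (oo F) (b * b)" "\<not> Nl 0 (oo F) (oo F) (a * b)"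
   using xy[OF x' y'] sq[OF x' y'] ab0 by (simp_all add: b_def n0)
  \<comment> \<open>Writing b = k + l a gives a b = k a. As \<open>b\<close> has square zero, k^2 a
    is null, so k = 0, which contradicts a b being nonzero.\<close>
  obtain k l where kl: "hq 0 (oo F) (oo F) b (scw k (fst (oo F)) + scw l a)" using two[OF n0 a b(1)] by blast
  have "hq 0 (oo F) (oo F) (a * b) (scw k a + scw l (a * a))"
   using hq_left[OF kl a(1), of 0] by (simp add: distrib_left scw_mult_right Zc_fst(2)[OF a(1)])
  moreover have aa: "hq 0 (oo F) (oo F) (scw k a + scw l (a * a)) (scw k a + 0)"
   by (rule hq_add[OF hq_refl]) (simp add: hq_0 Nl_scw a(3))
  ultimately have ab: "hq 0 (oo F) (oo F) (a * b) (scw k a)" using hq_trans by fastforce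
  have "hq 0 (oo F) (oo F) (a * b * b) (scw k (a * b))"
   using hq_right[OF ab b(1), of 0] by (simp add: scw_mult_left)
  moreover have "hq 0 (oo F) (oo F) (scw k (a * b)) (scw k (scw k a))" by (rule hq_scw[OF ab])
  moreover have "Nl 0 (oo F) (oo F) (a * b * b)" using Nl_comp_left[OF b(2) a(1), of 0] by (simp add: mult.assoc)
  ultimately have n5: "Nl 0 (oo F) (oo F) (scw (k * k) a)" by (simp add: Nl_hq scw_simps)
  have "k = 0"
  proof (rule ccontr)
   assume "k \<noteq> 0"
   then show False using Nl_scw[OF n5, of "1 / (k * k)"] a(2) by (simp add: scw_simps)
  qed
  then have "Nl 0 (oo F) (oo F) (a * b)" using ab by (simp add: scw_simps hq_0)
  then show ?thesis using b(3) by blast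
 qed
qed

end

section \<open>The shift functor as conjugation by identity matrices of nonzero degree\<close>

section \<open>Shifts\<close>

lemma shift_sel [simp]: "cobj (shift n X) i = cobj X (i + n)" "cdif (shift n X) i v = sgn1 n \<cdot>\<^sub>m cdif X (i + n) v"
 by (simp_all add: shift_def sgn1_def)

lemma cplx_cdif: "is_cplx X ==> cdif X i v \<in> carrier_mat (cdim X (i + 1) v) (cdim X i v)"
 by (simp add: is_cplx_def rep_map_def)

lemma cplx_ract: "is_cplx X ==> ract (cobj X i) a \<in> carrier_mat (cdim X i (tgt a)) (cdim X i (src a))"
 by (simp add: is_cplx_def is_rep_def)

lemma is_cplx_shift:
 assumes X: "is_cplx X" shows "is_cplx (shift n X)"
 unfolding is_cplx_def
proof (intro conjI allI)
 fix i v
 show "is_rep (cobj (shift n X) i)" using X by (simp add: is_cplx_def)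
 have i1: "i + 1 + n = i + n + 1" "i + 2 + n = i + n + 2" by simp_all
 have r: "rep_map (cobj X (i + n)) (cobj X (i + n + 1)) (cdif X (i + n))" using X by (simp add: is_cplx_def)
 show "rep_map (cobj (shift n X) i) (cobj (shift n X) (i + 1)) (cdif (shift n X) i)"
  unfolding rep_map_def shift_sel i1
 proof (intro conjI allI)
  fix v show "sgn1 n \<cdot>\<^sub>m cdif X (i + n) v \<in> carrier_mat (cdim X (i + n + 1) v) (cdim X (i + n) v)"
   using cplx_cdif[OF X] by simp
 next
  fix a
  have "cdif X (i + n) (tgt a) * ract (cobj X (i + n)) a = ract (cobj X (i + n + 1)) a * cdif X (i + n) (src a)"
   using r by (simp add: rep_map_def)
  then show "sgn1 n \<cdot>\<^sub>m cdif X (i + n) (tgt a) * ract (cobj X (i + n)) a = ract (cobj X (i + n + 1)) a * (sgn1 n \<cdot>\<^sub>m cdif X (i + n) (src a))"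
   by (simp add: mult_smult_assoc_mat[OF cplx_cdif[OF X] cplx_ract[OF X]] mult_smult_distrib[OF cplx_ract[OF X] cplx_cdif[OF X]])
 qed
 have z: "cdif X (i + n + 1) v * cdif X (i + n) v = 0\<^sub>m (cdim X (i + n + 2) v) (cdim X (i + n) v)" using X by (simp add: is_cplx_def)
 have c: "cdif X (i + n + 1) v \<in> carrier_mat (cdim X (i + n + 2) v) (cdim X (i + n + 1) v)"
  using cplx_cdif[OF X, of "i + n + 1" v] by (simp add: add.assoc)
 show "cdif (shift n X) (i + 1) v * cdif (shift n X) i v = 0\<^sub>m (cdim (shift n X) (i + 2) v) (cdim (shift n X) i v)"
  unfolding shift_sel i1
  using z mult_smult_assoc_mat[OF c, of "sgn1 n \<cdot>\<^sub>m cdif X (i + n) v" "cdim X (i + n) v" "sgn1 n"]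
   mult_smult_distrib[OF c cplx_cdif[OF X, of "i + n" v], of "sgn1 n"] cplx_cdif[OF X, of "i + n" v]
  by simp
next
 obtain N where N: "\<forall>i v. \<bar>i\<bar> > N --> cdim X i v = 0" using X unfolding is_cplx_def by blast
 have "\<bar>i\<bar> > N + \<bar>n\<bar> ==> \<bar>i + n\<bar> > N" for i by linarith
 then show "\<exists>N. \<forall>i v. \<bar>i\<bar> > N --> cdim (shift n X) i v = 0" using N by (auto intro!: exI[of _ "N + \<bar>n\<bar>"])
qed

lemma shift_shift:
 assumes "is_cplx X" shows "shift 1 (shift (- 1) X) = X"
proof -
 have "(- 1) \<cdot>\<^sub>m ((- 1) \<cdot>\<^sub>m cdif X i v) = cdif X i v" for i v
  by (rule eq_matI) simp_all
 then show ?thesis by (simp add: shift_def)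
qed

text \<open>The identity of \<open>X\<close>, read as a strict isomorphism of degree -n to
  \<open>X[n]\<close>, with \<open>tb\<close> as inverse. The sign in the differential of
  \<open>shift\<close> is exactly what makes it closed in the graded sense.\<close>

definition ta :: "int \<Rightarrow> 'k::field cplx \<Rightarrow> 'k bm" where
 "ta n X = cme (- n) X (shift n X) (\<lambda>i v. 1\<^sub>m (cdim X i v))"
definition tb :: "int \<Rightarrow> 'k::field cplx \<Rightarrow> 'k bm" where
 "tb n X = cme n (shift n X) X (\<lambda>i v. 1\<^sub>m (cdim X (i + n) v))"

lemma rep_map_id: "is_cplx X ==> rep_map (cobj X i) (cobj X i) (\<lambda>v. 1\<^sub>m (cdim X i v))"
 unfolding rep_map_def by (simp add: left_mult_one_mat[OF cplx_ract] right_mult_one_mat[OF cplx_ract])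

lemma ta_cmc: "cmc (- n) X (shift n X) (\<lambda>i v. 1\<^sub>m (cdim X i v))" "cmc n (shift n X) X (\<lambda>i v. 1\<^sub>m (cdim X (i + n) v))"
 by (simp_all add: cmc_def)

lemma ta_Sc:
 assumes X: "is_cplx X" shows "Sc (- n) (so X) (so (shift n X)) (ta n X)"
proof -
 note X' = is_cplx_shift[OF X, of n]
 have "rpm (- n) X (shift n X) (\<lambda>i v. 1\<^sub>m (cdim X i v))" using rep_map_id[OF X] by (simp add: rpm_def)
 from Sm_cme[OF X X' this] have m: "Sm (- n) (so X) (so (shift n X)) (ta n X)" by (simp add: ta_def)
 have e: "(\<lambda>i v. cdif (shift n X) (i + - n) v * 1\<^sub>m (cdim X i v)) = (\<lambda>i v. sgn1 (- n) \<cdot>\<^sub>m (1\<^sub>m (cdim X (i + 1) v) * cdif X i v))"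
 proof (intro ext)
  fix i v
  have c: "cdif X i v \<in> carrier_mat (cdim X (i + 1) v) (cdim X i v)" by (rule cplx_cdif[OF X])
  then show "cdif (shift n X) (i + - n) v * 1\<^sub>m (cdim X i v) = sgn1 (- n) \<cdot>\<^sub>m (1\<^sub>m (cdim X (i + 1) v) * cdif X i v)"
   by (simp add: left_mult_one_mat[OF c] right_mult_one_mat[of _ "cdim X (i + 1) v"]) (simp add: sgn1_def)
 qed
 have "sd (so (shift n X)) * ta n X = sg (- n) (ta n X * sd (so X))"
  unfolding ta_def cme_d_left(1)[OF X X' ta_cmc(1)] cme_d_right(1)[OF X X' ta_cmc(1)] sg_sc
   cme_sc[OF cplx_bd[OF X] cme_d_right(2)[OF X X' ta_cmc(1)]] e ..
 then show ?thesis using m by (simp add: Sc_def)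
qed

lemma ta_tb:
 assumes X: "is_cplx X" shows "tb n X * ta n X = se (so X)" "ta n X * tb n X = se (so (shift n X))"
proof -
 note b = cplx_bd[OF X] cplx_bd[OF is_cplx_shift[OF X, of n]]
 show "tb n X * ta n X = se (so X)"
  unfolding ta_def tb_def cme_mult[OF b ta_cmc] by (simp add: cid_def)
 show "ta n X * tb n X = se (so (shift n X))"
  unfolding ta_def tb_def cme_mult[OF b(2,1) ta_cmc(2,1)] by (simp add: cid_def)
qed

lemma tb_Sc:
 assumes X: "is_cplx X" shows "Sc n (so (shift n X)) (so X) (tb n X)"
proof -
 note X' = is_cplx_shift[OF X, of n]
 note b = cplx_bd[OF X] cplx_bd[OF X']
 define A B a b where "A = ta n X" and "B = tb n X" and "a = se (so X)" and "b = se (so (shift n X))"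
 note Sa = ta_Sc[OF X, of n, unfolded Sc_def Sm_def]
 have AB: "B * A = a" "A * B = b" using ta_tb[OF X, of n] by (simp_all add: A_def B_def a_def b_def)
 have Ba: "a * B = B" "B * b = B" "dgr n B" "dia B = B"
  using cme_id_left[OF cplx_bd[OF X'] cplx_bd[OF X] ta_cmc(2)] cme_id_right[OF cplx_bd[OF X'] ta_cmc(2)] dgr_cme[OF cplx_bd[OF X']] dia_cme[OF cplx_bd[OF X']]
  by (simp_all add: tb_def a_def b_def B_def)
 have inv: "x * B = sg n (B * y)" if "y * A = sg (- n) (A * x)" "a * x = x" "y * b = y" for x y
 proof -
  have "x * B = B * (A * x) * B" using AB(1) that(2) by (simp flip: mult.assoc)
  also have "A * x = sg n (y * A)" using that(1) by (simp add: sg_def split: if_splits)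
  finally show ?thesis using AB(2) that(3) by (simp add: sgs mult.assoc)
 qed
 have S: "sob (so X)" "sob (so (shift n X))" using sob_so X X' by blast+
 have "sA (so X) * B = sg n (B * sA (so (shift n X)))" "sB (so X) * B = sg n (B * sB (so (shift n X)))" "sd (so X) * B = sg n (B * sd (so (shift n X)))"
  by (rule inv; use S Sa in \<open>simp add: a_def b_def A_def sob_def del: so_sel\<close>)+
 then show ?thesis using Ba by (simp add: Sc_def Sm_def a_def b_def B_def del: so_sel)
qed

lemma shift_maps:
 assumes X: "is_cplx X"
 shows "Zc (- n) (Oc X) (Oc (shift n X)) (st (ta n X))" "Zc n (Oc (shift n X)) (Oc X) (st (tb n X))"
  "st (tb n X) * st (ta n X) = fst (Oc X)" "st (ta n X) * st (tb n X) = fst (Oc (shift n X))"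
proof -
 note S = sob_so[OF X] sob_so[OF is_cplx_shift[OF X, of n]]
 show "Zc (- n) (Oc X) (Oc (shift n X)) (st (ta n X))" "Zc n (Oc (shift n X)) (Oc X) (st (tb n X))"
  using Sc_Zc[OF S ta_Sc[OF X]] Sc_Zc[OF S(2,1) tb_Sc[OF X]] .
 have u: "upr (ta n X)" "upr (tb n X)" using ta_Sc[OF X] tb_Sc[OF X] by (auto simp: Sc_def intro: Sm_upr)
 show "st (tb n X) * st (ta n X) = fst (Oc X)" "st (ta n X) * st (tb n X) = fst (Oc (shift n X))"
  using u ta_tb[OF X, of n] by (simp_all add: oo_def st_mult[symmetric])
qed

lemma shift_weqv: "is_cplx X ==> weqv (- n) (Oc X) (Oc (shift n X)) (st (ta n X)) (st (tb n X))"
 using shift_maps[of X n] by (simp add: weqv_def hq_refl)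

text \<open>Shifting a chain map is conjugation by \<open>ta\<close> and \<open>tb\<close>, so
  invertibility and homotopies are transported without further computation.\<close>

lemma cshift_ce:
 assumes X: "is_cplx X" and Y: "is_cplx Y" and f: "chain_map X Y f"
 shows "ce (shift n X) (shift n Y) (cshift n f) = ta n Y * ce X Y f * tb n X"
  "chain_map (shift n X) (shift n Y) (cshift n f)"
  "st (ce (shift n X) (shift n Y) (cshift n f)) = st (ta n Y) * st (ce X Y f) * st (tb n X)"
proof -
 note X' = is_cplx_shift[OF X, of n] and Y' = is_cplx_shift[OF Y, of n]
 note b = cplx_bd[OF X] cplx_bd[OF X'] cplx_bd[OF Y] cplx_bd[OF Y']
 have f0: "cmc 0 X Y f" by (rule chain_cmc[OF X Y f])
 have fc: "f i v \<in> carrier_mat (cdim Y i v) (cdim X i v)" for i v using f0 by (simp add: cmc_def)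
 note m1 = cme_mult[OF b(2,1) ta_cmc(2) f0] cmc_mult[OF ta_cmc(2) f0]
 show e: "ce (shift n X) (shift n Y) (cshift n f) = ta n Y * ce X Y f * tb n X"
 proof -
  have "ta n Y * (ce X Y f * tb n X) = cme 0 (shift n X) (shift n Y)
    (\<lambda>i v. 1\<^sub>m (cdim Y (i + (n + 0)) v) * (f (i + n) v * 1\<^sub>m (cdim X (i + n) v)))"
   unfolding tb_def ta_def m1(1) cme_mult[OF b(2,3) m1(2) ta_cmc(1)] by simp
  also have "(\<lambda>i v. 1\<^sub>m (cdim Y (i + (n + 0)) v) * (f (i + n) v * 1\<^sub>m (cdim X (i + n) v))) = cshift n f"
   by (intro ext) (simp add: cshift_def left_mult_one_mat[OF fc] right_mult_one_mat[OF fc])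
  finally show ?thesis by (simp only: mult.assoc)
 qed
 have s1: "Sc n (so (shift n X)) (so Y) (ce X Y f * tb n X)"
  by (rule Sc_comp[OF tb_Sc[OF X] chain_Sc[OF X Y f]]) simp
 have s2: "Sc 0 (so (shift n X)) (so (shift n Y)) (ta n Y * ce X Y f * tb n X)"
  using Sc_comp[OF s1 ta_Sc[OF Y], of 0 n] by (simp add: mult.assoc)
 have "cmc 0 (shift n X) (shift n Y) (cshift n f)" using fc by (simp add: cmc_def cshift_def)
 then show "chain_map (shift n X) (shift n Y) (cshift n f)"
  unfolding chain_map_iff[OF X' Y'] e using s2 by blast
 have u: "upr (ta n Y)" "upr (ce X Y f)" "upr (tb n X)"
  using ta_Sc[OF Y] tb_Sc[OF X] chain_Sc[OF X Y f] by (auto simp: Sc_def intro: Sm_upr)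
 show "st (ce (shift n X) (shift n Y) (cshift n f)) = st (ta n Y) * st (ce X Y f) * st (tb n X)"
  unfolding e using u by (simp add: st_mult upr_mult)
qed

lemma conj_hq:
 assumes "hq p X Y g g'" "Zc q Y Y' a" "Zc r X' X b" "m = q + p + r"
 shows "hq m X' Y' (a * g * b) (a * g' * b)"
 by (rule hq_right[OF hq_left[OF assms(1,2) refl] assms(3) assms(4)])

lemma roof_shift_Gam:
 assumes X: "is_cplx X" and Y: "is_cplx Y" and R: "R \<in> Gam X Y g"
 shows "roof_shift n R \<in> Gam (shift n X) (shift n Y) (st (ta n Y) * g * st (tb n X))"
proof -
 have r: "is_roof R" "rsrc R = X" "rtgt R = Y" "H0 (rmid R) Y (g * dn R) (nu R)"
  using R by (auto simp: Gam_def)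
 define M where "M = rmid R"
 note fR = roof_facts[OF r(1), unfolded r(2,3), folded M_def]
 note M = fR(2)
 obtain t where t: "Z0 X M t" "H0 M M (t * dn R) (fst (Oc M))" "H0 X X (dn R * t) (fst (Oc X))"
  using roof_inverse[OF r(1)] r(2) by (metis M_def)
 let ?R = "roof_shift n R"
 have sel: "rsrc ?R = shift n X" "rmid ?R = shift n M" "rtgt ?R = shift n Y" "rden ?R = cshift n (rden R)" "rnum ?R = cshift n (rnum R)"
  by (simp_all add: roof_shift_def r M_def)
 note d = cshift_ce[OF M X fR(6), of n] and e = cshift_ce[OF M Y fR(7), of n]
 have dn: "dn ?R = st (ta n X) * dn R * st (tb n M)" and nu: "nu ?R = st (ta n Y) * nu R * st (tb n M)"
  using d(3) e(3) by (simp_all add: dn_def nu_def sel r M_def)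
 note sX = shift_maps[OF X, of n] and sM = shift_maps[OF M, of n] and sY = shift_maps[OF Y, of n]
 have bX: "st (tb n X) * (st (ta n X) * z) = fst (Oc X) * z" for z using sX(3) by (simp flip: mult.assoc)
 have bM: "st (tb n M) * (st (ta n M) * z) = fst (Oc M) * z" for z using sM(3) by (simp flip: mult.assoc)
 have uz: "fst (Oc X) * (dn R * z) = dn R * z" "fst (Oc M) * (t * z) = t * z" for z
  using fR(4) t(1) by (simp_all add: Zc_fst flip: mult.assoc)
 define t' where "t' = st (ta n M) * t * st (tb n X)"
 have t'0: "Zc n (Oc (shift n X)) (Oc M) (t * st (tb n X))" by (rule Zc_comp[OF sX(2) t(1)]) simp
 have t': "Z0 (shift n X) (shift n M) t'" using Zc_comp[OF t'0 sM(1), of 0] by (simp add: t'_def mult.assoc)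
 have h1: "H0 (shift n M) (shift n M) (t' * dn ?R) (fst (Oc (shift n M)))"
 proof -
  have "H0 (shift n M) (shift n M) (st (ta n M) * (t * dn R) * st (tb n M)) (st (ta n M) * fst (Oc M) * st (tb n M))"
   by (rule conj_hq[OF t(2) sM(1) sM(2)]) simp
  then show ?thesis by (simp add: t'_def dn mult.assoc bX uz) (simp add: Zc_fst(2)[OF sM(1)] sM(4) flip: mult.assoc)
 qed
 have h2: "H0 (shift n X) (shift n X) (dn ?R * t') (fst (Oc (shift n X)))"
 proof -
  have "H0 (shift n X) (shift n X) (st (ta n X) * (dn R * t) * st (tb n X)) (st (ta n X) * fst (Oc X) * st (tb n X))"
   by (rule conj_hq[OF t(3) sX(1) sX(2)]) simp
  then show ?thesis by (simp add: t'_def dn mult.assoc bM uz) (simp add: Zc_fst(2)[OF sX(1)] sX(4) flip: mult.assoc)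
 qed
 have "quasi_iso (shift n M) (shift n X) (cshift n (rden R))"
  by (rule inverse_quasi_iso[OF is_cplx_shift[OF M] is_cplx_shift[OF X] d(2) t'])
   (use h1 h2 in \<open>simp_all add: dn_def sel\<close>)
 then have rf: "is_roof ?R" unfolding is_roof_def sel using e(2) is_cplx_shift X Y M by blast
 have "H0 (shift n M) (shift n Y) (st (ta n Y) * (g * dn R) * st (tb n M)) (st (ta n Y) * nu R * st (tb n M))"
  by (rule conj_hq[OF r(4)[folded M_def] sY(1) sM(2)]) simp
 then have "H0 (shift n M) (shift n Y) (st (ta n Y) * g * st (tb n X) * dn ?R) (nu ?R)"
  by (simp add: dn nu mult.assoc bX uz)
 then show ?thesis using rf by (simp add: Gam_def sel)
qed

lemma Db_shift_Gam:
 assumes X: "is_cplx X" and Y: "is_cplx Y" and g: "Z0 X Y g"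
 shows "Z0 (shift n X) (shift n Y) (st (ta n Y) * g * st (tb n X))"
  "Db_shift n (Gam X Y g) = Gam (shift n X) (shift n Y) (st (ta n Y) * g * st (tb n X))"
proof -
 have g1: "Zc n (Oc (shift n X)) (Oc Y) (g * st (tb n X))" by (rule Zc_comp[OF shift_maps(2)[OF X] g]) simp
 show z: "Z0 (shift n X) (shift n Y) (st (ta n Y) * g * st (tb n X))"
  using Zc_comp[OF g1 shift_maps(1)[OF Y], of 0 n] by (simp add: mult.assoc)
 show "Db_shift n (Gam X Y g) = Gam (shift n X) (shift n Y) (st (ta n Y) * g * st (tb n X))"
 proof (intro equalityI subsetI)
  fix R assume "R \<in> Db_shift n (Gam X Y g)"
  then obtain A where "A \<in> Gam X Y g" "roof_eq (roof_shift n A) R" by (auto simp: Db_shift_def)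
  then show "R \<in> Gam (shift n X) (shift n Y) (st (ta n Y) * g * st (tb n X))"
   using roof_eq_Gam[OF z] roof_shift_Gam[OF X Y] by blast
 next
  fix R assume R: "R \<in> Gam (shift n X) (shift n Y) (st (ta n Y) * g * st (tb n X))"
  obtain A where A: "A \<in> Gam X Y g" using Gam_nonempty[OF X Y g] by blast
  have "roof_eq (roof_shift n A) R" by (rule Gam_roof_eq[OF z roof_shift_Gam[OF X Y A] R])
  then show "R \<in> Db_shift n (Gam X Y g)" using A by (auto simp: Db_shift_def)
 qed
qed

section \<open>The stalk complexes of the two string modules in strict form\<close>

section \<open>The string modules\<close>

text \<open>\<open>True\<close> gives \<open>P\<close>; \<open>False\<close> gives the string along
  the \<beta> arrows, which is \<open>S(P)\<close> up to shift.\<close>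

definition string_rep :: "bool \<Rightarrow> 'k::field rep" where
 "string_rep b = \<lparr>rdim = (\<lambda>_. 1), ract = (\<lambda>a. if (a = Alpha1 \<or> a = Alpha2) = b then 1\<^sub>m 1 else 0\<^sub>m 1 1)\<rparr>"

lemma P_rep_string: "P_rep = string_rep True"
 by (simp add: P_rep_def string_rep_def)

lemma string_stalk_sel: "rdim (cobj (stalk (string_rep b)) i) v = (if i = 0 then 1 else 0)"
 "cdif (stalk (string_rep b)) i v = 0\<^sub>m (if i = - 1 then 1 else 0) (if i = 0 then 1 else 0)"
 "ract (cobj (stalk (string_rep b)) i) a =
   (if i = 0 then if (a = Alpha1 \<or> a = Alpha2) = b then 1\<^sub>m 1 else 0\<^sub>m 1 1 else 0\<^sub>m 0 0)"
 by (simp_all add: stalk_def string_rep_def zero_rep_def)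

lemma is_cplx_string: "is_cplx (stalk (string_rep b))"
 unfolding is_cplx_def is_rep_def rep_map_def string_stalk_sel
proof (intro conjI allI)
 show "\<exists>N. \<forall>i v. \<bar>i\<bar> > N --> (if i = (0::int) then 1 else 0) = (0::nat)" by (rule exI[of _ 0]) simp
qed (auto simp: left_mult_one_mat right_mult_one_mat add_eq_0_iff2)

lemma dm_string: "dm (stalk (string_rep b)) s = (if fst s = 0 then 1 else 0)"
 by (simp add: dm_def string_stalk_sel)

lemma so_string: "so (stalk (string_rep b)) = (if b then Ps else Qs :: 'k::field so)"
proof -
 let ?X = "stalk (string_rep b) :: 'k cplx"
 note X = is_cplx_string[of b, where 'a = 'k]
 note bX = cplx_bd[OF X]
 have se0: "se (so ?X) = Em o1 o1 + Em o2 o2 + Em o3 o3"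
 proof (rule fm_eqI)
  fix a c :: idx
  obtain i v x where a: "a = ((i, v), x)" by (metis prod.exhaust)
  show "ent (se (so ?X)) a c = ent (Em o1 o1 + Em o2 o2 + Em o3 o3) a c"
   unfolding ent_se[OF bX] dm_string by (cases v) (auto simp: a)
 qed
 have sd0: "sd (so ?X) = 0"
  unfolding so_sel by (rule cme_zero[OF bX]) (auto simp: string_stalk_sel)
 have ar: "are True ?X = (if b then Em o2 o1 else Em o3 o2)" "are False ?X = (if b then Em o3 o2 else Em o2 o1)"
 proof -
  have "ent (are cc ?X) a c = ent (if cc = b then Em o2 o1 else Em o3 o2) a c" for cc and a c :: idx
  proof -
   obtain i v x where a: "a = ((i, v), x)" by (metis prod.exhaust)
   obtain j w y where c: "c = ((j, w), y)" by (metis prod.exhaust)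
   show ?thesis unfolding are_def
    by (subst ent_en[OF bX], cases cc; cases b; cases w)
     (auto simp: a c Ta_def dm_string arm_def string_stalk_sel sgn1_def split: if_splits)
  qed
  then have "are cc ?X = (if cc = b then Em o2 o1 else Em o3 o2)" for cc by (intro fm_eqI)
  from this[of True] this[of False] show "are True ?X = (if b then Em o2 o1 else Em o3 o2)" "are False ?X = (if b then Em o3 o2 else Em o2 o1)"
   by (cases b; simp)+
 qed
 show ?thesis using se0 sd0 ar by (cases b) (auto simp: Ps_def Qs_def swp_def intro!: so.equality)
qed

section \<open>The concrete cone satisfies the axioms of \<open>cone_triangle\<close>\<close>

section \<open>The mapping cone\<close>

lemma dim_ract: "is_cplx X ==> dim_row (ract (cobj X i) a) = cdim X i (tgt a) \<and> dim_col (ract (cobj X i) a) = cdim X i (src a)"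
 using cplx_ract[of X i a] by auto

lemma four_block_entry:
 assumes "A \<in> carrier_mat r1 c1" "B \<in> carrier_mat r1 c2" "C \<in> carrier_mat r2 c1" "D \<in> carrier_mat r2 c2" "x < r1 + r2" "y < c1 + c2"
 shows "four_block_mat A B C D $$ (x, y) = (if x < r1 then if y < c1 then A $$ (x, y) else B $$ (x, y - c1)
  else if y < c1 then C $$ (x - r1, y) else D $$ (x - r1, y - c1))"
 using assms by auto

lemma cone_cdif_entry:
 assumes X: "is_cplx X" and Y: "is_cplx Y" and f: "cmc 0 X Y f"
  and xy: "x < cdim X (j + 2) v + cdim Y (j + 1) v" "y < cdim X (j + 1) v + cdim Y j v"
 shows "cdif (cone X Y f) j v $$ (x, y) = (if x < cdim X (j + 2) v then if y < cdim X (j + 1) v then - (cdif X (j + 1) v $$ (x, y)) else 0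
   else if y < cdim X (j + 1) v then f (j + 1) v $$ (x - cdim X (j + 2) v, y) else cdif Y j v $$ (x - cdim X (j + 2) v, y - cdim X (j + 1) v))"
proof -
 have c: "cdif X (j + 1) v \<in> carrier_mat (cdim X (j + 2) v) (cdim X (j + 1) v)"
  using cplx_cdif[OF X, of "j + 1" v] by (simp add: add.assoc)
 then have c': "(- 1) \<cdot>\<^sub>m cdif X (j + 1) v \<in> carrier_mat (cdim X (j + 2) v) (cdim X (j + 1) v)" by simp
 have f': "f (j + 1) v \<in> carrier_mat (cdim Y (j + 1) v) (cdim X (j + 1) v)"
  using f[unfolded cmc_def, rule_format, of "j + 1" v] by simp
 have e: "cdif (cone X Y f) j v = four_block_mat ((- 1) \<cdot>\<^sub>m cdif X (j + 1) v) (0\<^sub>m (cdim X (j + 2) v) (cdim Y j v)) (f (j + 1) v) (cdif Y j v)"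
  by (simp add: cone_def)
 show ?thesis
  unfolding e four_block_entry[OF c' zero_carrier_mat f' cplx_cdif[OF Y] xy] using c xy by auto
qed

lemma cone_ract_entry:
 assumes X: "is_cplx X" and Y: "is_cplx Y"
  and xy: "x < cdim X (j + 1) (tgt a) + cdim Y j (tgt a)" "y < cdim X (j + 1) (src a) + cdim Y j (src a)"
 shows "ract (cobj (cone X Y f) j) a $$ (x, y) = (if x < cdim X (j + 1) (tgt a) then if y < cdim X (j + 1) (src a) then ract (cobj X (j + 1)) a $$ (x, y) else 0
   else if y < cdim X (j + 1) (src a) then 0 else ract (cobj Y j) a $$ (x - cdim X (j + 1) (tgt a), y - cdim X (j + 1) (src a)))"
proof -
 have e: "ract (cobj (cone X Y f) j) a = four_block_mat (ract (cobj X (j + 1)) a) (0\<^sub>m (cdim X (j + 1) (tgt a)) (cdim Y j (src a)))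
    (0\<^sub>m (cdim Y j (tgt a)) (cdim X (j + 1) (src a))) (ract (cobj Y j) a)"
  by (simp add: cone_def dsum_rep_def)
 show ?thesis
  unfolding e four_block_entry[OF cplx_ract[OF X] zero_carrier_mat zero_carrier_mat cplx_ract[OF Y] xy] using xy by auto
qed

lemma cone_arm_entry:
 assumes X: "is_cplx X" and Y: "is_cplx Y" and a: "arw c w = Some a"
  and xy: "x < cdim X (j + 1) (tgt a) + cdim Y j (tgt a)" "y < cdim X (j + 1) w + cdim Y j w"
 shows "arm (cone X Y f) c (j, w) $$ (x, y) = (if x < cdim X (j + 1) (tgt a) then if y < cdim X (j + 1) w then - (arm X c (j + 1, w) $$ (x, y)) else 0
   else if y < cdim X (j + 1) w then 0 else arm Y c (j, w) $$ (x - cdim X (j + 1) (tgt a), y - cdim X (j + 1) w))"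
proof -
 note src = src_arw[OF a]
 have d: "dim_row (ract (cobj (cone X Y f) j) a) = cdim X (j + 1) (tgt a) + cdim Y j (tgt a)"
  "dim_col (ract (cobj (cone X Y f) j) a) = cdim X (j + 1) w + cdim Y j w"
  using dim_ract[OF X] dim_ract[OF Y] by (simp_all add: cone_def dsum_rep_def src)
 have s1: "sgn1 (j + 1) = - sgn1 j" by (simp add: sgn1_def)
 show ?thesis
  using xy d dim_ract[OF X, of "j + 1" a] dim_ract[OF Y, of j a] cone_ract_entry[OF X Y xy(1), unfolded src, OF xy(2), of f]
  by (simp add: arm_def a src s1)
qed

text \<open>The cone contains \<open>X[1]\<close>, so \<open>p\<close> and \<open>J\<close> have
  degrees 1 and -1. The minus sign before the arrows of \<open>X\<close> stems from the degree sign
  in \<open>arm\<close>.\<close>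

lemma cone_structure:
 fixes X Y :: "'k::field cplx"
 assumes X: "is_cplx X" and Y: "is_cplx Y" and C: "is_cplx (cone X Y f)" and f: "chain_map X Y f"
 obtains J I p q where
  "Sm 1 (so (cone X Y f)) (so X) p" "Sm (- 1) (so X) (so (cone X Y f)) J"
  "Sm 0 (so Y) (so (cone X Y f)) I" "Sm 0 (so (cone X Y f)) (so Y) q"
  "p * J = se (so X)" "q * I = se (so Y)" "p * I = 0" "q * J = 0" "J * p + I * q = se (so (cone X Y f))"
  "sd (so (cone X Y f)) = I * sd (so Y) * q + I * ce X Y f * p - J * sd (so X) * p"
  "!!c. are c (cone X Y f) = I * are c Y * q - J * are c X * p"
  "ce (cone X Y f) (shift 1 X) (cone_out X Y) = ta 1 X * p"
  "cmc 0 (cone X Y f) (shift 1 X) (cone_out X Y)"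
proof -
 let ?C = "cone X Y f"
 note bX = cplx_bd[OF X] and bY = cplx_bd[OF Y] and bC = cplx_bd[OF C]
 \<comment> \<open>Positions below \<open>m\<close> in a block belong to \<open>X[1]\<close> and the
   others to \<open>Y\<close>; \<open>r1\<close> and \<open>r2\<close> undo the placements
   \<open>f1\<close> and \<open>f2\<close>.\<close>
 define m where "m s = dm X (fst s + 1, snd s)" for s :: blk
 have dmC: "dm ?C s = m s + dm Y s" for s by (simp add: dm_def m_def cone_def dsum_rep_def)
 define f1 where "f1 b = ((fst (fst b) - 1, snd (fst b)), snd b)" for b :: idx
 define r1 where "r1 b = ((fst (fst b) + 1, snd (fst b)), snd b)" for b :: idx
 define f2 where "f2 b = (fst b, m (fst b) + snd b)" for b :: idx
 define r2 where "r2 b = (fst b, snd b - m (fst b))" for b :: idx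
 define WX WY where "WX = {b::idx. snd b < dm X (fst b)}" and "WY = {b::idx. snd b < dm Y (fst b)}"
 have fin: "finite WX" "finite WY" using se_pr(2)[OF bX] se_pr(2)[OF bY] by (simp_all add: WX_def WY_def)
 have r1: "f1 (r1 a) = a" "r1 (f1 a) = a" "r1 a \<in> WX \<longleftrightarrow> snd a < m (fst a)" for a
  by (simp_all add: f1_def r1_def WX_def m_def)
 have r2: "r2 (f2 a) = a" "m (fst a) \<le> snd a ==> f2 (r2 a) = a"
  "m (fst a) \<le> snd a ==> r2 a \<in> WY \<longleftrightarrow> snd a < m (fst a) + dm Y (fst a)" "m (fst (f2 a)) \<le> snd (f2 a)" for a
  by (auto simp: f2_def r2_def WY_def)
 define J p I q :: "'k bm" where "J = slI f1 WX" and "p = slP f1 WX" and "I = slI f2 WY" and "q = slP f2 WY"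
 have eJ: "ent (J * y) a b = (if snd a < m (fst a) then ent y (r1 a) b else 0)" for y a b
  unfolding J_def using r1[of a] r1(2)
  by (subst ent_times_sup[of "{r1 a}"]) (auto simp: ent_slI[OF fin(1)])
 have ep: "ent (y * p) a b = (if snd b < m (fst b) then ent y a (r1 b) else 0)" for y a b
  unfolding p_def using r1[of b] r1(2)
  by (subst ent_times_sup[of "{r1 b}"]) (auto simp: ent_slP[OF fin(1)])
 have eI: "ent (I * y) a b = (if m (fst a) \<le> snd a \<and> snd a < m (fst a) + dm Y (fst a) then ent y (r2 a) b else 0)" for y a b
  unfolding I_def using r2[of a] r2(1) r2(4)[of "r2 a"]
  by (subst ent_times_sup[of "{r2 a}"]) (auto simp: ent_slI[OF fin(2)])
 have eq: "ent (y * q) a b = (if m (fst b) \<le> snd b \<and> snd b < m (fst b) + dm Y (fst b) then ent y a (r2 b) else 0)" for y a b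
  unfolding q_def using r2[of b] r2(1) r2(4)[of "r2 b"]
  by (subst ent_times_sup[of "{r2 b}"]) (auto simp: ent_slP[OF fin(2)])
 have inj: "inj_on f1 WX" "inj_on f2 WY" using r1(2) r2(1) by (metis inj_onI)+
 have pr: "pr WX = se (so X)" "pr WY = se (so Y)" using se_pr(1)[OF bX] se_pr(1)[OF bY] by (simp_all add: WX_def WY_def)
 have disj: "f1 ` WX \<inter> f2 ` WY = {}"
 proof -
  have "f1 x \<noteq> f2 y" if "x \<in> WX" for x y
   using that r1(2)[of x] r1(3)[of "f1 x"] r2(4)[of y] by auto
  then show ?thesis by blast
 qed
 have disj': "f2 ` WY \<inter> f1 ` WX = {}" using disj by blast
 have pJ: "p * J = se (so X)" "q * I = se (so Y)" "p * I = 0" "q * J = 0"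
  unfolding p_def J_def q_def I_def slP_slI[OF fin(1) inj(1)] slP_slI[OF fin(2) inj(2)] pr
   slP_slI_disjoint[OF fin disj] slP_slI_disjoint[OF fin(2,1) disj'] by (rule refl)+
 have units: "J * se (so X) = J" "I * se (so Y) = I" "se (so X) * p = p" "se (so Y) * q = q"
  using slI_pr[OF fin(1), of f1, where 'b = 'k] slI_pr[OF fin(2), of f2, where 'b = 'k] pr_slP[OF fin(1), of f1, where 'b = 'k] pr_slP[OF fin(2), of f2, where 'b = 'k]
  by (simp_all only: J_def I_def p_def q_def pr)
 have sum: "J * p + I * q = se (so ?C)"
 proof (rule fm_eqI)
  fix a b
  have "ent (J * p) a b = (if a = b \<and> snd a < m (fst a) then 1 else 0)"
   unfolding eJ unfolding p_def ent_slP[OF fin(1)] using r1[of a] by auto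
  moreover have "ent (I * q) a b = (if a = b \<and> m (fst a) \<le> snd a \<and> snd a < m (fst a) + dm Y (fst a) then 1 else 0)"
   unfolding eI unfolding q_def ent_slP[OF fin(2)] using r2[of a] by auto
  ultimately show "ent (J * p + I * q) a b = ent (se (so ?C)) a b"
   unfolding ent_se[OF bC] dmC by auto
 qed
 have f0: "cmc 0 X Y f" by (rule chain_cmc[OF X Y f])
 have sub: "\<not> x < k ==> x < k + l ==> x - k < l" for x k l :: nat by arith
 have dC: "cme 1 ?C ?C (cdif ?C) = I * cme 1 Y Y (cdif Y) * q + I * ce X Y f * p - J * cme 1 X X (cdif X) * p"
 proof (rule fm_eqI)
  fix a b :: idx
  obtain i v x where a: "a = ((i, v), x)" by (metis prod.exhaust)
  obtain j w y where b: "b = ((j, w), y)" by (metis prod.exhaust)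
  show "ent (cme 1 ?C ?C (cdif ?C)) a b = ent (I * cme 1 Y Y (cdif Y) * q + I * ce X Y f * p - J * cme 1 X X (cdif X) * p) a b"
  proof (cases "i = j + 1 \<and> v = w")
   case True
   note e = cone_cdif_entry[OF X Y f0, of x j w y]
   show ?thesis unfolding ent_plus ent_minus eq ep eI eJ unfolding cme_def ent_en[OF bX] ent_en[OF bY] ent_en[OF bC] dmC
    using True e by (cases "x < cdim X (j + 2) w"; cases "y < cdim X (j + 1) w"; cases "x < cdim X (j + 2) w + cdim Y (j + 1) w"; cases "y < cdim X (j + 1) w + cdim Y j w")
     (simp_all add: a b r1_def r2_def m_def dm_def Tp_def add.assoc sub)
  next
   case False
   then show ?thesis unfolding ent_plus ent_minus eq ep eI eJ unfolding cme_def ent_en[OF bX] ent_en[OF bY] ent_en[OF bC]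
    by (cases "w = v"; cases "j + 1 = i") (simp_all add: a b r1_def r2_def Tp_def)
  qed
 qed
 have aC: "are c ?C = I * are c Y * q - J * are c X * p" for c
 proof (rule fm_eqI)
  fix a b :: idx
  obtain i v x where a: "a = ((i, v), x)" by (metis prod.exhaust)
  obtain j w y where b: "b = ((j, w), y)" by (metis prod.exhaust)
  show "ent (are c ?C) a b = ent (I * are c Y * q - J * are c X * p) a b"
  proof (cases "arw c w")
   case None
   then show ?thesis unfolding ent_minus eq ep eI eJ unfolding are_def ent_en[OF bX] ent_en[OF bY] ent_en[OF bC]
    by (simp add: a b r1_def r2_def Ta_def)
  next
   case (Some \<alpha>)
   show ?thesis
   proof (cases "i = j \<and> v = tgt \<alpha>")
    case True
    note e = cone_arm_entry[OF X Y Some, of x j y f]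
    show ?thesis unfolding ent_minus eq ep eI eJ unfolding are_def ent_en[OF bX] ent_en[OF bY] ent_en[OF bC] dmC
     using True Some e by (cases "x < cdim X (j + 1) (tgt \<alpha>)"; cases "y < cdim X (j + 1) w"; cases "x < cdim X (j + 1) (tgt \<alpha>) + cdim Y j (tgt \<alpha>)"; cases "y < cdim X (j + 1) w + cdim Y j w")
      (simp_all add: a b r1_def r2_def m_def dm_def Ta_def sub)
   next
    case False
    then show ?thesis unfolding ent_minus eq ep eI eJ unfolding are_def ent_en[OF bX] ent_en[OF bY] ent_en[OF bC]
     using Some by (auto simp: a b r1_def r2_def Ta_def)
   qed
  qed
 qed
 have vts: "td (f1 b) = td b + - 1" "vt (f1 b) = vt b" "td (f2 b) = td b + 0" "vt (f2 b) = vt b" "td (f1 b) = td b - 1" "td (f2 b) = td b - 0" for b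
  by (simp_all add: f1_def f2_def td_def vt_def)
 have dg: "dgr (- 1) J" "dgr 1 p" "dgr 0 I" "dgr 0 q" "dia J = J" "dia p = p" "dia I = I" "dia q = q"
  unfolding J_def p_def I_def q_def
  by (rule dgr_slI dgr_slP dia_slI dia_slP, rule fin, rule vts)+
 have z: "p * (J * w) = se (so X) * w" "q * (I * w) = se (so Y) * w" "p * (I * w) = 0" "q * (J * w) = 0" for w
  using pJ by (simp_all flip: mult.assoc del: so_sel)
 have cu: "se (so ?C) * J = J" "se (so ?C) * I = I" "p * se (so ?C) = p" "q * se (so ?C) = q"
  unfolding sum[symmetric] distrib_left distrib_right mult.assoc pJ z units by (simp_all only: mult_zero_right add_0_left add_0_right)
 have ue: "se (so X) * are c X = are c X" "are c X * se (so X) = are c X" "se (so Y) * are c Y = are c Y" "are c Y * se (so Y) = are c Y" for c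
  using cme_are_left cme_are_right X Y by blast+
 have ue': "se (so X) * (are c X * w) = are c X * w" "se (so Y) * (are c Y * w) = are c Y * w" for c w
  using ue by (simp_all flip: mult.assoc del: so_sel)
 have ac: "are c X * p = sg 1 (p * are c ?C)" "are c ?C * J = sg (- 1) (J * are c X)"
  "are c ?C * I = sg 0 (I * are c Y)" "are c Y * q = sg 0 (q * are c ?C)" for c
  unfolding aC using units by (simp_all add: ring_dist mult.assoc z pJ ue ue' sg_def del: so_sel)
 have Sms: "Sm 1 (so ?C) (so X) p" "Sm (- 1) (so X) (so ?C) J" "Sm 0 (so Y) (so ?C) I" "Sm 0 (so ?C) (so Y) q"
  unfolding Sm_def so_sel(3,4) using ac dg units cu by blast+
 have "ce ?C (shift 1 X) (cone_out X Y) = ta 1 X * p"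
 proof (rule fm_eqI)
  fix a b :: idx
  obtain i v x where a: "a = ((i, v), x)" by (metis prod.exhaust)
  obtain j w y where b: "b = ((j, w), y)" by (metis prod.exhaust)
  show "ent (ce ?C (shift 1 X) (cone_out X Y)) a b = ent (ta 1 X * p) a b"
  proof (cases "i = j \<and> v = w")
   case True
   note e = four_block_entry[OF one_carrier_mat zero_carrier_mat zero_carrier_mat zero_carrier_mat, of x "cdim X (j + 1) w" 0 y "cdim Y j w"]
   show ?thesis unfolding ep ta_def cme_def ent_en[OF bX] ent_en[OF bC] dmC
    using True e by (cases "x < cdim X (j + 1) w"; cases "y < cdim X (j + 1) w"; cases "y < cdim X (j + 1) w + cdim Y j w")
     (simp_all add: a b r1_def m_def dm_def Tp_def cone_out_def)
  next
   case False
   then show ?thesis unfolding ep ta_def cme_def ent_en[OF bX] ent_en[OF bC] dmC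
    by (auto simp: a b r1_def m_def dm_def Tp_def)
  qed
 qed
 moreover have "cmc 0 ?C (shift 1 X) (cone_out X Y)"
 proof -
  have "(four_block_mat (1\<^sub>m k) (0\<^sub>m k l) (0\<^sub>m 0 k) (0\<^sub>m 0 l) :: 'k mat) \<in> carrier_mat (k + 0) (k + l)" for k l
   by (rule four_block_carrier_mat) simp_all
  then show ?thesis by (simp add: cmc_def cone_out_def cone_def dsum_rep_def)
 qed
 ultimately show thesis using that[of p J I q] Sms pJ sum dC aC by simp
qed

section \<open>Serre duality, isomorphisms, orthogonality and triangles in terms of weak
  morphisms\<close>

section \<open>Translation to the derived category\<close>

lemma Db_sel: "Ob (full_subcat Db A) = {X. is_cplx X} \<inter> A" "Hom (full_subcat Db A) = Db_hom" "Cmp (full_subcat Db A) = Db_comp"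
 "Idm (full_subcat Db A) X = chain_roof X X (cid X)" "Zer (full_subcat Db A) X Y = chain_roof X Y (czero X Y)"
 "Add (full_subcat Db A) = Db_add" "Scl (full_subcat Db A) = Db_scale"
 by (simp_all add: full_subcat_def Db_def)

lemma Db_UNIV: "Db = full_subcat Db UNIV"
 by (simp add: full_subcat_def)

lemma czero_Gam:
 assumes X: "is_cplx X" and Y: "is_cplx Y"
 shows "chain_roof X Y (czero X Y) = Gam X Y 0"
proof -
 have z: "ce X Y (czero X Y) = 0" by (rule cme_zero[OF cplx_bd[OF X]]) (simp add: czero_def)
 have "chain_map X Y (czero X Y)"
  unfolding chain_map_iff[OF X Y] z by (simp add: Sc_def Sm_def cmc_def czero_def)
 from chain_roof_Gam[OF X Y this] show ?thesis by (simp add: z st_simps)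
qed

lemma cid_Gam: "is_cplx X ==> chain_roof X X (cid X) = Gam X X (fst (Oc X))"
 using chain_roof_Gam[OF _ _ chain_cid] by (simp add: ce_cid)

lemma Gam_hom: "is_cplx X ==> is_cplx Y ==> Z0 X Y g ==> Gam X Y g \<in> Db_hom X Y"
 using Db_hom_Gam by blast

lemma Gam_homE:
 assumes "is_cplx X" "is_cplx Y" "a \<in> Db_hom X Y"
 obtains g where "Z0 X Y g" "a = Gam X Y g"
 using assms Db_hom_Gam by blast

lemma Gam_0_iff: "is_cplx X ==> is_cplx Y ==> Z0 X Y g ==> Gam X Y g = Gam X Y 0 \<longleftrightarrow> N0 X Y g"
 using Gam_eq_iff[OF _ _ _ Zc_0] by (simp add: hq_0)

lemma Zc_id': "is_cplx X ==> Z0 X X (fst (Oc X))"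
 by (rule Zc_id[OF ob_Oc])

text \<open>Serre duality on an arbitrary full subcategory, to be used once for the whole category
  and once for the right orthogonal of \<open>P\<close>.\<close>

locale serre_subcat =
 fixes A :: "'k::field cplx set" and S :: "('k cplx, 'k roof set) func" and \<phi> :: "'k cplx \<Rightarrow> 'k cplx \<Rightarrow> 'k roof set \<Rightarrow> 'k roof set \<Rightarrow> 'k"
 assumes aut: "linear_autoequivalence (full_subcat Db A) S"
  and bij: "!!X Y. is_cplx X ==> X \<in> A ==> is_cplx Y ==> Y \<in> A ==> bij_betw (\<phi> X Y) (Db_hom X Y) (dual_hom (full_subcat Db A) Y (fob S X))"
  and scl: "!!X Y f h c. is_cplx X ==> X \<in> A ==> is_cplx Y ==> Y \<in> A ==> f \<in> Db_hom X Y ==> h \<in> Db_hom Y (fob S X) ==>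
   \<phi> X Y (Db_scale c f) h = c * \<phi> X Y f h"
  and nat: "!!X Y X' Y' f u v h. is_cplx X ==> X \<in> A ==> is_cplx Y ==> Y \<in> A ==> is_cplx X' ==> X' \<in> A ==> is_cplx Y' ==> Y' \<in> A ==>
   f \<in> Db_hom X Y ==> u \<in> Db_hom X' X ==> v \<in> Db_hom Y Y' ==> h \<in> Db_hom Y' (fob S X') ==>
   \<phi> X' Y' (Db_comp v (Db_comp f u)) h = \<phi> X Y f (Db_comp (fmap S X' X u) (Db_comp h v))"
begin

lemma S_ob: "is_cplx X ==> X \<in> A ==> is_cplx (fob S X) \<and> fob S X \<in> A"
 using aut by (auto simp: linear_autoequivalence_def linear_endofunctor_def Db_sel)

lemma S_id: "is_cplx X ==> X \<in> A ==> fmap S X X (Gam X X (fst (Oc X))) = Gam (fob S X) (fob S X) (fst (Oc (fob S X)))"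
 using aut S_ob[of X] by (auto simp: linear_autoequivalence_def linear_endofunctor_def Db_sel cid_Gam)

lemma phi_zero:
 assumes X: "is_cplx X" "X \<in> A" and Y: "is_cplx Y" "Y \<in> A" and h: "h \<in> Db_hom Y (fob S X)"
 shows "\<phi> X Y (Gam X Y 0) h = 0"
proof -
 have "Db_scale 0 (Gam X Y 0) = Gam X Y 0" using Db_scale_Gam[OF X(1) Y(1) Zc_0, of 0] by (simp add: scw_simps)
 then show ?thesis using scl[OF X Y Gam_hom[OF X(1) Y(1) Zc_0] h, of 0] by simp
qed

text \<open>Naturality turns the pairing of \<open>f\<close> and \<open>h\<close> into the pairing
  of \<open>h * f\<close> with an identity, so a nonzero pairing forces a nonzero composite.\<close>

lemma phi_comp:
 assumes X: "is_cplx X" "X \<in> A" and Y: "is_cplx Y" "Y \<in> A" and f: "Z0 X Y f" and h: "Z0 Y (fob S X) h"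
  and nz: "\<phi> X Y (Gam X Y f) (Gam Y (fob S X) h) \<noteq> 0"
 shows "\<not> N0 X (fob S X) (h * f)"
proof
 assume n: "N0 X (fob S X) (h * f)"
 let ?I = "Gam X X (fst (Oc X))" and ?J = "Gam (fob S X) (fob S X) (fst (Oc (fob S X)))"
 note SX = S_ob[OF X]
 have SX1: "is_cplx (fob S X)" "fob S X \<in> A" using SX by auto
 have hf: "Z0 X (fob S X) (h * f)" by (rule Zc_comp[OF f h]) simp
 have c1: "Db_comp (Gam Y (fob S X) h) (Db_comp (Gam X Y f) ?I) = Gam X (fob S X) (h * f)"
  using Db_comp_Gam[OF X(1) X(1) Y(1) Zc_id'[OF X(1)] f] Db_comp_Gam[OF X(1) Y(1) SX1(1) f h] Zc_fst(2)[OF f] by simp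
 have c2: "Db_comp ?J (Db_comp ?J (Gam Y (fob S X) h)) = Gam Y (fob S X) h"
  using Db_comp_Gam[OF Y(1) SX1(1) SX1(1) h Zc_id'[OF SX1(1)]] Zc_fst(1)[OF h] by simp
 have "\<phi> X (fob S X) (Gam X (fob S X) (h * f)) ?J = \<phi> X Y (Gam X Y f) (Gam Y (fob S X) h)"
  using nat[OF X Y X SX1 Gam_hom[OF X(1) Y(1) f] Gam_hom[OF X(1) X(1) Zc_id'[OF X(1)]] Gam_hom[OF Y(1) SX1(1) h] Gam_hom[OF SX1(1) SX1(1) Zc_id'[OF SX1(1)]]]
  by (simp only: S_id[OF X] c1 c2)
 moreover have "Gam X (fob S X) (h * f) = Gam X (fob S X) 0" using n Gam_0_iff[OF X(1) SX1(1) hf] by simp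
 ultimately show False using nz phi_zero[OF X SX1 Gam_hom[OF SX1(1) SX1(1) Zc_id'[OF SX1(1)]]] by simp
qed

text \<open>Injectivity of \<phi>: its values are extensional functions, so a class that pairs to
  zero with every \<open>h\<close> has the same image as the zero class.\<close>

lemma serre_left:
 assumes X: "is_cplx X" "X \<in> A" and Y: "is_cplx Y" "Y \<in> A" and f: "Z0 X Y f" "\<not> N0 X Y f"
 shows "\<exists>h. Z0 Y (fob S X) h \<and> \<not> N0 X (fob S X) (h * f)"
proof -
 have SX: "is_cplx (fob S X)" using S_ob[OF X] by simp
 have F: "Gam X Y f \<in> Db_hom X Y" "Gam X Y 0 \<in> Db_hom X Y" using Gam_hom[OF X(1) Y(1) f(1)] Gam_hom[OF X(1) Y(1) Zc_0] .
 have "\<exists>h\<in>Db_hom Y (fob S X). \<phi> X Y (Gam X Y f) h \<noteq> 0"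
 proof (rule ccontr)
  assume "\<not> ?thesis"
  then have z: "\<phi> X Y (Gam X Y f) h = \<phi> X Y (Gam X Y 0) h" if "h \<in> Db_hom Y (fob S X)" for h
   using that phi_zero[OF X Y that] by auto
  have "\<phi> X Y ` Db_hom X Y \<subseteq> extensional (Db_hom Y (fob S X))"
   using bij[OF X Y] by (auto simp: bij_betw_def dual_hom_def Db_sel)
  then have "\<phi> X Y (Gam X Y f) = \<phi> X Y (Gam X Y 0)"
   using F z by (intro extensionalityI[of _ "Db_hom Y (fob S X)"]) auto
  then have "Gam X Y f = Gam X Y 0" using bij[OF X Y] F by (auto simp: bij_betw_def dest: inj_onD)
  then show False using f Gam_0_iff[OF X(1) Y(1) f(1)] by blast
 qed
 then obtain h' where h': "h' \<in> Db_hom Y (fob S X)" "\<phi> X Y (Gam X Y f) h' \<noteq> 0" by blast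
 obtain h where h: "Z0 Y (fob S X) h" "h' = Gam Y (fob S X) h" using Gam_homE[OF Y(1) SX h'(1)] .
 then show ?thesis using phi_comp[OF X Y f(1) h(1)] h'(2) by blast
qed

text \<open>Surjectivity of \<phi>: a functional that does not vanish at \<open>h\<close> comes from
  some \<open>v\<close>, which then pairs nontrivially with \<open>h\<close>.\<close>

lemma serre_right:
 assumes X: "is_cplx X" "X \<in> A" and Y: "is_cplx Y" "Y \<in> A" and h: "Z0 Y (fob S X) h" "\<not> N0 Y (fob S X) h"
 shows "\<exists>v. Z0 X Y v \<and> \<not> N0 X (fob S X) (h * v)"
proof -
 define Z where "Z = fob S X"
 have Z: "is_cplx Z" using S_ob[OF X] by (simp add: Z_def)
 note h = h[folded Z_def]
 interpret V: vector_space "scw :: 'k \<Rightarrow> 'k wk \<Rightarrow> 'k wk"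
  by unfold_locales (simp_all add: scw_simps)
 have "V.subspace {x. N0 Y Z x}"
  by (rule V.subspaceI) (auto simp: Nl_0 Nl_add Nl_scw)
 from V.separating_functional[OF this, of h] h(2) obtain L :: "'k wk \<Rightarrow> 'k"
  where L: "!!x y. L (x + y) = L x + L y" "!!c x. L (scw c x) = c * L x" "!!x. N0 Y Z x ==> L x = 0" "L h = 1"
  by auto
 \<comment> \<open>The functional is built on weak morphisms and carried to roof classes by chosen
   representatives. The choice does not matter, because \<open>L\<close> kills null-homotopic
   morphisms.\<close>
 define rp where "rp a = (SOME g. Z0 Y Z g \<and> a = Gam Y Z g)" for a
 define l where "l = restrict (\<lambda>a. L (rp a)) (Db_hom Y Z)"
 have lG: "l (Gam Y Z g) = L g" if g: "Z0 Y Z g" for g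
 proof -
  have "Z0 Y Z (rp (Gam Y Z g)) \<and> Gam Y Z g = Gam Y Z (rp (Gam Y Z g))"
   unfolding rp_def by (rule someI[of _ g]) (simp add: g)
  then have "H0 Y Z (rp (Gam Y Z g)) g" using Gam_eq_iff[OF Y(1) Z] g by metis
  then have "L (rp (Gam Y Z g) - g) = 0" using L(3) by (simp add: hq_def)
  then have "L (rp (Gam Y Z g)) = L g" using L(1)[of "rp (Gam Y Z g) - g" g] by simp
  then show ?thesis using Gam_hom[OF Y(1) Z g] by (simp add: l_def)
 qed
 have "l \<in> dual_hom (full_subcat Db A) Y Z"
  unfolding dual_hom_def Db_sel
 proof (intro CollectI conjI ballI allI)
  show "l \<in> extensional (Db_hom Y Z)" by (simp add: l_def)
  fix a assume a: "a \<in> Db_hom Y Z"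
  obtain x where x: "Z0 Y Z x" "a = Gam Y Z x" using Gam_homE[OF Y(1) Z a] .
  show "l (Db_scale c a) = c * l a" for c
   using lG[OF x(1)] lG[OF Zc_scw[OF x(1)]] by (simp add: x(2) Db_scale_Gam[OF Y(1) Z x(1)] L)
  fix b assume b: "b \<in> Db_hom Y Z"
  obtain y where y: "Z0 Y Z y" "b = Gam Y Z y" using Gam_homE[OF Y(1) Z b] .
  show "l (Db_add a b) = l a + l b"
   using lG[OF x(1)] lG[OF y(1)] lG[OF Zc_add[OF x(1) y(1)]] by (simp add: x(2) y(2) Db_add_Gam[OF Y(1) Z x(1) y(1)] L)
 qed
 then obtain v' where v': "v' \<in> Db_hom X Y" "\<phi> X Y v' = l"
  using bij[OF X Y] by (auto simp: bij_betw_def Z_def image_iff set_eq_iff) metis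
 obtain v where v: "Z0 X Y v" "v' = Gam X Y v" using Gam_homE[OF X(1) Y(1) v'(1)] .
 have "\<phi> X Y (Gam X Y v) (Gam Y Z h) \<noteq> 0" using lG[OF h(1)] L(4) v' v by simp
 then show ?thesis using phi_comp[OF X Y v(1)] h v(1) by (auto simp: Z_def)
qed

text \<open>The functor is full, so endomorphisms of the image come from \<open>X\<close>, and it is
  linear, so scalars go to scalars.\<close>

lemma S_End:
 assumes X: "is_cplx X" "X \<in> A" and E: "!!e. Z0 X X e ==> \<exists>k. H0 X X e (scw k (fst (Oc X)))"
  and e: "Z0 (fob S X) (fob S X) e"
 shows "\<exists>k. H0 (fob S X) (fob S X) e (scw k (fst (Oc (fob S X))))"
proof -
 have SX: "is_cplx (fob S X)" using S_ob[OF X] by simp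
 have "bij_betw (fmap S X X) (Db_hom X X) (Db_hom (fob S X) (fob S X))"
  using aut X by (simp add: linear_autoequivalence_def Db_sel)
 then obtain d' where d': "d' \<in> Db_hom X X" "fmap S X X d' = Gam (fob S X) (fob S X) e"
  using Gam_hom[OF SX SX e] by (metis bij_betw_imp_surj_on imageE)
 obtain d where d: "Z0 X X d" "d' = Gam X X d" using Gam_homE[OF X(1) X(1) d'(1)] .
 obtain k where k: "H0 X X d (scw k (fst (Oc X)))" using E[OF d(1)] by blast
 have "d' = Db_scale k (Gam X X (fst (Oc X)))"
  using Gam_cong[OF k] Db_scale_Gam[OF X(1) X(1) Zc_id'[OF X(1)], of k] by (simp add: d(2))
 moreover have "fmap S X X (Db_scale k (Gam X X (fst (Oc X)))) = Db_scale k (fmap S X X (Gam X X (fst (Oc X))))"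
  using aut X Gam_hom[OF X(1) X(1) Zc_id'[OF X(1)]] unfolding linear_autoequivalence_def linear_endofunctor_def Db_sel by blast
 ultimately have "Gam (fob S X) (fob S X) e = Gam (fob S X) (fob S X) (scw k (fst (Oc (fob S X))))"
  using d'(2) S_id[OF X] Db_scale_Gam[OF SX SX Zc_id'[OF SX], of k] by simp
 then show ?thesis using Gam_eq_iff[OF SX SX e Zc_scw[OF Zc_id'[OF SX]]] by blast
qed

end

lemma serre_subcat_ex:
 assumes "serre_functor (full_subcat Db A) S"
 shows "\<exists>\<phi>. serre_subcat A S \<phi>"
proof -
 let ?C = "full_subcat Db A"
 have a: "linear_autoequivalence ?C S" using assms by (simp add: serre_functor_def)
 obtain \<phi> where
  B: "\<forall>X\<in>Ob ?C. \<forall>Y\<in>Ob ?C. bij_betw (\<phi> X Y) (Hom ?C X Y) (dual_hom ?C Y (fob S X)) \<and>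
    (\<forall>f\<in>Hom ?C X Y. \<forall>h\<in>Hom ?C Y (fob S X).
     (\<forall>g\<in>Hom ?C X Y. \<phi> X Y (Add ?C f g) h = \<phi> X Y f h + \<phi> X Y g h) \<and>
     (\<forall>c. \<phi> X Y (Scl ?C c f) h = c * \<phi> X Y f h))"
  and D: "\<forall>X\<in>Ob ?C. \<forall>Y\<in>Ob ?C. \<forall>X'\<in>Ob ?C. \<forall>Y'\<in>Ob ?C.
    \<forall>f\<in>Hom ?C X Y. \<forall>u\<in>Hom ?C X' X. \<forall>v\<in>Hom ?C Y Y'. \<forall>h\<in>Hom ?C Y' (fob S X').
     \<phi> X' Y' (Cmp ?C v (Cmp ?C f u)) h = \<phi> X Y f (Cmp ?C (fmap S X' X u) (Cmp ?C h v))"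
  using assms unfolding serre_functor_def by (elim conjE exE) (rule that)
 have "serre_subcat A S \<phi>"
 proof
  show "linear_autoequivalence ?C S" by (rule a)
 next
  fix X Y assume h: "is_cplx X" "X \<in> A" "is_cplx Y" "Y \<in> A"
  then have XY: "X \<in> Ob ?C" "Y \<in> Ob ?C" by (simp_all add: Db_sel)
  note b = bspec[OF bspec[OF B XY(1)] XY(2), unfolded Db_sel]
  show "bij_betw (\<phi> X Y) (Db_hom X Y) (dual_hom ?C Y (fob S X))" by (rule conjunct1[OF b])
  show "\<phi> X Y (Db_scale c f) h = c * \<phi> X Y f h" if "f \<in> Db_hom X Y" "h \<in> Db_hom Y (fob S X)" for f h c
   using bspec[OF bspec[OF conjunct2[OF b] that(1)] that(2)] by simp
 next
  fix X Y X' Y' f u v h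
  assume h: "is_cplx X" "X \<in> A" "is_cplx Y" "Y \<in> A" "is_cplx X'" "X' \<in> A" "is_cplx Y'" "Y' \<in> A"
   and m: "f \<in> Db_hom X Y" "u \<in> Db_hom X' X" "v \<in> Db_hom Y Y'" "h \<in> Db_hom Y' (fob S X')"
  have o: "X \<in> Ob ?C" "Y \<in> Ob ?C" "X' \<in> Ob ?C" "Y' \<in> Ob ?C" using h by (simp_all add: Db_sel)
  show "\<phi> X' Y' (Db_comp v (Db_comp f u)) h = \<phi> X Y f (Db_comp (fmap S X' X u) (Db_comp h v))"
   using bspec[OF bspec[OF bspec[OF bspec[OF bspec[OF bspec[OF bspec[OF bspec[OF D o(1)] o(2)] o(3)] o(4)], unfolded Db_sel, OF m(1)] m(2)] m(3)] m(4)] .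
 qed
 then show ?thesis by blast
qed

lemma iso_in_weqv:
 assumes "iso_in (full_subcat Db A) X Y a"
 shows "is_cplx X \<and> is_cplx Y \<and> (\<exists>s t. weqv 0 (Oc X) (Oc Y) s t \<and> a = Gam X Y s)"
proof -
 have X: "is_cplx X" and Y: "is_cplx Y" and a: "a \<in> Db_hom X Y" using assms by (auto simp: iso_in_def Db_sel)
 from assms obtain b where b: "b \<in> Db_hom Y X" "Db_comp b a = chain_roof X X (cid X)" "Db_comp a b = chain_roof Y Y (cid Y)"
  by (auto simp: iso_in_def Db_sel)
 obtain s where s: "Z0 X Y s" "a = Gam X Y s" using Gam_homE[OF X Y a] .
 obtain t where t: "Z0 Y X t" "b = Gam Y X t" using Gam_homE[OF Y X b(1)] .
 have ts: "Z0 X X (t * s)" "Z0 Y Y (s * t)" by (rule Zc_comp[OF s(1) t(1)], simp) (rule Zc_comp[OF t(1) s(1)], simp)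
 have "Gam X X (t * s) = Gam X X (fst (Oc X))" "Gam Y Y (s * t) = Gam Y Y (fst (Oc Y))"
  using b(2,3) Db_comp_Gam[OF X Y X s(1) t(1)] Db_comp_Gam[OF Y X Y t(1) s(1)] by (simp_all add: s t cid_Gam X Y)
 then have "weqv 0 (Oc X) (Oc Y) s t"
  using Gam_eq_iff[OF X X ts(1) Zc_id'[OF X]] Gam_eq_iff[OF Y Y ts(2) Zc_id'[OF Y]] s(1) t(1) by (simp add: weqv_def)
 then show ?thesis using X Y s(2) by blast
qed

lemma weqv_isomorphic:
 assumes X: "is_cplx X" and Y: "is_cplx Y" and w: "weqv p (Oc X) (Oc Y) s t"
 shows "isomorphic Db X (shift p Y)"
proof -
 note Y' = is_cplx_shift[OF Y, of p]
 define x y where "x = st (ta p Y) * s" and "y = t * st (tb p Y)"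
 have "weqv 0 (Oc X) (Oc (shift p Y)) x y" unfolding x_def y_def by (rule weqv_trans[OF w shift_weqv[OF Y]]) simp
 then have xy: "Z0 X (shift p Y) x" "Z0 (shift p Y) X y"
  "H0 X X (y * x) (fst (Oc X))" "H0 (shift p Y) (shift p Y) (x * y) (fst (Oc (shift p Y)))"
  by (simp_all add: weqv_def)
 have "iso_in Db X (shift p Y) (Gam X (shift p Y) x)"
  unfolding iso_in_def
 proof (intro conjI bexI[of _ "Gam (shift p Y) X y"])
  show "X \<in> Ob Db" "shift p Y \<in> Ob Db" using X Y' by (simp_all add: Db_def)
  show "Gam X (shift p Y) x \<in> Hom Db X (shift p Y)" "Gam (shift p Y) X y \<in> Hom Db (shift p Y) X"
   using Gam_hom X Y' xy by (simp_all add: Db_def)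
  show "Cmp Db (Gam (shift p Y) X y) (Gam X (shift p Y) x) = Idm Db X" "Cmp Db (Gam X (shift p Y) x) (Gam (shift p Y) X y) = Idm Db (shift p Y)"
   using Gam_cong[OF xy(3)] Gam_cong[OF xy(4)] Db_comp_Gam[OF X Y' X xy(1,2)] Db_comp_Gam[OF Y' X Y' xy(2,1)]
   by (simp_all add: Db_def cid_Gam X Y')
 qed
 then show ?thesis unfolding isomorphic_def by blast
qed

lemma Oc_P: "Oc P_obj = oo Ps" and cplx_P: "is_cplx P_obj"
 by (simp_all add: P_obj_def P_rep_string so_string is_cplx_string)

text \<open>Through \<open>ta\<close> and \<open>tb\<close> the shifts of \<open>T\<close> are
  absorbed into the degree of the weak morphism.\<close>

lemma orth_iff:
 assumes T: "is_cplx T"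
 shows "(\<forall>i. Hom Db P_obj (shift i T) = {Zer Db P_obj (shift i T)}) \<longleftrightarrow>
  (\<forall>r x. Zc r (oo Ps) (Oc T) x --> Nl r (oo Ps) (Oc T) x)"
proof -
 have D: "Hom Db = Db_hom" "!!X Y. Zer Db X Y = chain_roof X Y (czero X Y)" by (simp_all add: Db_def)
 have T': "is_cplx (shift i T)" for i by (rule is_cplx_shift[OF T])
 note G = Gam_0_iff[OF cplx_P T', unfolded Oc_P] Db_hom_Gam[OF cplx_P T', unfolded Oc_P]
 show ?thesis unfolding D czero_Gam[OF cplx_P T']
 proof (intro iffI allI impI)
  fix r x assume h: "\<forall>i. Db_hom P_obj (shift i T) = {Gam P_obj (shift i T) 0}" and x: "Zc r (oo Ps) (Oc T) x"
  have z: "Zc 0 (oo Ps) (Oc (shift r T)) (st (ta r T) * x)" by (rule Zc_comp[OF x shift_maps(1)[OF T]]) simp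
  then have "Gam P_obj (shift r T) (st (ta r T) * x) = Gam P_obj (shift r T) 0" using h G(2)[of r] by blast
  then have "Nl 0 (oo Ps) (Oc (shift r T)) (st (ta r T) * x)" using G(1)[OF z] by simp
  then show "Nl r (oo Ps) (Oc T) x" by (rule weqv_Nl_left[OF shift_weqv[OF T] x]) simp
 next
  fix i assume h: "\<forall>r x. Zc r (oo Ps) (Oc T) x --> Nl r (oo Ps) (Oc T) x"
  have "Gam P_obj (shift i T) y = Gam P_obj (shift i T) 0" if y: "Zc 0 (oo Ps) (Oc (shift i T)) y" for y
  proof -
   have "Zc i (oo Ps) (Oc T) (st (tb i T) * y)" by (rule Zc_comp[OF y shift_maps(2)[OF T]]) simp
   then have "Nl i (oo Ps) (Oc T) (st (tb i T) * y)" using h by blast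
   then have "Nl 0 (oo Ps) (Oc (shift i T)) y" by (rule weqv_Nl_left[OF weqv_sym[OF shift_weqv[OF T]] y]) simp
   then show ?thesis using G(1)[OF y] by simp
  qed
  moreover have "Zc 0 (oo Ps) (Oc (shift i T)) 0" by (rule Zc_0)
  ultimately show "Db_hom P_obj (shift i T) = {Gam P_obj (shift i T) 0}" unfolding G(2) by blast
 qed
qed

lemma cone_triangle_cone:
 assumes X: "is_cplx X" and Y: "is_cplx Y" and C: "is_cplx (cone X Y f)" and f: "chain_map X Y f"
 obtains J I p q where "cone_triangle (Oc X) (Oc Y) (Oc (cone X Y f)) (st (ce X Y f)) J I p q"
  "chain_map (cone X Y f) (shift 1 X) (cone_out X Y)"
  "st (ce (cone X Y f) (shift 1 X) (cone_out X Y)) = st (ta 1 X) * p"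
proof -
 let ?C = "cone X Y f"
 obtain J I p q where S: "Sm 1 (so ?C) (so X) p" "Sm (- 1) (so X) (so ?C) J" "Sm 0 (so Y) (so ?C) I" "Sm 0 (so ?C) (so Y) q"
  and e: "p * J = se (so X)" "q * I = se (so Y)" "p * I = 0" "q * J = 0" "J * p + I * q = se (so ?C)"
  and d: "sd (so ?C) = I * sd (so Y) * q + I * ce X Y f * p - J * sd (so X) * p"
  and a: "!!c. are c ?C = I * are c Y * q - J * are c X * p"
  and o: "ce ?C (shift 1 X) (cone_out X Y) = ta 1 X * p" "cmc 0 ?C (shift 1 X) (cone_out X Y)"
  by (rule cone_structure[OF assms]) (rule that, assumption+)
 note sX = sob_so[OF X] and sY = sob_so[OF Y] and sC = sob_so[OF C]
 have u: "upr p" "upr J" "upr I" "upr q" "upr (ta 1 X)" using S ta_Sc[OF X] by (auto simp: Sc_def intro: Sm_upr)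
 have di: "dia p = p" "dia J = J" "dia I = I" "dia q = q" "dia (ce X Y f) = ce X Y f"
  using S chain_Sc[OF X Y f] by (auto simp: Sm_def Sc_def)
 have "cone_triangle (Oc X) (Oc Y) (Oc ?C) (st (ce X Y f)) (st J) (st I) (st p) (st q)"
 proof
  show "ob (Oc X)" "ob (Oc Y)" "ob (Oc ?C)" using ob_Oc X Y C by blast+
  show "Z0 X Y (st (ce X Y f))" by (rule chain_Zc[OF X Y f])
  show "Cm (- 1) (Oc X) (Oc ?C) (st J)" "Cm 0 (Oc Y) (Oc ?C) (st I)" "Cm 1 (Oc ?C) (Oc X) (st p)" "Cm 0 (Oc ?C) (Oc Y) (st q)"
   using Sm_Cm[OF sX sC S(2)] Sm_Cm[OF sY sC S(3)] Sm_Cm[OF sC sX S(1)] Sm_Cm[OF sC sY S(4)] .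
  show "st p * st J = fst (Oc X)" "st q * st I = fst (Oc Y)" "st p * st I = 0" "st q * st J = 0"
   using u e by (simp_all add: st_mult[symmetric] oo_def st_simps del: so_sel)
  show "st J * st p + st I * st q = fst (Oc ?C)"
   using u by (simp add: st_mult[symmetric] st_simps(1)[symmetric] e(5) oo_def del: so_sel)
  show "snd (Oc ?C) = st I * snd (Oc Y) * st q + st I * st (ce X Y f) * st p - st J * snd (Oc X) * st p"
  proof (rule wk_eqI)
   show "w1 (snd (Oc ?C)) = w1 (st I * snd (Oc Y) * st q + st I * st (ce X Y f) * st p - st J * snd (Oc X) * st p)"
    unfolding w_times w_plus w_minus w_st w_oo[OF sX] w_oo[OF sY] w_oo[OF sC] di d so_sel(4) a[of False] by (simp add: ring_dist)
   show "w2 (snd (Oc ?C)) = w2 (st I * snd (Oc Y) * st q + st I * st (ce X Y f) * st p - st J * snd (Oc X) * st p)"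
    unfolding w_times w_plus w_minus w_st w_oo[OF sX] w_oo[OF sY] w_oo[OF sC] di d so_sel(3) a[of True] by (simp add: ring_dist)
  qed
 qed
 moreover have "sd (so X) * p = sg 1 (p * sd (so ?C))"
 proof -
  have z: "p * (J * w) = se (so X) * w" "p * (I * w) = 0" for w using e by (simp_all flip: mult.assoc del: so_sel)
  have "se (so X) * (sd (so X) * w) = sd (so X) * w" for w using sX unfolding sob_def by (simp flip: mult.assoc del: so_sel)
  then show ?thesis unfolding d by (simp add: ring_dist mult.assoc z del: so_sel)
 qed
 then have "Sc 1 (so ?C) (so X) p" using S(1) by (simp add: Sc_def del: so_sel)
 then have "Sc 0 (so ?C) (so (shift 1 X)) (ta 1 X * p)" by (rule Sc_comp[OF _ ta_Sc[OF X]]) simp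
 then have "chain_map ?C (shift 1 X) (cone_out X Y)"
  unfolding chain_map_iff[OF C is_cplx_shift[OF X]] o(1) using o(2) by blast
 moreover have "st (ce ?C (shift 1 X) (cone_out X Y)) = st (ta 1 X) * st p" unfolding o(1) by (rule st_mult[OF u(5,1)])
 ultimately show thesis using that by blast
qed

text \<open>Carries the coordinates of Hom(F, F[i]) over to closed weak endomorphisms of degree
  \<open>i\<close>, where products are formed without shifts.\<close>

lemma spherical_coordinates:
 fixes F :: "'k::field cplx"
 assumes F: "is_cplx F" and s: "\<exists>\<psi> :: 'k roof set \<Rightarrow> 'k \<times> 'k.
    bij_betw \<psi> (Hom Db F (shift i F)) (sphere_part n i) \<and>
    (\<forall>f\<in>Hom Db F (shift i F). \<forall>g\<in>Hom Db F (shift i F). \<forall>c.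
      \<psi> (Add Db f g) = (fst (\<psi> f) + fst (\<psi> g), snd (\<psi> f) + snd (\<psi> g)) \<and>
      \<psi> (Scl Db c f) = (c * fst (\<psi> f), c * snd (\<psi> f)))"
 obtains a b :: "'k wk \<Rightarrow> 'k" where
  "!!x y. Zc i (Oc F) (Oc F) x ==> Zc i (Oc F) (Oc F) y ==> a (x + y) = a x + a y \<and> b (x + y) = b x + b y"
  "!!x c. Zc i (Oc F) (Oc F) x ==> a (scw c x) = c * a x \<and> b (scw c x) = c * b x"
  "!!x. Zc i (Oc F) (Oc F) x ==> Nl i (Oc F) (Oc F) x \<longleftrightarrow> a x = 0 \<and> b x = 0"
  "!!x. Zc i (Oc F) (Oc F) x ==> (a x, b x) \<in> sphere_part n i"
  "!!z. z \<in> sphere_part n i ==> \<exists>x. Zc i (Oc F) (Oc F) x \<and> (a x, b x) = z"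
proof -
 let ?G = "shift i F" and ?s = "st (ta i F)"
 note G = is_cplx_shift[OF F, of i]
 obtain \<psi> :: "'k roof set \<Rightarrow> 'k \<times> 'k" where bij: "bij_betw \<psi> (Db_hom F ?G) (sphere_part n i)"
  and lin: "!!f g c. f \<in> Db_hom F ?G ==> g \<in> Db_hom F ?G ==>
      \<psi> (Db_add f g) = (fst (\<psi> f) + fst (\<psi> g), snd (\<psi> f) + snd (\<psi> g)) \<and> \<psi> (Db_scale c f) = (c * fst (\<psi> f), c * snd (\<psi> f))"
  using s by (auto simp: Db_def)
 define \<gamma> where "\<gamma> x = Gam F ?G (?s * x)" for x
 define a b where "a x = fst (\<psi> (\<gamma> x))" and "b x = snd (\<psi> (\<gamma> x))" for x
 have sx: "Zc 0 (Oc F) (Oc ?G) (?s * x)" if "Zc i (Oc F) (Oc F) x" for x by (rule Zc_comp[OF that shift_maps(1)[OF F]]) simp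
 have hom: "\<gamma> x \<in> Db_hom F ?G" if "Zc i (Oc F) (Oc F) x" for x unfolding \<gamma>_def by (rule Gam_hom[OF F G sx[OF that]])
 have ad: "\<gamma> (x + y) = Db_add (\<gamma> x) (\<gamma> y)" if "Zc i (Oc F) (Oc F) x" "Zc i (Oc F) (Oc F) y" for x y
  unfolding \<gamma>_def Db_add_Gam[OF F G sx[OF that(1)] sx[OF that(2)]] by (simp add: distrib_left)
 have sca: "\<gamma> (scw c x) = Db_scale c (\<gamma> x)" if "Zc i (Oc F) (Oc F) x" for x c
  unfolding \<gamma>_def Db_scale_Gam[OF F G sx[OF that]] by (simp add: scw_mult_right)
 have l1: "a (x + y) = a x + a y \<and> b (x + y) = b x + b y" if "Zc i (Oc F) (Oc F) x" "Zc i (Oc F) (Oc F) y" for x y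
  using lin[OF hom[OF that(1)] hom[OF that(2)]] by (simp add: a_def b_def ad[OF that])
 have l2: "a (scw c x) = c * a x \<and> b (scw c x) = c * b x" if "Zc i (Oc F) (Oc F) x" for x c
  using lin[OF hom[OF that] hom[OF that], of c] by (simp add: a_def b_def sca[OF that])
 have z0: "Zc i (Oc F) (Oc F) 0" by (rule Zc_0)
 have ab0: "a 0 = 0" "b 0 = 0" using l2[OF z0, of 0] by (simp_all add: scw_simps)
 have nl: "Nl i (Oc F) (Oc F) x \<longleftrightarrow> \<gamma> x = \<gamma> 0" if x: "Zc i (Oc F) (Oc F) x" for x
 proof -
  have "\<gamma> x = \<gamma> 0 \<longleftrightarrow> Nl 0 (Oc F) (Oc ?G) (?s * x)" using Gam_0_iff[OF F G sx[OF x]] by (simp add: \<gamma>_def)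
  moreover have "Nl 0 (Oc F) (Oc ?G) (?s * x)" if "Nl i (Oc F) (Oc F) x" by (rule Nl_comp_left[OF that shift_maps(1)[OF F]]) simp
  moreover have "Nl i (Oc F) (Oc F) x" if "Nl 0 (Oc F) (Oc ?G) (?s * x)" by (rule weqv_Nl_left[OF shift_weqv[OF F] x that]) simp
  ultimately show ?thesis by blast
 qed
 have n3: "Nl i (Oc F) (Oc F) x \<longleftrightarrow> a x = 0 \<and> b x = 0" if x: "Zc i (Oc F) (Oc F) x" for x
 proof -
  have "\<gamma> x = \<gamma> 0 \<longleftrightarrow> \<psi> (\<gamma> x) = \<psi> (\<gamma> 0)" using bij hom[OF x] hom[OF z0] by (auto simp: bij_betw_def dest: inj_onD)
  also have "\<dots> \<longleftrightarrow> a x = 0 \<and> b x = 0" using ab0 by (simp add: a_def b_def prod_eq_iff)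
  finally show ?thesis using nl[OF x] by simp
 qed
 have r1: "(a x, b x) \<in> sphere_part n i" if "Zc i (Oc F) (Oc F) x" for x
  using bij hom[OF that] by (auto simp: a_def b_def bij_betw_def)
 have r2: "\<exists>x. Zc i (Oc F) (Oc F) x \<and> (a x, b x) = z" if z: "z \<in> sphere_part n i" for z
 proof -
  obtain h where h: "h \<in> Db_hom F ?G" "\<psi> h = z" using z bij by (metis bij_betw_imp_surj_on imageE)
  obtain g where g: "Zc 0 (Oc F) (Oc ?G) g" "h = Gam F ?G g" using Gam_homE[OF F G h(1)] .
  have "Zc i (Oc F) (Oc F) (st (tb i F) * g)" by (rule Zc_comp[OF g(1) shift_maps(2)[OF F]]) simp
  moreover have "?s * (st (tb i F) * g) = g" using shift_maps(4)[OF F, of i] Zc_fst(1)[OF g(1)] by (simp flip: mult.assoc)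
  then have "\<psi> (\<gamma> (st (tb i F) * g)) = z" using h g by (simp add: \<gamma>_def)
  ultimately show ?thesis by (intro exI[of _ "st (tb i F) * g"]) (auto simp: a_def b_def)
 qed
 show thesis by (rule that[OF l1 l2 n3 r1 r2])
qed

text \<open>Cramer's rule.\<close>

lemma combination:
 fixes e1 e2 a1 a2 b1 b2 :: "'k::field"
 assumes "e1 * a2 - e2 * a1 \<noteq> 0"
 obtains k l where "b1 = k * e1 + l * a1" "b2 = k * e2 + l * a2"
proof -
 define D where "D = e1 * a2 - e2 * a1"
 have D: "D \<noteq> 0" using assms by (simp add: D_def)
 have "b1 = (b1 * a2 - b2 * a1) / D * e1 + (e1 * b2 - e2 * b1) / D * a1"
  using D by (simp add: field_simps) (simp add: D_def algebra_simps)
 moreover have "b2 = (b1 * a2 - b2 * a1) / D * e2 + (e1 * b2 - e2 * b1) / D * a2"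
  using D by (simp add: field_simps) (simp add: D_def algebra_simps)
 ultimately show thesis by (rule that)
qed

theorem corollary3p3:
  fixes S S_perp :: "('k::{alg_closed_field, field_char_0} cplx, 'k roof set) func"
    and E F :: "'k cplx" and n :: int
    and u v w :: "'k roof set"
  assumes "serre_functor Db S"
    and "serre_functor (right_orth P_obj) S_perp"
    and "distinguished (shift (- 1) (fob S P_obj)) E P_obj u v w"
    and "w \<in> Hom Db P_obj (fob S P_obj)"
    and "w \<noteq> Zer Db P_obj (fob S P_obj)"
    and "spherical (right_orth P_obj) S_perp n F"
  shows "(\<exists>m. isomorphic Db F (shift m E)) \<or> n = 1"
proof (rule disjCI)
 assume n1: "n \<noteq> 1"
 define P :: "'k cplx" where "P = P_obj"
 define A where "A = {T :: 'k cplx. \<forall>i. Hom Db P (shift i T) = {Zer Db P (shift i T)}}"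
 have P: "is_cplx P" and OP: "Oc P = oo Ps" by (simp_all add: P_def cplx_P Oc_P)
 have A: "T \<in> A \<longleftrightarrow> (\<forall>r x. Zc r (oo Ps) (Oc T) x --> Nl r (oo Ps) (Oc T) x)" if "is_cplx T" for T
  using orth_iff[OF that] by (simp add: A_def P_def)
 have C: "right_orth P_obj = full_subcat Db A" by (simp add: right_orth_def A_def P_def)
 obtain \<phi> where "serre_subcat UNIV S \<phi>" using serre_subcat_ex[of UNIV S] assms(1) Db_UNIV by metis
 then interpret S: serre_subcat UNIV S \<phi> .
 obtain \<phi>' where "serre_subcat A S_perp \<phi>'" using serre_subcat_ex[of A S_perp] assms(2) C by metis
 then interpret T: serre_subcat A S_perp \<phi>' .
 define Q :: "'k cplx" where "Q = stalk (string_rep False)"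
 have Q: "is_cplx Q" and OQ: "Oc Q = oo Qs" by (simp_all add: Q_def so_string is_cplx_string)
 define N where "N = fob S P"
 have N: "is_cplx N" using S.S_ob[OF P] by (simp add: N_def)
 \<comment> \<open>\<open>S(P)\<close> is \<open>Q[2]\<close>: Serre duality turns the nonzero
   morphism from \<open>P\<close> to \<open>Q[2]\<close> into a morphism \<open>x\<close> to
   \<open>S(P)\<close>, and \<open>P_detect\<close> provides \<open>y\<close> in the other
   direction. Both endomorphism rings are \<open>k\<close>, so \<open>x\<close> is invertible as
   soon as \<open>y * x\<close> is nonzero.\<close>
 have "\<exists>x y. weqv (- 2) (oo Qs) (Oc N) x y"
 proof -
  obtain v0 :: "'k wk" where v0: "Zc 2 (oo Ps) (oo Qs) v0" "\<not> Nl 2 (oo Ps) (oo Qs) v0"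
  proof -
   obtain g :: "'k wk" where g: "Zc 2 (oo Ps) (oo Qs) g" "\<not> Nl 2 (oo Ps) (oo Qs) (g * fst (oo Ps))"
    using P_detect[OF sob_Ps Zc_id[OF ob_oo[OF sob_Ps]] P_id_nonzero] by auto
   then show thesis using that Zc_fst(2)[OF g(1)] by simp
  qed
  note tQ = shift_maps(1)[OF Q, of 2, unfolded OQ]
  have v1: "Zc 0 (oo Ps) (Oc (shift 2 Q)) (st (ta 2 Q) * v0)" by (rule Zc_comp[OF v0(1) tQ]) simp
  have "\<not> Nl 0 (oo Ps) (Oc (shift 2 Q)) (st (ta 2 Q) * v0)"
   using weqv_Nl_left[OF shift_weqv[OF Q, of 2, unfolded OQ] v0(1)] v0(2) by auto
  from S.serre_left[OF P UNIV_I is_cplx_shift[OF Q] UNIV_I v1[folded OP] this[folded OP]]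
  obtain \<theta> where \<theta>: "Z0 (shift 2 Q) N \<theta>" "\<not> Nl 0 (oo Ps) (Oc N) (\<theta> * (st (ta 2 Q) * v0))"
   by (auto simp: OP N_def)
  define x where "x = \<theta> * st (ta 2 Q)"
  have x: "Zc (- 2) (oo Qs) (Oc N) x" unfolding x_def by (rule Zc_comp[OF tQ \<theta>(1)]) simp
  have xv: "Zc 0 (oo Ps) (Oc N) (x * v0)" by (rule Zc_comp[OF v0(1) x]) simp
  have xv0: "\<not> Nl 0 (oo Ps) (Oc N) (x * v0)" using \<theta>(2) by (simp add: x_def mult.assoc)
  obtain y where y: "Zc 2 (Oc N) (oo Qs) y" "\<not> Nl 2 (oo Ps) (oo Qs) (y * (x * v0))"
   using P_detect[OF sob_so[OF N] xv xv0] by auto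
  have yx: "Zc 0 (oo Qs) (oo Qs) (y * x)" by (rule Zc_comp[OF x y(1)]) simp
  have xy: "Z0 N N (x * y)" by (rule Zc_comp[OF y(1) x]) simp
  obtain l where l: "hq 0 (oo Qs) (oo Qs) (y * x) (scw l (fst (oo Qs)))" using Q_to_Q(2)[OF yx] by blast
  have "\<exists>k. H0 P P e (scw k (fst (Oc P)))" if "Z0 P P e" for e
   using P_to_P(2)[of 0 e] that by (simp add: OP)
  from S.S_End[OF P UNIV_I this, of "x * y"] obtain k where k: "H0 N N (x * y) (scw k (fst (Oc N)))"
   using xy by (auto simp: N_def)
  have "l \<noteq> 0"
  proof
   assume "l = 0"
   then have "Nl 0 (oo Qs) (oo Qs) (y * x)" using l by (simp add: scw_simps hq_0)
   from Nl_comp_right[OF this v0(1), of 2] show False using y(2) by (simp add: mult.assoc)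
  qed
  moreover have "\<not> Nl (- 2) (oo Qs) (Oc N) x"
  proof
   assume "Nl (- 2) (oo Qs) (Oc N) x"
   from Nl_comp_right[OF this v0(1), of 0] show False using xv0 by simp
  qed
  ultimately show ?thesis using scalar_weqv[OF x _ k l] y(1) by auto
 qed
 then obtain x0 y0 where N2: "weqv (- 2) (oo Qs) (Oc N) x0 y0" by blast
 define X where "X = shift (- 1) N"
 have X: "is_cplx X" by (simp add: X_def is_cplx_shift N)
 have NX: "shift 1 X = N" by (simp add: X_def shift_shift N)
 have X2: "weqv (- 1) (oo Qs) (Oc X) (st (ta (- 1) N) * x0) (y0 * st (tb (- 1) N))"
  unfolding X_def by (rule weqv_trans[OF N2 shift_weqv[OF N]]) simp
 have D: "Hom Db = Db_hom" "Cmp Db = Db_comp" "!!X Y. Zer Db X Y = chain_roof X Y (czero X Y)" by (simp_all add: Db_def)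
 from assms(3) obtain X' Y' f a b c where
  cp: "is_cplx X'" "is_cplx Y'" "chain_map X' Y' f" and
  iso: "iso_in Db X X' a" "iso_in Db E Y' b" "iso_in Db P (cone X' Y' f) c" and
  rel: "Db_comp (Db_shift 1 a) w = Db_comp (chain_roof (cone X' Y' f) (shift 1 X') (cone_out X' Y')) c"
  unfolding distinguished_def by (auto simp: D X_def N_def P_def)
 define K where "K = cone X' Y' f"
 obtain \<alpha> \<alpha>' where \<alpha>: "weqv 0 (Oc X) (Oc X') \<alpha> \<alpha>'" "a = Gam X X' \<alpha>"
  using iso_in_weqv[of UNIV] iso(1) Db_UNIV by metis
 obtain \<beta> \<beta>' where E: "is_cplx E" and \<beta>: "weqv 0 (Oc E) (Oc Y') \<beta> \<beta>'"
  using iso_in_weqv[of UNIV] iso(2) Db_UNIV by metis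
 obtain \<gamma> \<gamma>' where K: "is_cplx K" and \<gamma>: "weqv 0 (Oc P) (Oc K) \<gamma> \<gamma>'" "c = Gam P K \<gamma>"
  using iso_in_weqv[of UNIV] iso(3) Db_UNIV unfolding K_def by metis
 obtain J I p q where tri: "cone_triangle (Oc X') (Oc Y') (Oc K) (st (ce X' Y' f)) J I p q"
  and co: "chain_map K (shift 1 X') (cone_out X' Y')" "st (ce K (shift 1 X') (cone_out X' Y')) = st (ta 1 X') * p"
  using cone_triangle_cone[OF cp(1,2) K[unfolded K_def] cp(3)] unfolding K_def by blast
 interpret cone_triangle "Oc X'" "Oc Y'" "Oc K" "st (ce X' Y' f)" J I p q by (rule tri)
 obtain s t where s: "weqv (- 1) (oo Qs) (Oc X') s t" using weqv_trans[OF X2 \<alpha>(1)] by auto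
 \<comment> \<open>Along the isomorphism of triangles \<open>p * \<gamma>\<close> corresponds to
   \<open>w\<close>, so if it were null, \<open>w\<close> would be zero.\<close>
 have "\<not> Nl 1 (oo Ps) (Oc X') (p * \<gamma>)"
 proof
  assume n: "Nl 1 (oo Ps) (Oc X') (p * \<gamma>)"
  note X1 = is_cplx_shift[OF X, of 1] and X1' = is_cplx_shift[OF cp(1), of 1]
  have "w \<in> Db_hom P (shift 1 X)" "w \<noteq> Gam P (shift 1 X) 0"
   using assms(4,5) czero_Gam[OF P N] by (simp_all add: D NX N_def P_def)
  then obtain w0 where w0: "Z0 P (shift 1 X) w0" "w = Gam P (shift 1 X) w0" "\<not> N0 P (shift 1 X) w0"
   using Gam_homE[OF P X1] Gam_0_iff[OF P X1] by metis
  have \<alpha>0: "Z0 X X' \<alpha>" and \<gamma>0: "Z0 P K \<gamma>" using \<alpha> \<gamma> by (auto simp: weqv_def)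
  define a1 where "a1 = st (ta 1 X') * \<alpha> * st (tb 1 X)"
  note sh = Db_shift_Gam[OF X cp(1) \<alpha>0, of 1, folded a1_def]
  have po: "Z0 K (shift 1 X') (st (ta 1 X') * p)" using chain_Zc[OF K X1' co(1)] co(2) by simp
  have aw: "Z0 P (shift 1 X') (a1 * w0)" by (rule Zc_comp[OF w0(1) sh(1)]) simp
  have pg: "Z0 P (shift 1 X') (st (ta 1 X') * p * \<gamma>)" by (rule Zc_comp[OF \<gamma>0 po]) simp
  have "Gam P (shift 1 X') (a1 * w0) = Gam P (shift 1 X') (st (ta 1 X') * p * \<gamma>)"
   using rel[folded K_def] Db_comp_Gam[OF P X1 X1' w0(1) sh(1)] Db_comp_Gam[OF P K X1' \<gamma>0 po]
   by (simp add: \<alpha>(2) \<gamma>(2) w0(2) sh(2) chain_roof_Gam[OF K X1' co(1)] co(2))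
  then have "H0 P (shift 1 X') (a1 * w0) (st (ta 1 X') * p * \<gamma>)" using Gam_eq_iff[OF P X1' aw pg] by simp
  moreover have "N0 P (shift 1 X') (st (ta 1 X') * p * \<gamma>)"
   using Nl_comp_left[OF n shift_maps(1)[OF cp(1), of 1], of 0] by (simp add: OP mult.assoc)
  ultimately have na: "N0 P (shift 1 X') (a1 * w0)" by (simp add: Nl_hq)
  have "weqv 1 (Oc (shift 1 X)) (Oc X) (st (tb 1 X)) (st (ta 1 X))" using weqv_sym[OF shift_weqv[OF X, of 1]] by simp
  from weqv_trans[OF weqv_trans[OF this \<alpha>(1) refl] shift_weqv[OF cp(1), of 1], of 0]
  have "weqv 0 (Oc (shift 1 X)) (Oc (shift 1 X')) a1 (st (ta 1 X) * \<alpha>' * st (tb 1 X'))" by (simp add: a1_def mult.assoc)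
  from weqv_Nl_left[OF this w0(1) na] show False using w0(3) by simp
 qed
 then interpret spherical_cone "Oc X'" "Oc Y'" "Oc K" "st (ce X' Y' f)" J I p q s t \<gamma> \<gamma>'
  using s \<gamma>(1) by unfold_locales (simp_all add: OP)
 have sph: "F \<in> Ob (full_subcat Db A)" "isomorphic (full_subcat Db A) (fob S_perp F) (shift n F)"
  and coord: "!!i. \<exists>\<psi> :: 'k roof set \<Rightarrow> 'k \<times> 'k.
    bij_betw \<psi> (Hom Db F (shift i F)) (sphere_part n i) \<and>
    (\<forall>f\<in>Hom Db F (shift i F). \<forall>g\<in>Hom Db F (shift i F). \<forall>c.
      \<psi> (Add Db f g) = (fst (\<psi> f) + fst (\<psi> g), snd (\<psi> f) + snd (\<psi> g)) \<and>
      \<psi> (Scl Db c f) = (c * fst (\<psi> f), c * snd (\<psi> f)))"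
  using assms(6) unfolding spherical_def C by (simp_all add: full_subcat_def)
 have F: "is_cplx F" "F \<in> A" using sph(1) by (simp_all add: Db_sel)
 have orth: "Zc r (oo Ps) (Oc F) x ==> Nl r (oo Ps) (Oc F) x" for r x using A[OF F(1)] F(2) by blast
 \<comment> \<open>Composed with the isomorphism from \<open>F[n]\<close> to the Serre dual of
   \<open>F\<close>, the morphism \<open>h\<close> has degree r - n. Shifting \<open>Y'\<close> by n
   - r brings it to degree zero and stays orthogonal to \<open>P\<close>, so Serre duality on the
   subcategory applies.\<close>
 have serre: "\<exists>v. Zc (n - r) (Oc F) (Oc Y') v \<and> \<not> Nl n (Oc F) (Oc F) (h * v)"
  if h: "Zc r (Oc Y') (Oc F) h" "\<not> Nl r (Oc Y') (Oc F) h" for r h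
 proof -
  define Y1 where "Y1 = shift (n - r) Y'"
  have Y1: "is_cplx Y1" by (simp add: Y1_def is_cplx_shift cp)
  note eY = shift_weqv[OF cp(2), of "n - r", folded Y1_def] and mY = shift_maps[OF cp(2), of "n - r", folded Y1_def]
  have "Nl m (oo Ps) (Oc Y1) x" if x: "Zc m (oo Ps) (Oc Y1) x" for m x
  proof (rule weqv_Nl_left[OF weqv_sym[OF eY] x])
   show "Nl (n - r + m) (oo Ps) (Oc Y') (st (tb (n - r) Y') * x)" by (rule Y_orth[OF Zc_comp[OF x mY(2)]]) simp
  qed simp
  then have Y1A: "Y1 \<in> A" using A[OF Y1] by blast
  obtain \<iota> where "iso_in (full_subcat Db A) (fob S_perp F) (shift n F) \<iota>" using sph(2) by (auto simp: isomorphic_def)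
  from iso_in_weqv[OF this] obtain i1 i2 where i: "weqv 0 (Oc (fob S_perp F)) (Oc (shift n F)) i1 i2" by blast
  have i': "Z0 (shift n F) (fob S_perp F) i2" using i by (simp add: weqv_def)
  have j: "weqv (- n) (Oc F) (Oc (fob S_perp F)) (i2 * st (ta n F)) (st (tb n F) * i1)"
   using weqv_trans[OF shift_weqv[OF F(1), of n] weqv_sym[OF i]] by simp
  define j0 where "j0 = i2 * st (ta n F)"
  have j0: "Zc (- n) (Oc F) (Oc (fob S_perp F)) j0" using j by (simp add: weqv_def j0_def)
  have h1: "Zc (r - n) (Oc Y') (Oc (fob S_perp F)) (j0 * h)" by (rule Zc_comp[OF h(1) j0]) simp
  have h2: "Z0 Y1 (fob S_perp F) (j0 * h * st (tb (n - r) Y'))" by (rule Zc_comp[OF mY(2) h1]) simp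
  have "\<not> Nl (r - n) (Oc Y') (Oc (fob S_perp F)) (j0 * h)"
   using weqv_Nl_left[OF j h(1), folded j0_def] h(2) by auto
  then have "\<not> N0 Y1 (fob S_perp F) (j0 * h * st (tb (n - r) Y'))"
   using weqv_Nl_right[OF weqv_sym[OF eY] h1] by auto
  from T.serre_right[OF F Y1 Y1A h2 this] obtain v where v: "Z0 F Y1 v"
   "\<not> N0 F (fob S_perp F) (j0 * h * st (tb (n - r) Y') * v)" by blast
  have "Zc (n - r) (Oc F) (Oc Y') (st (tb (n - r) Y') * v)" by (rule Zc_comp[OF v(1) mY(2)]) simp
  moreover have "\<not> Nl n (Oc F) (Oc F) (h * (st (tb (n - r) Y') * v))"
  proof
   assume "Nl n (Oc F) (Oc F) (h * (st (tb (n - r) Y') * v))"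
   from Nl_comp_left[OF this j0, of 0] show False using v(2) by (simp add: mult.assoc)
  qed
  ultimately show ?thesis by blast
 qed
 have zero: "Nl i (Oc F) (Oc F) x" if i: "i \<noteq> 0" "i \<noteq> n" and x: "Zc i (Oc F) (Oc F) x" for i x
 proof -
  obtain a b :: "'k wk \<Rightarrow> 'k" where
   ab1: "!!x y. Zc i (Oc F) (Oc F) x ==> Zc i (Oc F) (Oc F) y ==> a (x + y) = a x + a y \<and> b (x + y) = b x + b y" and
   ab2: "!!x c. Zc i (Oc F) (Oc F) x ==> a (scw c x) = c * a x \<and> b (scw c x) = c * b x" and
   ab3: "!!x. Zc i (Oc F) (Oc F) x ==> Nl i (Oc F) (Oc F) x \<longleftrightarrow> a x = 0 \<and> b x = 0" and
   ab4: "!!x. Zc i (Oc F) (Oc F) x ==> (a x, b x) \<in> sphere_part n i" and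
   ab5: "!!z. z \<in> sphere_part n i ==> \<exists>x. Zc i (Oc F) (Oc F) x \<and> (a x, b x) = z"
  by (rule spherical_coordinates[OF F(1) coord[of i]]) (rule that, assumption+)
  show ?thesis using ab3[OF x] ab4[OF x] i by (simp add: sphere_part_def)
 qed
 have nz: "\<exists>g. Zc n (Oc F) (Oc F) g \<and> \<not> Nl n (Oc F) (Oc F) g"
 proof -
  obtain a b :: "'k wk \<Rightarrow> 'k" where
   ab1: "!!x y. Zc n (Oc F) (Oc F) x ==> Zc n (Oc F) (Oc F) y ==> a (x + y) = a x + a y \<and> b (x + y) = b x + b y" and
   ab2: "!!x c. Zc n (Oc F) (Oc F) x ==> a (scw c x) = c * a x \<and> b (scw c x) = c * b x" and
   ab3: "!!x. Zc n (Oc F) (Oc F) x ==> Nl n (Oc F) (Oc F) x \<longleftrightarrow> a x = 0 \<and> b x = 0" and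
   ab4: "!!x. Zc n (Oc F) (Oc F) x ==> (a x, b x) \<in> sphere_part n n" and
   ab5: "!!z. z \<in> sphere_part n n ==> \<exists>x. Zc n (Oc F) (Oc F) x \<and> (a x, b x) = z"
  by (rule spherical_coordinates[OF F(1) coord[of n]]) (rule that, assumption+)
  have "(0, 1) \<in> sphere_part n n" by (simp add: sphere_part_def)
  then obtain g where g: "Zc n (Oc F) (Oc F) g" "(a g, b g) = (0, 1)" using ab5 by blast
  then have "\<not> Nl n (Oc F) (Oc F) g" using ab3[OF g(1)] g(2) by simp
  then show ?thesis using g(1) by blast
 qed
 have idF: "Z0 F F (fst (Oc F))" by (rule Zc_id'[OF F(1)])
 have idnz: "\<not> N0 F F (fst (Oc F))"
 proof
  obtain g where g: "Zc n (Oc F) (Oc F) g" "\<not> Nl n (Oc F) (Oc F) g" using nz by blast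
  assume "N0 F F (fst (Oc F))"
  from Nl_comp_left[OF this g(1), of n] show False using g by (simp add: Zc_fst)
 qed
 obtain a b :: "'k wk \<Rightarrow> 'k" where
   ab1: "!!x y. Z0 F F x ==> Z0 F F y ==> a (x + y) = a x + a y \<and> b (x + y) = b x + b y" and
   ab2: "!!x c. Z0 F F x ==> a (scw c x) = c * a x \<and> b (scw c x) = c * b x" and
   ab3: "!!x. Z0 F F x ==> N0 F F x \<longleftrightarrow> a x = 0 \<and> b x = 0" and
   ab4: "!!x. Z0 F F x ==> (a x, b x) \<in> sphere_part n 0" and
   ab5: "!!z. z \<in> sphere_part n 0 ==> \<exists>x. Z0 F F x \<and> (a x, b x) = z"
  by (rule spherical_coordinates[OF F(1) coord[of 0]]) (rule that, assumption+)
 have hqI: "H0 F F x y" if x: "Z0 F F x" and y: "Z0 F F y" and e: "a x = a y" "b x = b y" for x y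
 proof -
  have xy: "Z0 F F (x - y)" by (rule Zc_diff[OF x y])
  have "a (x - y) = 0 \<and> b (x - y) = 0" using ab1[OF xy y] e by simp
  then show ?thesis using ab3[OF xy] by (simp add: hq_def)
 qed
 let ?e = "fst (Oc F)"
 have e0: "a ?e \<noteq> 0 \<or> b ?e \<noteq> 0" using ab3[OF idF] idnz by blast
 \<comment> \<open>For nonzero \<open>n\<close> the second coordinate vanishes in degree zero, so
   the identity spans.\<close>
 have one: "\<exists>k. H0 F F x (scw k ?e)" if n0: "n \<noteq> 0" and x: "Z0 F F x" for x
 proof -
  have b0: "b x = 0" "b ?e = 0" using ab4[OF x] ab4[OF idF] n0 by (simp_all add: sphere_part_def)
  then have "H0 F F x (scw (a x / a ?e) ?e)"
   using e0 ab2[OF idF, of "a x / a ?e"] by (intro hqI x Zc_scw idF) simp_all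
  then show ?thesis by blast
 qed
 have two: "\<exists>k l. H0 F F z (scw k ?e + scw l x)"
  if x: "Z0 F F x" "\<not> N0 F F x" "N0 F F (x * x)" and z: "Z0 F F z" for x z
 proof -
  \<comment> \<open>Otherwise \<open>x\<close> would be a nonzero multiple of the identity, and its
    square could not be null. So the identity and \<open>x\<close> form a basis.\<close>
  have det: "a ?e * b x - b ?e * a x \<noteq> 0"
  proof
   assume d: "a ?e * b x - b ?e * a x = 0"
   define k where "k = (if a ?e \<noteq> 0 then a x / a ?e else b x / b ?e)"
   have kx: "a x = k * a ?e" "b x = k * b ?e"
    using d e0 by (auto simp: k_def field_simps)
   have hk: "H0 F F x (scw k ?e)"
    using ab2[OF idF, of k] kx by (intro hqI x Zc_scw idF) simp_all
   have "k \<noteq> 0" using kx x(2) ab3[OF x(1)] by auto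
   have "H0 F F (x * x) (scw k x)" using hq_right[OF hk x(1), of 0] Zc_fst(1)[OF x(1)] by (simp add: scw_mult_left)
   then have "N0 F F (scw k x)" using x(3) by (simp add: Nl_hq)
   from Nl_scw[OF this, of "1 / k"] show False using x(2) \<open>k \<noteq> 0\<close> by (simp add: scw_simps)
  qed
  obtain k l where kl: "a z = k * a ?e + l * a x" "b z = k * b ?e + l * b x" using combination[OF det] by metis
  have "H0 F F z (scw k ?e + scw l x)"
   using ab1[OF Zc_scw[OF idF, of k] Zc_scw[OF x(1), of l]] ab2[OF idF, of k] ab2[OF x(1), of l] kl
   by (intro hqI z Zc_add Zc_scw idF x(1)) simp_all
  then show ?thesis by blast
 qed
 have "\<exists>r x y. weqv r (Oc Y') (Oc F) x y"
  by (rule spherical_objects[OF sob_so[OF F(1)] se_pr[OF cplx_bd[OF F(1)]], of n])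
   (use orth serre zero one two nz n1 in blast)+
 then obtain r x y where xy: "weqv r (Oc Y') (Oc F) x y" by blast
 have "weqv r (Oc E) (Oc F) (x * \<beta>) (\<beta>' * y)" by (rule weqv_trans[OF \<beta> xy]) simp
 from weqv_isomorphic[OF F(1) E weqv_sym[OF this]] show "\<exists>m. isomorphic Db F (shift m E)" by blast
qed

end
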